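(* Let $n\ge 2$ and let $\Omega\subset\mathbb{R}^n$ be a bounded open set with Lipschitz boundary. The affine ball $$B_{\mathcal A}(\Omega)=\{u\in BV(\Omega):\ \|u\|_{L^1(\Omega)}+\mathcal{E}_{\mathbb{R}^n}(\bar u)\le 1\}$$ is compact in $L^q(\Omega)$ for any $1\le q<\frac{n}{n-1}$.
   Context: $BV(\Omega)$ is the space of functions $u\in L^1(\Omega)$ of bounded variation; $\bar u\in BV(\mathbb{R}^n)$ is the extension of $u$ by zero outside $\Omega$. For $w\in BV(\mathbb{R}^n)$, $\sigma_w$ is the Radon-Nikodym derivative of $Dw$ with respect to $|Dw|$, and the affine $BV$ energy is $$\mathcal{E}_{\mathbb{R}^n}(w)=\alpha_n\left(\int_{\mathbb{S}^{n-1}}\left(\int_{\mathbb{R}^n}|\sigma_w(x)\cdot\xi|\,d(|Dw|)(x)\right)^{-n}d\xi\right)^{-1/n},\qquad \alpha_n=(2\omega_{n-1})^{-1}(n\omega_n)^{1+1/n},$$ where $\omega_k$ is the volume of the unit ball in $\mathbb{R}^k$ and $d\xi$ is surface measure on the unit sphere $\mathbb{S}^{n-1}$; conventions: $0^{-n}=+\infty$, and the energy is $0$ if the outer integral is $+\infty$. *)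

theory Defs
  imports "HOL-Analysis.Analysis"
begin

section \<open>Vector measures\<close>

text \<open>
  An \<open>\<real>\<^sup>n\<close>-valued measure on the Borel sets of \<open>\<real>\<^sup>n\<close> is a countably additive set function;
  its values on other sets are irrelevant.
\<close>

definition vector_measure :: "((real ^ 'n) set \<Rightarrow> real ^ 'n) \<Rightarrow> bool" where
  "vector_measure D \<longleftrightarrow>
     (\<forall>A::nat \<Rightarrow> (real ^ 'n) set. range A \<subseteq> sets borel \<longrightarrow> disjoint_family A \<longrightarrow>
        (\<lambda>i. D (A i)) sums D (\<Union>i. A i))"

definition variation_of :: "((real ^ 'n) set \<Rightarrow> real ^ 'n) \<Rightarrow> (real ^ 'n) set \<Rightarrow> ennreal" where
  "variation_of D A =
     (SUP E\<in>{E::nat \<Rightarrow> (real ^ 'n) set. range E \<subseteq> sets borel \<and> disjoint_family E \<and> (\<Union>i. E i) = A}.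
        \<Sum>i. ennreal (norm (D (E i))))"

definition total_variation :: "((real ^ 'n) set \<Rightarrow> real ^ 'n) \<Rightarrow> (real ^ 'n) measure" where
  "total_variation D = measure_of UNIV (sets borel) (variation_of D)"

lemma vector_measure_empty:
  assumes "vector_measure D"
  shows "D {} = 0"
proof -
  have "(\<lambda>i::nat. D {}) sums D (\<Union>i::nat. {})"
    using assms unfolding vector_measure_def
    by (elim allE[of _ "\<lambda>_. {}"]) (auto simp: disjoint_family_on_def)
  then show ?thesis
    by (metis sums_summable summable_const_iff)
qed

lemma variation_of_upper:
  assumes "range E \<subseteq> sets borel" "disjoint_family E" "(\<Union>i::nat. E i) = A"
  shows "(\<Sum>i. ennreal (norm (D (E i)))) \<le> variation_of D A"
  unfolding variation_of_def using assms by (intro SUP_upper) auto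

lemma variation_of_empty:
  assumes "vector_measure D"
  shows "variation_of D {} = 0"
  unfolding variation_of_def
  by (intro antisym SUP_least) (auto simp: vector_measure_empty[OF assms])

lemma norm_vector_measure_UN_le:
  assumes "vector_measure D" "range B \<subseteq> sets borel" "disjoint_family B"
  shows "ennreal (norm (D (\<Union>i. B i))) \<le> (\<Sum>i. ennreal (norm (D (B i))))"
proof (cases "summable (\<lambda>i. norm (D (B i)))")
  case True
  have "D (\<Union>i. B i) = (\<Sum>i. D (B i))"
    using assms by (auto simp: vector_measure_def sums_iff)
  then have "norm (D (\<Union>i. B i)) \<le> (\<Sum>i. norm (D (B i)))"
    using summable_norm[OF True] by simp
  then have "ennreal (norm (D (\<Union>i. B i))) \<le> ennreal (\<Sum>i. norm (D (B i)))"
    by (rule ennreal_leI)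
  also have "ennreal (\<Sum>i. norm (D (B i))) = (\<Sum>i. ennreal (norm (D (B i))))"
    using True by (intro suminf_ennreal2[symmetric]) auto
  finally show ?thesis .
next
  case False
  have "(\<Sum>i. ennreal (norm (D (B i)))) = top"
  proof (rule ccontr)
    assume "(\<Sum>i. ennreal (norm (D (B i)))) \<noteq> top"
    with False show False
      using summable_suminf_not_top[of "\<lambda>i. norm (D (B i))"] norm_ge_zero by blast
  qed
  then show ?thesis by simp
qed

lemma variation_of_UN_le:
  assumes D: "vector_measure D" and A: "range A \<subseteq> sets borel" "disjoint_family A"
  shows "variation_of D (\<Union>i::nat. A i) \<le> (\<Sum>i. variation_of D (A i))"
  unfolding variation_of_def[of D "\<Union>i. A i"]
proof (intro SUP_least, clarsimp)
  fix E :: "nat \<Rightarrow> _" assume E: "range E \<subseteq> sets borel" "disjoint_family E" "(\<Union>i. E i) = (\<Union>i. A i)"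
  have "(\<Sum>j. ennreal (norm (D (E j)))) \<le> (\<Sum>j. \<Sum>i. ennreal (norm (D (E j \<inter> A i))))"
  proof (intro suminf_le)
    fix j
    have "E j = (\<Union>i. E j \<inter> A i)" using E(3) by auto
    then have "ennreal (norm (D (E j))) = ennreal (norm (D (\<Union>i. E j \<inter> A i)))" by simp
    also have "\<dots> \<le> (\<Sum>i. ennreal (norm (D (E j \<inter> A i))))"
      using A E by (intro norm_vector_measure_UN_le D) (auto simp: disjoint_family_on_def)
    finally show "ennreal (norm (D (E j))) \<le> (\<Sum>i. ennreal (norm (D (E j \<inter> A i))))" .
  qed auto
  also have "\<dots> = (\<integral>\<^sup>+j. (\<Sum>i. ennreal (norm (D (E j \<inter> A i)))) \<partial>count_space UNIV)"
    by (rule nn_integral_count_space_nat[symmetric])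
  also have "\<dots> = (\<Sum>i. \<integral>\<^sup>+j. ennreal (norm (D (E j \<inter> A i))) \<partial>count_space UNIV)"
    by (rule nn_integral_suminf) simp
  also have "\<dots> = (\<Sum>i. \<Sum>j. ennreal (norm (D (E j \<inter> A i))))"
    by (simp only: nn_integral_count_space_nat)
  also have "\<dots> \<le> (\<Sum>i. variation_of D (A i))"
  proof (intro suminf_le variation_of_upper)
    fix i show "(\<Union>j. E j \<inter> A i) = A i" using E(3) by auto
  next
    fix i
    show "disjoint_family (\<lambda>j. E j \<inter> A i)"
      using E(2) unfolding disjoint_family_on_def by blast
  qed (use A E in auto)
  finally show "(\<Sum>j. ennreal (norm (D (E j)))) \<le> (\<Sum>i. variation_of D (A i))" .
qed

lemma variation_of_superadd:
  assumes D: "vector_measure D" and AB: "A \<inter> B = {}"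
    and [measurable]: "A \<in> sets borel" "B \<in> sets borel"
  shows "variation_of D A + variation_of D B \<le> variation_of D (A \<union> B)"
proof -
  let ?P = "\<lambda>A. {E::nat \<Rightarrow> _. range E \<subseteq> sets borel \<and> disjoint_family E \<and> (\<Union>i. E i) = A}"
  have *: "(\<Sum>i. ennreal (norm (D (E i)))) + (\<Sum>i. ennreal (norm (D (F i)))) \<le> variation_of D (A \<union> B)"
    if E: "E \<in> ?P A" and F: "F \<in> ?P B" for E F
  proof -
    define G where "G k = (if even k then E (k div 2) else F (k div 2))" for k :: nat
    have UG: "(\<Union>k. G k) = A \<union> B"
    proof -
      have AB': "A = (\<Union>i. E i)" "B = (\<Union>i. F i)" using E F by simp_all
      have "E i = G (2 * i)" "F i = G (2 * i + 1)" for i by (simp_all add: G_def)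
      then have "E i \<subseteq> (\<Union>k. G k)" "F i \<subseteq> (\<Union>k. G k)" for i
        by (metis UN_upper UNIV_I)+
      then have "A \<union> B \<subseteq> (\<Union>k. G k)" unfolding AB' by (intro Un_least UN_least)
      moreover have "G k \<subseteq> A \<union> B" for k
        unfolding G_def AB' by auto
      ultimately show ?thesis by blast
    qed
    have dG: "disjoint_family G"
      unfolding disjoint_family_on_def
    proof (intro ballI impI)
      fix k l :: nat assume "k \<noteq> l"
      have EF: "E i \<inter> F j = {}" for i j using E F AB by auto
      have "E i \<inter> E j = {}" "F i \<inter> F j = {}" if "i \<noteq> j" for i j
        using E F that by (auto simp: disjoint_family_on_def)
      moreover have "k div 2 \<noteq> l div 2" if "even k = even l"
        using that \<open>k \<noteq> l\<close> by (metis dvd_mult_div_cancel odd_two_times_div_two_succ)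
      ultimately show "G k \<inter> G l = {}" using EF by (auto simp: G_def Int_commute)
    qed
    define f where "f k = ennreal (norm (D (G k)))" for k
    have "(\<Sum>i. ennreal (norm (D (E i)))) + (\<Sum>i. ennreal (norm (D (F i))))
       = (\<Sum>i. f (2 * i)) + (\<Sum>i. f (2 * i + 1))"
      by (simp add: f_def G_def)
    also have "\<dots> = (\<Sum>i. f (2 * i) + f (2 * i + 1))"
      by (rule suminf_add[OF summableI summableI])
    also have "\<dots> = (\<Sum>k. f k)"
    proof -
      have "f sums (\<Sum>k. f k)" by (rule summable_sums[OF summableI])
      from sums_group[OF this, of 2]
      have "(\<lambda>n. sum f {n * 2..<n * 2 + 2}) sums (\<Sum>k. f k)" by simp
      moreover have "sum f {n * 2..<n * 2 + 2} = f (2 * n) + f (2 * n + 1)" for n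
        by (simp add: numeral_2_eq_2 mult.commute)
      ultimately show ?thesis by (simp add: sums_iff)
    qed
    also have "\<dots> \<le> variation_of D (A \<union> B)"
      unfolding f_def
    proof (rule variation_of_upper[OF _ dG UG])
      show "range G \<subseteq> sets borel" using E F by (auto simp: G_def)
    qed
    finally show ?thesis .
  qed
  have ne: "?P C \<noteq> {}" if "C \<in> sets borel" for C
  proof -
    have "(\<lambda>i::nat. if i = 0 then C else {}) \<in> ?P C"
      using that by (auto simp: disjoint_family_on_def)
    then show ?thesis by blast
  qed
  have "variation_of D A + variation_of D B =
      (SUP F\<in>?P B. SUP E\<in>?P A.
        (\<Sum>i. ennreal (norm (D (E i)))) + (\<Sum>i. ennreal (norm (D (F i)))))"
    unfolding variation_of_def[of D A] variation_of_def[of D B]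
    using ne[of A] ne[of B] by (simp add: ennreal_SUP_add_left ennreal_SUP_add_right)
  also have "\<dots> \<le> variation_of D (A \<union> B)"
    by (intro SUP_least *)
  finally show ?thesis .
qed

lemma variation_of_UN_ge:
  assumes D: "vector_measure D" and A: "range A \<subseteq> sets borel" "disjoint_family A"
  shows "(\<Sum>i. variation_of D (A i)) \<le> variation_of D (\<Union>i::nat. A i)"
proof -
  have [measurable]: "A i \<in> sets borel" for i using A by auto
  have fin: "(\<Sum>i<n. variation_of D (A i)) \<le> variation_of D (\<Union>i<n. A i)" for n
  proof (induction n)
    case (Suc n)
    have "(\<Sum>i<Suc n. variation_of D (A i)) \<le> variation_of D (\<Union>i<n. A i) + variation_of D (A n)"
      using Suc by (simp add: add_right_mono)
    also have "\<dots> \<le> variation_of D ((\<Union>i<n. A i) \<union> A n)"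
    proof (intro variation_of_superadd D)
      have "A i \<inter> A n = {}" if "i < n" for i
        using disjoint_family_onD[OF A(2), of i n] that by simp
      then show "(\<Union>i<n. A i) \<inter> A n = {}" by blast
    qed auto
    finally show ?case by (simp add: lessThan_Suc Un_commute)
  qed simp
  have mono: "variation_of D B \<le> variation_of D C"
    if "B \<subseteq> C" and [measurable]: "B \<in> sets borel" "C \<in> sets borel" for B C
  proof -
    have "variation_of D B \<le> variation_of D B + variation_of D (C - B)" by simp
    also have "\<dots> \<le> variation_of D (B \<union> (C - B))"
      by (intro variation_of_superadd D) auto
    also have "B \<union> (C - B) = C" using that by auto
    finally show ?thesis .
  qed
  show ?thesis
    unfolding suminf_eq_SUP
    by (intro SUP_least order_trans[OF fin] mono) auto
qed

lemma sets_total_variation [simp, measurable_cong]: "sets (total_variation D) = sets borel"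
  using sets.sets_measure_of_eq[of borel] by (simp add: total_variation_def)

lemma emeasure_total_variation:
  assumes D: "vector_measure D" and A: "A \<in> sets borel"
  shows "emeasure (total_variation D) A = variation_of D A"
proof (rule emeasure_measure_of[OF total_variation_def])
  show "countably_additive (sets (total_variation D)) (variation_of D)"
    unfolding countably_additive_def sets_total_variation
    by (auto intro!: antisym variation_of_UN_le variation_of_UN_ge D)
qed (use A sets.sets_into_space in \<open>auto simp: positive_def variation_of_empty[OF D]\<close>)

lemma space_total_variation [simp]: "space (total_variation D) = UNIV"
  by (simp add: total_variation_def)

text \<open>The Radon--Nikodym derivative of a vector measure with respect to a positive one.\<close>

definition vector_RN_deriv ::
    "(real ^ 'n) measure \<Rightarrow> ((real ^ 'n) set \<Rightarrow> real ^ 'n) \<Rightarrow> real ^ 'n \<Rightarrow> real ^ 'n" where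
  "vector_RN_deriv M D =
     (SOME \<sigma>. integrable M \<sigma> \<and> (\<forall>A\<in>sets M. D A = (LINT x:A|M. \<sigma> x)))"


section \<open>Functions of bounded variation\<close>

definition C1c_fields :: "(real ^ 'n) set \<Rightarrow> (real ^ 'n \<Rightarrow> real ^ 'n) set" where
  "C1c_fields \<Omega> =
     {\<phi>. (\<exists>\<phi>' :: real ^ 'n \<Rightarrow> (real ^ 'n) \<Rightarrow>\<^sub>L (real ^ 'n).
            continuous_on UNIV \<phi>' \<and> (\<forall>x. (\<phi> has_derivative \<phi>' x) (at x))) \<and>
         compact (closure {x. \<phi> x \<noteq> 0}) \<and> closure {x. \<phi> x \<noteq> 0} \<subseteq> \<Omega>}"

definition divergence :: "(real ^ 'n \<Rightarrow> real ^ 'n) \<Rightarrow> real ^ 'n \<Rightarrow> real" where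
  "divergence \<phi> x = (\<Sum>i\<in>UNIV. frechet_derivative \<phi> (at x) (axis i 1) $ i)"

definition BV :: "(real ^ 'n) set \<Rightarrow> (real ^ 'n \<Rightarrow> real) set" where
  "BV \<Omega> =
     {u. integrable (lebesgue_on \<Omega>) u \<and>
         bdd_above {LINT x|lebesgue_on \<Omega>. u x * divergence \<phi> x | \<phi>.
                      \<phi> \<in> C1c_fields \<Omega> \<and> (\<forall>x. norm (\<phi> x) \<le> 1)}}"

text \<open>
  \<open>D\<close> is the distributional gradient of \<open>w\<close>.  The integral of a field \<open>\<phi>\<close> against \<open>D\<close> is the
  integral of \<open>\<phi> \<bullet> \<sigma>\<close> against \<open>|D|\<close>, where \<open>\<sigma>\<close> is the density of \<open>D\<close> with respect to \<open>|D|\<close>.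
  (Finiteness of \<open>|D|\<close> is automatic for an \<open>\<real>\<^sup>n\<close>-valued measure.)
\<close>

definition is_gradient_measure ::
    "(real ^ 'n \<Rightarrow> real) \<Rightarrow> ((real ^ 'n) set \<Rightarrow> real ^ 'n) \<Rightarrow> bool" where
  "is_gradient_measure w D \<longleftrightarrow>
     vector_measure D \<and> finite_measure (total_variation D) \<and>
     (\<forall>\<phi>\<in>C1c_fields UNIV.
        (LINT x|lebesgue. w x * divergence \<phi> x) =
        - (LINT x|total_variation D. \<phi> x \<bullet> vector_RN_deriv (total_variation D) D x))"

text \<open>For \<open>w \<in> BV UNIV\<close> such a measure exists, and it is unique on the Borel sets.\<close>

definition gradient_measure :: "(real ^ 'n \<Rightarrow> real) \<Rightarrow> (real ^ 'n) set \<Rightarrow> real ^ 'n" where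
  "gradient_measure w = (SOME D. is_gradient_measure w D)"

definition gradient_variation :: "(real ^ 'n \<Rightarrow> real) \<Rightarrow> (real ^ 'n) measure" where
  "gradient_variation w = total_variation (gradient_measure w)"

definition gradient_direction :: "(real ^ 'n \<Rightarrow> real) \<Rightarrow> real ^ 'n \<Rightarrow> real ^ 'n" where
  "gradient_direction w = vector_RN_deriv (gradient_variation w) (gradient_measure w)"


section \<open>The affine energy\<close>

text \<open>
  Surface measure on the unit sphere: the measure of \<open>A\<close> is \<open>n\<close> times the Lebesgue measure of
  the cone \<open>{r *\<^sub>R \<xi> | 0 < r \<le> 1, \<xi> \<in> A}\<close>; see \<open>emeasure_sphere_measure\<close> below.
\<close>

definition sphere_measure :: "(real ^ 'n) measure" where
  "sphere_measure =
     scale_measure (of_nat CARD('n))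
       (distr (restrict_space lborel (cball 0 1 - {0})) (restrict_space borel (sphere 0 1))
         (\<lambda>x. x /\<^sub>R norm x))"

lemma space_sphere_measure: "space sphere_measure = sphere 0 1"
  by (simp add: sphere_measure_def space_scale_measure space_restrict_space)

lemma emeasure_sphere_measure:
  fixes A :: "(real ^ 'n) set"
  assumes "A \<in> sets borel" "A \<subseteq> sphere 0 1"
  shows "emeasure sphere_measure A =
    of_nat CARD('n) * emeasure lborel {r *\<^sub>R \<xi> | r \<xi>. 0 < r \<and> r \<le> 1 \<and> \<xi> \<in> A}"
proof -
  let ?M = "restrict_space lborel (cball 0 1 - {0}) :: (real ^ 'n) measure"
  have [measurable]: "(\<lambda>x. x /\<^sub>R norm x) \<in> ?M \<rightarrow>\<^sub>M restrict_space borel (sphere 0 1)"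
    by (intro measurable_restrict_space2 measurable_restrict_space1)
       (auto simp: space_restrict_space)
  have A: "A \<in> sets (restrict_space borel (sphere 0 1))"
    using assms by (auto simp: sets_restrict_space_iff)
  have "(\<lambda>x. x /\<^sub>R norm x) -` A \<inter> space ?M = {r *\<^sub>R \<xi> | r \<xi>. 0 < r \<and> r \<le> 1 \<and> \<xi> \<in> A}"
  proof (intro equalityI subsetI)
    fix x assume "x \<in> (\<lambda>x. x /\<^sub>R norm x) -` A \<inter> space ?M"
    then have "x = norm x *\<^sub>R (x /\<^sub>R norm x)" "0 < norm x" "norm x \<le> 1" "x /\<^sub>R norm x \<in> A"
      by (auto simp: space_restrict_space)
    then show "x \<in> {r *\<^sub>R \<xi> | r \<xi>. 0 < r \<and> r \<le> 1 \<and> \<xi> \<in> A}" by blast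
  next
    fix x assume "x \<in> {r *\<^sub>R \<xi> | r \<xi>. 0 < r \<and> r \<le> 1 \<and> \<xi> \<in> A}"
    then show "x \<in> (\<lambda>x. x /\<^sub>R norm x) -` A \<inter> space ?M"
      using assms(2) by (auto simp: space_restrict_space)
  qed
  then show ?thesis
    using A assms
    by (simp add: sphere_measure_def emeasure_distr emeasure_restrict_space)
       (subst emeasure_restrict_space; auto)
qed

text \<open>
  In \<open>ennreal\<close>, \<open>inverse 0 = \<infinity>\<close>, which is the convention for \<open>0\<^sup>-\<^sup>n\<close>.
\<close>

definition affine_energy :: "(real ^ 'n \<Rightarrow> real) \<Rightarrow> real" where
  "affine_energy w =
     (let n = real CARD('n);
          \<alpha> = (2 * unit_ball_vol (n - 1)) powr (-1) * (n * unit_ball_vol n) powr (1 + 1 / n);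
          J = (\<integral>\<^sup>+ \<xi>. inverse
                 ((\<integral>\<^sup>+ x. ennreal \<bar>gradient_direction w x \<bullet> \<xi>\<bar> \<partial>gradient_variation w) ^ CARD('n))
               \<partial>sphere_measure)
      in if J = \<infinity> then 0 else \<alpha> * enn2real J powr (- 1 / n))"


section \<open>Lebesgue spaces and the affine ball\<close>

text \<open>Elements of \<open>L\<^sup>q(\<Omega>)\<close> are almost-everywhere classes; values outside \<open>\<Omega>\<close> play no role.\<close>

definition ae_class :: "'a::euclidean_space set \<Rightarrow> ('a \<Rightarrow> real) \<Rightarrow> ('a \<Rightarrow> real) set" where
  "ae_class \<Omega> u = {v \<in> borel_measurable (lebesgue_on \<Omega>). AE x in lebesgue_on \<Omega>. v x = u x}"

definition Lq_space :: "'a::euclidean_space set \<Rightarrow> real \<Rightarrow> ('a \<Rightarrow> real) set set" where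
  "Lq_space \<Omega> q =
     {ae_class \<Omega> f | f. f \<in> borel_measurable (lebesgue_on \<Omega>) \<and>
                       integrable (lebesgue_on \<Omega>) (\<lambda>x. \<bar>f x\<bar> powr q)}"

definition Lq_dist ::
    "'a::euclidean_space set \<Rightarrow> real \<Rightarrow> ('a \<Rightarrow> real) set \<Rightarrow> ('a \<Rightarrow> real) set \<Rightarrow> real" where
  "Lq_dist \<Omega> q F G =
     (LINT x|lebesgue_on \<Omega>. \<bar>(SOME f. f \<in> F) x - (SOME g. g \<in> G) x\<bar> powr q) powr (1 / q)"

definition Lq_topology :: "'a::euclidean_space set \<Rightarrow> real \<Rightarrow> ('a \<Rightarrow> real) set topology" where
  "Lq_topology \<Omega> q = Metric_space.mtopology (Lq_space \<Omega> q) (Lq_dist \<Omega> q)"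

lemma convex_powr_bound:
  fixes u v A B q :: real
  assumes q: "1 \<le> q" and AB: "0 < A" "0 < B"
  shows "\<bar>u + v\<bar> powr q \<le>
    (A + B) powr q * (A / (A + B) * (\<bar>u\<bar> / A) powr q + B / (A + B) * (\<bar>v\<bar> / B) powr q)"
proof -
  have *: "(a * s + b * t) powr q \<le> a * s powr q + b * t powr q"
    if "0 \<le> s" "0 \<le> t" "0 < a" "0 < b" "a + b = 1" for a b s t :: real
  proof (cases "s = 0 \<or> t = 0")
    case False
    with that have st: "s \<in> {0<..}" "t \<in> {0<..}" by auto
    have "b \<ge> 0" "b \<le> 1" "a = 1 - b" using that by auto
    with convex_onD[OF powr_convex[OF q] _ _ st, of b] show ?thesis by simp
  next
    case True
    have "a powr q \<le> a" "b powr q \<le> b"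
      using that q powr_mono'[of 1 q a] powr_mono'[of 1 q b] by auto
    with True that q show ?thesis
      by (auto simp: powr_mult intro!: mult_right_mono)
  qed
  have "\<bar>u + v\<bar> powr q \<le> (\<bar>u\<bar> + \<bar>v\<bar>) powr q"
    using q by (intro powr_mono2) auto
  also have "\<bar>u\<bar> + \<bar>v\<bar> = (A + B) * (A / (A + B) * (\<bar>u\<bar> / A) + B / (A + B) * (\<bar>v\<bar> / B))"
  proof -
    have "A / (A + B) * (\<bar>u\<bar> / A) = \<bar>u\<bar> / (A + B)" "B / (A + B) * (\<bar>v\<bar> / B) = \<bar>v\<bar> / (A + B)"
      using AB by simp_all
    then show ?thesis using AB by (simp only: add_divide_distrib[symmetric]) simp
  qed
  also have "\<dots> powr q =
      (A + B) powr q * (A / (A + B) * (\<bar>u\<bar> / A) + B / (A + B) * (\<bar>v\<bar> / B)) powr q"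
    using AB by (intro powr_mult)
  also have "\<dots> \<le> (A + B) powr q *
      (A / (A + B) * (\<bar>u\<bar> / A) powr q + B / (A + B) * (\<bar>v\<bar> / B) powr q)"
    using AB by (intro mult_left_mono *) (auto simp: add_divide_distrib[symmetric])
  finally show ?thesis .
qed

lemma Minkowski_powr:
  fixes f g :: "'a \<Rightarrow> real"
  assumes q: "1 \<le> q"
    and [measurable]: "f \<in> borel_measurable M" "g \<in> borel_measurable M"
    and f: "integrable M (\<lambda>x. \<bar>f x\<bar> powr q)" and g: "integrable M (\<lambda>x. \<bar>g x\<bar> powr q)"
  shows "integrable M (\<lambda>x. \<bar>f x + g x\<bar> powr q)"
    and "(LINT x|M. \<bar>f x + g x\<bar> powr q) powr (1 / q) \<le>
      (LINT x|M. \<bar>f x\<bar> powr q) powr (1 / q) + (LINT x|M. \<bar>g x\<bar> powr q) powr (1 / q)"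
proof -
  define h where "h A B x = (A + B) powr q *
      (A / (A + B) * (\<bar>f x\<bar> / A) powr q + B / (A + B) * (\<bar>g x\<bar> / B) powr q)" for A B x
  have h_eq: "h A B x = (A + B) powr q *
      (A / (A + B) * (\<bar>f x\<bar> powr q / A powr q) + B / (A + B) * (\<bar>g x\<bar> powr q / B powr q))"
    if "0 < A" "0 < B" for A B x
    using that by (simp add: h_def powr_divide)
  have h_int: "integrable M (h A B)" if "0 < A" "0 < B" for A B
    unfolding h_eq[OF that] using f g by auto
  have le: "\<bar>f x + g x\<bar> powr q \<le> h A B x" if "0 < A" "0 < B" for A B x
    unfolding h_def by (rule convex_powr_bound[OF q that])
  show int: "integrable M (\<lambda>x. \<bar>f x + g x\<bar> powr q)"
    by (rule Bochner_Integration.integrable_bound[OF h_int[of 1 1]])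
       (use le[of 1 1] in \<open>auto intro: order_trans[OF _ abs_ge_self]\<close>)
  let ?a = "(LINT x|M. \<bar>f x\<bar> powr q)" and ?b = "(LINT x|M. \<bar>g x\<bar> powr q)"
  let ?c = "(LINT x|M. \<bar>f x + g x\<bar> powr q)"
  have "?c powr (1 / q) \<le> ?a powr (1 / q) + ?b powr (1 / q) + e" if "e > 0" for e
  proof -
    define A where "A = ?a powr (1 / q) + e / 2"
    define B where "B = ?b powr (1 / q) + e / 2"
    have AB: "0 < A" "0 < B"
      using that by (auto simp: A_def B_def intro: add_nonneg_pos)
    have root: "z \<le> C powr q" if "z powr (1 / q) \<le> C" "0 \<le> z" for z C
    proof -
      have "z = (z powr (1 / q)) powr q" using q that by (simp add: powr_powr)
      also have "\<dots> \<le> C powr q" using q that by (intro powr_mono2) auto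
      finally show ?thesis .
    qed
    have ab: "?a \<le> A powr q" "?b \<le> B powr q"
      using that by (auto intro!: root simp: A_def B_def)
    have "?c \<le> (LINT x|M. h A B x)"
      by (intro integral_mono int h_int AB le)
    also have "\<dots> = (A + B) powr q *
        (A / (A + B) * (?a / A powr q) + B / (A + B) * (?b / B powr q))"
      unfolding h_eq[OF AB] using f g by simp
    also have "\<dots> \<le> (A + B) powr q * (A / (A + B) * 1 + B / (A + B) * 1)"
      using AB ab by (intro mult_left_mono add_mono) auto
    also have "\<dots> = (A + B) powr q"
      using AB by (simp add: add_divide_distrib[symmetric])
    finally have "?c powr (1 / q) \<le> ((A + B) powr q) powr (1 / q)"
      using q by (intro powr_mono2) auto
    also have "\<dots> = A + B" using q AB by (simp add: powr_powr)
    finally show ?thesis by (simp add: A_def B_def)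
  qed
  then show "?c powr (1 / q) \<le> ?a powr (1 / q) + ?b powr (1 / q)"
    by (rule field_le_epsilon)
qed

lemma ae_class_self: "f \<in> borel_measurable (lebesgue_on \<Omega>) \<Longrightarrow> f \<in> ae_class \<Omega> f"
  by (simp add: ae_class_def)

lemma ae_class_eqI:
  assumes "AE x in lebesgue_on \<Omega>. f x = g x"
  shows "ae_class \<Omega> f = ae_class \<Omega> g"
  unfolding ae_class_def using assms by (auto elim: eventually_elim2)

lemma Lq_space_rep:
  assumes "F \<in> Lq_space \<Omega> q"
  defines "f \<equiv> SOME f. f \<in> F"
  shows "f \<in> borel_measurable (lebesgue_on \<Omega>)"
    and "integrable (lebesgue_on \<Omega>) (\<lambda>x. \<bar>f x\<bar> powr q)"
    and "F = ae_class \<Omega> f"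
proof -
  from assms(1) obtain f0 where f0: "F = ae_class \<Omega> f0" "f0 \<in> borel_measurable (lebesgue_on \<Omega>)"
    "integrable (lebesgue_on \<Omega>) (\<lambda>x. \<bar>f0 x\<bar> powr q)"
    unfolding Lq_space_def by blast
  have "f \<in> F"
    unfolding f_def f0(1) by (rule someI[of _ f0]) (rule ae_class_self[OF f0(2)])
  then have f: "f \<in> borel_measurable (lebesgue_on \<Omega>)" "AE x in lebesgue_on \<Omega>. f x = f0 x"
    using f0 by (auto simp: ae_class_def)
  show "f \<in> borel_measurable (lebesgue_on \<Omega>)" by fact
  show "F = ae_class \<Omega> f" using f0(1) ae_class_eqI[OF f(2)] by simp
  note [measurable] = f(1) f0(2)
  show "integrable (lebesgue_on \<Omega>) (\<lambda>x. \<bar>f x\<bar> powr q)"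
    using f0(3) by (rule integrable_cong_AE_imp) (use f(2) in auto)
qed

lemma Metric_space_Lq:
  assumes q: "1 \<le> q"
  shows "Metric_space (Lq_space \<Omega> q) (Lq_dist \<Omega> q)"
proof
  fix F G
  show "0 \<le> Lq_dist \<Omega> q F G" by (simp add: Lq_dist_def)
  show "Lq_dist \<Omega> q F G = Lq_dist \<Omega> q G F" by (simp add: Lq_dist_def abs_minus_commute)
next
  fix F G assume F: "F \<in> Lq_space \<Omega> q" and G: "G \<in> Lq_space \<Omega> q"
  define f where "f = (SOME f. f \<in> F)"
  define g where "g = (SOME g. g \<in> G)"
  note f = Lq_space_rep[OF F, folded f_def] and g = Lq_space_rep[OF G, folded g_def]
  note [measurable] = f(1) g(1)
  have int: "integrable (lebesgue_on \<Omega>) (\<lambda>x. \<bar>f x - g x\<bar> powr q)"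
    using Minkowski_powr(1)[OF q, of f _ "\<lambda>x. - g x"] f g by simp
  show "Lq_dist \<Omega> q F G = 0 \<longleftrightarrow> F = G"
  proof
    assume "Lq_dist \<Omega> q F G = 0"
    then have "(LINT x|lebesgue_on \<Omega>. \<bar>f x - g x\<bar> powr q) = 0"
      by (simp add: Lq_dist_def f_def g_def)
    then have "AE x in lebesgue_on \<Omega>. \<bar>f x - g x\<bar> powr q = 0"
      by (subst (asm) integral_nonneg_eq_0_iff_AE[OF int]) auto
    then have "AE x in lebesgue_on \<Omega>. f x = g x" by simp
    then show "F = G" using ae_class_eqI f(3) g(3) by metis
  next
    assume "F = G"
    then show "Lq_dist \<Omega> q F G = 0" by (simp add: Lq_dist_def)
  qed
next
  fix F G H assume F: "F \<in> Lq_space \<Omega> q" and G: "G \<in> Lq_space \<Omega> q" and H: "H \<in> Lq_space \<Omega> q"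
  define f where "f = (SOME f. f \<in> F)"
  define g where "g = (SOME g. g \<in> G)"
  define h where "h = (SOME h. h \<in> H)"
  note f = Lq_space_rep[OF F, folded f_def] and g = Lq_space_rep[OF G, folded g_def]
    and h = Lq_space_rep[OF H, folded h_def]
  note [measurable] = f(1) g(1) h(1)
  have "integrable (lebesgue_on \<Omega>) (\<lambda>x. \<bar>f x - g x\<bar> powr q)"
    using Minkowski_powr(1)[OF q, of f _ "\<lambda>x. - g x"] f g by simp
  moreover have "integrable (lebesgue_on \<Omega>) (\<lambda>x. \<bar>g x - h x\<bar> powr q)"
    using Minkowski_powr(1)[OF q, of g _ "\<lambda>x. - h x"] g h by simp
  ultimately show "Lq_dist \<Omega> q F H \<le> Lq_dist \<Omega> q F G + Lq_dist \<Omega> q G H"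
    using Minkowski_powr(2)[OF q, of "\<lambda>x. f x - g x" "lebesgue_on \<Omega>" "\<lambda>x. g x - h x"]
    by (simp add: Lq_dist_def f_def[symmetric] g_def[symmetric] h_def[symmetric])
qed

text \<open>
  Near each boundary point, in coordinates along a unit vector \<open>e\<close> and its orthogonal
  complement, \<open>\<Omega>\<close> is the region above the graph of a Lipschitz function.
\<close>

definition lipschitz_boundary :: "(real ^ 'n) set \<Rightarrow> bool" where
  "lipschitz_boundary \<Omega> \<longleftrightarrow>
     (\<forall>p\<in>frontier \<Omega>. \<exists>r>0. \<exists>e L. \<exists>\<gamma> :: real ^ 'n \<Rightarrow> real.
        norm e = 1 \<and> L-lipschitz_on {y. y \<bullet> e = 0} \<gamma> \<and>
        \<Omega> \<inter> ball p r = {x \<in> ball p r. \<gamma> (x - (x \<bullet> e) *\<^sub>R e) < x \<bullet> e})"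

definition zero_extension :: "(real ^ 'n) set \<Rightarrow> (real ^ 'n \<Rightarrow> real) \<Rightarrow> real ^ 'n \<Rightarrow> real" where
  "zero_extension \<Omega> u x = (if x \<in> \<Omega> then u x else 0)"

definition affine_ball :: "(real ^ 'n) set \<Rightarrow> (real ^ 'n \<Rightarrow> real) set" where
  "affine_ball \<Omega> =
     {u \<in> BV \<Omega>. (LINT x|lebesgue_on \<Omega>. \<bar>u x\<bar>) + affine_energy (zero_extension \<Omega> u) \<le> 1}"

end

theory Submission
  imports Defs "HOL-Probability.Helly_Selection"
begin

text \<open>
  The integral of \<open>\<bar>\<sigma>\<^sub>w \<bullet> \<xi>\<bar>\<close> with respect to \<open>|Dw|\<close> is the supremum \<open>V\<^sub>w(\<xi>)\<close> over \<open>t > 0\<close> of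
  \<open>\<parallel>w(\<cdot> + t \<xi>) - w\<parallel>\<^sub>1 / t\<close>, so the affine energy depends only on the norm \<open>V\<^sub>w\<close> and is
  comparable to \<open>vol {V\<^sub>w \<le> 1}\<close> raised to the power \<open>-1/n\<close>. By Auerbach's lemma an energy
  bound yields a parallelepiped with columns in \<open>{V\<^sub>w \<le> 1}\<close> and determinant bounded below.

  Let \<open>u\<^sub>k\<close> be a sequence in the affine ball. If \<open>\<parallel>u\<^sub>k\<parallel>\<^sub>1 \<rightarrow> 0\<close> along a subsequence, averaging the
  translations over small copies of the parallelepiped bounds the superlevel sets of \<open>u\<^sub>k\<close> as in the
  Sobolev inequality, and the limit in \<open>L\<^sup>q\<close> is \<open>0\<close>. If \<open>\<parallel>u\<^sub>k\<parallel>\<^sub>1\<close> stays away from \<open>0\<close>, then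
  \<open>V\<^sub>w(\<xi>) \<ge> \<parallel>w\<parallel>\<^sub>1 \<bar>\<xi>\<bar> / R\<close> bounds the columns, so the determinant bound makes \<open>V\<^sub>w(\<xi>) / \<bar>\<xi>\<bar>\<close>
  uniformly bounded: the sequence is bounded in \<open>BV\<close> and has a subsequence converging in \<open>L\<^sup>1\<close>, hence
  in \<open>L\<^sup>q\<close>. The limit stays in the ball because \<open>V\<^sub>w\<close> is lower semicontinuous and reverse Fatou applies
  on the sphere. Zero extensions of functions in \<open>BV(\<Omega>)\<close> have finite variation because \<open>\<Omega>\<close> is Lipschitz.
\<close>

text \<open>The obstacle is that bounded energy does not mean bounded variation. The energy is
  invariant under volume-preserving linear maps, and suitable multiples of indicators of ever
  thinner ellipsoids in \<Omega> have bounded energy, L^1 norm tending to 0 and unbounded variation.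
  This forces the distinction by the L^1 norm. The integrability estimate is therefore stated
  through a determinant alone, which survives when the shape of the parallelepiped degenerates. A
  fixed bounded support controls that shape as soon as the L^1 norm is bounded below. Measuring
  variation by translations makes \<open>dir_var\<close> a supremum of functionals continuous in
  L^1. The measure chosen by \<open>gradient_measure\<close> then enters in two ways only: some
  gradient measure must exist, and the identity for the inner integral holds for every one of them.
  Existence comes from weak limits of difference quotients. The energy value 0 for an infinite outer
  integral concerns only functions vanishing almost everywhere; the limit 0 is treated apart from
  the semicontinuity argument.\<close>

section \<open>Translation invariance of Lebesgue integrals\<close>

lemma nn_integral_translation:
  fixes f :: "'a::euclidean_space \<Rightarrow> ennreal"
  assumes [measurable]: "f \<in> borel_measurable borel"
  shows "(\<integral>\<^sup>+ x. f (x + a) \<partial>lborel) = (\<integral>\<^sup>+ x. f x \<partial>lborel)"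
proof -
  have "(\<integral>\<^sup>+ x. f x \<partial>lborel) = (\<integral>\<^sup>+ x. f x \<partial>distr lborel borel ((+) a))"
    by (simp add: lborel_distr_plus)
  also have "\<dots> = (\<integral>\<^sup>+ x. f (x + a) \<partial>lborel)"
    by (subst nn_integral_distr) (auto simp: add.commute)
  finally show ?thesis by simp
qed

lemma integral_translation:
  fixes f :: "'a::euclidean_space \<Rightarrow> real"
  assumes [measurable]: "f \<in> borel_measurable borel"
  shows "(LINT x|lborel. f (x + a)) = (LINT x|lborel. f x)"
proof -
  have "(LINT x|lborel. f x) = (LINT x|distr lborel borel ((+) a). f x)"
    by (simp add: lborel_distr_plus)
  also have "\<dots> = (LINT x|lborel. f (x + a))"
    by (subst integral_distr) (auto simp: add.commute)
  finally show ?thesis by simp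
qed

lemma integrable_translation:
  fixes f :: "'a::euclidean_space \<Rightarrow> real"
  assumes f: "integrable lborel f"
  shows "integrable lborel (\<lambda>x. f (x + a))"
proof -
  have [measurable]: "f \<in> borel_measurable borel" using f by auto
  have "integrable (distr lborel borel ((+) a)) f"
    using f by (simp add: lborel_distr_plus)
  then show ?thesis
    by (subst (asm) integrable_distr_eq) (auto simp: add.commute)
qed

subsection \<open>Test functions\<close>

text \<open>The derivative is carried as an explicit map into the bounded linear functionals, so
  that its continuity refers to the operator norm and its supremum is a Lipschitz constant.\<close>

definition test_function ::
    "(real ^ 'n) set \<Rightarrow> (real ^ 'n \<Rightarrow> real) \<Rightarrow> (real ^ 'n \<Rightarrow> (real ^ 'n) \<Rightarrow>\<^sub>L real) \<Rightarrow> bool" where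
  "test_function A \<psi> \<psi>' \<longleftrightarrow>
     continuous_on UNIV \<psi>' \<and> (\<forall>x. (\<psi> has_derivative \<psi>' x) (at x)) \<and>
     compact (closure {x. \<psi> x \<noteq> 0}) \<and> closure {x. \<psi> x \<noteq> 0} \<subseteq> A"

lemma test_functionD:
  assumes "test_function A \<psi> \<psi>'"
  shows "continuous_on UNIV \<psi>'" "(\<psi> has_derivative \<psi>' x) (at x)"
    "compact (closure {x. \<psi> x \<noteq> 0})" "closure {x. \<psi> x \<noteq> 0} \<subseteq> A"
  using assms by (auto simp: test_function_def)

lemma test_function_continuous:
  assumes "test_function A \<psi> \<psi>'"
  shows "continuous_on UNIV \<psi>"
  using test_functionD(2)[OF assms]
  by (meson continuous_at_imp_continuous_on has_derivative_continuous)

lemma test_function_mono: "test_function A \<psi> \<psi>' \<Longrightarrow> A \<subseteq> B \<Longrightarrow> test_function B \<psi> \<psi>'"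
  by (auto simp: test_function_def)

lemma test_function_uminus:
  assumes "test_function A \<psi> \<psi>'"
  shows "test_function A (\<lambda>x. - \<psi> x) (\<lambda>x. - \<psi>' x)"
proof -
  have "((\<lambda>x. - \<psi> x) has_derivative blinfun_apply (- \<psi>' x)) (at x)" for x
    using has_derivative_minus[OF test_functionD(2)[OF assms]] by (simp add: uminus_blinfun.rep_eq)
  then show ?thesis
    using test_functionD[OF assms] by (simp add: test_function_def continuous_on_minus)
qed

lemma test_function_deriv_zero:
  assumes "test_function A \<psi> \<psi>'" "x \<notin> closure {x. \<psi> x \<noteq> 0}"
  shows "\<psi>' x = 0"
proof -
  let ?S = "- closure {x. \<psi> x \<noteq> 0}"
  have "((\<lambda>x. 0) has_derivative \<psi>' x) (at x)"
  proof (rule has_derivative_transform_within_open[OF test_functionD(2)[OF assms(1)], of ?S])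
    fix y assume "y \<in> ?S"
    then show "\<psi> y = 0" using closure_subset[of "{x. \<psi> x \<noteq> 0}"] by auto
  qed (use assms in auto)
  then have "blinfun_apply (\<psi>' x) = (\<lambda>x. 0)"
    by (rule has_derivative_unique) (rule has_derivative_const)
  then show ?thesis by (intro blinfun_eqI) simp
qed

lemma test_function_bounded:
  assumes "test_function A \<psi> \<psi>'"
  obtains B where "B > 0" "\<And>x. \<bar>\<psi> x\<bar> \<le> B" "\<And>x. norm (\<psi>' x) \<le> B"
proof -
  let ?K = "closure {x. \<psi> x \<noteq> 0}"
  have "compact (\<psi> ` ?K)" "compact (\<psi>' ` ?K)"
    using test_functionD[OF assms] test_function_continuous[OF assms]
    by (auto intro!: compact_continuous_image intro: continuous_on_subset)
  then obtain B1 B2 where B: "\<And>x. x \<in> ?K \<Longrightarrow> norm (\<psi> x) \<le> B1" "\<And>x. x \<in> ?K \<Longrightarrow> norm (\<psi>' x) \<le> B2"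
    by (auto dest!: compact_imp_bounded simp: bounded_iff) blast
  show ?thesis
  proof (rule that[of "\<bar>B1\<bar> + \<bar>B2\<bar> + 1"])
    fix x
    show "\<bar>\<psi> x\<bar> \<le> \<bar>B1\<bar> + \<bar>B2\<bar> + 1"
    proof (cases "x \<in> ?K")
      case False
      then have "\<psi> x = 0" using closure_subset[of "{x. \<psi> x \<noteq> 0}"] by auto
      then show ?thesis by simp
    qed (use B(1)[of x] in auto)
    show "norm (\<psi>' x) \<le> \<bar>B1\<bar> + \<bar>B2\<bar> + 1"
    proof (cases "x \<in> ?K")
      case False
      then show ?thesis using test_function_deriv_zero[OF assms] by simp
    qed (use B(2)[of x] in auto)
  qed auto
qed

lemma test_function_lipschitz:
  assumes "test_function A \<psi> \<psi>'" "\<And>x. norm (\<psi>' x) \<le> B"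
  shows "\<bar>\<psi> x - \<psi> y\<bar> \<le> B * norm (x - y)"
proof -
  have "norm (\<psi> x - \<psi> y) \<le> B * norm (x - y)"
  proof (rule differentiable_bound[of UNIV \<psi> "\<lambda>x. \<psi>' x"])
    show "onorm (blinfun_apply (\<psi>' x)) \<le> B" for x
      using assms(2)[of x] by (simp add: norm_blinfun.rep_eq)
  qed (use test_functionD(2)[OF assms(1)] in auto)
  then show ?thesis by simp
qed

lemma test_function_translate:
  assumes "test_function A \<psi> \<psi>'" "(\<lambda>x. x + h) ` A \<subseteq> B"
  shows "test_function B (\<lambda>x. \<psi> (x - h)) (\<lambda>x. \<psi>' (x - h))"
proof -
  have eq: "{x. \<psi> (x - h) \<noteq> 0} = (\<lambda>x. x + h) ` {x. \<psi> x \<noteq> 0}"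
    by (auto simp: image_iff) (metis diff_add_cancel)
  have cl: "closure {x. \<psi> (x - h) \<noteq> 0} = (\<lambda>x. x + h) ` closure {x. \<psi> x \<noteq> 0}"
    unfolding eq using closure_translation[of h "{x. \<psi> x \<noteq> 0}"] by (simp add: add.commute)
  have "((\<lambda>x. \<psi> (x - h)) has_derivative \<psi>' (x - h)) (at x)" for x
  proof -
    have "((\<lambda>x. x - h) has_derivative (\<lambda>x. x)) (at x)"
      by (auto intro!: derivative_eq_intros)
    from has_derivative_compose[OF this test_functionD(2)[OF assms(1), of "x - h"]]
    show ?thesis by simp
  qed
  moreover have "continuous_on UNIV (\<lambda>x. \<psi>' (x - h))"
    by (rule continuous_on_compose2[OF test_functionD(1)[OF assms(1)]]) (auto intro!: continuous_intros)
  ultimately show ?thesis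
    using test_functionD(3,4)[OF assms(1)] assms(2)
    unfolding test_function_def cl
    by (auto intro!: compact_continuous_image continuous_intros)
qed

text \<open>A field of constant direction turns the divergence into a directional derivative. This
  is how statements about vector fields are reduced to one direction at a time.\<close>

lemma test_function_field:
  assumes "test_function A \<psi> \<psi>'"
  shows "(\<lambda>x. \<psi> x *\<^sub>R v) \<in> C1c_fields A" "divergence (\<lambda>x. \<psi> x *\<^sub>R v) x = \<psi>' x v"
proof -
  have d: "((\<lambda>x. \<psi> x *\<^sub>R v) has_derivative (blinfun_scaleR_left v o\<^sub>L \<psi>' x)) (at x)" for x
  proof -
    have "blinfun_apply (blinfun_scaleR_left v o\<^sub>L \<psi>' x) = (\<lambda>u. \<psi>' x u *\<^sub>R v)" by auto
    then show ?thesis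
      using has_derivative_scaleR_left[OF test_functionD(2)[OF assms, of x]] by simp
  qed
  have "closure {x. \<psi> x *\<^sub>R v \<noteq> 0} \<subseteq> closure {x. \<psi> x \<noteq> 0}"
    by (intro closure_mono) auto
  then show "(\<lambda>x. \<psi> x *\<^sub>R v) \<in> C1c_fields A"
    unfolding C1c_fields_def mem_Collect_eq
  proof (intro conjI exI[of _ "\<lambda>x. (blinfun_scaleR_left v o\<^sub>L \<psi>' x)"] allI
        continuous_on_coordinatewise_then_product)
    show "compact (closure {x. \<psi> x *\<^sub>R v \<noteq> 0})"
      by (metis \<open>closure {x. \<psi> x *\<^sub>R v \<noteq> 0} \<subseteq> closure {x. \<psi> x \<noteq> 0}\<close> closed_Int_compact
          closed_closure inf_absorb1 test_functionD(3)[OF assms])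
    show "continuous_on UNIV (\<lambda>x. blinfun_apply (blinfun_scaleR_left v o\<^sub>L \<psi>' x) i)" for i
      using test_functionD(1)[OF assms] by (simp, intro continuous_intros)
  qed (use d test_functionD(4)[OF assms] in auto)
  have "frechet_derivative (\<lambda>x. \<psi> x *\<^sub>R v) (at x) = (blinfun_scaleR_left v o\<^sub>L \<psi>' x)"
    by (rule frechet_derivative_at[OF d, symmetric])
  then have "divergence (\<lambda>x. \<psi> x *\<^sub>R v) x = (\<Sum>i\<in>UNIV. \<psi>' x (v $ i *\<^sub>R axis i 1))"
    by (simp add: divergence_def blinfun.scaleR_right mult.commute)
  also have "\<dots> = \<psi>' x (\<Sum>i\<in>UNIV. v $ i *\<^sub>R axis i 1)"
    by (simp only: blinfun.sum_right)
  also have "(\<Sum>i\<in>UNIV. v $ i *\<^sub>R axis i 1) = v"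
    using basis_expansion[of v] by (simp add: scalar_mult_eq_scaleR)
  finally show "divergence (\<lambda>x. \<psi> x *\<^sub>R v) x = \<psi>' x v" .
qed

text \<open>The converse reduction: a field is handled through its scalar components, each tested in
  its own coordinate direction.\<close>

lemma field_test_function:
  fixes \<phi> :: "real ^ 'n \<Rightarrow> real ^ 'n"
  assumes "\<phi> \<in> C1c_fields A"
  obtains \<phi>' where "\<And>i. test_function A (\<lambda>x. \<phi> x $ i) (\<phi>' i)"
    "\<And>x. divergence \<phi> x = (\<Sum>i\<in>UNIV. \<phi>' i x (axis i 1))"
proof -
  from assms obtain D :: "real ^ 'n \<Rightarrow> (real ^ 'n) \<Rightarrow>\<^sub>L (real ^ 'n)"
    where D0: "continuous_on UNIV (\<lambda>x. blinfun_apply (D x))"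
    and D: "\<And>x. (\<phi> has_derivative blinfun_apply (D x)) (at x)"
    and c: "compact (closure {x. \<phi> x \<noteq> 0})" "closure {x. \<phi> x \<noteq> 0} \<subseteq> A"
    unfolding C1c_fields_def by blast
  \<comment> \<open>In \<open>C1c_fields\<close> the derivative is continuous as a function-valued
    map, that is, vector by vector. In finite dimension continuity on a basis gives continuity in
    the operator norm.\<close>
  have contD: "continuous_on UNIV D"
    by (rule continuous_on_blinfun_componentwise)
      (use continuous_on_product_then_coordinatewise[OF D0] in auto)
  define \<phi>' where "\<phi>' i x = blinfun_inner_right (axis i 1) o\<^sub>L D x" for i x
  have ap: "\<phi>' i x v = D x v $ i" for i x v
    by (simp add: \<phi>'_def inner_axis' )
  show ?thesis
  proof
    fix i
    have sub: "closure {x. \<phi> x $ i \<noteq> 0} \<subseteq> closure {x. \<phi> x \<noteq> 0}"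
      by (intro closure_mono) auto
    have "((\<lambda>x. \<phi> x $ i) has_derivative \<phi>' i x) (at x)" for x
    proof -
      have "blinfun_apply (\<phi>' i x) = (\<lambda>v. D x v $ i)" by (auto simp: ap)
      then show ?thesis
        using bounded_linear.has_derivative[OF bounded_linear_vec_nth D] by auto
    qed
    moreover have "continuous_on UNIV (\<phi>' i)"
      unfolding \<phi>'_def using contD by (auto intro!: continuous_intros)
    moreover have "compact (closure {x. \<phi> x $ i \<noteq> 0})"
      by (metis c(1) sub closed_Int_compact closed_closure inf_absorb1)
    ultimately show "test_function A (\<lambda>x. \<phi> x $ i) (\<phi>' i)"
      using sub c by (auto simp: test_function_def)
  next
    fix x
    have "frechet_derivative \<phi> (at x) = D x"
      by (rule frechet_derivative_at[OF D, symmetric])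
    then show "divergence \<phi> x = (\<Sum>i\<in>UNIV. \<phi>' i x (axis i 1))"
      by (simp add: divergence_def ap)
  qed
qed

section \<open>Integrals against translated test functions\<close>

text \<open>Differentiation under the integral: the difference quotients of \<psi> are bounded by
  its Lipschitz constant times \<open>norm \<xi>\<close>, so a multiple of
  \<open>\<bar>w\<bar>\<close> dominates.\<close>

lemma integral_test_translation_deriv:
  fixes w :: "real ^ 'n \<Rightarrow> real"
  assumes w: "integrable lborel w" and \<psi>: "test_function A \<psi> \<psi>'"
  shows "((\<lambda>t. LINT x|lborel. w x * \<psi> (x - t *\<^sub>R \<xi>)) has_real_derivative
     - (LINT x|lborel. w x * \<psi>' (x - s *\<^sub>R \<xi>) \<xi>)) (at s)"
proof -
  have [measurable]: "w \<in> borel_measurable borel" using w by auto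
  have [measurable]: "\<psi> \<in> borel_measurable borel" "\<psi>' \<in> borel_measurable borel"
    using test_function_continuous[OF \<psi>] test_functionD(1)[OF \<psi>]
    by (auto intro: borel_measurable_continuous_onI)
  have [measurable]: "(\<lambda>x. \<psi>' x v) \<in> borel_measurable borel" for v
    using test_functionD(1)[OF \<psi>] by (intro borel_measurable_continuous_onI continuous_intros)
  obtain B where B: "B > 0" "\<And>x. \<bar>\<psi> x\<bar> \<le> B" "\<And>x. norm (\<psi>' x) \<le> B"
    by (rule test_function_bounded[OF \<psi>]) blast
  have int: "integrable lborel (\<lambda>x. w x * \<psi> (x - t *\<^sub>R \<xi>))" for t
    by (rule Bochner_Integration.integrable_bound[OF integrable_mult_right[OF integrable_abs[OF w], of B]])
      (use B in \<open>auto simp: abs_mult mult.commute[of B] intro!: mult_left_mono order_trans[OF B(2) abs_ge_self]\<close>)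
  have d: "((\<lambda>t. \<psi> (x - t *\<^sub>R \<xi>)) has_real_derivative - \<psi>' (x - s *\<^sub>R \<xi>) \<xi>) (at s)" for x
  proof -
    have "((\<lambda>t. x - t *\<^sub>R \<xi>) has_derivative (\<lambda>r. - (r *\<^sub>R \<xi>))) (at s)"
      by (auto intro!: derivative_eq_intros)
    from has_derivative_compose[OF this test_functionD(2)[OF \<psi>]]
    show ?thesis
      unfolding has_field_derivative_def
      by (rule has_derivative_eq_rhs) (auto simp: blinfun.minus_right blinfun.scaleR_right)
  qed
  show ?thesis
    unfolding has_field_derivative_iff tendsto_at_iff_sequentially comp_def
  proof (intro allI impI)
    fix X :: "nat \<Rightarrow> real" assume X: "\<forall>i. X i \<in> UNIV - {s}" "X \<longlonglongrightarrow> s"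
    have "(\<lambda>i. LINT x|lborel. w x * ((\<psi> (x - X i *\<^sub>R \<xi>) - \<psi> (x - s *\<^sub>R \<xi>)) / (X i - s)))
        \<longlonglongrightarrow> (LINT x|lborel. w x * - \<psi>' (x - s *\<^sub>R \<xi>) \<xi>)"
    proof (rule integral_dominated_convergence[where w = "\<lambda>x. B * norm \<xi> * \<bar>w x\<bar>"])
      show "AE x in lborel. (\<lambda>i. w x * ((\<psi> (x - X i *\<^sub>R \<xi>) - \<psi> (x - s *\<^sub>R \<xi>)) / (X i - s)))
          \<longlonglongrightarrow> w x * - \<psi>' (x - s *\<^sub>R \<xi>) \<xi>"
      proof (intro AE_I2 tendsto_mult_left)
        fix x
        show "(\<lambda>i. (\<psi> (x - X i *\<^sub>R \<xi>) - \<psi> (x - s *\<^sub>R \<xi>)) / (X i - s)) \<longlonglongrightarrow> - \<psi>' (x - s *\<^sub>R \<xi>) \<xi>"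
          using d[of x, unfolded has_field_derivative_iff tendsto_at_iff_sequentially comp_def, rule_format, of X]
            X by simp
      qed
    next
      fix i
      have "\<bar>\<psi> (x - X i *\<^sub>R \<xi>) - \<psi> (x - s *\<^sub>R \<xi>)\<bar> \<le> B * norm \<xi> * \<bar>X i - s\<bar>" for x
      proof -
        have "\<bar>\<psi> (x - X i *\<^sub>R \<xi>) - \<psi> (x - s *\<^sub>R \<xi>)\<bar> \<le> B * norm ((s - X i) *\<^sub>R \<xi>)"
          using test_function_lipschitz[OF \<psi> B(3), of "x - X i *\<^sub>R \<xi>" "x - s *\<^sub>R \<xi>"]
          by (simp add: algebra_simps)
        then show ?thesis by (simp add: mult.commute mult.left_commute abs_minus_commute)
      qed
      then have "\<bar>(\<psi> (x - X i *\<^sub>R \<xi>) - \<psi> (x - s *\<^sub>R \<xi>)) / (X i - s)\<bar> \<le> B * norm \<xi>" for x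
        using X(1) by (simp add: divide_le_eq)
      then show "AE x in lborel. norm (w x * ((\<psi> (x - X i *\<^sub>R \<xi>) - \<psi> (x - s *\<^sub>R \<xi>)) / (X i - s)))
          \<le> B * norm \<xi> * \<bar>w x\<bar>"
        unfolding real_norm_def abs_mult by (intro AE_I2) (metis abs_ge_zero mult.commute mult_right_mono)
    qed (use w in auto)
    moreover have eq: "(LINT x|lborel. w x * ((\<psi> (x - X i *\<^sub>R \<xi>) - \<psi> (x - s *\<^sub>R \<xi>)) / (X i - s))) =
      ((LINT x|lborel. w x * \<psi> (x - X i *\<^sub>R \<xi>)) - (LINT x|lborel. w x * \<psi> (x - s *\<^sub>R \<xi>))) / (X i - s)" for i
    proof -
      have "(LINT x|lborel. w x * ((\<psi> (x - X i *\<^sub>R \<xi>) - \<psi> (x - s *\<^sub>R \<xi>)) / (X i - s))) =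
        (LINT x|lborel. (w x * \<psi> (x - X i *\<^sub>R \<xi>) - w x * \<psi> (x - s *\<^sub>R \<xi>)) / (X i - s))"
        by (simp add: right_diff_distrib)
      then show ?thesis by (simp only: integral_divide_zero Bochner_Integration.integral_diff[OF int int])
    qed
    ultimately show "(\<lambda>i. ((LINT x|lborel. w x * \<psi> (x - X i *\<^sub>R \<xi>)) -
        (LINT x|lborel. w x * \<psi> (x - s *\<^sub>R \<xi>))) / (X i - s))
      \<longlonglongrightarrow> - (LINT x|lborel. w x * \<psi>' (x - s *\<^sub>R \<xi>) \<xi>)"
      by (simp only: eq mult_minus_right Bochner_Integration.integral_minus)
  qed
qed

text \<open>Discrete integration by parts: translation invariance moves the difference from w to
  \<psi>, which is differentiable.\<close>

lemma integral_test_difference: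
  fixes w :: "real ^ 'n \<Rightarrow> real"
  assumes w: "integrable lborel w" and \<psi>: "test_function A \<psi> \<psi>'"
  shows "(LINT x|lborel. \<psi> x * (w (x + h) - w x)) =
    (LINT x|lborel. w x * \<psi> (x - h)) - (LINT x|lborel. w x * \<psi> x)"
proof -
  have [measurable]: "w \<in> borel_measurable borel" using w by auto
  have [measurable]: "\<psi> \<in> borel_measurable borel"
    using test_function_continuous[OF \<psi>] by (auto intro: borel_measurable_continuous_onI)
  obtain B where B: "B > 0" "\<And>x. \<bar>\<psi> x\<bar> \<le> B" "\<And>x. norm (\<psi>' x) \<le> B"
    by (rule test_function_bounded[OF \<psi>]) blast
  have int: "integrable lborel (\<lambda>x. \<psi> x * v x)" if "integrable lborel v" for v :: "real ^ 'n \<Rightarrow> real"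
    by (rule Bochner_Integration.integrable_bound[OF integrable_mult_right[OF integrable_abs[OF that], of B]])
      (use that in \<open>auto simp: abs_mult B mult_right_mono less_imp_le[OF B(1)]\<close>)
  have "(LINT x|lborel. \<psi> x * (w (x + h) - w x)) = (LINT x|lborel. \<psi> x * w (x + h)) - (LINT x|lborel. \<psi> x * w x)"
    using int[OF w] int[OF integrable_translation[OF w]] by (simp add: right_diff_distrib)
  also have "(LINT x|lborel. \<psi> x * w (x + h)) = (LINT x|lborel. w x * \<psi> (x - h))"
    using integral_translation[of "\<lambda>x. w x * \<psi> (x - h)" h] by (simp add: mult.commute)
  finally show ?thesis by (simp add: mult.commute)
qed

text \<open>Mean value inequality along the segment from 0 to \<open>t *\<^sub>R \<xi>\<close>. A
  bound on the distributional derivative, tested with all translates of \<psi> on the segment,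
  becomes a bound on a translation difference.\<close>

lemma integral_test_difference_bound:
  fixes w :: "real ^ 'n \<Rightarrow> real"
  assumes w: "integrable lborel w" and \<psi>: "test_function A \<psi> \<psi>'" and t: "t \<ge> 0"
    and C: "\<And>s. 0 \<le> s \<Longrightarrow> s \<le> t \<Longrightarrow> \<bar>LINT x|lborel. w x * \<psi>' (x - s *\<^sub>R \<xi>) \<xi>\<bar> \<le> C"
  shows "\<bar>LINT x|lborel. \<psi> x * (w (x + t *\<^sub>R \<xi>) - w x)\<bar> \<le> C * t"
proof -
  let ?h = "\<lambda>t. LINT x|lborel. w x * \<psi> (x - t *\<^sub>R \<xi>)"
  have "norm (?h t - ?h 0) \<le> C * norm (t - 0)"
  proof (rule field_differentiable_bound[where S = "{0..t}"
        and f' = "\<lambda>s. - (LINT x|lborel. w x * \<psi>' (x - s *\<^sub>R \<xi>) \<xi>)"])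
    show "(?h has_field_derivative - (LINT x|lborel. w x * \<psi>' (x - s *\<^sub>R \<xi>) \<xi>)) (at s within {0..t})" for s
      using integral_test_translation_deriv[OF w \<psi>] by (rule has_field_derivative_at_within)
  qed (use C t in auto)
  then show ?thesis using integral_test_difference[OF w \<psi>, of "t *\<^sub>R \<xi>"] t by simp
qed

section \<open>Continuously differentiable approximations of a sign\<close>

lemma real_polynomial_function_C1:
  fixes p :: "'a::euclidean_space \<Rightarrow> real"
  assumes "real_polynomial_function p"
  shows "\<exists>p' :: 'a \<Rightarrow> 'a \<Rightarrow>\<^sub>L real. continuous_on UNIV p' \<and> (\<forall>x. (p has_derivative blinfun_apply (p' x)) (at x))"
  using assms
proof induction
  case (linear f)
  then show ?case
    by (intro exI[of _ "\<lambda>_. Blinfun f"])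
      (auto simp: bounded_linear_Blinfun_apply bounded_linear_imp_has_derivative)
next
  case (const c)
  then show ?case by (intro exI[of _ "\<lambda>_. 0"]) auto
next
  case (add f g)
  then obtain f' g' where *: "continuous_on UNIV f'" "\<And>x. (f has_derivative blinfun_apply (f' x)) (at x)"
    "continuous_on UNIV g'" "\<And>x. (g has_derivative blinfun_apply (g' x)) (at x)" by blast
  then show ?case
    by (intro exI[of _ "\<lambda>x. f' x + g' x"])
      (auto simp: plus_blinfun.rep_eq intro!: continuous_intros has_derivative_add)
next
  case (mult f g)
  then obtain f' g' where *: "continuous_on UNIV f'" "\<And>x. (f has_derivative blinfun_apply (f' x)) (at x)"
    "continuous_on UNIV g'" "\<And>x. (g has_derivative blinfun_apply (g' x)) (at x)" by blast
  have c: "continuous_on UNIV f" "continuous_on UNIV g"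
    using * by (meson continuous_at_imp_continuous_on has_derivative_continuous)+
  have "((\<lambda>x. f x * g x) has_derivative blinfun_apply (f x *\<^sub>R g' x + g x *\<^sub>R f' x)) (at x)" for x
  proof -
    have "blinfun_apply (f x *\<^sub>R g' x + g x *\<^sub>R f' x) = (\<lambda>h. f x * g' x h + f' x h * g x)"
      by (auto simp: plus_blinfun.rep_eq scaleR_blinfun.rep_eq)
    then show ?thesis using has_derivative_mult[OF *(2) *(4)] by simp
  qed
  moreover have "continuous_on UNIV (\<lambda>x. f x *\<^sub>R g' x + g x *\<^sub>R f' x)"
    using * c by (auto intro!: continuous_intros)
  ultimately show ?case by blast
qed

text \<open>Squaring removes the kink of the positive part at 0; this makes truncation at a level
  compatible with continuous differentiability.\<close>

lemma DERIV_max0_square: "((\<lambda>s::real. (max 0 s)\<^sup>2) has_real_derivative 2 * max 0 x) (at x)"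
proof -
  consider "x > 0" | "x < 0" | "x = 0" by linarith
  then show ?thesis
  proof cases
    case 1
    have "((\<lambda>s::real. s\<^sup>2) has_real_derivative 2 * max 0 x) (at x)"
      using 1 by (auto intro!: derivative_eq_intros)
    then show ?thesis
      by (rule has_field_derivative_transform_within_open[of _ _ _ "{0<..}"]) (use 1 in auto)
  next
    case 2
    have "((\<lambda>s::real. 0) has_real_derivative 2 * max 0 x) (at x)"
      using 2 by (auto intro!: derivative_eq_intros)
    then show ?thesis
      by (rule has_field_derivative_transform_within_open[of _ _ _ "{..<0}"]) (use 2 in auto)
  next
    case 3
    have "((\<lambda>h. ((max 0 h)\<^sup>2 - (max 0 0)\<^sup>2) / (h - 0)) \<longlongrightarrow> 0) (at (0::real))"
    proof (rule Lim_null_comparison)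
      have "norm (((max 0 h)\<^sup>2 - (max 0 0)\<^sup>2) / (h - 0)) \<le> \<bar>h\<bar>" for h :: real
        by (auto simp: max_def power2_eq_square)
      then show "\<forall>\<^sub>F h in at (0::real). norm (((max 0 h)\<^sup>2 - (max 0 0)\<^sup>2) / (h - 0)) \<le> \<bar>h\<bar>" by simp
      show "((\<lambda>h. \<bar>h\<bar>) \<longlongrightarrow> 0) (at (0::real))"
        by (intro tendsto_rabs_zero) (rule tendsto_ident_at)
    qed
    then show ?thesis using 3 by (simp add: has_field_derivative_iff)
  qed
qed

text \<open>
  A polynomial \<open>p\<close> within \<open>\<eta>\<close> of a continuous function is made to vanish wherever that function
  does, without losing differentiability, by passing to \<open>((p - \<eta>)\<^sup>+)\<^sup>2 - ((- p - \<eta>)\<^sup>+)\<^sup>2\<close>.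
\<close>

lemma test_function_separation:
  fixes A :: "(real ^ 'n) set"
  assumes A: "open A" and K: "compact K1" "compact K2" "K1 \<inter> K2 = {}" "K1 \<subseteq> A" "K2 \<subseteq> A"
    and e: "0 < e" "e < 1"
  obtains \<psi> \<psi>' where "test_function A \<psi> \<psi>'" "\<And>x. \<bar>\<psi> x\<bar> \<le> 1"
    "\<And>x. x \<in> K1 \<Longrightarrow> 1 - e \<le> \<psi> x" "\<And>x. x \<in> K2 \<Longrightarrow> \<psi> x \<le> e - 1"
proof -
  have "compact (K1 \<union> K2)" "K1 \<union> K2 \<subseteq> A" using K by auto
  then obtain d where d: "d > 0" "(\<Union>x\<in>K1 \<union> K2. cball x d) \<subseteq> A"
    using compact_subset_open_imp_cball_epsilon_subset[OF _ A] by metis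
  \<comment> \<open>A neighbourhood of the two compact sets whose closure is still in A. The support
    of \<psi> will lie in this closure.\<close>
  define V where "V = (\<Union>x\<in>K1 \<union> K2. ball x (d / 2))"
  have oV: "open V" by (auto simp: V_def)
  have KV: "K1 \<subseteq> V" "K2 \<subseteq> V"
    using d(1) by (auto simp: V_def intro!: bexI[of _ "_"])
  have clV: "closure V \<subseteq> A"
  proof
    fix y assume "y \<in> closure V"
    then obtain z where z: "z \<in> V" "dist z y < d / 2"
      using d(1) closure_approachable[of y V] by (auto dest: spec[of _ "d/2"])
    then obtain x where "x \<in> K1 \<union> K2" "dist x z < d / 2" by (auto simp: V_def)
    then have "y \<in> cball x d" using z dist_triangle[of x y z] by auto
    then show "y \<in> A" using d \<open>x \<in> K1 \<union> K2\<close> by blast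
  qed
  have bV: "bounded V"
  proof -
    obtain B where B: "\<forall>x\<in>K1 \<union> K2. norm x \<le> B"
      using compact_imp_bounded[OF \<open>compact (K1 \<union> K2)\<close>] unfolding bounded_iff ..
    have "norm y \<le> B + d / 2" if y: "y \<in> V" for y
    proof -
      obtain x where "x \<in> K1 \<union> K2" "norm (y - x) < d / 2"
        using y by (auto simp: V_def dist_norm norm_minus_commute[of _ y])
      then show ?thesis using B[rule_format, of x] norm_triangle_sub[of y x] by simp
    qed
    then show ?thesis by (auto simp: bounded_iff)
  qed
  then obtain R where R: "closure V \<subseteq> ball 0 R"
    using bounded_subset_ballD[OF bounded_closure] by blast
  obtain f1 :: "real ^ 'n \<Rightarrow> real" where f1: "continuous_on UNIV f1" "\<And>x. f1 x \<in> closed_segment 1 0"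
    "\<And>x. x \<in> K1 \<Longrightarrow> f1 x = 1" "\<And>x. x \<in> K2 \<union> - V \<Longrightarrow> f1 x = 0"
    by (rule Urysohn[of K1 "K2 \<union> - V" 1 0]) (use K KV oV in \<open>auto simp: compact_imp_closed\<close>)
  obtain f2 :: "real ^ 'n \<Rightarrow> real" where f2: "continuous_on UNIV f2" "\<And>x. f2 x \<in> closed_segment 1 0"
    "\<And>x. x \<in> K2 \<Longrightarrow> f2 x = 1" "\<And>x. x \<in> K1 \<union> - V \<Longrightarrow> f2 x = 0"
    by (rule Urysohn[of K2 "K1 \<union> - V" 1 0]) (use K KV oV in \<open>auto simp: compact_imp_closed\<close>)
  define f where "f x = f1 x - f2 x" for x
  have "0 \<le> f1 x" "f1 x \<le> 1" "0 \<le> f2 x" "f2 x \<le> 1" for x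
    using f1(2)[of x] f2(2)[of x] by (auto simp: closed_segment_eq_real_ivl)
  then have fb: "\<bar>f x\<bar> \<le> 1" for x unfolding f_def by (smt (verit))
  have cf: "continuous_on (cball 0 R) f"
    unfolding f_def by (intro continuous_intros continuous_on_subset[OF f1(1)] continuous_on_subset[OF f2(1)]) auto
  \<comment> \<open>On \<open>K1\<close> the polynomial exceeds 1 - \<eta>, hence \<kappa> of it
    exceeds the square of 1 - 2 \<eta>, which is at least 1 - 4 \<eta> = 1 - e.\<close>
  define \<eta> where "\<eta> = e / 4"
  have \<eta>: "0 < \<eta>" "\<eta> < 1 / 4" using e by (auto simp: \<eta>_def)
  obtain p where p: "real_polynomial_function p" "\<And>x. x \<in> cball 0 R \<Longrightarrow> \<bar>f x - p x\<bar> < \<eta>"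
    using Stone_Weierstrass_real_polynomial_function[OF compact_cball cf \<eta>(1)] by blast
  obtain p' where p': "continuous_on UNIV p'" "\<And>x. (p has_derivative blinfun_apply (p' x)) (at x)"
    using real_polynomial_function_C1[OF p(1)] by blast
  have cp: "continuous_on UNIV p"
    using p' by (meson continuous_at_imp_continuous_on has_derivative_continuous)
  define \<kappa> where "\<kappa> s = (max 0 (s - \<eta>))\<^sup>2 - (max 0 (- s - \<eta>))\<^sup>2" for s
  define \<kappa>' where "\<kappa>' s = 2 * max 0 (s - \<eta>) + 2 * max 0 (- s - \<eta>)" for s
  have \<kappa>d: "(\<kappa> has_real_derivative \<kappa>' s) (at s)" for s
  proof -
    have 1: "((\<lambda>s. (max 0 (s - \<eta>))\<^sup>2) has_real_derivative 2 * max 0 (s - \<eta>) * 1) (at s)"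
      by (rule DERIV_chain2[OF DERIV_max0_square]) (auto intro!: derivative_eq_intros)
    have 2: "((\<lambda>s. (max 0 (- s - \<eta>))\<^sup>2) has_real_derivative 2 * max 0 (- s - \<eta>) * (-1)) (at s)"
      by (rule DERIV_chain2[OF DERIV_max0_square]) (auto intro!: derivative_eq_intros)
    show ?thesis
      using DERIV_diff[OF 1 2] by (simp add: \<kappa>_def[abs_def] \<kappa>'_def)
  qed
  \<comment> \<open>The polynomial is controlled only on the ball, so \<psi> is set to 0 outside.
    Off V inside the ball, f is 0 and \<bar>p\<bar> < \<eta>, where \<kappa> and \<kappa>' vanish.
    The two formulas thus agree on the overlap of the ball with the complement of
    \<open>closure V\<close>, and differentiability is checked on these two open sets.\<close>
  define \<psi> where "\<psi> x = (if x \<in> ball 0 R then \<kappa> (p x) else 0)" for x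
  define \<psi>' where "\<psi>' x = (if x \<in> ball 0 R then \<kappa>' (p x) *\<^sub>R p' x else 0)" for x
  have out: "\<psi> x = 0" "\<psi>' x = 0" if "x \<notin> V" for x
  proof -
    have "\<bar>p x\<bar> < \<eta>" if "x \<in> ball 0 R"
      using p(2)[of x] f1(4)[of x] f2(4)[of x] \<open>x \<notin> V\<close> that by (auto simp: f_def)
    then show "\<psi> x = 0" "\<psi>' x = 0"
      by (auto simp: \<psi>_def \<psi>'_def \<kappa>_def \<kappa>'_def max_def)
  qed
  have sub: "closure {x. \<psi> x \<noteq> 0} \<subseteq> closure V"
    using out by (intro closure_mono) auto
  have cov: "ball 0 R \<union> - closure V = UNIV" using R by auto
  have \<psi>t: "test_function A \<psi> \<psi>'"
    unfolding test_function_def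
  proof (intro conjI allI)
    have "continuous_on (ball 0 R \<union> - closure V) \<psi>'"
    proof (rule continuous_on_open_Un)
      have "continuous_on UNIV (\<lambda>x. \<kappa>' (p x) *\<^sub>R p' x)"
        unfolding \<kappa>'_def by (intro continuous_intros p' cp)
      then show "continuous_on (ball 0 R) \<psi>'"
        using continuous_on_cong[of "ball 0 R" "ball 0 R" \<psi>' "\<lambda>x. \<kappa>' (p x) *\<^sub>R p' x"]
        by (auto simp: \<psi>'_def elim: continuous_on_subset)
      have "x \<notin> V" if "x \<in> - closure V" for x using that closure_subset by auto
      then have "\<psi>' x = 0" if "x \<in> - closure V" for x using out(2) that by blast
      then show "continuous_on (- closure V) \<psi>'"
        using continuous_on_cong[of "- closure V" "- closure V" \<psi>' "\<lambda>x. 0"] by simp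
    qed auto
    then show "continuous_on UNIV \<psi>'" unfolding cov .
    fix x
    show "(\<psi> has_derivative blinfun_apply (\<psi>' x)) (at x)"
    proof (cases "x \<in> ball 0 R")
      case True
      have "((\<lambda>x. \<kappa> (p x)) has_derivative (\<lambda>h. blinfun_apply (p' x) h * \<kappa>' (p x))) (at x)"
        using has_derivative_compose[OF p'(2) \<kappa>d[unfolded has_field_derivative_def]]
        by (simp add: mult.commute)
      moreover have "blinfun_apply (\<psi>' x) = (\<lambda>h. blinfun_apply (p' x) h * \<kappa>' (p x))"
        using True by (auto simp: \<psi>'_def scaleR_blinfun.rep_eq)
      ultimately have "((\<lambda>x. \<kappa> (p x)) has_derivative blinfun_apply (\<psi>' x)) (at x)" by simp
      then show ?thesis
        by (rule has_derivative_transform_within_open[of _ _ _ _ "ball 0 R"]) (use True in \<open>auto simp: \<psi>_def\<close>)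
    next
      case False
      then have x: "x \<in> - closure V" using R by auto
      have *: "y \<notin> V" if "y \<in> - closure V" for y using that closure_subset by auto
      then have "((\<lambda>x. 0) has_derivative blinfun_apply (\<psi>' x)) (at x)"
        using x out(2) by (simp add: zero_blinfun.rep_eq)
      then show ?thesis
        by (rule has_derivative_transform_within_open[of _ _ _ _ "- closure V"]) (use x * out(1) in auto)
    qed
  next
    show "compact (closure {x. \<psi> x \<noteq> 0})"
      using bounded_subset[OF bounded_closure[OF bV] sub] by (simp add: compact_eq_bounded_closed)
    show "closure {x. \<psi> x \<noteq> 0} \<subseteq> A" using sub clV by auto
  qed
  have V_ball: "V \<subseteq> ball 0 R" using R closure_subset by blast
  have "\<bar>\<psi> x\<bar> \<le> 1" for x
  proof (cases "x \<in> ball 0 R")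
    case True
    have "\<bar>p x\<bar> < 1 + \<eta>" using p(2)[of x] fb[of x] True by auto
    then have "(max 0 (p x - \<eta>))\<^sup>2 \<le> 1" "(max 0 (- p x - \<eta>))\<^sup>2 \<le> 1"
      by (auto intro!: power_le_one)
    then show ?thesis using True by (auto simp: \<psi>_def \<kappa>_def abs_le_iff) (smt (verit) zero_le_power2)+
  qed (simp add: \<psi>_def)
  moreover have sq: "1 - e \<le> (1 - 2 * \<eta>)\<^sup>2"
    by (simp add: \<eta>_def power2_eq_square algebra_simps)
  have "1 - e \<le> \<psi> x" if "x \<in> K1" for x
  proof -
    have x: "x \<in> ball 0 R" using that KV V_ball by auto
    have "p x > 1 - \<eta>" using p(2)[of x] f1(3)[of x] f2(4)[of x] that x by (auto simp: f_def)
    then have "(1 - 2 * \<eta>)\<^sup>2 \<le> \<psi> x"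
      using x \<eta> by (simp add: \<psi>_def \<kappa>_def max_def)
    then show ?thesis using sq by simp
  qed
  moreover have "\<psi> x \<le> e - 1" if "x \<in> K2" for x
  proof -
    have x: "x \<in> ball 0 R" using that KV V_ball by auto
    have "- p x > 1 - \<eta>" using p(2)[of x] f1(4)[of x] f2(3)[of x] that x by (auto simp: f_def)
    then have "(1 - 2 * \<eta>)\<^sup>2 \<le> - \<psi> x"
      using x \<eta> by (simp add: \<psi>_def \<kappa>_def max_def)
    then show ?thesis using sq by simp
  qed
  ultimately show ?thesis using that \<psi>t by blast
qed

lemma inner_regular_diff:
  fixes M :: "'a::{second_countable_topology, complete_space} measure"
  assumes "finite_measure M" and M: "sets M = sets borel" and B: "B \<in> sets borel" and e: "0 < e"
  obtains K where "compact K" "K \<subseteq> B" "measure M (B - K) < e"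
proof -
  interpret finite_measure M by fact
  have "\<exists>K\<in>{K. K \<subseteq> B \<and> compact K}. emeasure M B < emeasure M K + ennreal e"
    by (rule SUP_approx_ennreal[OF _ _ inner_regular[OF M _ B]]) (use e in auto)
  then obtain K where K: "K \<subseteq> B" "compact K" "emeasure M B < emeasure M K + ennreal e" by auto
  have Ks: "K \<in> sets M" "B \<in> sets M" using K B M by (auto simp: compact_imp_closed)
  have "emeasure M K + ennreal e = ennreal (measure M K + e)"
    by (subst ennreal_plus) (use e in \<open>auto simp: emeasure_eq_measure\<close>)
  then have "ennreal (measure M B) < ennreal (measure M K + e)"
    using K(3) by (simp only: emeasure_eq_measure)
  then have "measure M B < measure M K + e" by (subst (asm) ennreal_less_iff) auto
  then have "measure M (B - K) < e"
    using finite_measure_Diff[OF Ks(2,1) K(1)] by simp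
  then show ?thesis using that K by blast
qed

text \<open>The sets where f is positive and negative carry almost all of the finite measure with
  density \<bar>f\<bar> on disjoint compact subsets, and a test function can be close to 1 on one
  and to -1 on the other. M may be infinite: it is used with Lebesgue measure as well as with the
  total variation of a gradient.\<close>

lemma test_function_duality:
  fixes f :: "real ^ 'n \<Rightarrow> real"
  assumes M: "sets M = sets borel" and f: "integrable M f" and A: "open A" and e: "e > 0"
  obtains \<psi> \<psi>' where "test_function A \<psi> \<psi>'" "\<And>x. \<bar>\<psi> x\<bar> \<le> 1"
    "(LINT x|M. indicator A x * \<bar>f x\<bar>) - e \<le> (LINT x|M. \<psi> x * f x)"
proof -
  note [measurable_cong] = M
  have [measurable]: "f \<in> borel_measurable borel" "A \<in> sets borel" using f A by auto
  define \<mu> where "\<mu> = density M (\<lambda>x. ennreal \<bar>f x\<bar>)"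
  have sets_\<mu>: "sets \<mu> = sets borel" by (simp add: \<mu>_def M)
  have fin: "finite_measure \<mu>"
  proof
    have "emeasure \<mu> (space \<mu>) = (\<integral>\<^sup>+ x. ennreal \<bar>f x\<bar> \<partial>M)"
      unfolding \<mu>_def by (subst emeasure_density) (auto intro!: nn_integral_cong)
    also have "\<dots> < \<infinity>" using f by (simp add: integrable_iff_bounded)
    finally show "emeasure \<mu> (space \<mu>) \<noteq> \<infinity>" by simp
  qed
  have int: "integrable M (\<lambda>x. indicator S x * \<bar>f x\<bar>)" if [measurable]: "S \<in> sets borel" for S
    by (rule Bochner_Integration.integrable_bound[OF integrable_abs[OF f]]) (auto simp: indicator_def)
  have meas: "measure \<mu> S = (LINT x|M. indicator S x * \<bar>f x\<bar>)" if [measurable]: "S \<in> sets borel" for S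
  proof -
    have "emeasure \<mu> S = (\<integral>\<^sup>+ x. ennreal (indicator S x * \<bar>f x\<bar>) \<partial>M)"
      unfolding \<mu>_def
      by (subst emeasure_density) (auto intro!: nn_integral_cong simp: indicator_def)
    also have "\<dots> = ennreal (LINT x|M. indicator S x * \<bar>f x\<bar>)"
      by (rule nn_integral_eq_integral) (use int in auto)
    finally show ?thesis by (simp add: measure_def)
  qed
  define I where "I = (LINT x|M. \<bar>f x\<bar>)"
  have I0: "I \<ge> 0" by (simp add: I_def)
  \<comment> \<open>Error budget: the defect \<epsilon> on the compact sets costs at most e/2, and
    each of the two remainders of mass below e/8, counted twice, costs at most e/4.\<close>
  define \<epsilon> where "\<epsilon> = min (1 / 2) (e / (2 * (I + 1)))"
  have \<epsilon>: "0 < \<epsilon>" "\<epsilon> < 1" "\<epsilon> * I \<le> e / 2"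
  proof -
    show "0 < \<epsilon>" "\<epsilon> < 1" using e I0 by (auto simp: \<epsilon>_def)
    have "\<epsilon> * I \<le> e / (2 * (I + 1)) * (I + 1)"
      using I0 e by (intro mult_mono) (auto simp: \<epsilon>_def)
    also have "\<dots> = e / 2" using I0 by (simp add: field_simps)
    finally show "\<epsilon> * I \<le> e / 2" .
  qed
  define P where "P = {x \<in> A. f x > 0}"
  define N where "N = {x \<in> A. f x < 0}"
  have [measurable]: "P \<in> sets borel" "N \<in> sets borel"
    unfolding P_def N_def by measurable
  have e8: "e / 8 > 0" using e by simp
  obtain K1 where K1: "compact K1" "K1 \<subseteq> P" "measure \<mu> (P - K1) < e / 8"
    by (rule inner_regular_diff[OF fin sets_\<mu> _ e8, of P]) auto
  obtain K2 where K2: "compact K2" "K2 \<subseteq> N" "measure \<mu> (N - K2) < e / 8"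
    by (rule inner_regular_diff[OF fin sets_\<mu> _ e8, of N]) auto
  have [measurable]: "K1 \<in> sets borel" "K2 \<in> sets borel" using K1 K2 by (auto simp: compact_imp_closed)
  have PN: "P \<inter> N = {}" by (auto simp: P_def N_def)
  then have "K1 \<inter> K2 = {}" using K1(2) K2(2) by blast
  obtain \<psi> \<psi>' where \<psi>: "test_function A \<psi> \<psi>'" "\<And>x. \<bar>\<psi> x\<bar> \<le> 1"
    "\<And>x. x \<in> K1 \<Longrightarrow> 1 - \<epsilon> \<le> \<psi> x" "\<And>x. x \<in> K2 \<Longrightarrow> \<psi> x \<le> \<epsilon> - 1"
  proof (rule test_function_separation[OF A K1(1) K2(1) \<open>K1 \<inter> K2 = {}\<close> _ _ \<epsilon>(1,2)])
    show "K1 \<subseteq> A" "K2 \<subseteq> A" using K1(2) K2(2) by (auto simp: P_def N_def)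
  qed blast
  have [measurable]: "\<psi> \<in> borel_measurable borel"
    using test_function_continuous[OF \<psi>(1)] by (auto intro: borel_measurable_continuous_onI)
  \<comment> \<open>On a remainder set only \<psi> f \<ge> -\<bar>f\<bar> is known, while the target
    is \<bar>f\<bar>; hence the factor 2.\<close>
  let ?r = "\<lambda>x. indicator A x * \<bar>f x\<bar> - \<epsilon> * \<bar>f x\<bar> - 2 * (indicator (P - K1) x * \<bar>f x\<bar>) - 2 * (indicator (N - K2) x * \<bar>f x\<bar>)"
  have pw: "?r x \<le> \<psi> x * f x" for x
  proof -
    have ab: "\<bar>\<psi> x * f x\<bar> \<le> \<bar>f x\<bar>" using \<psi>(2)[of x] by (simp add: abs_mult mult_left_le_one_le)
    have ef: "0 \<le> \<epsilon> * \<bar>f x\<bar>" using \<epsilon> by simp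
    consider "x \<in> K1" | "x \<in> K2" | "x \<in> P - K1" | "x \<in> N - K2" | "x \<in> A" "f x = 0" | "x \<notin> A"
      unfolding P_def N_def by (cases "x \<in> A"; cases "f x" "0::real" rule: linorder_cases) auto
    then show ?thesis
    proof cases
      case 1
      then have "x \<in> P" "x \<notin> N" using K1(2) PN by blast+
      then have "f x > 0" "x \<in> A" "x \<notin> N" by (auto simp: P_def)
      moreover have "(1 - \<epsilon>) * f x \<le> \<psi> x * f x"
        using \<psi>(3)[OF 1] \<open>f x > 0\<close> by (intro mult_right_mono) auto
      ultimately show ?thesis using 1 by (simp add: algebra_simps)
    next
      case 2
      then have "x \<in> N" "x \<notin> P" using K2(2) PN by blast+
      then have "f x < 0" "x \<in> A" "x \<notin> P" by (auto simp: N_def)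
      moreover have "(\<epsilon> - 1) * f x \<le> \<psi> x * f x"
        using \<psi>(4)[OF 2] \<open>f x < 0\<close> by (intro mult_right_mono_neg) auto
      ultimately show ?thesis using 2 by (simp add: algebra_simps)
    next
      case 3
      then have "x \<in> A" "x \<notin> N" by (auto simp: P_def N_def)
      then show ?thesis using 3 ab ef by (simp add: indicator_def)
    next
      case 4
      then have "x \<in> A" "x \<notin> P" by (auto simp: P_def N_def)
      then show ?thesis using 4 ab ef by (simp add: indicator_def)
    next
      case 6
      then have "x \<notin> P" "x \<notin> N" by (auto simp: P_def N_def)
      have "\<psi> x = 0" using test_functionD(4)[OF \<psi>(1)] 6 closure_subset[of "{x. \<psi> x \<noteq> 0}"] by auto
      then show ?thesis using 6 ef \<open>x \<notin> P\<close> \<open>x \<notin> N\<close> by (simp add: indicator_def)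
    qed (simp add: indicator_def)
  qed
  have "(LINT x|M. ?r x) \<le> (LINT x|M. \<psi> x * f x)"
  proof (rule integral_mono)
    show "integrable M ?r" using f int by (intro Bochner_Integration.integrable_diff integrable_mult_right integrable_abs) auto
    show "integrable M (\<lambda>x. \<psi> x * f x)"
      by (rule Bochner_Integration.integrable_bound[OF integrable_abs[OF f]])
        (use \<psi>(2) in \<open>auto simp: abs_mult mult_left_le_one_le\<close>)
  qed (use pw in auto)
  also have "(LINT x|M. ?r x) = (LINT x|M. indicator A x * \<bar>f x\<bar>) - \<epsilon> * I - 2 * measure \<mu> (P - K1) - 2 * measure \<mu> (N - K2)"
    using f int by (simp add: meas I_def)
  finally have "(LINT x|M. indicator A x * \<bar>f x\<bar>) - e \<le> (LINT x|M. \<psi> x * f x)"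
    using \<epsilon>(3) K1(3) K2(3) by linarith
  then show ?thesis using that \<psi> by blast
qed

subsection \<open>Directional variation\<close>

definition shift_diff :: "('a::euclidean_space \<Rightarrow> real) \<Rightarrow> 'a \<Rightarrow> real" where
  "shift_diff w h = (LINT x|lborel. \<bar>w (x + h) - w x\<bar>)"

lemma integrable_shift_diff:
  fixes w :: "'a::euclidean_space \<Rightarrow> real"
  assumes "integrable lborel w"
  shows "integrable lborel (\<lambda>x. \<bar>w (x + h) - w x\<bar>)"
  using assms by (intro integrable_abs Bochner_Integration.integrable_diff integrable_translation)

lemma shift_diff_nonneg: "0 \<le> shift_diff w h"
  by (simp add: shift_diff_def)

lemma shift_diff_0 [simp]: "shift_diff w 0 = 0"
  by (simp add: shift_diff_def)

lemma integral_abs_translation: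
  fixes w :: "'a::euclidean_space \<Rightarrow> real"
  assumes "integrable lborel w"
  shows "(LINT x|lborel. \<bar>w (x + h)\<bar>) = (LINT x|lborel. \<bar>w x\<bar>)"
  using integral_translation[of "\<lambda>x. \<bar>w x\<bar>" h] assms by simp

lemma shift_diff_le:
  assumes "integrable lborel w"
  shows "shift_diff w h \<le> 2 * (LINT x|lborel. \<bar>w x\<bar>)"
proof -
  have "shift_diff w h \<le> (LINT x|lborel. \<bar>w (x + h)\<bar> + \<bar>w x\<bar>)"
    unfolding shift_diff_def
    by (intro integral_mono integrable_shift_diff assms Bochner_Integration.integrable_add
        integrable_abs integrable_translation) auto
  also have "\<dots> = (LINT x|lborel. \<bar>w (x + h)\<bar>) + (LINT x|lborel. \<bar>w x\<bar>)"
    using assms by (intro Bochner_Integration.integral_add integrable_abs integrable_translation)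
  finally show ?thesis using integral_abs_translation[OF assms] by simp
qed

lemma shift_diff_add_le:
  assumes w: "integrable lborel w"
  shows "shift_diff w (h + k) \<le> shift_diff w h + shift_diff w k"
proof -
  have [measurable]: "w \<in> borel_measurable borel" using w by auto
  have i: "integrable lborel (\<lambda>x. \<bar>w (x + k + h) - w (x + k)\<bar>)"
    by (rule integrable_translation[OF integrable_shift_diff[OF w]])
  have "shift_diff w (h + k) \<le> (LINT x|lborel. \<bar>w (x + k + h) - w (x + k)\<bar> + \<bar>w (x + k) - w x\<bar>)"
    unfolding shift_diff_def
    by (intro integral_mono integrable_shift_diff w Bochner_Integration.integrable_add i) (auto simp: algebra_simps)
  also have "\<dots> = (LINT x|lborel. \<bar>w (x + k + h) - w (x + k)\<bar>) + shift_diff w k"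
    unfolding shift_diff_def by (intro Bochner_Integration.integral_add i integrable_shift_diff w)
  also have "(LINT x|lborel. \<bar>w (x + k + h) - w (x + k)\<bar>) = shift_diff w h"
    unfolding shift_diff_def by (rule integral_translation) measurable
  finally show ?thesis .
qed

lemma shift_diff_minus [simp]:
  assumes "integrable lborel w"
  shows "shift_diff w (- h) = shift_diff w h"
proof -
  have [measurable]: "w \<in> borel_measurable borel" using assms by auto
  show ?thesis
    using integral_translation[of "\<lambda>x. \<bar>w (x + h) - w x\<bar>" "- h"]
    by (simp add: shift_diff_def abs_minus_commute)
qed

lemma shift_diff_cmult: "shift_diff (\<lambda>x. c * w x) h = \<bar>c\<bar> * shift_diff w h"
  unfolding shift_diff_def by (simp add: abs_mult flip: right_diff_distrib)

lemma shift_diff_diff_le: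
  assumes w: "integrable lborel w" and v: "integrable lborel v"
  shows "shift_diff (\<lambda>x. w x - v x) h \<le> shift_diff w h + shift_diff v h"
proof -
  have "shift_diff (\<lambda>x. w x - v x) h \<le> (LINT x|lborel. \<bar>w (x + h) - w x\<bar> + \<bar>v (x + h) - v x\<bar>)"
    unfolding shift_diff_def
    by (intro integral_mono Bochner_Integration.integrable_add integrable_shift_diff
        Bochner_Integration.integrable_diff v w integrable_abs integrable_translation) auto
  also have "\<dots> = shift_diff w h + shift_diff v h"
    unfolding shift_diff_def by (intro Bochner_Integration.integral_add integrable_shift_diff w v)
  finally show ?thesis .
qed

text \<open>For fixed h the functional \<open>shift_diff\<close> is Lipschitz in the L^1 distance.
  The semicontinuity of \<open>dir_var\<close> and the passage of translation bounds to limits rest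
  on this.\<close>

lemma shift_diff_L1_le:
  assumes w: "integrable lborel w" and v: "integrable lborel v"
  shows "shift_diff w h \<le> shift_diff v h + 2 * (LINT x|lborel. \<bar>w x - v x\<bar>)"
proof -
  have wv: "integrable lborel (\<lambda>x. w x - v x)" using w v by auto
  have "shift_diff w h \<le> (LINT x|lborel. \<bar>v (x + h) - v x\<bar> + \<bar>(w (x + h) - v (x + h)) - (w x - v x)\<bar>)"
    unfolding shift_diff_def
    by (intro integral_mono Bochner_Integration.integrable_add integrable_shift_diff
        Bochner_Integration.integrable_diff v w integrable_abs integrable_translation) auto
  also have "\<dots> = shift_diff v h + shift_diff (\<lambda>x. w x - v x) h"
    unfolding shift_diff_def by (intro Bochner_Integration.integral_add integrable_shift_diff w v wv)
  finally show ?thesis using shift_diff_le[OF wv, of h] by simp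
qed

text \<open>
  Variation is measured by translations, without distributional derivatives; \<open>dir_var w \<xi>\<close> equals
  the integral of \<open>\<bar>\<sigma>\<^sub>w \<bullet> \<xi>\<bar>\<close> with respect to \<open>|Dw|\<close>.
\<close>

definition finite_variation :: "('a::euclidean_space \<Rightarrow> real) \<Rightarrow> bool" where
  "finite_variation w \<longleftrightarrow> integrable lborel w \<and> (\<exists>C. \<forall>h. shift_diff w h \<le> C * norm h)"

definition dir_var :: "('a::euclidean_space \<Rightarrow> real) \<Rightarrow> 'a \<Rightarrow> real" where
  "dir_var w \<xi> = (SUP t\<in>{0<..}. shift_diff w (t *\<^sub>R \<xi>) / t)"

lemma finite_variation_integrable: "finite_variation w \<Longrightarrow> integrable lborel w"
  by (simp add: finite_variation_def)

text \<open>The constant in \<open>finite_variation\<close> bounds all quotients, so that the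
  real-valued supremum in \<open>dir_var\<close> is a genuine one.\<close>

lemma dir_var_upper:
  assumes w: "finite_variation w" and t: "0 \<le> t"
  shows "shift_diff w (t *\<^sub>R \<xi>) \<le> t * dir_var w \<xi>"
proof (cases "t = 0")
  case False
  obtain C where C: "\<And>h. shift_diff w h \<le> C * norm h" using w by (auto simp: finite_variation_def)
  have "shift_diff w (t *\<^sub>R \<xi>) / t \<le> dir_var w \<xi>"
    unfolding dir_var_def
  proof (rule cSUP_upper)
    show "bdd_above ((\<lambda>t. shift_diff w (t *\<^sub>R \<xi>) / t) ` {0<..})"
    proof (rule bdd_aboveI2)
      fix t :: real assume "t \<in> {0<..}"
      then show "shift_diff w (t *\<^sub>R \<xi>) / t \<le> C * norm \<xi>"
        using C[of "t *\<^sub>R \<xi>"] by (simp add: divide_le_eq mult_ac)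
    qed
  qed (use False t in auto)
  then show ?thesis using False t by (simp add: divide_le_eq mult_ac)
qed simp

lemma dir_var_least:
  assumes "\<And>t. 0 < t \<Longrightarrow> shift_diff w (t *\<^sub>R \<xi>) \<le> t * C"
  shows "dir_var w \<xi> \<le> C"
  unfolding dir_var_def
  by (rule cSUP_least) (use assms in \<open>auto simp: divide_le_eq mult_ac\<close>)

lemma shift_diff_le_dir_var:
  assumes "finite_variation w" shows "shift_diff w \<xi> \<le> dir_var w \<xi>"
  using dir_var_upper[OF assms, of 1 \<xi>] by simp

lemma dir_var_nonneg:
  assumes "finite_variation w" shows "0 \<le> dir_var w \<xi>"
  using shift_diff_le_dir_var[OF assms] shift_diff_nonneg by (rule order_trans[rotated])

lemma dir_var_le_norm:
  assumes "\<And>h. shift_diff w h \<le> C * norm h"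
  shows "dir_var w \<xi> \<le> C * norm \<xi>"
proof (rule dir_var_least)
  fix t :: real assume "t > 0"
  then show "shift_diff w (t *\<^sub>R \<xi>) \<le> t * (C * norm \<xi>)"
    using assms[of "t *\<^sub>R \<xi>"] by (simp add: mult_ac)
qed

lemma dir_var_add_le:
  assumes w: "finite_variation w"
  shows "dir_var w (\<xi> + \<eta>) \<le> dir_var w \<xi> + dir_var w \<eta>"
proof (rule dir_var_least)
  fix t :: real assume t: "t > 0"
  have "shift_diff w (t *\<^sub>R (\<xi> + \<eta>)) \<le> shift_diff w (t *\<^sub>R \<xi>) + shift_diff w (t *\<^sub>R \<eta>)"
    using shift_diff_add_le[OF finite_variation_integrable[OF w]] by (simp add: scaleR_add_right)
  also have "\<dots> \<le> t * (dir_var w \<xi> + dir_var w \<eta>)"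
    using dir_var_upper[OF w, of t \<xi>] dir_var_upper[OF w, of t \<eta>] t by (simp add: distrib_left)
  finally show "shift_diff w (t *\<^sub>R (\<xi> + \<eta>)) \<le> t * (dir_var w \<xi> + dir_var w \<eta>)" .
qed

lemma dir_var_scaleR_le:
  assumes w: "finite_variation w"
  shows "dir_var w (c *\<^sub>R \<xi>) \<le> \<bar>c\<bar> * dir_var w \<xi>"
proof (rule dir_var_least)
  fix t :: real assume t: "t > 0"
  have "shift_diff w (t *\<^sub>R c *\<^sub>R \<xi>) = shift_diff w ((t * \<bar>c\<bar>) *\<^sub>R \<xi>)"
    using shift_diff_minus[OF finite_variation_integrable[OF w], of "(t * c) *\<^sub>R \<xi>"]
    by (cases "c \<ge> 0") auto
  also have "\<dots> \<le> t * (\<bar>c\<bar> * dir_var w \<xi>)"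
    using dir_var_upper[OF w, of "t * \<bar>c\<bar>" \<xi>] t by (simp add: mult.assoc)
  finally show "shift_diff w (t *\<^sub>R c *\<^sub>R \<xi>) \<le> t * (\<bar>c\<bar> * dir_var w \<xi>)" .
qed

lemma dir_var_scaleR:
  assumes w: "finite_variation w"
  shows "dir_var w (c *\<^sub>R \<xi>) = \<bar>c\<bar> * dir_var w \<xi>"
proof (cases "c = 0")
  case True
  then show ?thesis
    using dir_var_scaleR_le[OF w, of 0 \<xi>] dir_var_nonneg[OF w, of 0] by simp
next
  case False
  have "\<bar>c\<bar> * dir_var w \<xi> \<le> \<bar>c\<bar> * (\<bar>1 / c\<bar> * dir_var w (c *\<^sub>R \<xi>))"
    using dir_var_scaleR_le[OF w, of "1 / c" "c *\<^sub>R \<xi>"] False by (intro mult_left_mono) auto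
  then show ?thesis using dir_var_scaleR_le[OF w, of c \<xi>] False by (simp add: abs_mult[symmetric] flip: mult.assoc)
qed

lemma dir_var_0:
  assumes w: "finite_variation w"
  shows "dir_var w 0 = 0"
  using dir_var_scaleR[OF w, of 0 0] by simp

lemma dir_var_sum_le:
  assumes w: "finite_variation w" and "finite I"
  shows "dir_var w (\<Sum>i\<in>I. c i *\<^sub>R b i) \<le> (\<Sum>i\<in>I. \<bar>c i\<bar> * dir_var w (b i))"
  using assms(2)
proof (induction I)
  case (insert i I)
  have "dir_var w (\<Sum>i\<in>insert i I. c i *\<^sub>R b i) \<le> dir_var w (c i *\<^sub>R b i) + dir_var w (\<Sum>i\<in>I. c i *\<^sub>R b i)"
    using insert dir_var_add_le[OF w] by simp
  then show ?case using insert dir_var_scaleR[OF w] by simp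
qed (simp add: dir_var_0[OF w])

lemma continuous_on_dir_var:
  assumes w: "finite_variation w"
  shows "continuous_on UNIV (dir_var w)"
proof -
  obtain C0 where C0: "\<And>h. shift_diff w h \<le> C0 * norm h" using w by (auto simp: finite_variation_def)
  define C where "C = \<bar>C0\<bar>"
  have b: "dir_var w \<xi> \<le> C * norm \<xi>" for \<xi>
    by (rule order_trans[OF dir_var_le_norm[OF C0]]) (auto simp: C_def intro: mult_right_mono)
  have d: "dir_var w \<xi> - dir_var w \<eta> \<le> C * dist \<xi> \<eta>" for \<xi> \<eta>
    using dir_var_add_le[OF w, of \<eta> "\<xi> - \<eta>"] b[of "\<xi> - \<eta>"] by (simp add: dist_norm)
  have "C-lipschitz_on UNIV (dir_var w)"
  proof (rule lipschitz_onI)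
    show "dist (dir_var w \<xi>) (dir_var w \<eta>) \<le> C * dist \<xi> \<eta>" for \<xi> \<eta>
      using d[of \<xi> \<eta>] d[of \<eta> \<xi>] by (simp add: dist_real_def dist_commute abs_le_iff)
  qed (simp add: C_def)
  then show ?thesis by (rule lipschitz_on_continuous_on)
qed

lemma borel_measurable_dir_var [measurable]:
  "finite_variation w \<Longrightarrow> dir_var w \<in> borel_measurable borel"
  by (intro borel_measurable_continuous_onI continuous_on_dir_var)

text \<open>A translation by the diameter of the support separates the two copies of \<open>w\<close>.\<close>

lemma dir_var_ge_L1:
  fixes w :: "'a::euclidean_space \<Rightarrow> real"
  assumes w: "finite_variation w" and R: "R > 0" "\<And>x. R \<le> norm x \<Longrightarrow> w x = 0"
  shows "(LINT x|lborel. \<bar>w x\<bar>) * norm \<xi> \<le> R * dir_var w \<xi>"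
proof (cases "\<xi> = 0")
  case False
  note wi = finite_variation_integrable[OF w]
  define t where "t = 2 * R / norm \<xi>"
  have t: "t > 0" "norm (t *\<^sub>R \<xi>) = 2 * R" using False R by (auto simp: t_def)
  have "\<bar>w (x + t *\<^sub>R \<xi>) - w x\<bar> = \<bar>w (x + t *\<^sub>R \<xi>)\<bar> + \<bar>w x\<bar>" for x
  proof (cases "norm x < R")
    case True
    then have "norm (x + t *\<^sub>R \<xi>) \<ge> R"
      using norm_triangle_ineq2[of "t *\<^sub>R \<xi>" "- x"] t(2) by (simp add: add.commute)
    then show ?thesis using R by simp
  qed (use R in auto)
  then have "shift_diff w (t *\<^sub>R \<xi>) = (LINT x|lborel. \<bar>w (x + t *\<^sub>R \<xi>)\<bar> + \<bar>w x\<bar>)"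
    by (simp add: shift_diff_def)
  also have "\<dots> = (LINT x|lborel. \<bar>w (x + t *\<^sub>R \<xi>)\<bar>) + (LINT x|lborel. \<bar>w x\<bar>)"
    using wi by (intro Bochner_Integration.integral_add integrable_abs integrable_translation)
  also have "\<dots> = 2 * (LINT x|lborel. \<bar>w x\<bar>)"
    using integral_abs_translation[OF wi] by simp
  finally have "2 * (LINT x|lborel. \<bar>w x\<bar>) \<le> t * dir_var w \<xi>"
    using dir_var_upper[OF w, of t \<xi>] t by simp
  then show ?thesis using False R by (simp add: t_def field_simps)
qed (use dir_var_nonneg[OF w] R in auto)

subsection \<open>Vector measures and their densities\<close>

lemma norm_le_variation_of:
  assumes D: "vector_measure D" and A: "A \<in> sets borel"
  shows "ennreal (norm (D A)) \<le> variation_of D A"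
proof -
  define E where "E i = (if i = (0::nat) then A else {})" for i
  have "(\<Sum>i. ennreal (norm (D (E i)))) = ennreal (norm (D (E 0)))"
    by (subst suminf_finite[of "{0}"]) (auto simp: E_def vector_measure_empty[OF D])
  moreover have "(\<Sum>i. ennreal (norm (D (E i)))) \<le> variation_of D A"
  proof (rule variation_of_upper)
    show "range E \<subseteq> sets borel" using A by (auto simp: E_def)
    show "disjoint_family E" by (auto simp: E_def disjoint_family_on_def)
    show "(\<Union>i. E i) = A" by (auto simp: E_def split: if_splits)
  qed
  ultimately show ?thesis by (simp add: E_def)
qed

text \<open>Domination by M makes M + \<nu> a positive finite measure, to which the positive
  Radon-Nikodym theorem applies. Subtracting 1 from its density gives that of \<nu>.\<close>

lemma scalar_measure_density:
  fixes \<nu> :: "'a set \<Rightarrow> real"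
  assumes "finite_measure M"
    and sums: "\<And>A::nat \<Rightarrow> 'a set. range A \<subseteq> sets M \<Longrightarrow> disjoint_family A \<Longrightarrow> (\<lambda>i. \<nu> (A i)) sums \<nu> (\<Union>i. A i)"
    and le: "\<And>A. A \<in> sets M \<Longrightarrow> \<bar>\<nu> A\<bar> \<le> measure M A"
  obtains f where "integrable M f" "\<And>A. A \<in> sets M \<Longrightarrow> \<nu> A = (LINT x:A|M. f x)"
proof -
  interpret finite_measure M by fact
  define m where "m A = ennreal (measure M A + \<nu> A)" for A
  define N where "N = measure_of (space M) (sets M) m"
  have nn: "0 \<le> measure M A + \<nu> A" if "A \<in> sets M" for A using le[OF that] by linarith
  have e0: "\<nu> {} = 0" using le[of "{}"] by simp
  have em: "emeasure N A = m A" if "A \<in> sets M" for A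
    unfolding N_def
  proof (rule emeasure_measure_of_sigma)
    show "sigma_algebra (space M) (sets M)" ..
    show "positive (sets M) m" by (simp add: positive_def m_def e0)
    show "countably_additive (sets M) m"
    proof (rule countably_additiveI)
      fix A :: "nat \<Rightarrow> 'a set" assume A: "range A \<subseteq> sets M" "disjoint_family A"
      have s: "(\<lambda>i. measure M (A i) + \<nu> (A i)) sums (measure M (\<Union>i. A i) + \<nu> (\<Union>i. A i))"
        by (intro sums_add finite_measure_UNION sums A)
      have "(\<Sum>i. m (A i)) = ennreal (\<Sum>i. measure M (A i) + \<nu> (A i))"
        unfolding m_def using A s by (intro suminf_ennreal2 nn) (auto simp: sums_iff)
      then show "(\<Sum>i. m (A i)) = m (\<Union> (range A))"
        using s by (simp add: sums_iff m_def)
    qed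
  qed fact
  have sets_N: "sets N = sets M" by (simp add: N_def)
  have "absolutely_continuous M N"
    unfolding absolutely_continuous_def
  proof
    fix A assume "A \<in> null_sets M"
    then have A: "A \<in> sets M" "measure M A = 0" by (auto simp: null_sets_def measure_def)
    then have "\<nu> A = 0" using le[of A] by simp
    then show "A \<in> null_sets N" using A em[of A] by (auto simp: null_sets_def sets_N m_def)
  qed
  from Radon_Nikodym[OF this sets_N] obtain g where
    g: "g \<in> borel_measurable M" "density M g = N" by blast
  note [measurable] = g(1)
  have gA: "(\<integral>\<^sup>+ x. g x * indicator A x \<partial>M) = m A" if "A \<in> sets M" for A
    using em[OF that] emeasure_density[OF g(1) that] g(2) by simp
  have "(\<integral>\<^sup>+ x. g x \<partial>M) = m (space M)"
    unfolding gA[OF sets.top, symmetric] by (intro nn_integral_cong) (auto simp: indicator_def)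
  then have gf: "(\<integral>\<^sup>+ x. g x \<partial>M) \<noteq> \<infinity>" by (simp add: m_def)
  have fin: "AE x in M. g x \<noteq> \<infinity>" by (rule nn_integral_noteq_infinite) (use gf in auto)
  define f where "f x = enn2real (g x) - 1" for x
  have gi: "integrable M (\<lambda>x. enn2real (g x))"
  proof (rule integrableI_nonneg)
    have "(\<integral>\<^sup>+ x. ennreal (enn2real (g x)) \<partial>M) \<le> (\<integral>\<^sup>+ x. g x \<partial>M)"
      by (intro nn_integral_mono) (simp add: ennreal_enn2real_if)
    then show "(\<integral>\<^sup>+ x. ennreal (enn2real (g x)) \<partial>M) < \<infinity>"
      using gf by (simp add: top.not_eq_extremum order_le_less_trans)
  qed auto
  show ?thesis
  proof
    show "integrable M f" unfolding f_def using gi by auto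
    fix A assume A: "A \<in> sets M"
    have gAi: "integrable M (\<lambda>x. indicator A x *\<^sub>R enn2real (g x))"
      using A gi by (rule integrable_mult_indicator)
    have "ennreal (LINT x|M. indicator A x *\<^sub>R enn2real (g x)) =
        (\<integral>\<^sup>+ x. ennreal (indicator A x *\<^sub>R enn2real (g x)) \<partial>M)"
      by (rule nn_integral_eq_integral[symmetric, OF gAi]) auto
    also have "\<dots> = (\<integral>\<^sup>+ x. g x * indicator A x \<partial>M)"
      by (rule nn_integral_cong_AE) (use fin in \<open>auto simp: indicator_def ennreal_enn2real_if\<close>)
    also have "\<dots> = m A" by (rule gA[OF A])
    finally have "(LINT x|M. indicator A x *\<^sub>R enn2real (g x)) = measure M A + \<nu> A"
      unfolding m_def using nn[OF A] by (subst (asm) ennreal_inj) auto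
    moreover have "(LINT x:A|M. f x) = (LINT x|M. indicator A x *\<^sub>R enn2real (g x)) - (LINT x|M. indicator A x)"
      unfolding set_lebesgue_integral_def f_def using gAi A
      by (subst Bochner_Integration.integral_diff[symmetric]) (auto simp: algebra_simps fmeasurable_def less_top[symmetric])
    ultimately show "\<nu> A = (LINT x:A|M. f x)" using A by simp
  qed
qed

text \<open>The derivative is a choice, so a witness must be produced. Each component of D is
  dominated by the total variation, since \<bar>D A\<bar> is a term of the variation of A, and the
  scalar densities are assembled into a vector.\<close>

lemma vector_RN_deriv:
  fixes D :: "(real ^ 'n) set \<Rightarrow> real ^ 'n"
  assumes D: "vector_measure D" and fin: "finite_measure (total_variation D)"
  defines "\<sigma> \<equiv> vector_RN_deriv (total_variation D) D"
  shows "integrable (total_variation D) \<sigma>"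
    and "A \<in> sets borel \<Longrightarrow> D A = (LINT x:A|total_variation D. \<sigma> x)"
proof -
  let ?M = "total_variation D"
  interpret finite_measure ?M by fact
  have "\<exists>f. integrable ?M f \<and> (\<forall>A\<in>sets ?M. D A $ i = (LINT x:A|?M. f x))" for i
  proof (rule scalar_measure_density[OF fin, of "\<lambda>A. D A $ i"])
    fix A :: "nat \<Rightarrow> (real ^ 'n) set" assume "range A \<subseteq> sets ?M" "disjoint_family A"
    then have "(\<lambda>j. D (A j)) sums D (\<Union>j. A j)" using D by (simp add: vector_measure_def)
    then show "(\<lambda>j. D (A j) $ i) sums D (\<Union>j. A j) $ i"
      by (rule bounded_linear.sums[OF bounded_linear_vec_nth])
  next
    fix A assume "A \<in> sets ?M"
    then have A: "A \<in> sets borel" by simp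
    have "ennreal (norm (D A)) \<le> ennreal (measure ?M A)"
      using norm_le_variation_of[OF D A] emeasure_total_variation[OF D A] by (simp add: emeasure_eq_measure)
    then have "norm (D A) \<le> measure ?M A" by (subst (asm) ennreal_le_iff) auto
    then show "\<bar>D A $ i\<bar> \<le> measure ?M A" using component_le_norm_cart[of "D A" i] by linarith
  qed blast
  then obtain f where f: "\<And>i. integrable ?M (f i)" "\<And>i A. A \<in> sets ?M \<Longrightarrow> D A $ i = (LINT x:A|?M. f i x)"
    by metis
  define s where "s x = (\<Sum>i\<in>UNIV. f i x *\<^sub>R axis i (1::real))" for x
  have si: "s x $ i = f i x" for x i
    by (simp add: s_def axis_def if_distrib cong: if_cong)
  have int: "integrable ?M s"
    unfolding s_def using f(1) by auto
  have "D A = (LINT x:A|?M. s x)" if A: "A \<in> sets ?M" for A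
  proof (rule vec_eq_iff[THEN iffD2], rule allI)
    fix i
    have "integrable ?M (\<lambda>x. indicator A x *\<^sub>R s x)" using A int by (rule integrable_mult_indicator)
    from integral_bounded_linear[OF bounded_linear_vec_nth this, of i]
    show "D A $ i = (LINT x:A|?M. s x) $ i"
      using f(2)[OF A, of i] by (simp add: set_lebesgue_integral_def si)
  qed
  then have "\<exists>\<sigma>. integrable ?M \<sigma> \<and> (\<forall>A\<in>sets ?M. D A = (LINT x:A|?M. \<sigma> x))" using int by blast
  from someI_ex[OF this]
  show "integrable ?M \<sigma>" "A \<in> sets borel \<Longrightarrow> D A = (LINT x:A|?M. \<sigma> x)"
    unfolding \<sigma>_def vector_RN_deriv_def by auto
qed

section \<open>Directional variation as an integral against the gradient measure\<close>

lemma integral_lebesgue_eq_lborel: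
  fixes f :: "'a::euclidean_space \<Rightarrow> real"
  assumes "f \<in> borel_measurable borel"
  shows "(LINT x|lebesgue. f x) = (LINT x|lborel. f x)"
  using integral_completion[of f lborel] assms by simp

lemma gradient_measure_directional:
  fixes w :: "real ^ 'n \<Rightarrow> real"
  assumes w: "w \<in> borel_measurable borel" and D: "is_gradient_measure w D" and \<psi>: "test_function A \<psi> \<psi>'"
  shows "(LINT x|total_variation D. \<psi> x * (vector_RN_deriv (total_variation D) D x \<bullet> \<xi>)) =
    - (LINT x|lborel. w x * \<psi>' x \<xi>)"
proof -
  note [measurable] = w
  have [measurable]: "(\<lambda>x. \<psi>' x \<xi>) \<in> borel_measurable borel"
    using test_functionD(1)[OF \<psi>] by (intro borel_measurable_continuous_onI continuous_intros)
  have "(\<lambda>x. \<psi> x *\<^sub>R \<xi>) \<in> C1c_fields UNIV"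
    using test_function_field(1)[OF test_function_mono[OF \<psi>, of UNIV]] by simp
  then have "(LINT x|lebesgue. w x * divergence (\<lambda>x. \<psi> x *\<^sub>R \<xi>) x) =
      - (LINT x|total_variation D. (\<psi> x *\<^sub>R \<xi>) \<bullet> vector_RN_deriv (total_variation D) D x)"
    using D unfolding is_gradient_measure_def by blast
  then show ?thesis
    by (simp add: test_function_field(2)[OF \<psi>] integral_lebesgue_eq_lborel inner_commute)
qed

text \<open>The left side is the derivative at 0 of the integral of w against \<psi>(x - t \<xi>).
  Its difference quotients are the integrals of \<psi> against translation differences of w divided
  by t, and \<bar>\<psi>\<bar> \<le> 1.\<close>

lemma integral_test_le_dir_var:
  fixes w :: "real ^ 'n \<Rightarrow> real"
  assumes w: "finite_variation w" and \<psi>: "test_function A \<psi> \<psi>'" "\<And>x. \<bar>\<psi> x\<bar> \<le> 1"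
  shows "- (LINT x|lborel. w x * \<psi>' x \<xi>) \<le> dir_var w \<xi>"
proof -
  note wi = finite_variation_integrable[OF w]
  let ?h = "\<lambda>t. LINT x|lborel. w x * \<psi> (x - t *\<^sub>R \<xi>)"
  have [measurable]: "w \<in> borel_measurable borel" "\<psi> \<in> borel_measurable borel"
    using wi test_function_continuous[OF \<psi>(1)] by (auto intro: borel_measurable_continuous_onI)
  have "((\<lambda>t. (?h t - ?h 0) / (t - 0)) \<longlongrightarrow> - (LINT x|lborel. w x * \<psi>' x \<xi>)) (at 0)"
    using integral_test_translation_deriv[OF wi \<psi>(1), of \<xi> 0]
    by (simp add: has_field_derivative_iff)
  then have "((\<lambda>t. (?h t - ?h 0) / (t - 0)) \<longlongrightarrow> - (LINT x|lborel. w x * \<psi>' x \<xi>)) (at_right 0)"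
    by (rule filterlim_mono) (auto simp: at_le)
  then show ?thesis
  proof (rule tendsto_upperbound)
    have "(?h t - ?h 0) / (t - 0) \<le> dir_var w \<xi>" if t: "t > 0" for t
    proof -
      have "?h t - ?h 0 = (LINT x|lborel. \<psi> x * (w (x + t *\<^sub>R \<xi>) - w x))"
        using integral_test_difference[OF wi \<psi>(1)] by simp
      also have "\<dots> \<le> shift_diff w (t *\<^sub>R \<xi>)"
        unfolding shift_diff_def
      proof (rule integral_mono)
        have le: "\<bar>\<psi> x * (w (x + t *\<^sub>R \<xi>) - w x)\<bar> \<le> \<bar>w (x + t *\<^sub>R \<xi>) - w x\<bar>" for x
          using \<psi>(2)[of x] by (simp add: abs_mult mult_left_le_one_le)
        show "integrable lborel (\<lambda>x. \<psi> x * (w (x + t *\<^sub>R \<xi>) - w x))"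
          by (rule Bochner_Integration.integrable_bound[OF integrable_shift_diff[OF wi]]) (use le in auto)
        show "\<psi> x * (w (x + t *\<^sub>R \<xi>) - w x) \<le> \<bar>w (x + t *\<^sub>R \<xi>) - w x\<bar>" for x
          using le[of x] by linarith
      qed (rule integrable_shift_diff[OF wi])
      also have "\<dots> \<le> t * dir_var w \<xi>" using dir_var_upper[OF w] t by simp
      finally show ?thesis using t by (simp add: divide_le_eq mult_ac)
    qed
    then show "\<forall>\<^sub>F t in at_right 0. (?h t - ?h 0) / (t - 0) \<le> dir_var w \<xi>"
      by (auto simp: eventually_at_right_field intro!: exI[of _ 1])
  qed simp
qed

text \<open>
  Both inequalities test against \<open>C\<^sup>1\<close> functions approximating a sign: that of \<open>\<sigma> \<bullet> \<xi>\<close> for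
  \<open>\<le>\<close>, that of \<open>w (x + t \<xi>) - w x\<close> for \<open>\<ge>\<close>.
\<close>

lemma gradient_measure_dir_var:
  fixes w :: "real ^ 'n \<Rightarrow> real"
  assumes w: "finite_variation w" and D: "is_gradient_measure w D"
  shows "(\<integral>\<^sup>+ x. ennreal \<bar>vector_RN_deriv (total_variation D) D x \<bullet> \<xi>\<bar> \<partial>total_variation D) =
    ennreal (dir_var w \<xi>)"
proof -
  let ?M = "total_variation D"
  define \<sigma> where "\<sigma> = vector_RN_deriv ?M D"
  note wi = finite_variation_integrable[OF w]
  have [measurable]: "w \<in> borel_measurable borel" using wi by auto
  have "vector_measure D" "finite_measure ?M" using D by (auto simp: is_gradient_measure_def)
  from vector_RN_deriv(1)[OF this] have \<sigma>i: "integrable ?M (\<lambda>x. \<sigma> x \<bullet> \<xi>)" by (simp add: \<sigma>_def)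
  have int: "(LINT x|?M. \<psi> x * (\<sigma> x \<bullet> \<xi>)) = - (LINT x|lborel. w x * \<psi>' x \<xi>)"
    if "test_function A \<psi> \<psi>'" for A \<psi> \<psi>'
    using gradient_measure_directional[OF _ D that] by (simp add: \<sigma>_def)
  define N where "N = (LINT x|?M. \<bar>\<sigma> x \<bullet> \<xi>\<bar>)"
  have "N \<le> dir_var w \<xi>"
  proof (rule field_le_epsilon)
    fix e :: real assume e: "e > 0"
    obtain \<psi> \<psi>' where \<psi>: "test_function UNIV \<psi> \<psi>'" "\<And>x. \<bar>\<psi> x\<bar> \<le> 1"
      "(LINT x|?M. indicator UNIV x * \<bar>\<sigma> x \<bullet> \<xi>\<bar>) - e \<le> (LINT x|?M. \<psi> x * (\<sigma> x \<bullet> \<xi>))"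
      by (rule test_function_duality[OF sets_total_variation \<sigma>i open_UNIV e]) blast
    have "- (LINT x|lborel. w x * \<psi>' x \<xi>) \<le> dir_var w \<xi>"
      by (rule integral_test_le_dir_var[OF w \<psi>(1,2)])
    then show "N \<le> dir_var w \<xi> + e"
      using \<psi>(3) int[OF \<psi>(1)] by (simp add: N_def)
  qed
  moreover have "dir_var w \<xi> \<le> N"
  proof (rule dir_var_least)
    fix t :: real assume t: "t > 0"
    show "shift_diff w (t *\<^sub>R \<xi>) \<le> t * N"
    proof (rule field_le_epsilon)
      fix e :: real assume e: "e > 0"
      have fi: "integrable lborel (\<lambda>x. w (x + t *\<^sub>R \<xi>) - w x)"
        using wi by (intro Bochner_Integration.integrable_diff integrable_translation)
      obtain \<psi> \<psi>' where \<psi>: "test_function UNIV \<psi> \<psi>'" "\<And>x. \<bar>\<psi> x\<bar> \<le> 1"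
        "(LINT x|lborel. indicator UNIV x * \<bar>w (x + t *\<^sub>R \<xi>) - w x\<bar>) - e
          \<le> (LINT x|lborel. \<psi> x * (w (x + t *\<^sub>R \<xi>) - w x))"
        by (rule test_function_duality[OF sets_lborel fi open_UNIV e]) blast
      have [measurable]: "\<psi> \<in> borel_measurable borel"
        using test_function_continuous[OF \<psi>(1)] by (auto intro: borel_measurable_continuous_onI)
      \<comment> \<open>All translates of \<psi> are again test functions bounded by 1, so N bounds
        the derivative along the whole segment.\<close>
      have "\<bar>LINT x|lborel. \<psi> x * (w (x + t *\<^sub>R \<xi>) - w x)\<bar> \<le> N * t"
      proof (rule integral_test_difference_bound[OF wi \<psi>(1)])
        fix s :: real
        have "test_function UNIV (\<lambda>x. \<psi> (x - s *\<^sub>R \<xi>)) (\<lambda>x. \<psi>' (x - s *\<^sub>R \<xi>))"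
          by (rule test_function_translate[OF \<psi>(1)]) auto
        from int[OF this] have "\<bar>LINT x|lborel. w x * \<psi>' (x - s *\<^sub>R \<xi>) \<xi>\<bar> =
            \<bar>LINT x|?M. \<psi> (x - s *\<^sub>R \<xi>) * (\<sigma> x \<bullet> \<xi>)\<bar>" by simp
        also have "\<dots> \<le> (LINT x|?M. \<bar>\<psi> (x - s *\<^sub>R \<xi>) * (\<sigma> x \<bullet> \<xi>)\<bar>)"
          using integral_norm_bound[of ?M "\<lambda>x. \<psi> (x - s *\<^sub>R \<xi>) * (\<sigma> x \<bullet> \<xi>)"] by simp
        also have "\<dots> \<le> N"
          unfolding N_def
        proof (rule integral_mono)
          have le: "\<bar>\<psi> (x - s *\<^sub>R \<xi>) * (\<sigma> x \<bullet> \<xi>)\<bar> \<le> \<bar>\<sigma> x \<bullet> \<xi>\<bar>" for x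
            using \<psi>(2)[of "x - s *\<^sub>R \<xi>"] by (simp add: abs_mult mult_left_le_one_le)
          then show "\<bar>\<psi> (x - s *\<^sub>R \<xi>) * (\<sigma> x \<bullet> \<xi>)\<bar> \<le> \<bar>\<sigma> x \<bullet> \<xi>\<bar>" for x .
          show "integrable ?M (\<lambda>x. \<bar>\<psi> (x - s *\<^sub>R \<xi>) * (\<sigma> x \<bullet> \<xi>)\<bar>)"
            by (rule Bochner_Integration.integrable_bound[OF integrable_abs[OF \<sigma>i]]) (use le \<sigma>i in auto)
        qed (use \<sigma>i in auto)
        finally show "\<bar>LINT x|lborel. w x * \<psi>' (x - s *\<^sub>R \<xi>) \<xi>\<bar> \<le> N" .
      qed (use t in auto)
      then show "shift_diff w (t *\<^sub>R \<xi>) \<le> t * N + e"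
        using \<psi>(3) by (simp add: shift_diff_def mult.commute)
    qed
  qed
  ultimately have "dir_var w \<xi> = N" by simp
  moreover have "(\<integral>\<^sup>+ x. ennreal \<bar>\<sigma> x \<bullet> \<xi>\<bar> \<partial>?M) = ennreal N"
    unfolding N_def by (rule nn_integral_eq_integral) (use \<sigma>i in auto)
  ultimately show ?thesis by (simp add: \<sigma>_def)
qed

subsection \<open>Weak limits of measures on bounded sets\<close>

text \<open>Schoenberg's space-filling curve, with \<open>1/2 - cos (\<pi> t)\<close> clamped to the unit interval as base function.\<close>

definition schoenberg_base :: "real \<Rightarrow> real" where
  "schoenberg_base t = max 0 (min 1 (1 / 2 - cos (pi * t)))"

text \<open>Coordinate j of an n-dimensional curve collects the ternary digits of t at the positions
  congruent to j modulo n and reads them as binary digits.\<close>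

definition schoenberg_coord :: "nat \<Rightarrow> nat \<Rightarrow> real \<Rightarrow> real" where
  "schoenberg_coord n j t = (\<Sum>k. schoenberg_base (3 ^ (n * k + j) * t) / 2 ^ Suc k)"

lemma schoenberg_base_bounds: "0 \<le> schoenberg_base t" "schoenberg_base t \<le> 1"
  by (auto simp: schoenberg_base_def)

lemma continuous_schoenberg_coord: "continuous_on UNIV (schoenberg_coord n j)"
proof -
  let ?f = "\<lambda>k t. schoenberg_base (3 ^ (n * k + j) * t) / 2 ^ Suc k"
  have u: "uniform_limit UNIV (\<lambda>N t. \<Sum>k<N. ?f k t) (schoenberg_coord n j) sequentially"
    unfolding schoenberg_coord_def
  proof (rule Weierstrass_m_test[where M = "\<lambda>k. (1 / 2) ^ Suc k"])
    show "norm (?f k t) \<le> (1 / 2) ^ Suc k" for k t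
      using schoenberg_base_bounds[of "3 ^ (n * k + j) * t"]
      by (simp add: power_one_over divide_simps)
    show "summable (\<lambda>k. (1 / 2 :: real) ^ Suc k)"
      using summable_geometric[of "1/2::real"] by (simp add: summable_Suc_iff)
  qed
  show ?thesis
  proof (rule uniform_limit_theorem[OF _ u])
    show "\<forall>\<^sub>F N in sequentially. continuous_on UNIV (\<lambda>t. \<Sum>k<N. ?f k t)"
      unfolding schoenberg_base_def
      by (intro always_eventually allI continuous_intros) auto
  qed simp
qed

lemma binary_expansion:
  fixes y :: real
  assumes "0 \<le> y" "y < 1"
  obtains b :: "nat \<Rightarrow> real" where "\<And>k. b k \<in> {0, 1}" "(\<lambda>k. b k / 2 ^ Suc k) sums y"
proof
  define b where "b k = real_of_int (\<lfloor>2 ^ Suc k * y\<rfloor> - 2 * \<lfloor>2 ^ k * y\<rfloor>)" for k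
  show "b k \<in> {0, 1}" for k
  proof -
    have "2 * \<lfloor>2 ^ k * y\<rfloor> \<le> \<lfloor>2 ^ Suc k * y\<rfloor>"
      by (simp add: le_floor_iff mult.assoc)
    moreover have "\<lfloor>2 ^ Suc k * y\<rfloor> < 2 * \<lfloor>2 ^ k * y\<rfloor> + 2"
      unfolding floor_less_iff using floor_correct[of "2 ^ k * y"] by (simp, linarith)
    ultimately have "\<lfloor>2 ^ Suc k * y\<rfloor> - 2 * \<lfloor>2 ^ k * y\<rfloor> = 0 \<or> \<lfloor>2 ^ Suc k * y\<rfloor> - 2 * \<lfloor>2 ^ k * y\<rfloor> = 1"
      by linarith
    then show ?thesis unfolding b_def by fastforce
  qed
  have part: "(\<Sum>k<N. b k / 2 ^ Suc k) = \<lfloor>2 ^ N * y\<rfloor> / 2 ^ N" for N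
  proof (induction N)
    case 0
    have "\<lfloor>y\<rfloor> = 0" using assms by (simp add: floor_eq_iff)
    then show ?case by simp
  next
    case (Suc N)
    then show ?case by (simp add: b_def field_simps)
  qed
  have "(\<lambda>N. \<lfloor>2 ^ N * y\<rfloor> / 2 ^ N) \<longlonglongrightarrow> y"
  proof (rule tendsto_sandwich[where f = "\<lambda>N. y - (1 / 2) ^ N" and h = "\<lambda>N. y"])
    have "y - (1 / 2) ^ N \<le> \<lfloor>2 ^ N * y\<rfloor> / 2 ^ N" for N
    proof -
      have "y - (1 / 2) ^ N = (2 ^ N * y - 1) / 2 ^ N" by (simp add: power_one_over diff_divide_distrib)
      also have "\<dots> \<le> \<lfloor>2 ^ N * y\<rfloor> / 2 ^ N"
        using floor_correct[of "2 ^ N * y"] by (intro divide_right_mono) auto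
      finally show ?thesis .
    qed
    then show "\<forall>\<^sub>F N in sequentially. y - (1 / 2) ^ N \<le> \<lfloor>2 ^ N * y\<rfloor> / 2 ^ N" by simp
    have "\<lfloor>2 ^ N * y\<rfloor> / 2 ^ N \<le> y" for N
      using floor_correct[of "2 ^ N * y"] by (simp add: field_simps)
    then show "\<forall>\<^sub>F N in sequentially. \<lfloor>2 ^ N * y\<rfloor> / 2 ^ N \<le> y" by simp
    have "(\<lambda>N. y - (1 / 2) ^ N) \<longlonglongrightarrow> y - 0"
      by (intro tendsto_intros LIMSEQ_power_zero) simp
    then show "(\<lambda>N. y - (1 / 2) ^ N) \<longlonglongrightarrow> y" by simp
  qed simp
  then show "(\<lambda>k. b k / 2 ^ Suc k) sums y"
    unfolding sums_def part .
qed

text \<open>The ternary digits of t are 0 or 2. After multiplication by 3^m the first m digits form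
  an even integer, invisible to cos (\<pi> t), which has period 2. What remains lies in [0, 1/3] if
  the next digit is 0 and in [2/3, 1] if it is 2; there the cosine is \<ge> 1/2 resp. \<le> -1/2,
  and clamping gives exactly 0 resp. 1.\<close>

lemma schoenberg_base_digit:
  fixes a :: "nat \<Rightarrow> real"
  assumes a: "\<And>k. a k \<in> {0, 1}"
  defines "t \<equiv> (\<Sum>k. 2 * a k / 3 ^ Suc k)"
  shows "t \<in> {0..1}" and "schoenberg_base (3 ^ m * t) = a m"
proof -
  have a01: "0 \<le> a k" "a k \<le> 1" for k using a[of k] by auto
  have geo: "(\<lambda>k. 2 / 3 ^ Suc k :: real) sums 1"
  proof -
    have "(\<lambda>k. (2 / 3) * (1 / 3) ^ k :: real) sums ((2 / 3) * (1 / (1 - 1 / 3)))"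
      by (intro sums_mult geometric_sums) simp
    then show ?thesis by (simp add: power_one_over)
  qed
  have tail: "summable (\<lambda>k. 2 * a (k + N) / 3 ^ Suc k)" "0 \<le> (\<Sum>k. 2 * a (k + N) / 3 ^ Suc k)"
    "(\<Sum>k. 2 * a (k + N) / 3 ^ Suc k) \<le> 1" for N
  proof -
    have le: "2 * a (k + N) / 3 ^ Suc k \<le> 2 / 3 ^ Suc k" for k
      using a01[of "k + N"] by (simp add: divide_right_mono)
    show s: "summable (\<lambda>k. 2 * a (k + N) / 3 ^ Suc k)"
      by (rule summable_comparison_test_ev[OF _ sums_summable[OF geo]])
        (use le a01 in auto)
    show "0 \<le> (\<Sum>k. 2 * a (k + N) / 3 ^ Suc k)"
      by (rule suminf_nonneg[OF s]) (use a01 in auto)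
    show "(\<Sum>k. 2 * a (k + N) / 3 ^ Suc k) \<le> 1"
      using suminf_le[OF le s sums_summable[OF geo]] sums_unique[OF geo] by simp
  qed
  show "t \<in> {0..1}" using tail(2,3)[of 0] by (simp add: t_def)
  define \<rho> where "\<rho> = (\<Sum>k. 2 * a (k + Suc m) / 3 ^ Suc k) / 3"
  have \<rho>: "0 \<le> \<rho>" "\<rho> \<le> 1 / 3" using tail(2,3)[of "Suc m"] by (auto simp: \<rho>_def)
  define z where "z = (\<Sum>k<m. (if a k = 1 then 1 else 0) * 3 ^ (m - Suc k) :: int)"
  have "3 ^ m * t = 3 ^ m * (\<Sum>k. 2 * a (k + Suc m) / 3 ^ Suc (k + Suc m)) + 3 ^ m * (\<Sum>k<Suc m. 2 * a k / 3 ^ Suc k)"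
    unfolding t_def using suminf_split_initial_segment[OF tail(1)[of 0], of "Suc m"]
    by (simp add: distrib_left)
  also have "3 ^ m * (\<Sum>k. 2 * a (k + Suc m) / 3 ^ Suc (k + Suc m)) = \<rho>"
  proof -
    have "\<rho> = (\<Sum>k. 2 * a (k + Suc m) / 3 ^ Suc k / 3)"
      unfolding \<rho>_def by (rule suminf_divide[OF tail(1), symmetric])
    also have "\<dots> = (\<Sum>k. 3 ^ m * (2 * a (k + Suc m) / 3 ^ Suc (k + Suc m)))"
      by (intro suminf_cong) (simp add: power_add)
    also have "\<dots> = 3 ^ m * (\<Sum>k. 2 * a (k + Suc m) / 3 ^ Suc (k + Suc m))"
    proof (rule suminf_mult)
      have "summable (\<lambda>k. (1 / 3 ^ Suc m) * (2 * a (k + Suc m) / 3 ^ Suc k))"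
        by (intro summable_mult tail)
      then show "summable (\<lambda>k. 2 * a (k + Suc m) / 3 ^ Suc (k + Suc m))"
        by (simp add: power_add mult_ac)
    qed
    finally show ?thesis by simp
  qed
  also have "3 ^ m * (\<Sum>k<Suc m. 2 * a k / 3 ^ Suc k) = 2 * real_of_int z + 2 * a m / 3"
  proof -
    have "3 ^ m * (\<Sum>k<m. 2 * a k / 3 ^ Suc k) = 2 * real_of_int z"
      unfolding z_def of_int_sum sum_distrib_left
    proof (intro sum.cong refl)
      fix k assume "k \<in> {..<m}"
      then have "(3::real) ^ m = 3 ^ (m - Suc k) * 3 ^ Suc k"
        by (subst power_add[symmetric]) simp
      then show "3 ^ m * (2 * a k / 3 ^ Suc k) = 2 * real_of_int ((if a k = 1 then 1 else 0) * 3 ^ (m - Suc k))"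
        using a[of k] by auto
    qed
    then show ?thesis by (simp add: distrib_left)
  qed
  finally have eq: "3 ^ m * t = \<rho> + 2 * a m / 3 + 2 * real_of_int z" by simp
  have cos_eq: "cos (pi * (3 ^ m * t)) = cos (pi * (\<rho> + 2 * a m / 3))"
  proof -
    have "pi * (3 ^ m * t) = pi * (\<rho> + 2 * a m / 3) + 2 * pi * real_of_int z"
      unfolding eq by (simp add: algebra_simps)
    then show ?thesis
      using sin_cos_eq_iff[of "pi * (3 ^ m * t)"] by (metis cos_add sin_cos_eq_iff)
  qed
  show "schoenberg_base (3 ^ m * t) = a m"
  proof (cases "a m = 0")
    case True
    have "pi * \<rho> \<le> pi * (1 / 3)" using \<rho> by (intro mult_left_mono) auto
    then have "cos (pi / 3) \<le> cos (pi * \<rho>)"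
      using \<rho> by (intro cos_monotone_0_pi_le) auto
    then show ?thesis using True cos_eq by (simp add: schoenberg_base_def cos_60)
  next
    case False
    then have am: "a m = 1" using a[of m] by simp
    have "pi * (2 / 3) \<le> pi * (\<rho> + 2 / 3)" "pi * (\<rho> + 2 / 3) \<le> pi * 1"
      using \<rho> by (auto intro!: mult_left_mono)
    then have "cos (pi * (\<rho> + 2 / 3)) \<le> cos (pi * (2 / 3))"
      by (intro cos_monotone_0_pi_le) auto
    moreover have "cos (pi * (2 / 3)) = - 1 / 2" using cos_120 by (simp add: mult.commute)
    ultimately show ?thesis using am cos_eq by (simp add: schoenberg_base_def)
  qed
qed

lemma space_filling_curve:
  obtains s :: "real \<Rightarrow> real ^ 'n" where "continuous_on UNIV s" "cball 0 R \<subseteq> s ` {0..1}"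
proof -
  obtain \<iota> :: "'n \<Rightarrow> nat" and n where \<iota>: "\<iota> ` UNIV = {i. i < n}" "inj \<iota>"
    using finite_imp_inj_to_nat_seg[of "UNIV :: 'n set"] by auto
  \<comment> \<open>Larger than every coordinate of a point of the ball, so that the rescaled
    coordinates are strictly below 1, as \<open>binary_expansion\<close> demands.\<close>
  define \<rho> where "\<rho> = \<bar>R\<bar> + 1"
  have \<rho>: "\<rho> > 0" by (simp add: \<rho>_def)
  define s where "s t = (\<chi> i. 2 * \<rho> * schoenberg_coord n (\<iota> i) t - \<rho>)" for t :: real
  show ?thesis
  proof
    show "continuous_on UNIV s"
      unfolding s_def by (intro continuous_intros continuous_schoenberg_coord)
    show "cball 0 R \<subseteq> s ` {0..1}"
    proof
      fix x :: "real ^ 'n" assume "x \<in> cball 0 R"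
      then have x: "\<bar>x $ i\<bar> < \<rho>" for i
        using component_le_norm_cart[of x i] by (simp add: \<rho>_def)
      define y where "y i = (x $ i + \<rho>) / (2 * \<rho>)" for i
      have "0 \<le> y i" "y i < 1" for i
        using x[of i] \<rho> by (auto simp: y_def field_simps abs_less_iff)
      then have "\<exists>b. (\<forall>k. b k \<in> {0, 1 :: real}) \<and> (\<lambda>k. b k / 2 ^ Suc k) sums y i" for i
        using binary_expansion[of "y i"] by metis
      then obtain b where b: "\<And>i k. b i k \<in> {0, 1 :: real}" "\<And>i. (\<lambda>k. b i k / 2 ^ Suc k) sums y i"
        by metis
      \<comment> \<open>The binary digits of the n coordinates are interleaved into a single
        sequence: digit m belongs to the coordinate numbered m mod n.\<close>
      define a where "a m = b (inv \<iota> (m mod n)) (m div n)" for m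
      have ab: "a (n * k + \<iota> i) = b i k" for k i
      proof -
        have "\<iota> i < n" using \<iota>(1) by auto
        then show ?thesis using \<iota>(2) by (simp add: a_def)
      qed
      have a01: "\<And>k. a k \<in> {0, 1}" using b(1) by (simp add: a_def)
      define t where "t = (\<Sum>k. 2 * a k / 3 ^ Suc k)"
      have "schoenberg_coord n (\<iota> i) t = y i" for i
        unfolding schoenberg_coord_def t_def schoenberg_base_digit(2)[of a, OF a01] ab
        using b(2) by (simp add: sums_iff)
      then have "s t = x" using \<rho> by (simp add: s_def y_def vec_eq_iff)
      moreover have "t \<in> {0..1}" unfolding t_def by (rule schoenberg_base_digit(1)[of a, OF a01])
      ultimately show "x \<in> s ` {0..1}" by blast
    qed
  qed
qed

text \<open>
  A sequence on a ball is pulled back to the unit interval along a Borel section of a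
  space-filling curve, where Helly's selection theorem applies, and its weak limit is pushed forward.
\<close>

lemma weak_limit_in_ball:
  fixes P :: "nat \<Rightarrow> (real ^ 'n) measure"
  assumes P: "\<And>k. prob_space (P k)" "\<And>k. sets (P k) = sets borel"
    and supp: "\<And>k. AE x in P k. norm x \<le> R"
  obtains r Q where "strict_mono (r :: nat \<Rightarrow> nat)" "prob_space Q" "sets Q = sets borel"
    "\<And>\<psi> :: real ^ 'n \<Rightarrow> real. continuous_on UNIV \<psi> \<Longrightarrow> bounded (range \<psi>) \<Longrightarrow>
       (\<lambda>k. LINT x|P (r k). \<psi> x) \<longlonglongrightarrow> (LINT x|Q. \<psi> x)"
proof -
  obtain s :: "real \<Rightarrow> real ^ 'n" where s: "continuous_on UNIV s" "cball 0 R \<subseteq> s ` {0..1}"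
    by (rule space_filling_curve)
  have [measurable]: "s \<in> borel_measurable borel" by (rule borel_measurable_continuous_onI[OF s(1)])
  define F where "F x = {0..1} \<inter> s -` {x}" for x
  have F: "compact (F x)" for x
    unfolding F_def using closed_vimage[of "{x}" s] s(1) by (intro compact_Int_closed) auto
  \<comment> \<open>The smallest parameter mapped to x, a minimum because the fibre is compact. The
    value 1 off the ball is a default on a set of measure 0 for every P k.\<close>
  define \<kappa> where "\<kappa> x = (if norm x \<le> R then Inf (F x) else 1)" for x
  have Finf: "Inf (F x) \<in> F x" if "norm x \<le> R" for x
  proof (rule closed_contains_Inf)
    have "x \<in> s ` {0..1}" using s(2) that by auto
    then show "F x \<noteq> {}" by (auto simp: F_def)
  qed (use F[of x] in \<open>auto simp: compact_imp_closed compact_imp_bounded bounded_imp_bdd_below\<close>)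
  have s\<kappa>: "s (\<kappa> x) = x" if "norm x \<le> R" for x using Finf[OF that] that by (simp add: \<kappa>_def F_def)
  have \<kappa>01: "0 \<le> \<kappa> x" "\<kappa> x \<le> 1" for x using Finf[of x] by (auto simp: \<kappa>_def F_def)
  have [measurable]: "\<kappa> \<in> borel_measurable borel"
  proof (rule borel_measurableI_le)
    fix a :: real
    show "{x \<in> space borel. \<kappa> x \<le> a} \<in> sets borel"
    proof (cases "a < 1")
      case True
      \<comment> \<open>Taking the smallest parameter makes the sublevel sets images of compact
        intervals, hence Borel. For a < 1 the default value 1 does not interfere.\<close>
      have "{x. \<kappa> x \<le> a} = cball 0 R \<inter> s ` ({0..1} \<inter> {..a})"
      proof (intro equalityI subsetI)
        fix x assume x: "x \<in> {x. \<kappa> x \<le> a}"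
        then have n: "norm x \<le> R" using True by (auto simp: \<kappa>_def split: if_splits)
        then show "x \<in> cball 0 R \<inter> s ` ({0..1} \<inter> {..a})"
          using x s\<kappa>[OF n] \<kappa>01[of x] by (auto intro!: image_eqI[of _ _ "\<kappa> x"])
      next
        fix x assume "x \<in> cball 0 R \<inter> s ` ({0..1} \<inter> {..a})"
        then obtain t where t: "norm x \<le> R" "t \<in> F x" "t \<le> a" by (auto simp: F_def)
        have "Inf (F x) \<le> t"
          using t(2) F[of x] by (intro cInf_lower) (auto simp: compact_imp_bounded bounded_imp_bdd_below)
        then show "x \<in> {x. \<kappa> x \<le> a}" using t by (simp add: \<kappa>_def)
      qed
      moreover have "compact (s ` ({0..1} \<inter> {..a}))"
        by (intro compact_continuous_image continuous_on_subset[OF s(1)] compact_Int_closed) auto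
      ultimately show ?thesis by (simp add: compact_imp_closed)
    next
      case False
      then have "\<kappa> x \<le> a" for x using \<kappa>01(2)[of x] by linarith
      then have "{x. \<kappa> x \<le> a} = UNIV" by auto
      then show ?thesis by simp
    qed
  qed
  define \<nu> where "\<nu> k = distr (P k) borel \<kappa>" for k
  have \<kappa>m: "\<kappa> \<in> borel_measurable (P k)" for k by (simp add: measurable_cong_sets[OF P(2) refl])
  have rd: "real_distribution (\<nu> k)" for k
    unfolding \<nu>_def by (rule prob_space.real_distribution_distr[OF P(1) \<kappa>m])
  have t: "tight \<nu>"
    unfolding tight_def
  proof (intro conjI allI impI rd exI)
    fix e :: real assume e: "e > 0"
    show "(-1::real) < 1" by simp
    fix k
    have "measure (\<nu> k) {-1<..1} = measure (P k) (\<kappa> -` {-1<..1} \<inter> space (P k))"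
      unfolding \<nu>_def by (rule measure_distr[OF \<kappa>m]) simp
    also have "\<kappa> -` {-1<..1} \<inter> space (P k) = space (P k)"
    proof -
      have "\<kappa> x \<in> {-1<..1}" for x using \<kappa>01[of x] by auto
      then show ?thesis by auto
    qed
    finally show "1 - e < measure (\<nu> k) {-1<..1}"
      using e prob_space.prob_space[OF P(1)] by simp
  qed
  obtain r M where r: "strict_mono r" "real_distribution M" "weak_conv_m (\<nu> \<circ> id \<circ> r) M"
    using tight_imp_convergent_subsubsequence[OF t, of id] by (auto simp: strict_mono_id)
  interpret M: real_distribution M by fact
  show ?thesis
  proof
    show "strict_mono r" by fact
    show "prob_space (distr M borel s)" by (rule M.prob_space_distr) simp
    fix \<psi> :: "real ^ 'n \<Rightarrow> real" assume \<psi>: "continuous_on UNIV \<psi>" "bounded (range \<psi>)"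
    then have [measurable]: "\<psi> \<in> borel_measurable borel" by (auto intro: borel_measurable_continuous_onI)
    obtain B where B: "\<And>x. norm (\<psi> x) \<le> B" using \<psi>(2) by (auto simp: bounded_iff)
    have "continuous_on UNIV (\<lambda>t. \<psi> (s t))" by (rule continuous_on_compose2[OF \<psi>(1) s(1)]) simp
    then have c: "isCont (\<lambda>t. \<psi> (s t)) t" for t by (simp add: continuous_on_eq_continuous_at)
    have "(\<lambda>k. LINT t|(\<nu> \<circ> id \<circ> r) k. \<psi> (s t)) \<longlonglongrightarrow> (LINT t|M. \<psi> (s t))"
      by (rule weak_conv_imp_integral_bdd_continuous_conv[OF _ r(2,3), where B = B]) (use c B rd in auto)
    moreover have "(LINT t|(\<nu> \<circ> id \<circ> r) k. \<psi> (s t)) = (LINT x|P (r k). \<psi> x)" for k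
    proof -
      have "(LINT t|(\<nu> \<circ> id \<circ> r) k. \<psi> (s t)) = (LINT x|P (r k). \<psi> (s (\<kappa> x)))"
        by (simp add: \<nu>_def integral_distr[OF \<kappa>m])
      also have "\<dots> = (LINT x|P (r k). \<psi> x)"
        by (rule integral_cong_AE)
          (use supp[of "r k"] s\<kappa> in \<open>auto simp: measurable_cong_sets[OF P(2) refl]\<close>)
      finally show ?thesis .
    qed
    ultimately show "(\<lambda>k. LINT x|P (r k). \<psi> x) \<longlonglongrightarrow> (LINT x|distr M borel s. \<psi> x)"
      by (simp add: integral_distr)
  qed simp
qed

text \<open>
  The mass missing from \<open>f k\<close> is placed in a ball away from the support and removed from the
  limit by the cutoff.
\<close>

lemma weak_limit_nonneg:
  fixes f :: "nat \<Rightarrow> real ^ 'n \<Rightarrow> real"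
  assumes f: "\<And>k. integrable lborel (f k)" "\<And>k x. 0 \<le> f k x" "\<And>k. (LINT x|lborel. f k x) \<le> C"
    and R: "\<And>k x. R \<le> norm x \<Longrightarrow> f k x = 0"
  obtains r \<mu> where "strict_mono (r :: nat \<Rightarrow> nat)" "finite_measure \<mu>" "sets \<mu> = sets borel"
    "\<And>\<psi> :: real ^ 'n \<Rightarrow> real. continuous_on UNIV \<psi> \<Longrightarrow> bounded (range \<psi>) \<Longrightarrow>
       (\<lambda>k. LINT x|lborel. \<psi> x * f (r k) x) \<longlonglongrightarrow> (LINT x|\<mu>. \<psi> x)"
proof -
  \<comment> \<open>Positive whatever the sign of C, and large enough that f k / c has mass at most
    1.\<close>
  define c where "c = \<bar>C\<bar> + 1"
  have c: "c > 0" by (simp add: c_def)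
  define S where "S = \<bar>R\<bar>"
  have S: "S \<ge> 0" "\<And>k x. S \<le> norm x \<Longrightarrow> f k x = 0" using R by (auto simp: S_def)
  define m where "m k = (LINT x|lborel. f k x) / c" for k
  have m: "m k \<le> 1" for k using f(3)[of k] c by (simp add: m_def c_def)
  \<comment> \<open>The centre lies at distance S + 2 along an arbitrary coordinate axis. The ball
    is thus outside the support of the f k and beyond radius S + 1, where the cutoff \<zeta> has
    reached 0, while \<zeta> = 1 on the support.\<close>
  define B0 :: "(real ^ 'n) set" where "B0 = ball ((S + 2) *\<^sub>R axis undefined 1) (1 / 2)"
  have [measurable]: "B0 \<in> sets borel" by (simp add: B0_def)
  have B0: "S + 1 < norm x" "norm x < S + 3" if "x \<in> B0" for x
  proof -
    have a: "norm ((S + 2) *\<^sub>R axis undefined 1 :: real ^ 'n) = S + 2" using S(1) by simp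
    have d: "norm ((S + 2) *\<^sub>R axis undefined 1 - x) < 1 / 2" using that by (simp add: B0_def dist_norm)
    show "S + 1 < norm x"
      using norm_triangle_ineq2[of "(S + 2) *\<^sub>R axis undefined 1" x] a d by linarith
    show "norm x < S + 3"
      using norm_triangle_ineq2[of x "(S + 2) *\<^sub>R axis undefined 1"] a d
        norm_minus_commute[of x "(S + 2) *\<^sub>R axis undefined 1"] by linarith
  qed
  define V where "V = measure lborel B0"
  have V: "V > 0" unfolding V_def B0_def by (subst content_ball) auto
  have B0f: "emeasure lborel B0 \<noteq> \<infinity>" "emeasure lborel B0 < \<infinity>"
    using emeasure_lborel_ball_finite[of "(S + 2) *\<^sub>R axis undefined 1 :: real ^ 'n" "1/2"] by (auto simp: B0_def)
  define g where "g k x = f k x / c + (1 - m k) / V * indicator B0 x" for k x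
  have [measurable]: "f k \<in> borel_measurable borel" for k using f(1)[of k] by auto
  have [measurable]: "g k \<in> borel_measurable borel" for k unfolding g_def by measurable
  have g0: "0 \<le> g k x" for k x
    using f(2) c V m[of k] by (auto simp: g_def intro!: add_nonneg_nonneg mult_nonneg_nonneg divide_nonneg_nonneg)
  have iB: "integrable lborel (\<lambda>x. indicator B0 x :: real)" using B0f by simp
  have gi: "integrable lborel (g k)" for k
    unfolding g_def using f(1)[of k] iB by (intro Bochner_Integration.integrable_add) auto
  have g1: "(LINT x|lborel. g k x) = 1" for k
    unfolding g_def using f(1)[of k] iB V by (subst Bochner_Integration.integral_add) (auto simp: m_def V_def)
  define P where "P k = density lborel (\<lambda>x. ennreal (g k x))" for k
  have P1: "prob_space (P k)" for k
  proof
    have "emeasure (P k) (space (P k)) = (\<integral>\<^sup>+ x. ennreal (g k x) \<partial>lborel)"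
      unfolding P_def by (subst emeasure_density) (auto intro!: nn_integral_cong)
    also have "\<dots> = 1" using nn_integral_eq_integral[OF gi[of k]] g0 g1 by simp
    finally show "emeasure (P k) (space (P k)) = 1" .
  qed
  have P2: "sets (P k) = sets borel" for k by (simp add: P_def)
  have P3: "AE x in P k. norm x \<le> S + 3" for k
  proof -
    have "0 < g k x \<longrightarrow> norm x \<le> S + 3" for x
      using S(2)[of x k] B0(2)[of x] by (cases "x \<in> B0"; cases "S \<le> norm x") (auto simp: g_def)
    then show ?thesis unfolding P_def by (subst AE_density) auto
  qed
  obtain r Q where r: "strict_mono (r :: nat \<Rightarrow> nat)" and Q: "prob_space Q" "sets Q = sets borel"
    and lim: "\<And>\<psi> :: real ^ 'n \<Rightarrow> real. continuous_on UNIV \<psi> \<Longrightarrow> bounded (range \<psi>) \<Longrightarrow>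
       (\<lambda>k. LINT x|P (r k). \<psi> x) \<longlonglongrightarrow> (LINT x|Q. \<psi> x)"
    by (rule weak_limit_in_ball[of P, OF P1 P2 P3]) blast
  note [measurable_cong] = Q(2)
  interpret Q: prob_space Q by fact
  define \<zeta> where "\<zeta> x = max 0 (min 1 (S + 1 - norm x))" for x :: "real ^ 'n"
  have \<zeta>01: "0 \<le> \<zeta> x" "\<zeta> x \<le> 1" for x by (auto simp: \<zeta>_def)
  have \<zeta>c: "continuous_on UNIV \<zeta>" unfolding \<zeta>_def by (intro continuous_intros)
  have [measurable]: "\<zeta> \<in> borel_measurable borel" by (rule borel_measurable_continuous_onI[OF \<zeta>c])
  define \<mu> where "\<mu> = density Q (\<lambda>x. ennreal (c * \<zeta> x))"
  show ?thesis
  proof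
    show "strict_mono r" by fact
    show "sets \<mu> = sets borel" by (simp add: \<mu>_def Q(2))
    show "finite_measure \<mu>"
    proof
      have "emeasure \<mu> (space \<mu>) = (\<integral>\<^sup>+ x. ennreal (c * \<zeta> x) \<partial>Q)"
        unfolding \<mu>_def by (subst emeasure_density) (auto intro!: nn_integral_cong)
      also have "\<dots> \<le> (\<integral>\<^sup>+ x. ennreal c \<partial>Q)"
        using \<zeta>01 c by (intro nn_integral_mono ennreal_leI) (simp add: mult_left_le)
      also have "\<dots> < \<infinity>" by (simp add: Q.emeasure_space_1)
      finally show "emeasure \<mu> (space \<mu>) \<noteq> \<infinity>" by simp
    qed
    fix \<psi> :: "real ^ 'n \<Rightarrow> real" assume \<psi>: "continuous_on UNIV \<psi>" "bounded (range \<psi>)"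
    have [measurable]: "\<psi> \<in> borel_measurable borel" by (rule borel_measurable_continuous_onI[OF \<psi>(1)])
    obtain B where B: "\<And>x. \<bar>\<psi> x\<bar> \<le> B" using \<psi>(2) by (auto simp: bounded_iff)
    have bd: "bounded (range (\<lambda>x. c * \<zeta> x * \<psi> x))"
    proof -
      have "norm (c * \<zeta> x * \<psi> x) \<le> c * 1 * B" for x
        unfolding norm_mult using B[of x] \<zeta>01[of x] c by (intro mult_mono) auto
      then show ?thesis by (auto simp: bounded_iff)
    qed
    have "(\<lambda>k. LINT x|P (r k). c * \<zeta> x * \<psi> x) \<longlonglongrightarrow> (LINT x|Q. c * \<zeta> x * \<psi> x)"
      by (rule lim[OF _ bd]) (intro continuous_intros \<psi> \<zeta>c)
    moreover have "(LINT x|Q. c * \<zeta> x * \<psi> x) = (LINT x|\<mu>. \<psi> x)"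
      unfolding \<mu>_def by (subst integral_density) (use c \<zeta>01 in auto)
    moreover have "(LINT x|P k. c * \<zeta> x * \<psi> x) = (LINT x|lborel. \<psi> x * f k x)" for k
    proof -
      have "(LINT x|P k. c * \<zeta> x * \<psi> x) = (LINT x|lborel. g k x * (c * \<zeta> x * \<psi> x))"
        unfolding P_def by (subst integral_density) (use g0 in auto)
      also have "\<dots> = (LINT x|lborel. \<psi> x * f k x)"
      proof (intro Bochner_Integration.integral_cong refl)
        fix x
        consider "S \<le> norm x" "x \<in> B0" | "S \<le> norm x" "x \<notin> B0" | "norm x < S" by linarith
        then show "g k x * (c * \<zeta> x * \<psi> x) = \<psi> x * f k x"
        proof cases
          case 1
          then show ?thesis using B0(1)[of x] S(2)[of x k] by (simp add: \<zeta>_def)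
        next
          case 2
          then show ?thesis using S(2)[of x k] by (simp add: g_def)
        next
          case 3
          then have "x \<notin> B0" using B0(1)[of x] by auto
          moreover have "\<zeta> x = 1" using 3 by (simp add: \<zeta>_def)
          ultimately show ?thesis using c by (simp add: g_def)
        qed
      qed
      finally show ?thesis .
    qed
    ultimately show "(\<lambda>k. LINT x|lborel. \<psi> x * f (r k) x) \<longlonglongrightarrow> (LINT x|\<mu>. \<psi> x)" by simp
  qed
qed

text \<open>Positive and negative parts converge along successive subsequences. The two limits need
  not be mutually singular; only their difference matters.\<close>

lemma weak_limit_signed:
  fixes f :: "nat \<Rightarrow> real ^ 'n \<Rightarrow> real"
  assumes f: "\<And>k. integrable lborel (f k)" "\<And>k. (LINT x|lborel. \<bar>f k x\<bar>) \<le> C"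
    and R: "\<And>k x. R \<le> norm x \<Longrightarrow> f k x = 0"
  obtains r \<mu> \<nu> where "strict_mono (r :: nat \<Rightarrow> nat)"
    "finite_measure \<mu>" "sets \<mu> = sets borel" "finite_measure \<nu>" "sets \<nu> = sets borel"
    "\<And>\<psi> :: real ^ 'n \<Rightarrow> real. continuous_on UNIV \<psi> \<Longrightarrow> bounded (range \<psi>) \<Longrightarrow>
       (\<lambda>k. LINT x|lborel. \<psi> x * f (r k) x) \<longlonglongrightarrow> (LINT x|\<mu>. \<psi> x) - (LINT x|\<nu>. \<psi> x)"
proof -
  define p where "p k x = max 0 (f k x)" for k x
  define n where "n k x = max 0 (- f k x)" for k x
  have [measurable]: "f k \<in> borel_measurable borel" for k using f(1)[of k] by auto
  have pi: "integrable lborel (p k)" for k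
    unfolding p_def by (rule Bochner_Integration.integrable_bound[OF integrable_abs[OF f(1)[of k]]]) auto
  have ni: "integrable lborel (n k)" for k
    unfolding n_def by (rule Bochner_Integration.integrable_bound[OF integrable_abs[OF f(1)[of k]]]) auto
  have pC: "(LINT x|lborel. p k x) \<le> C" for k
    by (rule order_trans[OF integral_mono[OF pi integrable_abs[OF f(1)[of k]]] f(2)[of k]]) (auto simp: p_def)
  have nC: "(LINT x|lborel. n k x) \<le> C" for k
    by (rule order_trans[OF integral_mono[OF ni integrable_abs[OF f(1)[of k]]] f(2)[of k]]) (auto simp: n_def)
  have p0: "0 \<le> p k x" and n0: "0 \<le> n k x" for k x by (auto simp: p_def n_def)
  have pR: "p k x = 0" and nR: "n k x = 0" if "R \<le> norm x" for k x
    using R[OF that, of k] by (auto simp: p_def n_def)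
  obtain r1 \<mu> where r1: "strict_mono (r1 :: nat \<Rightarrow> nat)" and \<mu>: "finite_measure \<mu>" "sets \<mu> = sets borel"
    and lim1: "\<And>\<psi> :: real ^ 'n \<Rightarrow> real. continuous_on UNIV \<psi> \<Longrightarrow> bounded (range \<psi>) \<Longrightarrow>
       (\<lambda>k. LINT x|lborel. \<psi> x * p (r1 k) x) \<longlonglongrightarrow> (LINT x|\<mu>. \<psi> x)"
    by (rule weak_limit_nonneg[of p, OF pi p0 pC pR]) blast+
  obtain r2 \<nu> where r2: "strict_mono (r2 :: nat \<Rightarrow> nat)" and \<nu>: "finite_measure \<nu>" "sets \<nu> = sets borel"
    and lim2: "\<And>\<psi> :: real ^ 'n \<Rightarrow> real. continuous_on UNIV \<psi> \<Longrightarrow> bounded (range \<psi>) \<Longrightarrow>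
       (\<lambda>k. LINT x|lborel. \<psi> x * n (r1 (r2 k)) x) \<longlonglongrightarrow> (LINT x|\<nu>. \<psi> x)"
    by (rule weak_limit_nonneg[of "\<lambda>k. n (r1 k)", OF ni n0 nC nR]) blast+
  show ?thesis
  proof (rule that[of "r1 \<circ> r2" \<mu> \<nu>])
    show "strict_mono (r1 \<circ> r2)" using r1 r2 by (rule strict_mono_o)
    fix \<psi> :: "real ^ 'n \<Rightarrow> real" assume \<psi>: "continuous_on UNIV \<psi>" "bounded (range \<psi>)"
    have [measurable]: "\<psi> \<in> borel_measurable borel" by (rule borel_measurable_continuous_onI[OF \<psi>(1)])
    obtain B where B: "\<And>x. \<bar>\<psi> x\<bar> \<le> B" using \<psi>(2) by (auto simp: bounded_iff)
    have mi: "integrable lborel (\<lambda>x. \<psi> x * h x)" if "integrable lborel h" for h :: "real ^ 'n \<Rightarrow> real"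
    proof (rule Bochner_Integration.integrable_bound[OF integrable_mult_right[OF integrable_abs[OF that], of B]])
      have "norm (\<psi> x * h x) \<le> norm (B * \<bar>h x\<bar>)" for x
        using B[of x] by (auto simp: abs_mult intro!: mult_right_mono)
      then show "AE x in lborel. norm (\<psi> x * h x) \<le> norm (B * \<bar>h x\<bar>)" by simp
    qed (use that in auto)
    have "(\<lambda>k. (LINT x|lborel. \<psi> x * p (r1 (r2 k)) x) - (LINT x|lborel. \<psi> x * n (r1 (r2 k)) x))
        \<longlonglongrightarrow> (LINT x|\<mu>. \<psi> x) - (LINT x|\<nu>. \<psi> x)"
      using LIMSEQ_subseq_LIMSEQ[OF lim1[OF \<psi>] r2] lim2[OF \<psi>]
      by (intro tendsto_diff) (simp_all add: comp_def)
    moreover have "(LINT x|lborel. \<psi> x * p k x) - (LINT x|lborel. \<psi> x * n k x) = (LINT x|lborel. \<psi> x * f k x)" for k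
    proof -
      have "(LINT x|lborel. \<psi> x * p k x) - (LINT x|lborel. \<psi> x * n k x) = (LINT x|lborel. \<psi> x * p k x - \<psi> x * n k x)"
        using mi[OF pi] mi[OF ni] by simp
      also have "(\<lambda>x. \<psi> x * p k x - \<psi> x * n k x) = (\<lambda>x. \<psi> x * f k x)"
        by (auto simp: p_def n_def max_def)
      finally show ?thesis .
    qed
    ultimately show "(\<lambda>k. LINT x|lborel. \<psi> x * f ((r1 \<circ> r2) k) x) \<longlonglongrightarrow> (LINT x|\<mu>. \<psi> x) - (LINT x|\<nu>. \<psi> x)"
      by simp
  qed (use \<mu> \<nu> in auto)
qed

text \<open>With \<sigma> split as p - n, the identity for sets is rewritten without subtraction as
  p + \<nu> = n + \<mu>. In this form it makes sense in \<open>ennreal\<close> and extends to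
  nonnegative functions by the usual induction. A bounded g is treated through the nonnegative
  function g + B.\<close>

lemma integral_signed_density:
  fixes g \<sigma> :: "'a \<Rightarrow> real"
  assumes M: "finite_measure M" "integrable M \<sigma>"
    and \<mu>: "finite_measure \<mu>" "sets \<mu> = sets M" and \<nu>: "finite_measure \<nu>" "sets \<nu> = sets M"
    and eq: "\<And>A. A \<in> sets M \<Longrightarrow> (LINT x:A|M. \<sigma> x) = measure \<mu> A - measure \<nu> A"
    and g: "g \<in> borel_measurable M" "\<And>x. \<bar>g x\<bar> \<le> B"
  shows "(LINT x|M. g x * \<sigma> x) = (LINT x|\<mu>. g x) - (LINT x|\<nu>. g x)"
proof -
  interpret M: finite_measure M by fact
  interpret \<mu>: finite_measure \<mu> by fact
  interpret \<nu>: finite_measure \<nu> by fact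
  note [measurable_cong] = \<mu>(2) \<nu>(2)
  note [measurable] = borel_measurable_integrable[OF M(2)]
  define p where "p x = max 0 (\<sigma> x)" for x
  define n where "n x = max 0 (- \<sigma> x)" for x
  have pm[measurable]: "p \<in> borel_measurable M" and nm[measurable]: "n \<in> borel_measurable M"
    unfolding p_def n_def by measurable
  have pi: "integrable M p" and ni: "integrable M n"
    unfolding p_def n_def by (rule Bochner_Integration.integrable_bound[OF integrable_abs[OF M(2)]]; auto)+
  have pn: "\<sigma> x = p x - n x" "0 \<le> p x" "0 \<le> n x" for x by (auto simp: p_def n_def)
  have nn: "(\<integral>\<^sup>+ x. h x * ennreal (p x) \<partial>M) + (\<integral>\<^sup>+ x. h x \<partial>\<nu>) = (\<integral>\<^sup>+ x. h x * ennreal (n x) \<partial>M) + (\<integral>\<^sup>+ x. h x \<partial>\<mu>)"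
    if "h \<in> borel_measurable M" for h :: "'a \<Rightarrow> ennreal"
    using that
  proof (induction rule: borel_measurable_induct)
    case (cong f g)
    have sp: "space \<mu> = space M" "space \<nu> = space M" using \<mu>(2) \<nu>(2) by (auto dest: sets_eq_imp_space_eq)
    have "(\<integral>\<^sup>+ x. f x * ennreal (p x) \<partial>M) = (\<integral>\<^sup>+ x. g x * ennreal (p x) \<partial>M)"
      "(\<integral>\<^sup>+ x. f x * ennreal (n x) \<partial>M) = (\<integral>\<^sup>+ x. g x * ennreal (n x) \<partial>M)"
      "(\<integral>\<^sup>+ x. f x \<partial>\<nu>) = (\<integral>\<^sup>+ x. g x \<partial>\<nu>)" "(\<integral>\<^sup>+ x. f x \<partial>\<mu>) = (\<integral>\<^sup>+ x. g x \<partial>\<mu>)"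
      using cong(3) sp by (auto intro!: nn_integral_cong)
    then show ?case using cong by simp
  next
    case (set A)
    have i: "integrable M (\<lambda>x. indicator A x *\<^sub>R p x)" "integrable M (\<lambda>x. indicator A x *\<^sub>R n x)"
      using integrable_mult_indicator[OF set pi] integrable_mult_indicator[OF set ni] by auto
    have e: "(\<integral>\<^sup>+ x. indicator A x * ennreal (q x) \<partial>M) = ennreal (LINT x|M. indicator A x *\<^sub>R q x)"
      if "integrable M (\<lambda>x. indicator A x *\<^sub>R q x)" "\<And>x. 0 \<le> q x" for q
    proof -
      have "(\<integral>\<^sup>+ x. indicator A x * ennreal (q x) \<partial>M) = (\<integral>\<^sup>+ x. ennreal (indicator A x *\<^sub>R q x) \<partial>M)"
        by (intro nn_integral_cong) (simp add: indicator_def)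
      also have "\<dots> = ennreal (LINT x|M. indicator A x *\<^sub>R q x)"
        by (rule nn_integral_eq_integral[OF that(1)]) (use that(2) in auto)
      finally show ?thesis .
    qed
    have "(LINT x:A|M. \<sigma> x) = (LINT x|M. indicator A x *\<^sub>R p x) - (LINT x|M. indicator A x *\<^sub>R n x)"
      unfolding set_lebesgue_integral_def pn(1) using i by (simp add: right_diff_distrib)
    then have "(LINT x|M. indicator A x *\<^sub>R p x) + measure \<nu> A = (LINT x|M. indicator A x *\<^sub>R n x) + measure \<mu> A"
      using eq[OF set] by simp
    moreover have "0 \<le> (LINT x|M. indicator A x *\<^sub>R p x)" "0 \<le> (LINT x|M. indicator A x *\<^sub>R n x)"
      using pn by (auto intro!: Bochner_Integration.integral_nonneg)
    ultimately show ?case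
      using set \<mu>(2) \<nu>(2) e[OF i(1)] e[OF i(2)] pn
      by (simp add: \<mu>.emeasure_eq_measure \<nu>.emeasure_eq_measure ennreal_plus[symmetric] del: ennreal_plus)
  next
    case (mult u c)
    then show ?case
      by (simp add: nn_integral_cmult mult.assoc distrib_left[symmetric])
  next
    case (add u v)
    have "((\<integral>\<^sup>+ x. u x * ennreal (p x) \<partial>M) + (\<integral>\<^sup>+ x. u x \<partial>\<nu>)) + ((\<integral>\<^sup>+ x. v x * ennreal (p x) \<partial>M) + (\<integral>\<^sup>+ x. v x \<partial>\<nu>)) =
      ((\<integral>\<^sup>+ x. u x * ennreal (n x) \<partial>M) + (\<integral>\<^sup>+ x. u x \<partial>\<mu>)) + ((\<integral>\<^sup>+ x. v x * ennreal (n x) \<partial>M) + (\<integral>\<^sup>+ x. v x \<partial>\<mu>))"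
      using add by simp
    then show ?case using add(1,3,4)
      by (simp add: nn_integral_add ring_distribs ac_simps)
  next
    case (seq U)
    have [measurable]: "\<And>i. U i \<in> borel_measurable M" using seq by auto
    have incU: "incseq U" using seq by blast
    have inc: "incseq (\<lambda>i x. U i x * ennreal (q x))" for q
      using incU by (auto simp: incseq_def le_fun_def intro!: mult_right_mono)
    have s: "(\<integral>\<^sup>+ x. (SUP i. U i) x * ennreal (q x) \<partial>M) = (SUP i. \<integral>\<^sup>+ x. U i x * ennreal (q x) \<partial>M)"
      if [measurable]: "q \<in> borel_measurable M" for q
      by (subst nn_integral_monotone_convergence_SUP[OF inc, symmetric])
        (auto simp: SUP_mult_right_ennreal image_comp)
    have t: "(\<integral>\<^sup>+ x. (SUP i. U i) x \<partial>N) = (SUP i. \<integral>\<^sup>+ x. U i x \<partial>N)" if [measurable_cong]: "sets N = sets M" for N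
      unfolding SUP_apply by (rule nn_integral_monotone_convergence_SUP[OF incU]) measurable
    have incs: "incseq (\<lambda>i. \<integral>\<^sup>+ x. U i x * ennreal (q x) \<partial>M)" for q
      using inc by (auto simp: incseq_def le_fun_def intro!: nn_integral_mono)
    have inct: "incseq (\<lambda>i. \<integral>\<^sup>+ x. U i x \<partial>N)" for N
      using incU by (auto simp: incseq_def le_fun_def intro!: nn_integral_mono)
    show ?case
      using seq.IH by (simp only: s[OF pm] s[OF nm] t[OF \<mu>(2)] t[OF \<nu>(2)] ennreal_SUP_add[OF incs inct, symmetric])
  qed
  have B0: "0 \<le> B" using g(2)[of undefined] by linarith
  have real_eq: "(LINT x|M. h x * \<sigma> x) = (LINT x|\<mu>. h x) - (LINT x|\<nu>. h x)"
    if h[measurable]: "h \<in> borel_measurable M" and h0: "\<And>x. 0 \<le> h x" and hb: "\<And>x. h x \<le> b" for h :: "'a \<Rightarrow> real" and b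
  proof -
    have iM: "integrable M (\<lambda>x. h x * q x)" if q: "integrable M q" for q :: "'a \<Rightarrow> real"
    proof (rule Bochner_Integration.integrable_bound[OF integrable_mult_right[OF integrable_abs[OF q], of b]])
      have "norm (h x * q x) \<le> norm (b * \<bar>q x\<bar>)" for x
        using h0[of x] hb[of x] by (auto simp: abs_mult intro!: mult_right_mono)
      then show "AE x in M. norm (h x * q x) \<le> norm (b * \<bar>q x\<bar>)" by simp
    qed (use q in auto)
    have i\<mu>: "integrable \<mu> h" and i\<nu>: "integrable \<nu> h"
      using h0 hb by (auto intro!: \<mu>.integrable_const_bound[where B = b] \<nu>.integrable_const_bound[where B = b])
    have "(\<integral>\<^sup>+ x. ennreal (h x) * ennreal (p x) \<partial>M) = ennreal (LINT x|M. h x * p x)"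
      "(\<integral>\<^sup>+ x. ennreal (h x) * ennreal (n x) \<partial>M) = ennreal (LINT x|M. h x * n x)"
      using nn_integral_eq_integral[OF iM[OF pi]] nn_integral_eq_integral[OF iM[OF ni]] h0 pn
      by (simp_all add: ennreal_mult[symmetric])
    moreover have "(\<integral>\<^sup>+ x. ennreal (h x) \<partial>\<mu>) = ennreal (LINT x|\<mu>. h x)" "(\<integral>\<^sup>+ x. ennreal (h x) \<partial>\<nu>) = ennreal (LINT x|\<nu>. h x)"
      using nn_integral_eq_integral[OF i\<mu>] nn_integral_eq_integral[OF i\<nu>] h0 by simp_all
    ultimately have "ennreal (LINT x|M. h x * p x) + ennreal (LINT x|\<nu>. h x) = ennreal (LINT x|M. h x * n x) + ennreal (LINT x|\<mu>. h x)"
      using nn[of "\<lambda>x. ennreal (h x)"] by simp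
    moreover have "0 \<le> (LINT x|M. h x * p x)" "0 \<le> (LINT x|M. h x * n x)" "0 \<le> (LINT x|\<mu>. h x)" "0 \<le> (LINT x|\<nu>. h x)"
      using h0 pn by (auto intro!: Bochner_Integration.integral_nonneg)
    ultimately have "(LINT x|M. h x * p x) + (LINT x|\<nu>. h x) = (LINT x|M. h x * n x) + (LINT x|\<mu>. h x)"
      by (simp add: ennreal_plus[symmetric] del: ennreal_plus)
    moreover have "(LINT x|M. h x * \<sigma> x) = (LINT x|M. h x * p x) - (LINT x|M. h x * n x)"
      unfolding pn(1) using iM[OF pi] iM[OF ni] by (simp add: right_diff_distrib)
    ultimately show ?thesis by simp
  qed
  have gB: "0 \<le> g x + B" "g x + B \<le> 2 * B" for x using g(2)[of x] by (auto simp: abs_le_iff)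
  have [measurable]: "g \<in> borel_measurable M" by (rule g(1))
  have ig: "integrable \<mu> g" "integrable \<nu> g"
    using g(2) by (auto intro!: \<mu>.integrable_const_bound[where B = B] \<nu>.integrable_const_bound[where B = B])
  have igM: "integrable M (\<lambda>x. g x * \<sigma> x)"
  proof (rule Bochner_Integration.integrable_bound[OF integrable_mult_right[OF integrable_abs[OF M(2)], of B]])
    have "norm (g x * \<sigma> x) \<le> norm (B * \<bar>\<sigma> x\<bar>)" for x
      using g(2)[of x] by (auto simp: abs_mult intro!: mult_right_mono)
    then show "AE x in M. norm (g x * \<sigma> x) \<le> norm (B * \<bar>\<sigma> x\<bar>)" by simp
  qed auto
  have "(LINT x|M. (g x + B) * \<sigma> x) = (LINT x|\<mu>. g x + B) - (LINT x|\<nu>. g x + B)"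
    by (rule real_eq[OF _ gB]) measurable
  moreover have "(LINT x|M. B * \<sigma> x) = (LINT x|\<mu>. B) - (LINT x|\<nu>. B)"
    by (rule real_eq[of _ B]) (use B0 in auto)
  moreover have "(LINT x|M. (g x + B) * \<sigma> x) = (LINT x|M. g x * \<sigma> x) + (LINT x|M. B * \<sigma> x)"
    using igM M(2) by (simp add: distrib_right)
  ultimately show ?thesis using ig by (simp del: integral_mult_right_zero)
qed

subsection \<open>Existence of the gradient measure\<close>

text \<open>The measures \<open>D\<^sub>i\<close> are weak limits of the difference quotients of \<open>w\<close> in the coordinate directions.\<close>

lemma gradient_measure_exists:
  fixes w :: "real ^ 'n \<Rightarrow> real"
  assumes w: "finite_variation w" and R: "\<And>x. R \<le> norm x \<Longrightarrow> w x = 0"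
  shows "\<exists>D. is_gradient_measure w D"
proof -
  note wi = finite_variation_integrable[OF w]
  have wm[measurable]: "w \<in> borel_measurable borel" using wi by auto
  obtain C where C: "\<And>h. shift_diff w h \<le> C * norm h" using w by (auto simp: finite_variation_def)
  define t where "t k = 1 / real (Suc k)" for k
  have t: "t k > 0" "t k \<le> 1" for k by (auto simp: t_def)
  have t0: "t \<longlonglongrightarrow> 0"
    unfolding t_def using LIMSEQ_inverse_real_of_nat[unfolded inverse_eq_divide] by simp
  define limit_pair where "limit_pair i \<mu> \<nu> \<longleftrightarrow>
      (finite_measure \<mu> \<and> sets \<mu> = sets borel \<and> finite_measure \<nu> \<and> sets \<nu> = sets borel) \<and>
      (\<forall>A \<psi> \<psi>'. test_function A \<psi> \<psi>' \<longrightarrow>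
        (LINT x|\<mu>. \<psi> x) - (LINT x|\<nu>. \<psi> x) = - (LINT x|lborel. w x * \<psi>' x (axis i 1)))"
    for i :: 'n and \<mu> \<nu> :: "(real ^ 'n) measure"
  have "\<exists>\<mu> \<nu>. limit_pair i \<mu> \<nu>" for i
  proof -
    define f where "f k x = (w (x + t k *\<^sub>R axis i 1) - w x) / t k" for k x
    have fi: "integrable lborel (f k)" for k
      unfolding f_def using wi by (intro integrable_divide Bochner_Integration.integrable_diff integrable_translation)
    have fC: "(LINT x|lborel. \<bar>f k x\<bar>) \<le> C" for k
    proof -
      have "(LINT x|lborel. \<bar>f k x\<bar>) = shift_diff w (t k *\<^sub>R axis i 1) / t k"
        using t[of k] by (simp add: f_def shift_diff_def)
      then show ?thesis using C[of "t k *\<^sub>R axis i 1"] t[of k] by (simp add: divide_le_eq)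
    qed
    \<comment> \<open>All steps t k are at most 1, so the difference quotients share one bounded
      support and the weak limit theorem applies.\<close>
    have fR: "f k x = 0" if "\<bar>R\<bar> + 1 \<le> norm x" for k x
    proof -
      have "norm x \<le> norm (x + t k *\<^sub>R axis i 1) + norm (t k *\<^sub>R axis i (1::real) :: real ^ 'n)"
        using norm_triangle_ineq4[of "x + t k *\<^sub>R axis i 1" "t k *\<^sub>R axis i 1"] by simp
      then have "R \<le> norm (x + t k *\<^sub>R axis i 1)" using t[of k] that by simp
      then show ?thesis using R that by (simp add: f_def)
    qed
    obtain r \<mu> \<nu> where r: "strict_mono (r :: nat \<Rightarrow> nat)" and
      \<mu>\<nu>: "finite_measure \<mu>" "sets \<mu> = sets borel" "finite_measure \<nu>" "sets \<nu> = sets borel" and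
      lim: "\<And>\<psi> :: real ^ 'n \<Rightarrow> real. continuous_on UNIV \<psi> \<Longrightarrow> bounded (range \<psi>) \<Longrightarrow>
       (\<lambda>k. LINT x|lborel. \<psi> x * f (r k) x) \<longlonglongrightarrow> (LINT x|\<mu>. \<psi> x) - (LINT x|\<nu>. \<psi> x)"
      by (rule weak_limit_signed[of f, OF fi fC fR]) blast+
    have "(LINT x|\<mu>. \<psi> x) - (LINT x|\<nu>. \<psi> x) = - (LINT x|lborel. w x * \<psi>' x (axis i 1))"
      if \<psi>: "test_function A \<psi> \<psi>'" for A \<psi> \<psi>'
    proof (rule LIMSEQ_unique)
      obtain B where B: "B > 0" "\<And>x. \<bar>\<psi> x\<bar> \<le> B" "\<And>x. norm (\<psi>' x) \<le> B"
        by (rule test_function_bounded[OF \<psi>]) blast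
      then have "bounded (range \<psi>)" by (auto simp: bounded_iff)
      then show "(\<lambda>k. LINT x|lborel. \<psi> x * f (r k) x) \<longlonglongrightarrow> (LINT x|\<mu>. \<psi> x) - (LINT x|\<nu>. \<psi> x)"
        using lim test_function_continuous[OF \<psi>] by blast
      let ?h = "\<lambda>t. LINT x|lborel. w x * \<psi> (x - t *\<^sub>R axis i 1)"
      let ?d = "- (LINT x|lborel. w x * \<psi>' x (axis i 1))"
      have "((\<lambda>t. (?h t - ?h 0) / (t - 0)) \<longlongrightarrow> ?d) (at 0)"
        using integral_test_translation_deriv[OF wi \<psi>, of "axis i 1" 0]
        by (simp add: has_field_derivative_iff)
      moreover have "filterlim t (at 0) sequentially"
        using t0 t by (auto simp: filterlim_at less_imp_neq[THEN not_sym])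
      ultimately have "(\<lambda>k. (?h (t k) - ?h 0) / (t k - 0)) \<longlonglongrightarrow> ?d"
        by (rule filterlim_compose)
      moreover have "(?h (t k) - ?h 0) / (t k - 0) = (LINT x|lborel. \<psi> x * f k x)" for k
        using integral_test_difference[OF wi \<psi>, of "t k *\<^sub>R axis i 1"] by (simp add: f_def)
      ultimately have "(\<lambda>k. LINT x|lborel. \<psi> x * f k x) \<longlonglongrightarrow> ?d" by simp
      from LIMSEQ_subseq_LIMSEQ[OF this r]
      show "(\<lambda>k. LINT x|lborel. \<psi> x * f (r k) x) \<longlonglongrightarrow> ?d" by (simp add: comp_def)
    qed
    then have "limit_pair i \<mu> \<nu>" using \<mu>\<nu> unfolding limit_pair_def by blast
    then show ?thesis by blast
  qed
  then obtain \<mu> \<nu> where lp: "\<And>i. limit_pair i (\<mu> i) (\<nu> i)" by metis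
  have fin: "\<And>i::'n. finite_measure (\<mu> i)" "\<And>i::'n. finite_measure (\<nu> i)"
    and S: "\<And>i. sets (\<mu> i) = sets borel" "\<And>i. sets (\<nu> i) = sets borel"
    and eq: "\<And>i A \<psi> \<psi>'. test_function A \<psi> \<psi>' \<Longrightarrow>
        (LINT x|\<mu> i. \<psi> x) - (LINT x|\<nu> i. \<psi> x) = - (LINT x|lborel. w x * \<psi>' x (axis i 1))"
    using lp unfolding limit_pair_def by blast+
  interpret \<mu>: finite_measure "\<mu> i" for i by (rule fin)
  interpret \<nu>: finite_measure "\<nu> i" for i by (rule fin)
  define D where "D A = (\<chi> i. measure (\<mu> i) A - measure (\<nu> i) A)" for A
  have D: "vector_measure D"
    unfolding vector_measure_def
  proof (intro allI impI)
    fix A :: "nat \<Rightarrow> (real ^ 'n) set" assume A: "range A \<subseteq> sets borel" "disjoint_family A"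
    have "(\<lambda>j. D (A j) $ i) sums (D (\<Union>j. A j) $ i)" for i
      unfolding D_def using A S by (simp, intro sums_diff \<mu>.finite_measure_UNION \<nu>.finite_measure_UNION) auto
    then show "(\<lambda>j. D (A j)) sums D (\<Union>j. A j)"
      unfolding sums_def by (intro vec_tendstoI) simp
  qed
  \<comment> \<open>The total mass of all component measures. It dominates the sum over any
    partition, hence the total variation.\<close>
  define b where "b = (\<Sum>i\<in>UNIV. emeasure (\<mu> i) UNIV + emeasure (\<nu> i) UNIV)"
  have "variation_of D UNIV \<le> b"
    unfolding variation_of_def
  proof (rule SUP_least, clarsimp)
    fix E :: "nat \<Rightarrow> (real ^ 'n) set" assume E: "range E \<subseteq> sets borel" "disjoint_family E" "(\<Union>j. E j) = UNIV"
    have "(\<Sum>j. ennreal (norm (D (E j)))) \<le> (\<Sum>j. \<Sum>i\<in>UNIV. emeasure (\<mu> i) (E j) + emeasure (\<nu> i) (E j))"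
    proof (intro suminf_le summableI)
      fix j
      have "norm (D (E j)) \<le> (\<Sum>i\<in>UNIV. measure (\<mu> i) (E j) + measure (\<nu> i) (E j))"
        by (rule order_trans[OF norm_le_l1_cart]) (auto simp: D_def intro!: sum_mono abs_triangle_ineq4[THEN order_trans])
      then have "ennreal (norm (D (E j))) \<le> ennreal (\<Sum>i\<in>UNIV. measure (\<mu> i) (E j) + measure (\<nu> i) (E j))"
        by (rule ennreal_leI)
      also have "\<dots> = (\<Sum>i\<in>UNIV. emeasure (\<mu> i) (E j) + emeasure (\<nu> i) (E j))"
        by (simp add: \<mu>.emeasure_eq_measure \<nu>.emeasure_eq_measure sum_ennreal[symmetric] ennreal_plus add_nonneg_nonneg)
      finally show "ennreal (norm (D (E j))) \<le> (\<Sum>i\<in>UNIV. emeasure (\<mu> i) (E j) + emeasure (\<nu> i) (E j))" .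
    qed
    also have "\<dots> = (\<Sum>i\<in>UNIV. \<Sum>j. emeasure (\<mu> i) (E j) + emeasure (\<nu> i) (E j))"
      by (rule suminf_sum) (rule summableI)
    also have "\<dots> = b"
      unfolding b_def
    proof (intro sum.cong refl)
      fix i
      have "(\<Sum>j. emeasure (\<mu> i) (E j) + emeasure (\<nu> i) (E j)) = (\<Sum>j. emeasure (\<mu> i) (E j)) + (\<Sum>j. emeasure (\<nu> i) (E j))"
        by (rule suminf_add[symmetric]) (rule summableI)+
      also have "\<dots> = emeasure (\<mu> i) (\<Union>j. E j) + emeasure (\<nu> i) (\<Union>j. E j)"
        using E S by (intro arg_cong2[where f = "(+)"] suminf_emeasure) auto
      finally show "(\<Sum>j. emeasure (\<mu> i) (E j) + emeasure (\<nu> i) (E j)) = emeasure (\<mu> i) UNIV + emeasure (\<nu> i) UNIV"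
        using E(3) by simp
    qed
    finally show "(\<Sum>j. ennreal (norm (D (E j)))) \<le> b" .
  qed
  moreover have "b < \<infinity>"
    unfolding b_def by (auto simp: \<mu>.emeasure_eq_measure \<nu>.emeasure_eq_measure)
  ultimately have finD: "finite_measure (total_variation D)"
    by (intro finite_measureI) (auto simp: emeasure_total_variation[OF D] top.not_eq_extremum dest: order.strict_trans1)
  let ?M = "total_variation D"
  let ?\<sigma> = "vector_RN_deriv ?M D"
  note \<sigma> = vector_RN_deriv[OF D finD]
  have \<sigma>i: "integrable ?M (\<lambda>x. ?\<sigma> x $ i)" for i
    by (rule integrable_bounded_linear[OF bounded_linear_vec_nth \<sigma>(1)])
  have \<sigma>A: "(LINT x:A|?M. ?\<sigma> x $ i) = measure (\<mu> i) A - measure (\<nu> i) A" if "A \<in> sets ?M" for A i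
  proof -
    have "integrable ?M (\<lambda>x. indicator A x *\<^sub>R ?\<sigma> x)" using that \<sigma>(1) by (rule integrable_mult_indicator)
    from integral_bounded_linear[OF bounded_linear_vec_nth this, of i]
    have "(LINT x:A|?M. ?\<sigma> x $ i) = (LINT x:A|?M. ?\<sigma> x) $ i" by (simp add: set_lebesgue_integral_def)
    also have "\<dots> = D A $ i" using \<sigma>(2)[of A] that by simp
    finally show ?thesis by (simp add: D_def)
  qed
  have "is_gradient_measure w D"
    unfolding is_gradient_measure_def
  proof (intro conjI ballI D finD)
    fix \<phi> :: "real ^ 'n \<Rightarrow> real ^ 'n" assume "\<phi> \<in> C1c_fields UNIV"
    then obtain \<phi>' where \<phi>: "\<And>i. test_function UNIV (\<lambda>x. \<phi> x $ i) (\<phi>' i)"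
      "\<And>x. divergence \<phi> x = (\<Sum>i\<in>UNIV. \<phi>' i x (axis i 1))"
      by (rule field_test_function) blast
    have "\<exists>B. (\<forall>x. \<bar>\<phi> x $ i\<bar> \<le> B) \<and> (\<forall>x. norm (\<phi>' i x) \<le> B)" for i
      by (rule test_function_bounded[OF \<phi>(1), of i]) blast
    then obtain B where B: "\<And>i x. \<bar>\<phi> x $ i\<bar> \<le> B i" "\<And>i x. norm (\<phi>' i x) \<le> B i" by metis
    have [measurable]: "(\<lambda>x. \<phi> x $ i) \<in> borel_measurable borel" for i
      using test_function_continuous[OF \<phi>(1)] by (auto intro: borel_measurable_continuous_onI)
    have [measurable]: "(\<lambda>x. \<phi>' i x v) \<in> borel_measurable borel" for i v
      using test_functionD(1)[OF \<phi>(1)] by (intro borel_measurable_continuous_onI continuous_intros)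
    have i1: "integrable lborel (\<lambda>x. w x * \<phi>' i x (axis i 1))" for i
    proof (rule Bochner_Integration.integrable_bound[OF integrable_mult_right[OF integrable_abs[OF wi], of "B i"]])
      have "norm (w x * \<phi>' i x (axis i 1)) \<le> norm (B i * \<bar>w x\<bar>)" for x
      proof -
        have "\<bar>\<phi>' i x (axis i 1)\<bar> \<le> B i"
          using norm_blinfun[of "\<phi>' i x" "axis i 1"] B(2)[of i x] by simp
        then have "\<bar>w x\<bar> * \<bar>\<phi>' i x (axis i 1)\<bar> \<le> \<bar>w x\<bar> * \<bar>B i\<bar>"
          by (intro mult_left_mono) auto
        then show ?thesis by (simp add: abs_mult mult.commute)
      qed
      then show "AE x in lborel. norm (w x * \<phi>' i x (axis i 1)) \<le> norm (B i * \<bar>w x\<bar>)" by simp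
    qed auto
    have i2: "integrable ?M (\<lambda>x. \<phi> x $ i * ?\<sigma> x $ i)" for i
    proof (rule Bochner_Integration.integrable_bound[OF integrable_mult_right[OF integrable_abs[OF \<sigma>i], of "B i" i]])
      have "norm (\<phi> x $ i * ?\<sigma> x $ i) \<le> norm (B i * \<bar>?\<sigma> x $ i\<bar>)" for x
        using B(1)[of x i] by (auto simp: abs_mult intro!: mult_right_mono)
      then show "AE x in ?M. norm (\<phi> x $ i * ?\<sigma> x $ i) \<le> norm (B i * \<bar>?\<sigma> x $ i\<bar>)" by simp
    qed (use \<sigma>i in auto)
    have "(LINT x|lebesgue. w x * divergence \<phi> x) = (LINT x|lborel. (\<Sum>i\<in>UNIV. w x * \<phi>' i x (axis i 1)))"
      by (subst integral_lebesgue_eq_lborel) (auto simp: \<phi>(2) sum_distrib_left)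
    also have "\<dots> = (\<Sum>i\<in>UNIV. LINT x|lborel. w x * \<phi>' i x (axis i 1))"
      by (rule Bochner_Integration.integral_sum) (rule i1)
    also have "\<dots> = (\<Sum>i\<in>UNIV. - (LINT x|?M. \<phi> x $ i * ?\<sigma> x $ i))"
    proof (intro sum.cong refl)
      fix i
      have "(LINT x|?M. \<phi> x $ i * ?\<sigma> x $ i) = (LINT x|\<mu> i. \<phi> x $ i) - (LINT x|\<nu> i. \<phi> x $ i)"
        by (rule integral_signed_density[OF finD \<sigma>i fin(1) _ fin(2) _ \<sigma>A _ B(1)]) (simp_all add: S)
      then show "(LINT x|lborel. w x * \<phi>' i x (axis i 1)) = - (LINT x|?M. \<phi> x $ i * ?\<sigma> x $ i)"
        using eq[OF \<phi>(1), of i] by simp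
    qed
    also have "\<dots> = - (LINT x|?M. (\<Sum>i\<in>UNIV. \<phi> x $ i * ?\<sigma> x $ i))"
      by (subst Bochner_Integration.integral_sum) (auto simp: i2 sum_negf)
    finally show "(LINT x|lebesgue. w x * divergence \<phi> x) = - (LINT x|?M. \<phi> x \<bullet> ?\<sigma> x)"
      by (simp add: inner_vec_def)
  qed
  then show ?thesis by blast
qed

subsection \<open>Zero extension across a Lipschitz boundary\<close>

lemma integrable_indicator_mult:
  fixes g :: "'a \<Rightarrow> real"
  assumes g: "integrable M g" and [measurable]: "A \<in> sets M"
  shows "integrable M (\<lambda>x. indicator A x * g x)"
  using integrable_mult_indicator[OF _ g, of A] by simp

lemma integral_indicator_mono:
  fixes g :: "'a \<Rightarrow> real"
  assumes g: "integrable M g" and "A \<in> sets M" "B \<in> sets M" "A \<subseteq> B" "\<And>x. 0 \<le> g x"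
  shows "(LINT x|M. indicator A x * g x) \<le> (LINT x|M. indicator B x * g x)"
  using assms by (intro integral_mono integrable_indicator_mult) (auto simp: indicator_def)

text \<open>Testing with fields \<psi> v, where v is the unit vector in direction \<xi>, extracts
  one direction from the definition of \<open>BV\<close>. All fields are supported inside \<Omega>,
  so the bound does not yet see the jump of the zero extension at the boundary.\<close>

lemma BV_directional_bound:
  fixes u :: "real ^ 'n \<Rightarrow> real"
  assumes \<Omega>: "open \<Omega>" and u: "u \<in> BV \<Omega>" and w: "integrable lborel w" "\<And>x. x \<notin> \<Omega> \<Longrightarrow> w x = 0"
    and wu: "AE x in lebesgue. w x = zero_extension \<Omega> u x"
  obtains C where "0 \<le> C"
    "\<And>\<psi> \<psi>' \<xi>. test_function \<Omega> \<psi> \<psi>' \<Longrightarrow> (\<And>x. \<bar>\<psi> x\<bar> \<le> 1) \<Longrightarrow> \<bar>LINT x|lborel. w x * \<psi>' x \<xi>\<bar> \<le> C * norm \<xi>"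
proof -
  let ?S = "{LINT x|lebesgue_on \<Omega>. u x * divergence \<phi> x | \<phi>. \<phi> \<in> C1c_fields \<Omega> \<and> (\<forall>x. norm (\<phi> x) \<le> 1)}"
  obtain C0 where C0: "\<And>y. y \<in> ?S \<Longrightarrow> y \<le> C0"
    using u by (auto simp: BV_def bdd_above_def)
  have um: "u \<in> borel_measurable (lebesgue_on \<Omega>)" using u by (auto simp: BV_def)
  define C where "C = \<bar>C0\<bar>"
  have [measurable]: "w \<in> borel_measurable borel" using w by auto
  have le: "(LINT x|lborel. w x * \<psi>' x \<xi>) \<le> C * norm \<xi>"
    if \<psi>: "test_function \<Omega> \<psi> \<psi>'" "\<And>x. \<bar>\<psi> x\<bar> \<le> 1" for \<psi> \<psi>' \<xi>
  proof (cases "\<xi> = 0")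
    case True then show ?thesis by simp
  next
    case False
    define v where "v = \<xi> /\<^sub>R norm \<xi>"
    have v: "norm v = 1" "\<xi> = norm \<xi> *\<^sub>R v" using False by (auto simp: v_def)
    have [measurable]: "(\<lambda>x. \<psi>' x v) \<in> borel_measurable borel"
      using test_functionD(1)[OF \<psi>(1)] by (intro borel_measurable_continuous_onI continuous_intros)
    have ms: "(\<lambda>x. u x * \<psi>' x v) \<in> borel_measurable (lebesgue_on \<Omega>)"
    proof (intro borel_measurable_times um)
      have "(\<lambda>x. \<psi>' x v) \<in> borel_measurable lebesgue" by (rule measurable_completion) simp
      then show "(\<lambda>x. \<psi>' x v) \<in> borel_measurable (lebesgue_on \<Omega>)" by (rule measurable_restrict_space1)
    qed
    have "(LINT x|lebesgue_on \<Omega>. u x * divergence (\<lambda>x. \<psi> x *\<^sub>R v) x) \<in> ?S"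
      using test_function_field(1)[OF \<psi>(1), of v] \<psi>(2) v by auto
    from C0[OF this] have "(LINT x|lebesgue_on \<Omega>. u x * \<psi>' x v) \<le> C"
      by (simp add: test_function_field(2)[OF \<psi>(1)] C_def)
    moreover have "(LINT x|lebesgue_on \<Omega>. u x * \<psi>' x v) = (LINT x|lborel. w x * \<psi>' x v)"
    proof -
      have "(LINT x|lebesgue_on \<Omega>. u x * \<psi>' x v) = (LINT x|lebesgue. indicator \<Omega> x *\<^sub>R (u x * \<psi>' x v))"
        by (rule integral_restrict_space) (use \<Omega> in auto)
      also have "\<dots> = (LINT x|lebesgue. w x * \<psi>' x v)"
      proof (rule integral_cong_AE)
        show "(\<lambda>x. indicator \<Omega> x *\<^sub>R (u x * \<psi>' x v)) \<in> borel_measurable lebesgue"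
          using ms \<Omega> by (subst (asm) borel_measurable_restrict_space_iff) auto
        show "(\<lambda>x. w x * \<psi>' x v) \<in> borel_measurable lebesgue" by (rule measurable_completion) simp
        show "AE x in lebesgue. indicator \<Omega> x *\<^sub>R (u x * \<psi>' x v) = w x * \<psi>' x v"
          using wu by eventually_elim (auto simp: zero_extension_def)
      qed
      also have "\<dots> = (LINT x|lborel. w x * \<psi>' x v)" by (rule integral_lebesgue_eq_lborel) simp
      finally show ?thesis .
    qed
    ultimately have "(LINT x|lborel. w x * \<psi>' x v) \<le> C" by simp
    then have "norm \<xi> * (LINT x|lborel. w x * \<psi>' x v) \<le> norm \<xi> * C" by (intro mult_left_mono) auto
    moreover have "(LINT x|lborel. w x * \<psi>' x \<xi>) = norm \<xi> * (LINT x|lborel. w x * \<psi>' x v)"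
      by (subst v(2)) (simp add: blinfun.scaleR_right mult.left_commute)
    ultimately show ?thesis by (simp add: mult.commute)
  qed
  show ?thesis
  proof (rule that[of C])
    fix \<psi> \<psi>' \<xi> assume \<psi>: "test_function \<Omega> \<psi> \<psi>'" "\<And>x. \<bar>\<psi> x\<bar> \<le> 1"
    have "- (LINT x|lborel. w x * \<psi>' x \<xi>) \<le> C * norm \<xi>"
      using le[OF test_function_uminus[OF \<psi>(1)], of \<xi>] \<psi>(2) by (simp add: uminus_blinfun.rep_eq)
    then show "\<bar>LINT x|lborel. w x * \<psi>' x \<xi>\<bar> \<le> C * norm \<xi>" using le[OF \<psi>, of \<xi>] by simp
  qed (simp add: C_def)
qed

text \<open>By duality the integral is attained up to e by a test function supported in A. While it
  is moved along the segment to h its support stays in \<Omega>, where the derivative bound C is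
  available.\<close>

lemma shift_diff_inside:
  fixes w :: "real ^ 'n \<Rightarrow> real"
  assumes w: "integrable lborel w"
    and C: "\<And>\<psi> \<psi>' \<xi>. test_function \<Omega> \<psi> \<psi>' \<Longrightarrow> (\<And>x. \<bar>\<psi> x\<bar> \<le> 1) \<Longrightarrow> \<bar>LINT x|lborel. w x * \<psi>' x \<xi>\<bar> \<le> C * norm \<xi>"
    and A: "open A" "\<And>x s. x \<in> A \<Longrightarrow> 0 \<le> s \<Longrightarrow> s \<le> 1 \<Longrightarrow> x + s *\<^sub>R h \<in> \<Omega>"
  shows "(LINT x|lborel. indicator A x * \<bar>w (x + h) - w x\<bar>) \<le> C * norm h"
proof (rule field_le_epsilon)
  fix e :: real assume e: "e > 0"
  have fi: "integrable lborel (\<lambda>x. w (x + h) - w x)"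
    using w by (intro Bochner_Integration.integrable_diff integrable_translation)
  obtain \<psi> \<psi>' where \<psi>: "test_function A \<psi> \<psi>'" "\<And>x. \<bar>\<psi> x\<bar> \<le> 1"
    "(LINT x|lborel. indicator A x * \<bar>w (x + h) - w x\<bar>) - e \<le> (LINT x|lborel. \<psi> x * (w (x + h) - w x))"
    by (rule test_function_duality[OF sets_lborel fi A(1) e]) blast
  have "\<bar>LINT x|lborel. \<psi> x * (w (x + 1 *\<^sub>R h) - w x)\<bar> \<le> (C * norm h) * 1"
  proof (rule integral_test_difference_bound[OF w \<psi>(1)])
    fix s :: real assume s: "0 \<le> s" "s \<le> 1"
    have "test_function \<Omega> (\<lambda>x. \<psi> (x - s *\<^sub>R h)) (\<lambda>x. \<psi>' (x - s *\<^sub>R h))"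
      by (rule test_function_translate[OF \<psi>(1)]) (use A(2) s in auto)
    from C[OF this] \<psi>(2) show "\<bar>LINT x|lborel. w x * \<psi>' (x - s *\<^sub>R h) h\<bar> \<le> C * norm h" by simp
  qed simp
  then show "(LINT x|lborel. indicator A x * \<bar>w (x + h) - w x\<bar>) \<le> C * norm h + e"
    using \<psi>(3) by simp
qed

text \<open>
  The points \<open>Z\<close> that the translation by \<open>v\<close> carries into \<open>\<Omega>\<close> have disjoint translates by
  \<open>v, 2 v, 3 v, \<dots>\<close>, all inside \<open>\<Omega>\<close>. Telescoping along these bounds the integral of
  \<open>\<bar>w\<bar>\<close> over \<open>Z + v\<close> by that over \<open>Z + j v\<close> plus \<open>C \<bar>v\<bar>\<close>, and one averages over \<open>j\<close>.
\<close>

lemma shift_diff_boundary: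
  fixes w :: "real ^ 'n \<Rightarrow> real"
  assumes \<Omega>: "open \<Omega>" and w: "integrable lborel w" "\<And>x. x \<notin> \<Omega> \<Longrightarrow> w x = 0"
    and C: "\<And>\<psi> \<psi>' \<xi>. test_function \<Omega> \<psi> \<psi>' \<Longrightarrow> (\<And>x. \<bar>\<psi> x\<bar> \<le> 1) \<Longrightarrow> \<bar>LINT x|lborel. w x * \<psi>' x \<xi>\<bar> \<le> C * norm \<xi>"
    and r: "r > 0" and v: "v \<noteq> 0" "norm v \<le> r / 4"
    and up: "\<And>x s. x \<in> \<Omega> \<Longrightarrow> x \<in> ball p r \<Longrightarrow> 0 \<le> s \<Longrightarrow> x + s *\<^sub>R v \<in> ball p r \<Longrightarrow> x + s *\<^sub>R v \<in> \<Omega>"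
  shows "(LINT x|lborel. indicator (ball p (r / 4)) x * \<bar>w (x + v) - w x\<bar>)
    \<le> (2 * C + 4 * (LINT x|lborel. \<bar>w x\<bar>) / r) * norm v"
proof -
  have [measurable]: "w \<in> borel_measurable borel" "\<Omega> \<in> sets borel" using w \<Omega> by auto
  have nv: "norm v > 0" using v by simp
  \<comment> \<open>From radius 3r/4 one step of length at most r/4 stays in the ball of radius r.
    From radius r/4 a journey of length at most r/2 stays within 3r/4.\<close>
  define A where "A = \<Omega> \<inter> ball p (3 * r / 4)"
  define Z where "Z = {y \<in> ball p (r / 4). y \<notin> \<Omega> \<and> y + v \<in> \<Omega>}"
  have [measurable]: "A \<in> sets borel" "Z \<in> sets borel"
    unfolding A_def Z_def by measurable
  define W where "W = (LINT x|lborel. \<bar>w x\<bar>)"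
  have near: "x + s *\<^sub>R v \<in> ball p (a + b)" if "x \<in> ball p a" "0 \<le> s" "s * norm v \<le> b" for x s a b
  proof -
    have "norm (p - (x + s *\<^sub>R v)) = norm ((p - x) - s *\<^sub>R v)" by (simp add: algebra_simps)
    then show ?thesis using that norm_triangle_ineq4[of "p - x" "s *\<^sub>R v"] by (simp add: dist_norm)
  qed
  have inA: "(LINT x|lborel. indicator A x * \<bar>w (x + v) - w x\<bar>) \<le> C * norm v"
  proof (rule shift_diff_inside[OF w(1) C])
    show "open A" using \<Omega> by (auto simp: A_def)
    fix x and s :: real assume x: "x \<in> A" and s: "0 \<le> s" "s \<le> 1"
    have "s * norm v \<le> 1 * norm v" using s by (intro mult_right_mono) auto
    then have "s * norm v \<le> r / 4" using v by linarith
    then have "x + s *\<^sub>R v \<in> ball p r" using near[of x "3 * r / 4" s "r / 4"] x s by (simp add: A_def)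
    then show "x + s *\<^sub>R v \<in> \<Omega>" using x s up[of x s] r by (auto simp: A_def)
  qed
  \<comment> \<open>The number of steps fitting into length r/2. Since
    \<open>norm v \<le> r / 4\<close>, rounding down still leaves M \<ge> r / (4
    \<open>norm v\<close>), the source of the term with 4 / r.\<close>
  define M where "M = nat \<lfloor>r / (2 * norm v)\<rfloor>"
  have M1: "real M * norm v \<le> r / 2"
  proof -
    have "real M \<le> r / (2 * norm v)" using r nv by (simp add: M_def)
    then show ?thesis using nv by (simp add: field_simps)
  qed
  have M2: "r / (4 * norm v) \<le> real M"
  proof -
    have "1 \<le> r / (4 * norm v)" using v(2) nv by (simp add: field_simps)
    moreover have "r / (2 * norm v) = r / (4 * norm v) + r / (4 * norm v)" using nv by (simp add: field_simps)
    moreover have "r / (2 * norm v) - 1 < real M"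
    proof -
      have "0 \<le> \<lfloor>r / (2 * norm v)\<rfloor>" using r nv by simp
      then show ?thesis unfolding M_def by linarith
    qed
    ultimately show ?thesis by linarith
  qed
  have ZA: "y + real j *\<^sub>R v \<in> A" if y: "y \<in> Z" and j: "1 \<le> j" "j \<le> M" for y j
  proof -
    have jM: "real j * norm v \<le> r / 2"
      using j M1 mult_right_mono[of "real j" "real M" "norm v"] by simp
    have b: "y + real j *\<^sub>R v \<in> ball p (3 * r / 4)"
      using near[of y "r / 4" "real j" "r / 2"] y jM by (simp add: Z_def)
    have "y + 1 *\<^sub>R v \<in> ball p (r / 4 + r / 4)" using near[of y "r / 4" 1 "r / 4"] y v by (simp add: Z_def)
    then have y1: "y + v \<in> ball p r" using r by simp
    have e: "(y + v) + (real j - 1) *\<^sub>R v = y + real j *\<^sub>R v" by (simp add: algebra_simps)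
    have "(y + v) + (real j - 1) *\<^sub>R v \<in> \<Omega>"
      by (rule up) (use y y1 j b r in \<open>auto simp: Z_def e\<close>)
    then show ?thesis using b by (simp add: A_def e)
  qed
  have count: "(\<Sum>j=1..M. indicator Z (x - real j *\<^sub>R v)) \<le> (indicator A x :: real)" for x
  proof (cases "\<exists>j\<in>{1..M}. x - real j *\<^sub>R v \<in> Z")
    case False
    then have "(\<Sum>j=1..M. indicator Z (x - real j *\<^sub>R v)) = (0::real)" by (intro sum.neutral) auto
    then show ?thesis by simp
  next
    case True
    \<comment> \<open>If x belonged to the translates with i < j, then x - i v would be a forward
      translate of a point of Z, hence in \<Omega>, whereas Z avoids \<Omega>.\<close>
    have disj: False if "x - real i *\<^sub>R v \<in> Z" "x - real j *\<^sub>R v \<in> Z" "i < j" "1 \<le> i" "j \<le> M" for i j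
    proof -
      have "(x - real j *\<^sub>R v) + real (j - i) *\<^sub>R v \<in> A" by (rule ZA) (use that in auto)
      moreover have "(x - real j *\<^sub>R v) + real (j - i) *\<^sub>R v = x - real i *\<^sub>R v"
        using that by (simp add: of_nat_diff algebra_simps)
      ultimately show False using that(1) by (simp add: A_def Z_def)
    qed
    obtain j where j: "j \<in> {1..M}" "x - real j *\<^sub>R v \<in> Z" using True by blast
    have "(\<Sum>i=1..M. indicator Z (x - real i *\<^sub>R v)) = (\<Sum>i\<in>{j}. indicator Z (x - real i *\<^sub>R v) :: real)"
    proof (rule sum.mono_neutral_right)
      show "\<forall>i\<in>{1..M} - {j}. indicator Z (x - real i *\<^sub>R v) = (0::real)"
      proof
        fix i assume i: "i \<in> {1..M} - {j}"
        then have "x - real i *\<^sub>R v \<notin> Z"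
          using disj[of i j] disj[of j i] j by (cases i j rule: linorder_cases) auto
        then show "indicator Z (x - real i *\<^sub>R v) = (0::real)" by simp
      qed
    qed (use j in auto)
    moreover have "x \<in> A" using ZA[OF j(2), of j] j(1) by simp
    ultimately show ?thesis using j by simp
  qed
  have transl: "(LINT y|lborel. indicator Z y * g (y + real j *\<^sub>R v)) = (LINT x|lborel. indicator Z (x - real j *\<^sub>R v) * g x)"
    if [measurable]: "g \<in> borel_measurable borel" for g :: "real ^ 'n \<Rightarrow> real" and j
    using integral_translation[of "\<lambda>x. indicator Z (x - real j *\<^sub>R v) * g x" "real j *\<^sub>R v"] by simp
  have packed: "(\<Sum>j=1..M. LINT y|lborel. indicator Z y * g (y + real j *\<^sub>R v)) \<le> (LINT x|lborel. indicator A x * g x)"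
    if g: "integrable lborel g" "\<And>x. 0 \<le> g x" for g :: "real ^ 'n \<Rightarrow> real"
  proof -
    have [measurable]: "g \<in> borel_measurable borel" using g by auto
    have ii: "integrable lborel (\<lambda>x. indicator Z (x - real j *\<^sub>R v) * g x)" for j
    proof (rule Bochner_Integration.integrable_bound[OF g(1)])
      show "AE x in lborel. norm (indicator Z (x - real j *\<^sub>R v) * g x) \<le> norm (g x)"
        by (auto simp: indicator_def)
    qed auto
    have "(\<Sum>j=1..M. LINT y|lborel. indicator Z y * g (y + real j *\<^sub>R v)) =
        (LINT x|lborel. (\<Sum>j=1..M. indicator Z (x - real j *\<^sub>R v) * g x))"
      by (subst Bochner_Integration.integral_sum) (auto simp: ii transl)
    also have "\<dots> \<le> (LINT x|lborel. indicator A x * g x)"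
    proof (rule integral_mono)
      show "integrable lborel (\<lambda>x. \<Sum>j=1..M. indicator Z (x - real j *\<^sub>R v) * g x)"
        using ii by (intro Bochner_Integration.integrable_sum)
      show "integrable lborel (\<lambda>x. indicator A x * g x)" by (rule integrable_indicator_mult[OF g(1)]) simp
      show "(\<Sum>j=1..M. indicator Z (x - real j *\<^sub>R v) * g x) \<le> indicator A x * g x" for x
        using mult_right_mono[OF count[of x] g(2)[of x]] by (simp add: sum_distrib_right)
    qed
    finally show ?thesis .
  qed
  define a where "a j = (LINT y|lborel. indicator Z y * \<bar>w (y + real j *\<^sub>R v)\<bar>)" for j
  define d where "d j = (LINT y|lborel. indicator Z y * \<bar>w (y + real j *\<^sub>R v + v) - w (y + real j *\<^sub>R v)\<bar>)" for j
  have wi: "integrable lborel (\<lambda>x. \<bar>w (x + h)\<bar>)" for h using w by (intro integrable_abs integrable_translation)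
  have di: "integrable lborel (\<lambda>x. \<bar>w (x + h + v) - w (x + h)\<bar>)" for h
    using integrable_translation[OF integrable_shift_diff[OF w(1), of v], of h] by simp
  have d0: "0 \<le> d j" for j unfolding d_def by (intro Bochner_Integration.integral_nonneg) auto
  have sumd: "(\<Sum>j=1..M. d j) \<le> C * norm v"
    unfolding d_def using packed[OF integrable_shift_diff[OF w(1), of v]] inA by simp
  have suma: "(\<Sum>j=1..M. a j) \<le> W"
  proof -
    have "(\<Sum>j=1..M. a j) \<le> (LINT x|lborel. indicator A x * \<bar>w x\<bar>)"
      unfolding a_def using packed[OF integrable_abs[OF w(1)]] by simp
    also have "\<dots> \<le> (LINT x|lborel. indicator UNIV x * \<bar>w x\<bar>)"
      using w by (intro integral_indicator_mono) auto
    finally show ?thesis by (simp add: W_def)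
  qed
  have step: "a j \<le> a (Suc j) + d j" for j
  proof -
    have "a j \<le> (LINT y|lborel. indicator Z y * \<bar>w (y + real (Suc j) *\<^sub>R v)\<bar> +
        indicator Z y * \<bar>w (y + real j *\<^sub>R v + v) - w (y + real j *\<^sub>R v)\<bar>)"
      unfolding a_def
    proof (rule integral_mono)
      show "indicator Z y * \<bar>w (y + real j *\<^sub>R v)\<bar> \<le> indicator Z y * \<bar>w (y + real (Suc j) *\<^sub>R v)\<bar> +
        indicator Z y * \<bar>w (y + real j *\<^sub>R v + v) - w (y + real j *\<^sub>R v)\<bar>" for y
        by (auto simp: indicator_def algebra_simps)
    qed (intro Bochner_Integration.integrable_add integrable_indicator_mult wi di; simp)+
    also have "\<dots> = a (Suc j) + d j"
      unfolding a_def d_def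
      by (intro Bochner_Integration.integral_add integrable_indicator_mult wi di) auto
    finally show ?thesis .
  qed
  have "a 1 \<le> a (Suc j) + (\<Sum>i=1..j. d i)" for j
  proof (induction j)
    case (Suc j)
    then show ?case using step[of "Suc j"] by simp
  qed simp
  have a1: "a 1 \<le> a j + C * norm v" if j: "j \<in> {1..M}" for j
  proof -
    obtain i where i: "j = Suc i" using j by (cases j) auto
    have "(\<Sum>i=1..i. d i) \<le> (\<Sum>i=1..M. d i)" using i j d0 by (intro sum_mono2) auto
    then show ?thesis using \<open>a 1 \<le> a (Suc i) + (\<Sum>i=1..i. d i)\<close> sumd i by simp
  qed
  have "real M * a 1 = (\<Sum>j=1..M. a 1)" by simp
  also have "\<dots> \<le> (\<Sum>j=1..M. a j + C * norm v)" by (intro sum_mono a1)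
  also have "\<dots> \<le> W + real M * (C * norm v)" using suma by (simp add: sum.distrib)
  finally have "real M * (a 1 - C * norm v) \<le> W" by (simp add: algebra_simps)
  have aZ: "a 1 \<le> C * norm v + 4 * W / r * norm v"
  proof (cases "a 1 - C * norm v \<le> 0")
    case True
    have "0 \<le> 4 * W / r * norm v" using r by (simp add: W_def)
    then show ?thesis using True by linarith
  next
    case False
    have "r / (4 * norm v) * (a 1 - C * norm v) \<le> real M * (a 1 - C * norm v)"
      using False M2 by (intro mult_right_mono) auto
    then have "r / (4 * norm v) * (a 1 - C * norm v) \<le> W"
      using \<open>real M * (a 1 - C * norm v) \<le> W\<close> by linarith
    then have "a 1 - C * norm v \<le> W * (4 * norm v / r)" using r nv by (simp add: field_simps)
    then show ?thesis by (simp add: mult_ac)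
  qed
  \<comment> \<open>Three cases: for x in \<Omega> the interior estimate applies; for x outside with
    x + v inside, x lies in Z and w x = 0; if both are outside, the difference is 0.\<close>
  have "(LINT x|lborel. indicator (ball p (r / 4)) x * \<bar>w (x + v) - w x\<bar>)
      \<le> (LINT x|lborel. indicator A x * \<bar>w (x + v) - w x\<bar> + indicator Z x * \<bar>w (x + v)\<bar>)"
  proof (rule integral_mono)
    show "indicator (ball p (r / 4)) x * \<bar>w (x + v) - w x\<bar> \<le> indicator A x * \<bar>w (x + v) - w x\<bar> + indicator Z x * \<bar>w (x + v)\<bar>" for x
    proof (cases "x \<in> ball p (r / 4)")
      case True
      then have "x \<in> ball p (3 * r / 4)" using r by auto
      then show ?thesis using True w(2)[of x] w(2)[of "x + v"] by (auto simp: A_def Z_def indicator_def)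
    qed simp
  qed (use integrable_shift_diff[OF w(1)] wi[of v] in \<open>auto intro!: Bochner_Integration.integrable_add integrable_indicator_mult\<close>)
  also have "\<dots> = (LINT x|lborel. indicator A x * \<bar>w (x + v) - w x\<bar>) + a 1"
    unfolding a_def using integrable_shift_diff[OF w(1)] wi[of v]
    by (subst Bochner_Integration.integral_add) (auto intro!: integrable_indicator_mult)
  also have "\<dots> \<le> C * norm v + (C * norm v + 4 * W / r * norm v)" by (rule add_mono[OF inA aZ])
  finally show ?thesis by (simp add: W_def algebra_simps)
qed

text \<open>Directions v in the cone L \<bar>pr v\<bar> < v \<bullet> e rise faster than the graph
  of \<gamma>, so moving along them inside the ball does not leave \<Omega>, and
  \<open>shift_diff_boundary\<close> applies. An arbitrary h is a difference v1 - v2 of two cone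
  vectors of length comparable to that of h.\<close>

lemma lipschitz_boundary_local_shift:
  fixes w :: "real ^ 'n \<Rightarrow> real"
  assumes \<Omega>: "open \<Omega>" "lipschitz_boundary \<Omega>" and p: "p \<in> frontier \<Omega>"
    and w: "integrable lborel w" "\<And>x. x \<notin> \<Omega> \<Longrightarrow> w x = 0" and C0: "0 \<le> C"
    and C: "\<And>\<psi> \<psi>' \<xi>. test_function \<Omega> \<psi> \<psi>' \<Longrightarrow> (\<And>x. \<bar>\<psi> x\<bar> \<le> 1) \<Longrightarrow> \<bar>LINT x|lborel. w x * \<psi>' x \<xi>\<bar> \<le> C * norm \<xi>"
  shows "\<exists>\<rho>>0. \<exists>K. \<forall>h. norm h \<le> \<rho> \<longrightarrow>
    (LINT x|lborel. indicator (ball p \<rho>) x * \<bar>w (x + h) - w x\<bar>) \<le> K * norm h"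
proof -
  have [measurable]: "w \<in> borel_measurable borel" using w by auto
  obtain r e L and \<gamma> :: "real ^ 'n \<Rightarrow> real" where r: "r > 0" and e: "norm e = 1"
    and lip: "L-lipschitz_on {y. y \<bullet> e = 0} \<gamma>"
    and graph: "\<Omega> \<inter> ball p r = {x \<in> ball p r. \<gamma> (x - (x \<bullet> e) *\<^sub>R e) < x \<bullet> e}"
    using \<Omega>(2) p unfolding lipschitz_boundary_def by blast
  have L0: "L \<ge> 0" using lip by (rule lipschitz_on_nonneg)
  have ee: "e \<bullet> e = 1" using e by (simp add: dot_square_norm)
  define pr where "pr x = x - (x \<bullet> e) *\<^sub>R e" for x
  have pr_perp: "pr x \<bullet> e = 0" for x by (simp add: pr_def inner_diff_left ee)
  have pr_add: "pr (x + y) = pr x + pr y" for x y by (simp add: pr_def inner_add_left algebra_simps)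
  have pr_scale: "pr (s *\<^sub>R x) = s *\<^sub>R pr x" for s x by (simp add: pr_def algebra_simps)
  have up: "x + s *\<^sub>R v \<in> \<Omega>"
    if v: "L * norm (pr v) < v \<bullet> e" and x: "x \<in> \<Omega>" "x \<in> ball p r" "0 \<le> s" "x + s *\<^sub>R v \<in> ball p r" for x s v
  proof (cases "s = 0")
    case True then show ?thesis using x by simp
  next
    case False
    have "x \<in> \<Omega> \<inter> ball p r" using x by simp
    then have "\<gamma> (pr x) < x \<bullet> e" unfolding graph pr_def by simp
    moreover have "\<bar>\<gamma> (pr (x + s *\<^sub>R v)) - \<gamma> (pr x)\<bar> \<le> L * norm (pr (x + s *\<^sub>R v) - pr x)"
      using lipschitz_onD[OF lip, of "pr (x + s *\<^sub>R v)" "pr x"] pr_perp by (simp add: dist_norm)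
    moreover have "L * norm (pr (x + s *\<^sub>R v) - pr x) = s * (L * norm (pr v))"
      using x(3) by (simp add: pr_add pr_scale)
    moreover have "s * (L * norm (pr v)) < s * (v \<bullet> e)" using v False x(3) by simp
    ultimately have "\<gamma> (pr (x + s *\<^sub>R v)) < (x + s *\<^sub>R v) \<bullet> e" by (simp add: inner_add_left)
    then have "x + s *\<^sub>R v \<in> \<Omega> \<inter> ball p r" unfolding graph using x(4) by (simp add: pr_def)
    then show ?thesis by simp
  qed
  define W where "W = (LINT x|lborel. \<bar>w x\<bar>)"
  define K where "K = 2 * C + 4 * W / r"
  have cone: "(LINT x|lborel. indicator (ball p (r / 4)) x * \<bar>w (x + v) - w x\<bar>) \<le> K * norm v"
    if "L * norm (pr v) < v \<bullet> e" "norm v \<le> r / 4" for v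
    unfolding K_def W_def
  proof (rule shift_diff_boundary[OF \<Omega>(1) w C r _ that(2)])
    show "v \<noteq> 0" using that by (auto simp: pr_def)
  qed (use up[OF that(1)] in auto)
  \<comment> \<open>With v2 = \<kappa> \<bar>h\<bar> e, the sum h + v2 has height at least (L + 1)
    \<bar>h\<bar> over a horizontal part of length at most \<bar>h\<bar>, so it is in the cone. The
    radius \<rho> then keeps both vectors shorter than r/8 and \<open>ball p \<rho>\<close> shifted
    by v2 within radius r/4.\<close>
  define \<kappa> where "\<kappa> = L + 2"
  define \<rho> where "\<rho> = r / (8 * (\<kappa> + 1))"
  have \<kappa>: "\<kappa> \<ge> 2" using L0 by (simp add: \<kappa>_def)
  have \<rho>: "\<rho> > 0" "(\<kappa> + 1) * \<rho> = r / 8"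
    using r \<kappa> nonzero_mult_div_cancel_left[of "\<kappa> + 1" "r / 8"] by (auto simp: \<rho>_def)
  have "\<rho> \<le> (\<kappa> + 1) * \<rho>" using \<kappa> \<rho>(1) by simp
  then have \<rho>8: "\<rho> \<le> r / 8" using \<rho>(2) by simp
  have K0: "0 \<le> K" using C0 r by (simp add: K_def W_def)
  have "(LINT x|lborel. indicator (ball p \<rho>) x * \<bar>w (x + h) - w x\<bar>) \<le> (K * (2 * \<kappa> + 1)) * norm h"
    if h: "norm h \<le> \<rho>" for h
  proof (cases "h = 0")
    case True then show ?thesis by simp
  next
    case False
    then have nh: "norm h > 0" by simp
    define v2 where "v2 = (\<kappa> * norm h) *\<^sub>R e"
    define v1 where "v1 = h + v2"
    have n2: "norm v2 = \<kappa> * norm h" using \<kappa> e by (simp add: v2_def)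
    have n1: "norm v1 \<le> (\<kappa> + 1) * norm h"
      using norm_triangle_ineq[of h v2] n2 by (simp add: v1_def algebra_simps)
    have "(\<kappa> + 1) * norm h \<le> (\<kappa> + 1) * \<rho>" using h \<kappa> by (intro mult_left_mono) auto
    then have b1: "norm v1 \<le> r / 8" using n1 \<rho> by simp
    have "norm v2 \<le> (\<kappa> + 1) * norm h" unfolding n2 by (intro mult_right_mono) auto
    then have b2: "norm v2 \<le> r / 8" using \<open>(\<kappa> + 1) * norm h \<le> (\<kappa> + 1) * \<rho>\<close> \<rho>(2) by linarith
    have pr2: "pr v2 = 0" by (simp add: pr_def v2_def ee)
    have c2: "L * norm (pr v2) < v2 \<bullet> e" using nh \<kappa> by (simp add: pr2) (simp add: v2_def ee)
    have c1: "L * norm (pr v1) < v1 \<bullet> e"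
    proof -
      have "norm (pr h) \<le> norm h"
      proof (rule power2_le_imp_le)
        have "(norm (pr h))\<^sup>2 = (norm h)\<^sup>2 - (h \<bullet> e)\<^sup>2"
          unfolding power2_norm_eq_inner pr_def
          by (simp add: inner_diff_left inner_diff_right ee inner_commute[of e h] power2_eq_square)
        then show "(norm (pr h))\<^sup>2 \<le> (norm h)\<^sup>2" by simp
      qed simp
      then have "L * norm (pr v1) \<le> L * norm h" using L0 by (simp add: v1_def pr_add pr2 mult_left_mono)
      moreover have "- norm h \<le> h \<bullet> e" using Cauchy_Schwarz_ineq2[of h e] e by simp
      moreover have "v1 \<bullet> e = h \<bullet> e + (L + 2) * norm h" by (simp add: v1_def v2_def inner_add_left ee \<kappa>_def)
      moreover have "(L + 2) * norm h = L * norm h + 2 * norm h" by (simp add: algebra_simps)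
      ultimately show ?thesis using nh by linarith
    qed
    let ?B = "indicator (ball p (r / 4)) :: real ^ 'n \<Rightarrow> real"
    have shift: "(LINT x|lborel. indicator (ball p \<rho>) x * g (x - v2)) \<le> (LINT x|lborel. ?B x * g x)"
      if g: "integrable lborel g" "\<And>x. 0 \<le> g x" for g :: "real ^ 'n \<Rightarrow> real"
    proof -
      have [measurable]: "g \<in> borel_measurable borel" using g by auto
      have "(LINT x|lborel. indicator (ball p \<rho>) x * g (x - v2)) \<le> (LINT x|lborel. ?B (x - v2) * g (x - v2))"
      proof (rule integral_mono)
        have gi: "integrable lborel (\<lambda>x. g (x - v2))" using integrable_translation[OF g(1), of "- v2"] by simp
        have [measurable]: "g \<in> borel_measurable borel" using g by auto
        show "integrable lborel (\<lambda>x. indicator (ball p \<rho>) x * g (x - v2))" by (rule integrable_indicator_mult[OF gi]) simp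
        show "integrable lborel (\<lambda>x. ?B (x - v2) * g (x - v2))"
          by (rule Bochner_Integration.integrable_bound[OF gi]) (auto simp: indicator_def)
        fix x
        have "x - v2 \<in> ball p (r / 4)" if "x \<in> ball p \<rho>"
        proof -
          have "norm (p - (x - v2)) \<le> norm (p - x) + norm v2"
            using norm_triangle_ineq[of "p - x" v2] by (simp add: algebra_simps)
          then show ?thesis using that b2 \<rho>8 by (simp add: dist_norm)
        qed
        then show "indicator (ball p \<rho>) x * g (x - v2) \<le> ?B (x - v2) * g (x - v2)"
          using g(2)[of "x - v2"] by (auto simp: indicator_def)
      qed
      also have "\<dots> = (LINT x|lborel. ?B x * g x)"
      proof -
        have "(\<lambda>x. ?B x * g x) \<in> borel_measurable borel"
          by (intro borel_measurable_times borel_measurable_indicator) (use g in auto)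
        from integral_translation[OF this, of "- v2"] show ?thesis by simp
      qed
      finally show ?thesis .
    qed
    have i1: "integrable lborel (\<lambda>x. \<bar>w (x + v1) - w x\<bar>)" and i2: "integrable lborel (\<lambda>x. \<bar>w (x + v2) - w x\<bar>)"
      by (rule integrable_shift_diff[OF w(1)])+
    \<comment> \<open>Both values are compared with w at x - v2: x + h is reached from there by v1,
      and x by v2.\<close>
    have "(LINT x|lborel. indicator (ball p \<rho>) x * \<bar>w (x + h) - w x\<bar>)
        \<le> (LINT x|lborel. indicator (ball p \<rho>) x * \<bar>w (x - v2 + v1) - w (x - v2)\<bar> +
             indicator (ball p \<rho>) x * \<bar>w (x - v2 + v2) - w (x - v2)\<bar>)"
    proof (rule integral_mono)
      show "integrable lborel (\<lambda>x. indicator (ball p \<rho>) x * \<bar>w (x + h) - w x\<bar>)"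
        by (intro integrable_indicator_mult integrable_shift_diff w) simp
      show "integrable lborel (\<lambda>x. indicator (ball p \<rho>) x * \<bar>w (x - v2 + v1) - w (x - v2)\<bar> +
             indicator (ball p \<rho>) x * \<bar>w (x - v2 + v2) - w (x - v2)\<bar>)"
        using integrable_translation[OF i1, of "- v2"] integrable_translation[OF i2, of "- v2"]
        by (intro Bochner_Integration.integrable_add integrable_indicator_mult) simp_all
      show "indicator (ball p \<rho>) x * \<bar>w (x + h) - w x\<bar> \<le> indicator (ball p \<rho>) x * \<bar>w (x - v2 + v1) - w (x - v2)\<bar> +
             indicator (ball p \<rho>) x * \<bar>w (x - v2 + v2) - w (x - v2)\<bar>" for x
        by (auto simp: indicator_def v1_def)
    qed
    also have "\<dots> = (LINT x|lborel. indicator (ball p \<rho>) x * \<bar>w (x - v2 + v1) - w (x - v2)\<bar>) +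
        (LINT x|lborel. indicator (ball p \<rho>) x * \<bar>w (x - v2 + v2) - w (x - v2)\<bar>)"
      using integrable_translation[OF i1, of "- v2"] integrable_translation[OF i2, of "- v2"]
      by (intro Bochner_Integration.integral_add integrable_indicator_mult) simp_all
    also have "\<dots> \<le> K * norm v1 + K * norm v2"
      using shift[OF i1] shift[OF i2] cone[OF c1] cone[OF c2] b1 b2 r by simp
    also have "\<dots> \<le> K * ((\<kappa> + 1) * norm h) + K * (\<kappa> * norm h)"
      using n1 n2 K0 by (intro add_mono mult_left_mono) auto
    also have "\<dots> = (K * (2 * \<kappa> + 1)) * norm h" by (simp add: algebra_simps)
    finally show ?thesis .
  qed
  then show ?thesis using \<rho>(1) by blast
qed

text \<open>Local translation bounds around the points of the compact set
  \<open>closure \<Omega>\<close> are summed over a finite cover. They serve translations shorter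
  than a fixed \<delta>; for longer ones twice the L^1 norm is at most a multiple of
  \<open>norm h\<close>.\<close>

lemma finite_variation_zero_extension:
  fixes w :: "real ^ 'n \<Rightarrow> real"
  assumes \<Omega>: "open \<Omega>" "bounded \<Omega>" "lipschitz_boundary \<Omega>"
    and w: "integrable lborel w" "\<And>x. x \<notin> \<Omega> \<Longrightarrow> w x = 0" and C0: "0 \<le> C"
    and C: "\<And>\<psi> \<psi>' \<xi>. test_function \<Omega> \<psi> \<psi>' \<Longrightarrow> (\<And>x. \<bar>\<psi> x\<bar> \<le> 1) \<Longrightarrow> \<bar>LINT x|lborel. w x * \<psi>' x \<xi>\<bar> \<le> C * norm \<xi>"
  shows "finite_variation w"
proof -
  have [measurable]: "w \<in> borel_measurable borel" using w by auto
  define local_bound where "local_bound p \<rho> K \<longleftrightarrow> \<rho> > 0 \<and> (\<forall>h. norm h \<le> \<rho> \<longrightarrow>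
    (LINT x|lborel. indicator (ball p \<rho>) x * \<bar>w (x + h) - w x\<bar>) \<le> K * norm h)" for p \<rho> K
  have "\<exists>\<rho> K. local_bound p \<rho> K" if p: "p \<in> closure \<Omega>" for p
  proof (cases "p \<in> \<Omega>")
    case True
    obtain r where r: "r > 0" "ball p r \<subseteq> \<Omega>" using \<Omega>(1) True by (meson open_contains_ball)
    have "(LINT x|lborel. indicator (ball p (r / 2)) x * \<bar>w (x + h) - w x\<bar>) \<le> C * norm h" if h: "norm h \<le> r / 2" for h
    proof (rule shift_diff_inside[OF w(1) C])
      fix x and s :: real assume x: "x \<in> ball p (r / 2)" and s: "0 \<le> s" "s \<le> 1"
      have "s * norm h \<le> 1 * norm h" using s by (intro mult_right_mono) auto
      moreover have "norm (p - (x + s *\<^sub>R h)) = norm ((p - x) - s *\<^sub>R h)" by (simp add: algebra_simps)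
      ultimately have "x + s *\<^sub>R h \<in> ball p r"
        using x s h norm_triangle_ineq4[of "p - x" "s *\<^sub>R h"] by (simp add: dist_norm)
      then show "x + s *\<^sub>R h \<in> \<Omega>" using r by blast
    qed auto
    then have "local_bound p (r / 2) C" using r(1) by (simp add: local_bound_def)
    then show ?thesis by blast
  next
    case False
    then have "p \<in> frontier \<Omega>" using p \<Omega>(1) by (simp add: frontier_def interior_open)
    have "\<exists>\<rho>>0. \<exists>K. \<forall>h. norm h \<le> \<rho> \<longrightarrow>
        (LINT x|lborel. indicator (ball p \<rho>) x * \<bar>w (x + h) - w x\<bar>) \<le> K * norm h"
      by (rule lipschitz_boundary_local_shift[OF \<Omega>(1,3) \<open>p \<in> frontier \<Omega>\<close> w C0 C])
    then show ?thesis unfolding local_bound_def by blast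
  qed
  then obtain \<rho> K where "\<And>p. p \<in> closure \<Omega> \<Longrightarrow> local_bound p (\<rho> p) (K p)" by metis
  then have \<rho>: "\<And>p. p \<in> closure \<Omega> \<Longrightarrow> \<rho> p > 0"
    and K: "\<And>p h. p \<in> closure \<Omega> \<Longrightarrow> norm h \<le> \<rho> p \<Longrightarrow>
      (LINT x|lborel. indicator (ball p (\<rho> p)) x * \<bar>w (x + h) - w x\<bar>) \<le> K p * norm h"
    unfolding local_bound_def by blast+
  have "compact (closure \<Omega>)" using \<Omega>(2) by simp
  \<comment> \<open>The cover uses half the radii: if x or x + h lies in \<Omega> and
    \<open>norm h \<le> \<delta>\<close>, then x is within \<delta> of a half ball and hence in the
    full ball.\<close>
  moreover have "closure \<Omega> \<subseteq> (\<Union>p\<in>closure \<Omega>. ball p (\<rho> p / 2))"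
  proof
    fix p assume "p \<in> closure \<Omega>"
    then show "p \<in> (\<Union>p\<in>closure \<Omega>. ball p (\<rho> p / 2))" using \<rho>[of p] by (intro UN_I[of p]) auto
  qed
  ultimately obtain T where T: "T \<subseteq> closure \<Omega>" "finite T" "closure \<Omega> \<subseteq> (\<Union>p\<in>T. ball p (\<rho> p / 2))"
    by (elim compactE_image) auto
  define \<delta> where "\<delta> = Min (insert 1 ((\<lambda>p. \<rho> p / 2) ` T))"
  have \<delta>0: "\<delta> > 0" unfolding \<delta>_def using T(1,2) \<rho> by (subst Min_gr_iff) auto
  have \<delta>T: "\<delta> \<le> \<rho> p / 2" if "p \<in> T" for p unfolding \<delta>_def using T(2) that by (intro Min_le) auto
  define W where "W = (LINT x|lborel. \<bar>w x\<bar>)"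
  define Ks where "Ks = (\<Sum>p\<in>T. K p)"
  have small: "shift_diff w h \<le> Ks * norm h" if h: "norm h \<le> \<delta>" for h
  proof -
    have "shift_diff w h \<le> (LINT x|lborel. (\<Sum>p\<in>T. indicator (ball p (\<rho> p)) x * \<bar>w (x + h) - w x\<bar>))"
      unfolding shift_diff_def
    proof (rule integral_mono)
      fix x
      show "\<bar>w (x + h) - w x\<bar> \<le> (\<Sum>p\<in>T. indicator (ball p (\<rho> p)) x * \<bar>w (x + h) - w x\<bar>)"
      proof (cases "x \<in> \<Omega> \<or> x + h \<in> \<Omega>")
        case False
        then show ?thesis using w(2) by (simp add: sum_nonneg)
      next
        case True
        then obtain y where y: "y \<in> \<Omega>" "norm (x - y) \<le> \<delta>" using h \<delta>0 by fastforce
        then obtain p where p: "p \<in> T" "y \<in> ball p (\<rho> p / 2)" using T(3) closure_subset by blast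
        have "norm (p - x) \<le> norm (p - y) + norm (x - y)"
          using norm_triangle_ineq4[of "p - y" "x - y"] by simp
        then have "x \<in> ball p (\<rho> p)" using p y(2) \<delta>T[OF p(1)] by (simp add: dist_norm)
        then have "\<bar>w (x + h) - w x\<bar> = indicator (ball p (\<rho> p)) x * \<bar>w (x + h) - w x\<bar>" by simp
        also have "\<dots> \<le> (\<Sum>p\<in>T. indicator (ball p (\<rho> p)) x * \<bar>w (x + h) - w x\<bar>)"
          by (rule member_le_sum[OF p(1)]) (use T in auto)
        finally show ?thesis .
      qed
    qed (use integrable_shift_diff[OF w(1)] in \<open>auto intro!: integrable_indicator_mult\<close>)
    also have "\<dots> = (\<Sum>p\<in>T. LINT x|lborel. indicator (ball p (\<rho> p)) x * \<bar>w (x + h) - w x\<bar>)"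
      using integrable_shift_diff[OF w(1)] by (intro Bochner_Integration.integral_sum integrable_indicator_mult) auto
    also have "\<dots> \<le> (\<Sum>p\<in>T. K p * norm h)"
    proof (rule sum_mono)
      fix p assume p: "p \<in> T"
      then have "norm h \<le> \<rho> p" using \<delta>T[OF p] h \<rho>[of p] T(1) by auto
      then show "(LINT x|lborel. indicator (ball p (\<rho> p)) x * \<bar>w (x + h) - w x\<bar>) \<le> K p * norm h"
        using K[of p h] p T(1) by blast
    qed
    finally show ?thesis by (simp add: Ks_def sum_distrib_right)
  qed
  have "shift_diff w h \<le> max Ks (2 * W / \<delta>) * norm h" for h
  proof (cases "norm h \<le> \<delta>")
    case True
    show ?thesis using small[OF True] by (rule order_trans) (intro mult_right_mono, auto)
  next
    case False
    have W0: "0 \<le> W" by (simp add: W_def)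
    have "shift_diff w h \<le> 2 * W" unfolding W_def by (rule shift_diff_le[OF w(1)])
    also have "\<dots> = 2 * W / \<delta> * \<delta>" using \<delta>0 by simp
    also have "\<dots> \<le> max Ks (2 * W / \<delta>) * norm h"
      using False W0 \<delta>0 by (intro mult_mono) (auto simp: le_max_iff_disj)
    finally show ?thesis .
  qed
  then show ?thesis using w(1) by (auto simp: finite_variation_def)
qed

subsection \<open>Lebesgue measure under linear maps\<close>

text \<open>
  The library states this only for index types that are well-ordered, which \<open>'n\<close> need not be.
\<close>

lemma prod_Basis_cart: "(\<Prod>b\<in>Basis. (x :: real ^ 'n) \<bullet> b) = (\<Prod>i\<in>UNIV. x $ i)"
proof -
  have B: "(Basis :: (real ^ 'n) set) = range (\<lambda>i. axis i 1)" by (auto simp: Basis_vec_def)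
  have I: "inj (\<lambda>i. axis i (1::real) :: real ^ 'n)" by (auto simp: inj_def axis_eq_axis)
  show ?thesis unfolding B using prod.reindex[OF I, of "\<lambda>b. x \<bullet> b"]
    by (simp add: cart_eq_inner_axis comp_def)
qed

lemma emeasure_box_cart:
  fixes l u :: "real ^ 'n"
  assumes "\<And>i. l $ i \<le> u $ i"
  shows "emeasure lborel (box l u) = ennreal (\<Prod>i\<in>UNIV. u $ i - l $ i)"
    and "emeasure lborel (cbox l u) = ennreal (\<Prod>i\<in>UNIV. u $ i - l $ i)"
proof -
  have "l \<bullet> b \<le> u \<bullet> b" if "b \<in> Basis" for b
    using that assms by (auto simp: Basis_vec_def cart_eq_inner_axis[symmetric])
  then show "emeasure lborel (box l u) = ennreal (\<Prod>i\<in>UNIV. u $ i - l $ i)"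
    "emeasure lborel (cbox l u) = ennreal (\<Prod>i\<in>UNIV. u $ i - l $ i)"
    using prod_Basis_cart[of "u - l"] by (simp_all add: emeasure_lborel_box emeasure_lborel_cbox)
qed

lemma lborel_eqI_cart:
  fixes M :: "(real ^ 'n) measure"
  assumes "\<And>l u. (\<And>i. l $ i \<le> u $ i) \<Longrightarrow> emeasure M (box l u) = ennreal (\<Prod>i\<in>UNIV. u $ i - l $ i)"
    and "sets M = sets borel"
  shows "lborel = M"
proof (rule lborel_eqI[OF _ assms(2)])
  fix l u :: "real ^ 'n" assume le: "\<And>b. b \<in> Basis \<Longrightarrow> l \<bullet> b \<le> u \<bullet> b"
  have "l $ i \<le> u $ i" for i
    using le[of "axis i 1"] by (auto simp: Basis_vec_def cart_eq_inner_axis)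
  then show "emeasure M (box l u) = (\<Prod>b\<in>Basis. (u - l) \<bullet> b)"
    using assms(1)[of l u] by (simp add: prod_Basis_cart)
qed

lemma distr_lborel_swap:
  "distr lborel borel (\<lambda>x :: real ^ 'n. \<chi> i. x $ Transposition.transpose m n i) = lborel"
proof -
  let ?\<tau> = "Transposition.transpose m n"
  let ?T = "\<lambda>x :: real ^ 'n. \<chi> i. x $ ?\<tau> i"
  have [measurable]: "?T \<in> borel_measurable borel"
    by (intro borel_measurable_continuous_onI continuous_intros)
  have "lborel = distr lborel borel ?T"
  proof (rule lborel_eqI_cart)
    fix l u :: "real ^ 'n" assume le: "\<And>i. l $ i \<le> u $ i"
    have "?T -` box l u = box (?T l) (?T u)"
    proof (intro set_eqI)
      fix x :: "real ^ 'n"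
      have "(\<forall>i. l $ i < x $ ?\<tau> i \<and> x $ ?\<tau> i < u $ i) \<longleftrightarrow> (\<forall>i. l $ ?\<tau> i < x $ i \<and> x $ i < u $ ?\<tau> i)"
        by (metis transpose_involutory)
      then show "x \<in> ?T -` box l u \<longleftrightarrow> x \<in> box (?T l) (?T u)" by (simp add: mem_box_cart)
    qed
    then have "emeasure (distr lborel borel ?T) (box l u) = emeasure lborel (box (?T l) (?T u))"
      by (subst emeasure_distr) auto
    also have "\<dots> = ennreal (\<Prod>i\<in>UNIV. u $ ?\<tau> i - l $ ?\<tau> i)"
      using le by (subst emeasure_box_cart) auto
    also have "(\<Prod>i\<in>UNIV. u $ ?\<tau> i - l $ ?\<tau> i) = (\<Prod>i\<in>UNIV. u $ i - l $ i)"
      by (rule prod.reindex_bij_betw) simp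
    finally show "emeasure (distr lborel borel ?T) (box l u) = ennreal (\<Prod>i\<in>UNIV. u $ i - l $ i)" .
  qed simp
  then show ?thesis by simp
qed

lemma emeasure_lborel_shear_image:
  fixes l u :: "real ^ 'n"
  assumes mn: "m \<noteq> n" and le: "\<And>i. l $ i \<le> u $ i"
  defines "T \<equiv> \<lambda>x :: real ^ 'n. \<chi> i. if i = m then x $ m + x $ n else x $ i"
  shows "emeasure lborel (T ` cbox l u) = ennreal (\<Prod>i\<in>UNIV. u $ i - l $ i)"
proof -
  have Tadd: "T (x + y) = T x + T y" for x y by (auto simp: T_def vec_eq_iff)
  have Tc: "continuous_on UNIV T"
    unfolding T_def
  proof (rule continuous_on_vec_lambda)
    show "continuous_on UNIV (\<lambda>x :: real ^ 'n. if i = m then x $ m + x $ n else x $ i)" for i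
      by (cases "i = m") (simp_all add: continuous_on_add continuous_on_component)
  qed
  have Tb: "T ` cbox a b \<in> sets borel" for a b
    by (intro borel_compact compact_continuous_image continuous_on_subset[OF Tc]) auto
  \<comment> \<open>Moving the box along axis n makes the lower corner nonnegative in that
    coordinate, as the shear formula for intervals requires. By additivity of T the image is only
    translated.\<close>
  define v where "v = axis n \<bar>l $ n\<bar>"
  have le': "(l + v) $ i \<le> (u + v) $ i" for i using le[of i] by simp
  have n0: "0 \<le> (l + v) $ n" by (simp add: v_def)
  have ne: "cbox (l + v) (u + v) \<noteq> {}" using le' by (simp add: interval_ne_empty_cart)
  have "T ` cbox (l + v) (u + v) = (\<lambda>x. x + T v) ` (T ` cbox l u)"
  proof -
    have "cbox (l + v) (u + v) = (\<lambda>x. x + v) ` cbox l u"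
      using cbox_translation[of v l u] by (simp add: add.commute)
    then show ?thesis by (simp add: image_image Tadd)
  qed
  moreover have "emeasure lborel ((\<lambda>x. x + T v) ` S) = emeasure lborel S" if [measurable]: "S \<in> sets borel" for S
  proof -
    have "(\<lambda>x. x + T v) ` S = (\<lambda>x. x - T v) -` S" by (force simp: image_iff)
    moreover have "(\<lambda>x. x - T v) -` S \<in> sets borel"
      by (rule measurable_sets_borel[OF _ that]) measurable
    ultimately have "emeasure lborel ((\<lambda>x. x + T v) ` S) = (\<integral>\<^sup>+ x. indicator ((\<lambda>x. x - T v) -` S) x \<partial>lborel)"
      by simp
    also have "\<dots> = (\<integral>\<^sup>+ x. indicator S (x + (- T v)) \<partial>lborel)"
      by (intro nn_integral_cong) (simp add: indicator_def)
    finally show ?thesis using nn_integral_translation[of "indicator S" "- T v"] by simp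
  qed
  ultimately have "emeasure lborel (T ` cbox l u) = emeasure lborel (T ` cbox (l + v) (u + v))"
    using Tb by simp
  also have "\<dots> = emeasure lebesgue (T ` cbox (l + v) (u + v))" using Tb by simp
  also have "\<dots> = ennreal (measure lebesgue (T ` cbox (l + v) (u + v)))"
    using measurable_shear_interval[OF mn ne n0] unfolding T_def by (rule emeasure_eq_measure2)
  also have "measure lebesgue (T ` cbox (l + v) (u + v)) = measure lborel (cbox (l + v) (u + v))"
    using measure_shear_interval[OF mn ne n0] by (simp add: T_def)
  also have "\<dots> = (\<Prod>i\<in>UNIV. u $ i - l $ i)"
    by (subst content_cbox_cart[OF ne]) simp
  finally show ?thesis .
qed

text \<open>The measures of images of closed boxes under T are known, and these are preimages under
  the inverse U. Exhausting open boxes by closed ones gives invariance under U, and composing with T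
  gives invariance under T.\<close>

lemma distr_lborel_shear:
  assumes mn: "m \<noteq> n"
  shows "distr lborel borel (\<lambda>x :: real ^ 'n. \<chi> i. if i = m then x $ m + x $ n else x $ i) = lborel"
proof -
  define T :: "real ^ 'n \<Rightarrow> real ^ 'n" where "T x = (\<chi> i. if i = m then x $ m + x $ n else x $ i)" for x
  define U :: "real ^ 'n \<Rightarrow> real ^ 'n" where "U x = (\<chi> i. if i = m then x $ m - x $ n else x $ i)" for x
  have TU: "T (U x) = x" "U (T x) = x" for x using mn by (auto simp: T_def U_def vec_eq_iff)
  have "continuous_on UNIV T" "continuous_on UNIV U"
    unfolding T_def U_def
  proof (rule_tac [!] continuous_on_vec_lambda)
    show "continuous_on UNIV (\<lambda>x :: real ^ 'n. if i = m then x $ m + x $ n else x $ i)"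
      "continuous_on UNIV (\<lambda>x :: real ^ 'n. if i = m then x $ m - x $ n else x $ i)" for i
      by (cases "i = m"; simp add: continuous_on_add continuous_on_diff continuous_on_component)+
  qed
  then have [measurable]: "T \<in> borel_measurable borel" "U \<in> borel_measurable borel"
    by (auto intro: borel_measurable_continuous_onI)
  have img: "T ` S = U -` S" for S
  proof (intro set_eqI)
    show "x \<in> T ` S \<longleftrightarrow> x \<in> U -` S" for x using TU(1)[of x] TU(2) by (metis imageE image_eqI vimageE vimageI)
  qed
  have "lborel = distr lborel borel U"
  proof (rule lborel_eqI_cart)
    fix l u :: "real ^ 'n" assume le: "\<And>i. l $ i \<le> u $ i"
    have e: "emeasure (distr lborel borel U) S = emeasure lborel (T ` S)" if "S \<in> sets borel" for S
      using that by (subst emeasure_distr) (auto simp: img)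
    have cb: "emeasure lborel (T ` cbox a b) = ennreal (\<Prod>i\<in>UNIV. b $ i - a $ i)" if "\<And>i. a $ i \<le> b $ i" for a b
      using emeasure_lborel_shear_image[OF mn that] by (simp add: T_def)
    have sb: "T ` S \<in> sets lborel" if "S \<in> sets borel" for S
      unfolding img using that measurable_sets_borel[of U borel S] by simp
    have "emeasure lborel (T ` box l u) \<le> emeasure lborel (T ` cbox l u)"
      by (intro emeasure_mono image_mono box_subset_cbox sb) auto
    then have up: "emeasure lborel (T ` box l u) \<le> ennreal (\<Prod>i\<in>UNIV. u $ i - l $ i)" using cb[OF le] by simp
    have "ennreal (\<Prod>i\<in>UNIV. u $ i - l $ i) \<le> emeasure lborel (T ` box l u)"
    proof (cases "\<forall>i. l $ i < u $ i")
      case False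
      then obtain i where "u $ i - l $ i = 0" using le by (metis diff_self order_less_le)
      then have "(\<Prod>i\<in>UNIV. u $ i - l $ i) = 0" by (intro prod_zero) auto
      then show ?thesis by (simp only: ennreal_0 zero_le)
    next
      case True
      define \<delta> where "\<delta> = Min (range (\<lambda>i. (u $ i - l $ i) / 2))"
      have \<delta>2: "\<delta> \<le> (u $ i - l $ i) / 2" for i unfolding \<delta>_def by (rule Min_le) auto
      have \<delta>1: "\<delta> > 0" unfolding \<delta>_def using True by (subst Min_gr_iff) auto
      have "((\<lambda>s. ennreal (\<Prod>i\<in>UNIV. (u $ i - s) - (l $ i + s))) \<longlongrightarrow> ennreal (\<Prod>i\<in>UNIV. (u $ i - 0) - (l $ i + 0))) (at_right 0)"
        by (intro tendsto_ennrealI tendsto_intros)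
      then have "((\<lambda>s. ennreal (\<Prod>i\<in>UNIV. (u $ i - s) - (l $ i + s))) \<longlongrightarrow> ennreal (\<Prod>i\<in>UNIV. u $ i - l $ i)) (at_right 0)"
        by simp
      then show ?thesis
      proof (rule tendsto_upperbound)
        have "ennreal (\<Prod>i\<in>UNIV. (u $ i - s) - (l $ i + s)) \<le> emeasure lborel (T ` box l u)" if s: "0 < s" "s < \<delta>" for s
        proof -
          let ?l = "\<chi> i. l $ i + s" and ?u = "\<chi> i. u $ i - s"
          have "?l $ i \<le> ?u $ i" for i using \<delta>2[of i] s by simp
          then have "ennreal (\<Prod>i\<in>UNIV. (u $ i - s) - (l $ i + s)) = emeasure lborel (T ` cbox ?l ?u)"
            by (subst cb) auto
          also have "\<dots> \<le> emeasure lborel (T ` box l u)"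
          proof (intro emeasure_mono image_mono sb)
            show "cbox ?l ?u \<subseteq> box l u"
            proof
              fix x assume x: "x \<in> cbox ?l ?u"
              have "l $ i < x $ i \<and> x $ i < u $ i" for i
                using x s(1) by (auto simp: mem_box_cart dest!: spec[of _ i])
              then show "x \<in> box l u" by (simp add: mem_box_cart)
            qed
          qed auto
          finally show ?thesis .
        qed
        then show "\<forall>\<^sub>F s in at_right 0. ennreal (\<Prod>i\<in>UNIV. u $ i - s - (l $ i + s)) \<le> emeasure lborel (T ` box l u)"
          using \<delta>1 by (auto simp: eventually_at_right_field)
      qed simp
    qed
    then show "emeasure (distr lborel borel U) (box l u) = ennreal (\<Prod>i\<in>UNIV. u $ i - l $ i)"
      using up e[of "box l u"] by simp
  qed simp
  then have "distr lborel borel T = distr (distr lborel borel U) borel T" by simp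
  also have "\<dots> = distr lborel borel (\<lambda>x. x)"
    by (subst distr_distr) (auto simp: comp_def TU)
  also have "\<dots> = lborel" by (rule distr_id2) simp
  finally show ?thesis unfolding T_def[abs_def] .
qed

text \<open>Determinants multiply and preimages compose, so the formula need only be checked on
  elementary matrices: diagonal ones scale the coordinates, transpositions and shears preserve the
  measure.\<close>

lemma emeasure_lborel_linear_vimage:
  fixes A :: "real ^ 'n ^ 'n"
  assumes "det A \<noteq> 0" "S \<in> sets borel"
  shows "emeasure lborel S = ennreal \<bar>det A\<bar> * emeasure lborel ((*v) A -` S)"
proof -
  have meas[measurable]: "(*v) A \<in> borel_measurable borel" for A :: "real ^ 'n ^ 'n"
    by (intro borel_measurable_continuous_onI linear_continuous_on matrix_vector_mul_bounded_linear)
  have inv: "emeasure lborel S = ennreal \<bar>det A\<bar> * emeasure lborel ((*v) A -` S)"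
    if "distr lborel borel ((*v) A) = lborel" "\<bar>det A\<bar> = 1" "S \<in> sets borel" for A :: "real ^ 'n ^ 'n" and S
    using emeasure_distr[of "(*v) A" lborel borel S] that by simp
  \<comment> \<open>Keeping \<open>det A \<noteq> 0\<close> as a premise inside the property makes
    it vacuous for matrices with a zero row and still stable under products.\<close>
  define scales where "scales A \<longleftrightarrow> (det A \<noteq> 0 \<longrightarrow> (\<forall>S\<in>sets borel. emeasure lborel S = ennreal \<bar>det A\<bar> * emeasure lborel ((*v) A -` S)))"
    for A :: "real ^ 'n ^ 'n"
  have "scales A"
  proof (rule induct_matrix_elementary_alt)
    fix A B :: "real ^ 'n ^ 'n" assume AB: "scales A" "scales B"
    show "scales (A ** B)"
      unfolding scales_def
    proof (intro impI ballI)
      fix S :: "(real ^ 'n) set" assume d: "det (A ** B) \<noteq> 0" and S: "S \<in> sets borel"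
      have "(*v) A -` S \<in> sets borel" using measurable_sets_borel[OF meas S] .
      then have "emeasure lborel S = ennreal \<bar>det A\<bar> * (ennreal \<bar>det B\<bar> * emeasure lborel ((*v) B -` ((*v) A -` S)))"
        using AB S d by (auto simp: scales_def det_mul)
      also have "(*v) B -` ((*v) A -` S) = (*v) (A ** B) -` S" by (auto simp: matrix_vector_mul_assoc)
      finally show "emeasure lborel S = ennreal \<bar>det (A ** B)\<bar> * emeasure lborel ((*v) (A ** B) -` S)"
        by (simp add: det_mul abs_mult ennreal_mult mult.assoc)
    qed
  next
    fix A :: "real ^ 'n ^ 'n" and i assume "row i A = 0"
    then show "scales A" by (simp add: scales_def det_zero_row)
  next
    fix A :: "real ^ 'n ^ 'n" assume dg: "\<And>i j. i \<noteq> j \<Longrightarrow> A $ i $ j = 0"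
    show "scales A"
      unfolding scales_def
    proof (intro impI ballI)
      fix S :: "(real ^ 'n) set" assume d: "det A \<noteq> 0" and S: "S \<in> sets borel"
      have dt: "det A = (\<Prod>i\<in>UNIV. A $ i $ i)" by (rule det_diagonal[OF dg])
      then have nz: "A $ i $ i \<noteq> 0" for i using d by (auto simp: prod_zero_iff)
      define c where "c = (\<chi> i. A $ i $ i)"
      have Av: "A *v x = (\<chi> i. A $ i $ i * x $ i)" for x
      proof (subst vec_eq_iff, intro allI)
        fix i
        have "(A *v x) $ i = (\<Sum>j\<in>UNIV. A $ i $ j * x $ j)" by (simp add: matrix_vector_mult_def)
        also have "\<dots> = (\<Sum>j\<in>{i}. A $ i $ j * x $ j)" by (rule sum.mono_neutral_right) (auto simp: dg)
        finally show "(A *v x) $ i = (\<chi> i. A $ i $ i * x $ i) $ i" by simp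
      qed
      have B: "(Basis :: (real ^ 'n) set) = range (\<lambda>i. axis i 1)" by (auto simp: Basis_vec_def)
      have T: "(*v) A = (\<lambda>x. 0 + (\<Sum>j\<in>Basis. ((c \<bullet> j) * (x \<bullet> j)) *\<^sub>R j))"
      proof
        fix x
        have "A *v x = (\<Sum>j\<in>Basis. ((A *v x) \<bullet> j) *\<^sub>R j)" by (rule euclidean_representation[symmetric])
        also have "\<dots> = (\<Sum>j\<in>Basis. ((c \<bullet> j) * (x \<bullet> j)) *\<^sub>R j)"
          by (intro sum.cong refl) (auto simp: B Av c_def cart_eq_inner_axis[symmetric])
        finally show "A *v x = 0 + (\<Sum>j\<in>Basis. ((c \<bullet> j) * (x \<bullet> j)) *\<^sub>R j)" by simp
      qed
      have "lborel = density (distr lborel borel ((*v) A)) (\<lambda>_. ennreal (\<Prod>j\<in>Basis. \<bar>c \<bullet> j\<bar>))"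
        unfolding T by (rule lborel_affine_euclidean) (auto simp: B c_def cart_eq_inner_axis[symmetric] nz)
      moreover have "(\<Prod>j\<in>Basis. \<bar>c \<bullet> j\<bar>) = \<bar>det A\<bar>"
        using prod_Basis_cart[of c] by (simp add: dt abs_prod[symmetric] c_def)
      ultimately have "emeasure lborel S = emeasure (density (distr lborel borel ((*v) A)) (\<lambda>_. ennreal \<bar>det A\<bar>)) S" by simp
      also have "\<dots> = ennreal \<bar>det A\<bar> * emeasure lborel ((*v) A -` S)"
        using S by (simp add: emeasure_density_const emeasure_distr)
      finally show "emeasure lborel S = ennreal \<bar>det A\<bar> * emeasure lborel ((*v) A -` S)" .
    qed
  next
    fix m n :: 'n assume mn: "m \<noteq> n"
    let ?A = "(\<chi> i j. mat 1 $ i $ Transposition.transpose m n j) :: real ^ 'n ^ 'n"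
    have Av: "?A *v x = (\<chi> i. x $ Transposition.transpose m n i)" for x
    proof (subst vec_eq_iff, intro allI)
      fix i
      have "(?A *v x) $ i = (\<Sum>j\<in>UNIV. (if i = Transposition.transpose m n j then 1 else 0) * x $ j)"
        by (simp add: matrix_vector_mult_def mat_def)
      also have "\<dots> = (\<Sum>j\<in>{Transposition.transpose m n i}. (if i = Transposition.transpose m n j then 1 else 0) * x $ j)"
        by (rule sum.mono_neutral_right) auto
      finally show "(?A *v x) $ i = (\<chi> i. x $ Transposition.transpose m n i) $ i" by simp
    qed
    have "?A ** ?A = mat 1"
      by (subst matrix_eq) (simp add: matrix_vector_mul_assoc[symmetric] Av)
    then have "det ?A * det ?A = 1" by (metis det_I det_mul)
    then have "\<bar>det ?A\<bar> = 1" using square_eq_1_iff[of "det ?A"] by auto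
    moreover have "distr lborel borel ((*v) ?A) = lborel" unfolding ext[OF Av] by (rule distr_lborel_swap)
    ultimately show "scales ?A" unfolding scales_def using inv by blast
  next
    fix m n :: 'n assume mn: "m \<noteq> n"
    let ?A = "(\<chi> i j. of_bool (i = m \<and> j = n \<or> i = j)) :: real ^ 'n ^ 'n"
    have Av: "?A *v x = (\<chi> i. if i = m then x $ m + x $ n else x $ i)" for x
    proof (subst vec_eq_iff, intro allI)
      fix i
      have "(?A *v x) $ i = (\<Sum>j\<in>UNIV. of_bool (i = m \<and> j = n \<or> i = j) * x $ j)"
        by (simp add: matrix_vector_mult_def)
      also have "\<dots> = (\<Sum>j\<in>(if i = m then {m, n} else {i}). of_bool (i = m \<and> j = n \<or> i = j) * x $ j)"
        by (rule sum.mono_neutral_right) auto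
      finally show "(?A *v x) $ i = (\<chi> i. if i = m then x $ m + x $ n else x $ i) $ i" using mn by simp
    qed
    have "?A = (\<chi> k. if k = m then row m (mat 1) + 1 *s row n (mat 1) else row k (mat 1))"
      using mn by (auto simp: vec_eq_iff row_def mat_def)
    then have "det ?A = 1" using det_row_operation[OF mn, of "mat 1" 1] by simp
    moreover have "distr lborel borel ((*v) ?A) = lborel" unfolding ext[OF Av] by (rule distr_lborel_shear[OF mn])
    ultimately show "scales ?A" unfolding scales_def using inv[of ?A] by simp
  qed
  then show ?thesis using assms by (simp add: scales_def)
qed

subsection \<open>Integrability gained from finite variation\<close>

text \<open>A translation bound over the dilates of the parallelepiped spanned by the columns of B.
  The estimates below use B only through S and \<bar>det B\<bar>, so they are uniform over all
  shapes of equal volume.\<close>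

definition box_shift_bound :: "(real ^ 'n \<Rightarrow> real) \<Rightarrow> real ^ 'n ^ 'n \<Rightarrow> real \<Rightarrow> bool" where
  "box_shift_bound w B S \<longleftrightarrow>
     (\<forall>r\<ge>0. \<forall>t. (\<forall>i. 0 \<le> t $ i \<and> t $ i \<le> r) \<longrightarrow> shift_diff w (B *v t) \<le> r * S)"

lemma emeasure_linear_image_cbox:
  fixes B :: "real ^ 'n ^ 'n"
  assumes B: "det B \<noteq> 0"
  shows "(*v) B ` cbox l u \<in> sets borel"
    and "emeasure lborel ((*v) B ` cbox l u) = ennreal \<bar>det B\<bar> * emeasure lborel (cbox l u)"
proof -
  have "compact ((*v) B ` cbox l u)"
    by (intro compact_continuous_image linear_continuous_on matrix_vector_mul_bounded_linear compact_cbox)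
  then show s: "(*v) B ` cbox l u \<in> sets borel" by (simp add: compact_imp_closed)
  have "inj ((*v) B)" using B by (simp add: invertible_det_nz[symmetric] inj_matrix_vector_mult)
  then have "(*v) B -` (*v) B ` cbox l u = cbox l u" by (rule inj_vimage_image_eq)
  then show "emeasure lborel ((*v) B ` cbox l u) = ennreal \<bar>det B\<bar> * emeasure lborel (cbox l u)"
    using emeasure_lborel_linear_vimage[OF B s] by simp
qed

lemma superlevel_finite:
  fixes w :: "'a::euclidean_space \<Rightarrow> real"
  assumes w: "integrable lborel w" and a: "a > 0"
  shows "emeasure lborel {x. a \<le> \<bar>w x\<bar>} \<le> ennreal ((LINT x|lborel. \<bar>w x\<bar>) / a)"
    and "emeasure lborel {x. a \<le> \<bar>w x\<bar>} < \<infinity>"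
    and "measure lborel {x. a \<le> \<bar>w x\<bar>} \<le> (LINT x|lborel. \<bar>w x\<bar>) / a"
proof -
  have [measurable]: "w \<in> borel_measurable borel" using w by auto
  have "emeasure lborel {x. a \<le> \<bar>w x\<bar>} = emeasure lborel {x \<in> UNIV. 1 \<le> ennreal (1 / a) * ennreal \<bar>w x\<bar>}"
  proof (rule arg_cong[where f = "emeasure lborel"], intro Collect_cong)
    fix x
    have "1 \<le> ennreal (1 / a) * ennreal \<bar>w x\<bar> \<longleftrightarrow> ennreal 1 \<le> ennreal (1 / a * \<bar>w x\<bar>)"
      using a by (simp add: ennreal_mult[symmetric])
    also have "\<dots> \<longleftrightarrow> a \<le> \<bar>w x\<bar>" using a by (subst ennreal_le_iff) (auto simp: field_simps)
    finally show "a \<le> \<bar>w x\<bar> \<longleftrightarrow> x \<in> UNIV \<and> 1 \<le> ennreal (1 / a) * ennreal \<bar>w x\<bar>" by simp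
  qed
  also have "\<dots> \<le> ennreal (1 / a) * (\<integral>\<^sup>+ x. ennreal \<bar>w x\<bar> * indicator UNIV x \<partial>lborel)"
    by (rule nn_integral_Markov_inequality) auto
  also have "(\<integral>\<^sup>+ x. ennreal \<bar>w x\<bar> * indicator UNIV x \<partial>lborel) = ennreal (LINT x|lborel. \<bar>w x\<bar>)"
    using nn_integral_eq_integral[OF integrable_abs[OF w]] by simp
  finally show 1: "emeasure lborel {x. a \<le> \<bar>w x\<bar>} \<le> ennreal ((LINT x|lborel. \<bar>w x\<bar>) / a)"
    using a by (simp add: ennreal_mult[symmetric])
  then show 2: "emeasure lborel {x. a \<le> \<bar>w x\<bar>} < \<infinity>" by (rule order_le_less_trans) simp
  show "measure lborel {x. a \<le> \<bar>w x\<bar>} \<le> (LINT x|lborel. \<bar>w x\<bar>) / a"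
    using 1 2 a by (simp add: emeasure_eq_ennreal_measure ennreal_le_iff)
qed

text \<open>
  If \<open>E = {2 \<lambda> \<le> \<bar>w\<bar>}\<close> and \<open>F = {\<lambda> \<le> \<bar>w\<bar>}\<close>, then \<open>\<bar>w (x + h) - w x\<bar> \<ge> \<lambda>\<close> for
  \<open>x \<in> E\<close>, \<open>x + h \<notin> F\<close>. Averaging over \<open>h\<close> in a parallelepiped of volume \<open>2 \<bar>F\<bar>\<close>, at most half
  of \<open>E\<close> is lost.
\<close>

lemma superlevel_estimate:
  fixes w :: "real ^ 'n \<Rightarrow> real" and B :: "real ^ 'n ^ 'n"
  assumes w: "integrable lborel w" and B: "det B \<noteq> 0" and S: "box_shift_bound w B S" and l: "l > 0"
  shows "measure lborel {x. 2 * l \<le> \<bar>w x\<bar>}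
    \<le> 2 / l * S * (2 * measure lborel {x. l \<le> \<bar>w x\<bar>} / \<bar>det B\<bar>) powr (1 / CARD('n))"
proof -
  define E where "E = {x. 2 * l \<le> \<bar>w x\<bar>}"
  define F where "F = {x. l \<le> \<bar>w x\<bar>}"
  have [measurable]: "w \<in> borel_measurable borel" using w by auto
  have [measurable]: "E \<in> sets borel" "F \<in> sets borel" unfolding E_def F_def by measurable
  define e where "e = measure lborel E"
  define f where "f = measure lborel F"
  have ef: "emeasure lborel E = ennreal e" "emeasure lborel F = ennreal f"
    using superlevel_finite(2)[OF w, of "2 * l"] superlevel_finite(2)[OF w, of l] l
    by (auto simp: e_def f_def E_def F_def emeasure_eq_ennreal_measure)
  have ef0: "0 \<le> e" "0 \<le> f" by (auto simp: e_def f_def)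
  have "E \<subseteq> F" using l by (auto simp: E_def F_def)
  then have "ennreal e \<le> ennreal f" unfolding ef[symmetric] by (intro emeasure_mono) auto
  then have ef1: "e \<le> f" using ef0 by (simp add: ennreal_le_iff)
  define n where "n = CARD('n)"
  have n: "n > 0" by (simp add: n_def)
  have d: "\<bar>det B\<bar> > 0" using B by simp
  define r where "r = (2 * f / \<bar>det B\<bar>) powr (1 / n)"
  have r0: "0 \<le> r" by (simp add: r_def)
  have rn: "r ^ n * \<bar>det B\<bar> = 2 * f"
  proof (cases "f = 0")
    case False
    then have "r ^ n = (2 * f / \<bar>det B\<bar>)"
      unfolding r_def using n d ef0 by (subst powr_realpow[symmetric]) (auto simp: powr_powr)
    then show ?thesis using d by simp
  qed (use n in \<open>auto simp: r_def\<close>)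
  define P where "P = (*v) B ` cbox 0 (\<chi> i. r)"
  have Pm[measurable]: "P \<in> sets borel" unfolding P_def by (rule emeasure_linear_image_cbox(1)[OF B])
  have P: "emeasure lborel P = ennreal (2 * f)"
  proof -
    have "emeasure lborel (cbox 0 (\<chi> i. r) :: (real ^ 'n) set) = ennreal (r ^ n)"
      using r0 by (subst emeasure_box_cart) (auto simp: n_def)
    then have "emeasure lborel P = ennreal (\<bar>det B\<bar> * r ^ n)"
      unfolding P_def using emeasure_linear_image_cbox(2)[OF B] r0 by (simp add: ennreal_mult)
    then show ?thesis using rn by (simp add: mult.commute)
  qed
  have T: "shift_diff w h \<le> r * S" if "h \<in> P" for h
  proof -
    from that obtain t where t: "t \<in> cbox 0 (\<chi> i. r)" "h = B *v t" by (auto simp: P_def)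
    then have "\<forall>i. 0 \<le> t $ i \<and> t $ i \<le> r" by (auto simp: mem_box_cart)
    then show ?thesis using S r0 t(2) unfolding box_shift_bound_def by blast
  qed
  have pw: "ennreal e \<le> (\<integral>\<^sup>+ x. indicator E x * indicator F (x + h) \<partial>lborel) + ennreal (r * S / l)" if h: "h \<in> P" for h
  proof -
    let ?D = "{x. l \<le> \<bar>w (x + h) - w x\<bar>}"
    have di: "integrable lborel (\<lambda>x. w (x + h) - w x)"
      using w by (intro Bochner_Integration.integrable_diff integrable_translation)
    have "E \<subseteq> (E \<inter> {x. x + h \<in> F}) \<union> ?D"
      unfolding E_def F_def by auto
    then have "emeasure lborel E \<le> emeasure lborel ((E \<inter> {x. x + h \<in> F}) \<union> ?D)"
      by (intro emeasure_mono) measurable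
    also have "\<dots> \<le> emeasure lborel (E \<inter> {x. x + h \<in> F}) + emeasure lborel ?D"
      by (intro emeasure_subadditive) measurable
    also have "emeasure lborel (E \<inter> {x. x + h \<in> F}) = (\<integral>\<^sup>+ x. indicator (E \<inter> {x. x + h \<in> F}) x \<partial>lborel)"
      by (rule nn_integral_indicator[symmetric]) measurable
    also have "\<dots> = (\<integral>\<^sup>+ x. indicator E x * indicator F (x + h) \<partial>lborel)"
      by (intro nn_integral_cong) (auto simp: indicator_def)
    also have "emeasure lborel ?D \<le> ennreal (shift_diff w h / l)"
      using superlevel_finite(1)[OF di l] by (simp add: shift_diff_def)
    also have "\<dots> \<le> ennreal (r * S / l)" using T[OF h] l by (intro ennreal_leI divide_right_mono) auto
    finally show ?thesis by (simp add: ef)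
  qed
  have "ennreal e * ennreal (2 * f) = (\<integral>\<^sup>+ h. ennreal e * indicator P h \<partial>lborel)"
    using P by (simp add: nn_integral_cmult_indicator)
  also have "\<dots> \<le> (\<integral>\<^sup>+ h. (\<integral>\<^sup>+ x. indicator E x * indicator F (x + h) \<partial>lborel) + ennreal (r * S / l) * indicator P h \<partial>lborel)"
    using pw by (intro nn_integral_mono) (auto simp: indicator_def)
  also have "\<dots> = (\<integral>\<^sup>+ h. (\<integral>\<^sup>+ x. indicator E x * indicator F (x + h) \<partial>lborel) \<partial>lborel) + ennreal (r * S / l) * ennreal (2 * f)"
    using P by (subst nn_integral_add) (auto simp: nn_integral_cmult_indicator)
  \<comment> \<open>For fixed x the vectors h with x + h in F fill a set of measure f. The overlap
    is thus e f, half of the left side e (2 f).\<close>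
  also have "(\<integral>\<^sup>+ h. (\<integral>\<^sup>+ x. indicator E x * indicator F (x + h) \<partial>lborel) \<partial>lborel) =
      (\<integral>\<^sup>+ x. (\<integral>\<^sup>+ h. indicator E x * indicator F (x + h) \<partial>lborel) \<partial>lborel)"
    by (rule lborel_pair.Fubini') simp
  also have "\<dots> = (\<integral>\<^sup>+ x. indicator E x * ennreal f \<partial>lborel)"
  proof (intro nn_integral_cong)
    fix x
    have "(\<integral>\<^sup>+ h. indicator E x * indicator F (x + h) \<partial>lborel) = indicator E x * (\<integral>\<^sup>+ h. indicator F (x + h) \<partial>lborel)"
      by (rule nn_integral_cmult) measurable
    also have "(\<integral>\<^sup>+ h. indicator F (x + h) \<partial>lborel) = (\<integral>\<^sup>+ h. indicator F h \<partial>lborel)"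
      using nn_integral_translation[of "indicator F" x] by (simp add: add.commute)
    also have "\<dots> = ennreal f" by (simp add: ef)
    finally show "(\<integral>\<^sup>+ h. indicator E x * indicator F (x + h) \<partial>lborel) = indicator E x * ennreal f" .
  qed
  also have "\<dots> = ennreal e * ennreal f" by (subst nn_integral_multc) (auto simp: ef)
  finally have main: "ennreal e * ennreal (2 * f) \<le> ennreal e * ennreal f + ennreal (r * S / l) * ennreal (2 * f)" .
  show ?thesis
  proof (cases "f = 0")
    case True
    then have "e = 0" using ef0 ef1 by simp
    then show ?thesis using True by (simp add: e_def[symmetric] f_def[symmetric] E_def[symmetric] F_def[symmetric])
  next
    case False
    then have f: "f > 0" using ef0 by simp
    have "P \<noteq> {}" using P f by auto
    then have "0 \<le> r * S" using T shift_diff_nonneg order_trans by blast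
    then have rSl: "0 \<le> r * S / l" using l by simp
    have "ennreal e * ennreal (2 * f) = ennreal (e * (2 * f))" "ennreal e * ennreal f = ennreal (e * f)"
      "ennreal (r * S / l) * ennreal (2 * f) = ennreal (r * S / l * (2 * f))"
      by (rule ennreal_mult[symmetric]; use ef0 rSl in simp)+
    then have "ennreal (e * (2 * f)) \<le> ennreal (e * f) + ennreal (r * S / l * (2 * f))"
      using main by (simp only:)
    also have "\<dots> = ennreal (e * f + r * S / l * (2 * f))"
      by (rule ennreal_plus[symmetric]) (intro mult_nonneg_nonneg ef0 rSl; simp add: ef0)+
    finally have "e * (2 * f) \<le> e * f + r * S / l * (2 * f)"
    proof (subst (asm) ennreal_le_iff)
      show "0 \<le> e * f + r * S / l * (2 * f)"
        by (intro add_nonneg_nonneg mult_nonneg_nonneg ef0 rSl; simp add: ef0)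
    qed
    then have "f * e \<le> f * (2 / l * S * r)" by (simp add: algebra_simps)
    then have "e \<le> 2 / l * S * r" using f by (simp only: mult_le_cancel_left_pos)
    then show ?thesis by (simp add: e_def f_def E_def F_def r_def n_def)
  qed
qed

text \<open>Below 2^K one factor s is kept and the others are bounded by 2^K. Above, if s lies
  between 2^(j-1) and 2^j, the summand with k + K + 1 = j alone suffices.\<close>

lemma powr_le_dyadic_sum:
  fixes s q :: real
  assumes s: "0 \<le> s" and q: "1 \<le> q"
  shows "ennreal (s powr q) \<le> ennreal ((2 ^ K) powr (q - 1)) * ennreal s +
    (\<Sum>k. ennreal ((2 ^ (k + K + 1)) powr q) * (if 2 ^ (k + K) \<le> s then 1 else 0))"
proof (cases "s < 2 ^ K")
  case True
  have "s powr q = s powr (q - 1) * s"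
    using s q powr_add[of s "q - 1" 1] by (cases "s = 0") auto
  also have "\<dots> \<le> (2 ^ K) powr (q - 1) * s" using s q True by (intro mult_right_mono powr_mono2) auto
  finally have "ennreal (s powr q) \<le> ennreal ((2 ^ K) powr (q - 1)) * ennreal s"
    using s by (simp add: ennreal_mult[symmetric] ennreal_leI)
  then show ?thesis by (rule order_trans) simp
next
  case False
  obtain m where m: "s < 2 ^ m" using real_arch_pow[of 2 s] by auto
  define j where "j = (LEAST m. s < 2 ^ m)"
  have j: "s < 2 ^ j" unfolding j_def by (rule LeastI[of _ m]) (rule m)
  have "\<not> j \<le> K"
  proof
    assume "j \<le> K"
    then have "2 ^ j \<le> (2::real) ^ K" by (intro power_increasing) auto
    then show False using False j by linarith
  qed
  then obtain k where k: "j = k + K + 1" by (metis Suc_eq_plus1 add.commute less_imp_Suc_add not_le add_Suc_right)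
  have le: "2 ^ (k + K) \<le> s"
    using not_less_Least[of "k + K" "\<lambda>m. s < 2 ^ m"] k unfolding j_def[symmetric] by simp
  have "s powr q \<le> (2 ^ (k + K + 1)) powr q" using s q j k by (intro powr_mono2) auto
  then have "ennreal (s powr q) \<le> ennreal ((2 ^ (k + K + 1)) powr q) * (if 2 ^ (k + K) \<le> s then 1 else 0)"
    using le by (simp add: ennreal_leI)
  also have "\<dots> \<le> (\<Sum>k. ennreal ((2 ^ (k + K + 1)) powr q) * (if 2 ^ (k + K) \<le> s then 1 else 0))"
    using sum_le_suminf[of "\<lambda>k. ennreal ((2 ^ (k + K + 1)) powr q) * (if 2 ^ (k + K) \<le> s then 1 else 0)" "{k}"]
    by simp
  finally show ?thesis by (rule order_trans) simp
qed

text \<open>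
  Iterating the superlevel estimate gives \<open>\<bar>{2\<^sup>k \<le> \<bar>w\<bar>}\<bar> \<le> M 2\<^bsup>-k p\<^esup>\<close> with the
  critical exponent \<open>p = n / (n - 1)\<close>, the fixed point of \<open>p = 1 + p / n\<close>.
\<close>

lemma superlevel_decay:
  fixes c S0 :: real
  assumes n: "CARD('n) \<ge> 2" and c: "c > 0" and S0: "0 \<le> S0"
  defines "p \<equiv> real CARD('n) / (real CARD('n) - 1)"
  obtains M where "0 < M"
    "\<And>(w :: real ^ 'n \<Rightarrow> real) B S k. integrable lborel w \<Longrightarrow> box_shift_bound w B S \<Longrightarrow> 0 \<le> S \<Longrightarrow> S \<le> S0 \<Longrightarrow>
      c \<le> \<bar>det B\<bar> \<Longrightarrow> (LINT x|lborel. \<bar>w x\<bar>) \<le> 1 \<Longrightarrow>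
      measure lborel {x. 2 ^ k \<le> \<bar>w x\<bar>} \<le> M * 2 powr (- real k * p)"
proof -
  define m where "m = real CARD('n)"
  have m: "m \<ge> 2" using n by (simp add: m_def)
  have p: "p = m / (m - 1)" by (simp add: p_def m_def)
  have p1: "p > 1" and pm: "1 + p / m = p" and pinv: "1 - 1 / m = 1 / p"
    using m by (auto simp: p field_simps)
  define C1 where "C1 = 2 * S0 * (2 / c) powr (1 / m)"
  have C1: "0 \<le> C1" using S0 by (simp add: C1_def)
  \<comment> \<open>M solves the recursion: it is large enough for C1 M^(1/m) \<le> M 2^(-p), which
    is the induction step, and M \<ge> 1 covers level k = 0 by Markov's inequality.\<close>
  define M where "M = max 1 ((C1 * 2 powr p) powr p)"
  have M: "1 \<le> M" "(C1 * 2 powr p) powr p \<le> M" by (auto simp: M_def)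
  have M2: "C1 * M powr (1 / m) \<le> M * 2 powr (- p)"
  proof -
    have "C1 * 2 powr p = ((C1 * 2 powr p) powr p) powr (1 / p)"
      using C1 p1 by (simp add: powr_powr)
    also have "\<dots> \<le> M powr (1 / p)" using M p1 by (intro powr_mono2) auto
    finally have "C1 * 2 powr p \<le> M powr (1 - 1 / m)" using pinv by simp
    then have "C1 * 2 powr p * (M powr (1 / m) * 2 powr (- p)) \<le> M powr (1 - 1 / m) * (M powr (1 / m) * 2 powr (- p))"
      by (intro mult_right_mono) auto
    also have "\<dots> = (M powr (1 - 1 / m) * M powr (1 / m)) * 2 powr (- p)" by simp
    also have "M powr (1 - 1 / m) * M powr (1 / m) = M" using M by (simp add: powr_add[symmetric])
    also have "C1 * 2 powr p * (M powr (1 / m) * 2 powr (- p)) = C1 * M powr (1 / m) * (2 powr p * 2 powr (- p))" by simp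
    also have "2 powr p * 2 powr (- p) = (1::real)" by (simp add: powr_add[symmetric])
    finally show ?thesis by simp
  qed
  show ?thesis
  proof (rule that[of M])
    show "0 < M" using M by simp
    fix w :: "real ^ 'n \<Rightarrow> real" and B S k
    assume w: "integrable lborel w" and S: "box_shift_bound w B S" "0 \<le> S" "S \<le> S0" and B: "c \<le> \<bar>det B\<bar>"
      and w1: "(LINT x|lborel. \<bar>w x\<bar>) \<le> 1"
    have B0: "det B \<noteq> 0" using B c by auto
    show "measure lborel {x. 2 ^ k \<le> \<bar>w x\<bar>} \<le> M * 2 powr (- real k * p)"
    proof (induction k)
      case 0
      show ?case using superlevel_finite(3)[OF w, of 1] w1 M by simp
    next
      case (Suc k)
      let ?a = "measure lborel {x. 2 ^ k \<le> \<bar>w x\<bar>}"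
      have "measure lborel {x. 2 ^ Suc k \<le> \<bar>w x\<bar>} \<le> 2 / 2 ^ k * S * (2 * ?a / \<bar>det B\<bar>) powr (1 / m)"
        using superlevel_estimate[OF w B0 S(1), of "2 ^ k"] by (simp add: m_def)
      also have "\<dots> \<le> 2 / 2 ^ k * S0 * (2 * (M * 2 powr (- real k * p)) / c) powr (1 / m)"
        using S B c Suc m M by (intro mult_mono powr_mono2 frac_le) auto
      also have "(2 * (M * 2 powr (- real k * p)) / c) powr (1 / m) =
          (2 / c) powr (1 / m) * M powr (1 / m) * 2 powr (- real k * p / m)"
      proof -
        have "2 * (M * 2 powr (- real k * p)) / c = (2 / c) * M * 2 powr (- real k * p)" by simp
        then have "(2 * (M * 2 powr (- real k * p)) / c) powr (1 / m) = ((2 / c) * M * 2 powr (- real k * p)) powr (1 / m)"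
          by (simp only:)
        also have "\<dots> = (2 / c) powr (1 / m) * M powr (1 / m) * (2 powr (- real k * p)) powr (1 / m)"
          using c M by (simp only: powr_mult)
        finally show ?thesis by (simp add: powr_powr)
      qed
      also have "2 / 2 ^ k * S0 * ((2 / c) powr (1 / m) * M powr (1 / m) * 2 powr (- real k * p / m)) =
          C1 * M powr (1 / m) * (2 powr (- real k) * 2 powr (- real k * p / m))"
        by (simp add: C1_def powr_minus powr_realpow divide_inverse)
      also have "2 powr (- real k) * 2 powr (- real k * p / m) = (2::real) powr (- real k * p)"
      proof -
        have "- real k + - real k * p / m = - real k * (1 + p / m)" by (simp add: algebra_simps)
        then show ?thesis unfolding powr_add[symmetric] pm by simp
      qed
      also have "C1 * M powr (1 / m) * 2 powr (- real k * p) \<le> M * 2 powr (- p) * 2 powr (- real k * p)"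
        using M2 by (intro mult_right_mono) auto
      also have "\<dots> = M * 2 powr (- real (Suc k) * p)"
        by (simp add: powr_add[symmetric] mult.assoc algebra_simps)
      finally show ?case .
    qed
  qed
qed

text \<open>Above level 2^K the layers contribute a geometric series of ratio 2^(q - p) < 1, small
  for large K uniformly in w. Below that level the q-th power is at most 2^(K (q - 1)) times
  \<bar>w\<bar>, which fixes \<delta> once K is chosen.\<close>

lemma Lq_small_of_L1_small:
  fixes c S0 q e :: real
  assumes n: "CARD('n) \<ge> 2" and c: "c > 0" and S0: "0 \<le> S0" and e: "e > 0"
    and q: "1 \<le> q" "q < real CARD('n) / (real CARD('n) - 1)"
  obtains \<delta> where "\<delta> > 0"
    "\<And>(w :: real ^ 'n \<Rightarrow> real) B S. integrable lborel w \<Longrightarrow> box_shift_bound w B S \<Longrightarrow> 0 \<le> S \<Longrightarrow> S \<le> S0 \<Longrightarrow>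
      c \<le> \<bar>det B\<bar> \<Longrightarrow> (LINT x|lborel. \<bar>w x\<bar>) \<le> \<delta> \<Longrightarrow> (\<integral>\<^sup>+ x. ennreal (\<bar>w x\<bar> powr q) \<partial>lborel) \<le> ennreal e"
proof -
  define p where "p = real CARD('n) / (real CARD('n) - 1)"
  obtain M where M: "0 < M" and decay:
    "\<And>(w :: real ^ 'n \<Rightarrow> real) B S k. integrable lborel w \<Longrightarrow> box_shift_bound w B S \<Longrightarrow> 0 \<le> S \<Longrightarrow> S \<le> S0 \<Longrightarrow>
      c \<le> \<bar>det B\<bar> \<Longrightarrow> (LINT x|lborel. \<bar>w x\<bar>) \<le> 1 \<Longrightarrow>
      measure lborel {x. 2 ^ k \<le> \<bar>w x\<bar>} \<le> M * 2 powr (- real k * p)"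
    using superlevel_decay[OF n c S0] unfolding p_def by metis
  define \<rho> where "\<rho> = 2 powr (q - p)"
  have \<rho>: "0 < \<rho>" "\<rho> < 1"
    using q(2) powr_less_mono[of "q - p" 0 2] by (auto simp: \<rho>_def p_def)
  define A where "A = 2 powr q * M / (1 - \<rho>)"
  have A: "A > 0" using M \<rho> by (simp add: A_def)
  have "(\<lambda>K. A * \<rho> ^ K) \<longlonglongrightarrow> A * 0" using \<rho> by (intro tendsto_intros LIMSEQ_power_zero) auto
  then have "\<forall>\<^sub>F K in sequentially. A * \<rho> ^ K < e / 2" using e by (intro order_tendstoD) auto
  then obtain K where K: "A * \<rho> ^ K < e / 2" by (auto simp: eventually_sequentially)
  define b where "b = ((2::real) ^ K) powr (q - 1)"
  have b: "b > 0" by (simp add: b_def)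
  define \<delta> where "\<delta> = min 1 (e / (2 * b))"
  show ?thesis
  proof (rule that[of \<delta>])
    show "\<delta> > 0" using e b by (simp add: \<delta>_def)
    fix w :: "real ^ 'n \<Rightarrow> real" and B S
    assume w: "integrable lborel w" and S: "box_shift_bound w B S" "0 \<le> S" "S \<le> S0" and B: "c \<le> \<bar>det B\<bar>"
      and w\<delta>: "(LINT x|lborel. \<bar>w x\<bar>) \<le> \<delta>"
    have [measurable]: "w \<in> borel_measurable borel" using w by auto
    have w1: "(LINT x|lborel. \<bar>w x\<bar>) \<le> 1" using w\<delta> by (simp add: \<delta>_def)
    let ?L = "\<lambda>k. {x. 2 ^ k \<le> \<bar>w x\<bar>}"
    have "(\<integral>\<^sup>+ x. ennreal (\<bar>w x\<bar> powr q) \<partial>lborel) \<le>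
      (\<integral>\<^sup>+ x. ennreal b * ennreal \<bar>w x\<bar> + (\<Sum>k. ennreal ((2 ^ (k + K + 1)) powr q) * indicator (?L (k + K)) x) \<partial>lborel)"
    proof (intro nn_integral_mono)
      fix x
      show "ennreal (\<bar>w x\<bar> powr q) \<le>
        ennreal b * ennreal \<bar>w x\<bar> + (\<Sum>k. ennreal ((2 ^ (k + K + 1)) powr q) * indicator (?L (k + K)) x)"
      proof -
        have "indicator (?L j) x = (if 2 ^ j \<le> \<bar>w x\<bar> then 1 else 0 :: ennreal)" for j
          by (simp add: indicator_def)
        then show ?thesis using powr_le_dyadic_sum[of "\<bar>w x\<bar>" q K] q(1) unfolding b_def by (simp only: abs_ge_zero)
      qed
    qed
    also have "\<dots> = ennreal b * (\<integral>\<^sup>+ x. ennreal \<bar>w x\<bar> \<partial>lborel) +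
        (\<Sum>k. ennreal ((2 ^ (k + K + 1)) powr q) * emeasure lborel (?L (k + K)))"
      by (subst nn_integral_add) (auto simp: nn_integral_cmult nn_integral_suminf nn_integral_cmult_indicator)
    also have "(\<integral>\<^sup>+ x. ennreal \<bar>w x\<bar> \<partial>lborel) = ennreal (LINT x|lborel. \<bar>w x\<bar>)"
      by (rule nn_integral_eq_integral) (use w in auto)
    also have "ennreal b * ennreal (LINT x|lborel. \<bar>w x\<bar>) \<le> ennreal (e / 2)"
    proof -
      have "b * (LINT x|lborel. \<bar>w x\<bar>) \<le> b * (e / (2 * b))"
        using w\<delta> b by (intro mult_left_mono) (auto simp: \<delta>_def)
      then show ?thesis using b by (simp add: ennreal_mult[symmetric] ennreal_leI)
    qed
    also have "(\<Sum>k. ennreal ((2 ^ (k + K + 1)) powr q) * emeasure lborel (?L (k + K))) \<le>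
        (\<Sum>k. ennreal (2 powr q * M * \<rho> ^ K * \<rho> ^ k))"
    proof (intro suminf_le summableI)
      fix k
      have "emeasure lborel (?L (k + K)) = ennreal (measure lborel (?L (k + K)))"
        using superlevel_finite(2)[OF w, of "2 ^ (k + K)"] by (simp add: emeasure_eq_ennreal_measure)
      then have "ennreal ((2 ^ (k + K + 1)) powr q) * emeasure lborel (?L (k + K)) =
          ennreal ((2 ^ (k + K + 1)) powr q * measure lborel (?L (k + K)))"
        by (simp add: ennreal_mult)
      also have "\<dots> \<le> ennreal ((2 ^ (k + K + 1)) powr q * (M * 2 powr (- real (k + K) * p)))"
        using decay[OF w S B w1, of "k + K"] by (intro ennreal_leI mult_left_mono) auto
      also have "(2 ^ (k + K + 1)) powr q * (M * 2 powr (- real (k + K) * p)) = 2 powr q * M * \<rho> ^ (k + K)"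
      proof -
        have "(2 ^ (k + K + 1)) powr q = ((2::real) powr real (k + K) * 2) powr q"
        proof -
          have "(2::real) powr real (k + K) = 2 ^ (k + K)" by (rule powr_realpow) simp
          then show ?thesis by (simp only: power_add power_one_right)
        qed
        then have "(2 ^ (k + K + 1)) powr q = (2::real) powr (real (k + K) * q) * 2 powr q"
          by (simp only: powr_mult powr_powr)
        moreover have "\<rho> ^ (k + K) = 2 powr (real (k + K) * q) * 2 powr (- real (k + K) * p)"
          unfolding \<rho>_def by (subst powr_realpow[symmetric])
            (auto simp: powr_powr powr_add[symmetric] algebra_simps)
        ultimately show ?thesis by simp
      qed
      finally show "ennreal ((2 ^ (k + K + 1)) powr q) * emeasure lborel (?L (k + K)) \<le> ennreal (2 powr q * M * \<rho> ^ K * \<rho> ^ k)"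
        by (simp add: power_add mult_ac)
    qed
    also have "(\<Sum>k. ennreal (2 powr q * M * \<rho> ^ K * \<rho> ^ k)) = ennreal (A * \<rho> ^ K)"
    proof -
      have s: "(\<lambda>k. 2 powr q * M * \<rho> ^ K * \<rho> ^ k) sums (2 powr q * M * \<rho> ^ K * (1 / (1 - \<rho>)))"
        using \<rho> by (intro sums_mult geometric_sums) auto
      have "(\<Sum>k. ennreal (2 powr q * M * \<rho> ^ K * \<rho> ^ k)) = ennreal (\<Sum>k. 2 powr q * M * \<rho> ^ K * \<rho> ^ k)"
        using s M \<rho> by (intro suminf_ennreal2) (auto simp: sums_iff)
      also have "(\<Sum>k. 2 powr q * M * \<rho> ^ K * \<rho> ^ k) = A * \<rho> ^ K" using s by (simp add: sums_iff A_def)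
      finally show ?thesis .
    qed
    also have "ennreal (e / 2) + ennreal (A * \<rho> ^ K) \<le> ennreal (e / 2) + ennreal (e / 2)"
      using K by (intro add_left_mono ennreal_leI) simp
    also have "\<dots> = ennreal e" using e by (simp add: ennreal_plus[symmetric] del: ennreal_plus)
    finally show "(\<integral>\<^sup>+ x. ennreal (\<bar>w x\<bar> powr q) \<partial>lborel) \<le> ennreal e"
      by (auto elim: order_trans intro: add_mono)
  qed
qed

subsection \<open>Compactness in the space of integrable functions\<close>

text \<open>Completeness of L^1: along a subsequence with summable consecutive distances the
  functions converge almost everywhere, and Fatou's lemma turns this into convergence of the whole
  sequence.\<close>

lemma L1_Cauchy_limit:
  fixes g :: "nat \<Rightarrow> 'a \<Rightarrow> real"
  assumes g: "\<And>k. integrable M (g k)"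
    and Cau: "\<And>e. e > 0 \<Longrightarrow> \<exists>N. \<forall>k\<ge>N. \<forall>l\<ge>N. (LINT x|M. \<bar>g k x - g l x\<bar>) \<le> e"
  obtains w where "integrable M w" "(\<lambda>k. LINT x|M. \<bar>g k x - w x\<bar>) \<longlonglongrightarrow> 0"
proof -
  have [measurable]: "g k \<in> borel_measurable M" for k using g by auto
  have gd: "integrable M (\<lambda>x. \<bar>g k x - g l x\<bar>)" for k l using g by auto
  have nn: "(\<integral>\<^sup>+ x. ennreal \<bar>g k x - g l x\<bar> \<partial>M) = ennreal (LINT x|M. \<bar>g k x - g l x\<bar>)" for k l
    by (rule nn_integral_eq_integral[OF gd]) simp
  have "\<forall>j. \<exists>N. \<forall>k\<ge>N. \<forall>l\<ge>N. (LINT x|M. \<bar>g k x - g l x\<bar>) \<le> (1 / 2) ^ j"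
    using Cau by simp
  then obtain N where N: "\<And>j k l. N j \<le> k \<Longrightarrow> N j \<le> l \<Longrightarrow> (LINT x|M. \<bar>g k x - g l x\<bar>) \<le> (1 / 2) ^ j"
    by metis
  \<comment> \<open>Summing all earlier thresholds yields a monotone choice that dominates each N
    j.\<close>
  define \<phi> where "\<phi> j = (\<Sum>i\<le>j. N i) + j" for j
  have \<phi>N: "N j \<le> \<phi> j" for j
    using member_le_sum[of j "{..j}" N] by (simp add: \<phi>_def)
  have \<phi>mono: "\<phi> j \<le> \<phi> (Suc j)" for j by (simp add: \<phi>_def)
  have \<phi>le: "\<phi> i \<le> \<phi> j" if "i \<le> j" for i j using lift_Suc_mono_le[of \<phi>, OF \<phi>mono that] .
  have "(\<integral>\<^sup>+ x. (\<Sum>j. ennreal \<bar>g (\<phi> (Suc j)) x - g (\<phi> j) x\<bar>) \<partial>M) =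
      (\<Sum>j. \<integral>\<^sup>+ x. ennreal \<bar>g (\<phi> (Suc j)) x - g (\<phi> j) x\<bar> \<partial>M)"
    by (rule nn_integral_suminf) measurable
  also have "\<dots> \<le> (\<Sum>j. ennreal ((1 / 2) ^ j))"
  proof (intro suminf_le summableI)
    fix j
    have "N j \<le> \<phi> (Suc j)" using \<phi>N[of j] \<phi>mono[of j] by linarith
    then show "(\<integral>\<^sup>+ x. ennreal \<bar>g (\<phi> (Suc j)) x - g (\<phi> j) x\<bar> \<partial>M) \<le> ennreal ((1 / 2) ^ j)"
      unfolding nn using N[of j] \<phi>N[of j] by (intro ennreal_leI) auto
  qed
  also have "\<dots> = ennreal (\<Sum>j. (1 / 2) ^ j)"
    by (rule suminf_ennreal2) (auto intro: summable_geometric)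
  also have "\<dots> < \<infinity>" by simp
  finally have "AE x in M. (\<Sum>j. ennreal \<bar>g (\<phi> (Suc j)) x - g (\<phi> j) x\<bar>) \<noteq> \<infinity>"
    by (intro nn_integral_noteq_infinite) auto
  then have conv: "AE x in M. convergent (\<lambda>j. g (\<phi> j) x)"
  proof eventually_elim
    fix x assume "(\<Sum>j. ennreal \<bar>g (\<phi> (Suc j)) x - g (\<phi> j) x\<bar>) \<noteq> \<infinity>"
    then have "summable (\<lambda>j. \<bar>g (\<phi> (Suc j)) x - g (\<phi> j) x\<bar>)"
      by (intro summable_suminf_not_top) auto
    then have "summable (\<lambda>j. g (\<phi> (Suc j)) x - g (\<phi> j) x)" by (rule summable_rabs_cancel)
    then have "convergent (\<lambda>n. g (\<phi> n) x - g (\<phi> 0) x)"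
      unfolding summable_iff_convergent by (simp add: sum_lessThan_telescope[of "\<lambda>j. g (\<phi> j) x"])
    then show "convergent (\<lambda>j. g (\<phi> j) x)" by (simp add: convergent_diff_const_right_iff)
  qed
  define w where "w x = lim (\<lambda>j. g (\<phi> j) x)" for x
  have [measurable]: "w \<in> borel_measurable M" unfolding w_def by measurable
  have key: "(\<integral>\<^sup>+ x. ennreal \<bar>g k x - w x\<bar> \<partial>M) \<le> ennreal ((1 / 2) ^ j)" if k: "\<phi> j \<le> k" for k j
  proof -
    have "(\<integral>\<^sup>+ x. ennreal \<bar>g k x - w x\<bar> \<partial>M) = (\<integral>\<^sup>+ x. liminf (\<lambda>l. ennreal \<bar>g k x - g (\<phi> l) x\<bar>) \<partial>M)"
    proof (rule nn_integral_cong_AE)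
      show "AE x in M. ennreal \<bar>g k x - w x\<bar> = liminf (\<lambda>l. ennreal \<bar>g k x - g (\<phi> l) x\<bar>)"
        using conv
      proof eventually_elim
        fix x assume "convergent (\<lambda>j. g (\<phi> j) x)"
        then have "(\<lambda>l. g (\<phi> l) x) \<longlonglongrightarrow> w x" unfolding w_def by (simp add: convergent_LIMSEQ_iff)
        then have "(\<lambda>l. ennreal \<bar>g k x - g (\<phi> l) x\<bar>) \<longlonglongrightarrow> ennreal \<bar>g k x - w x\<bar>"
          by (intro tendsto_ennrealI tendsto_rabs tendsto_diff tendsto_const)
        then show "ennreal \<bar>g k x - w x\<bar> = liminf (\<lambda>l. ennreal \<bar>g k x - g (\<phi> l) x\<bar>)"
          by (intro lim_imp_Liminf[symmetric]) auto
      qed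
    qed
    also have "\<dots> \<le> liminf (\<lambda>l. \<integral>\<^sup>+ x. ennreal \<bar>g k x - g (\<phi> l) x\<bar> \<partial>M)"
      by (rule nn_integral_liminf) measurable
    also have "\<dots> \<le> liminf (\<lambda>l. ennreal ((1 / 2) ^ j))"
    proof (rule Liminf_mono)
      show "\<forall>\<^sub>F l in sequentially. (\<integral>\<^sup>+ x. ennreal \<bar>g k x - g (\<phi> l) x\<bar> \<partial>M) \<le> ennreal ((1 / 2) ^ j)"
        unfolding eventually_sequentially
      proof (intro exI[of _ j] allI impI)
        fix l assume "j \<le> l"
        then have "N j \<le> \<phi> l" "N j \<le> k" using \<phi>N[of j] \<phi>le k by (meson order_trans)+
        then show "(\<integral>\<^sup>+ x. ennreal \<bar>g k x - g (\<phi> l) x\<bar> \<partial>M) \<le> ennreal ((1 / 2) ^ j)"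
          unfolding nn using N by (intro ennreal_leI) auto
      qed
    qed
    also have "\<dots> = ennreal ((1 / 2) ^ j)" by (simp add: Liminf_const)
    finally show ?thesis .
  qed
  have wd: "integrable M (\<lambda>x. g k x - w x)" if "\<phi> 0 \<le> k" for k
    by (rule integrableI_bounded) (use key[OF that] in \<open>auto simp: order_le_less_trans\<close>)
  have wi: "integrable M w"
    using Bochner_Integration.integrable_diff[OF g[of "\<phi> 0"] wd[OF order_refl]] by simp
  show ?thesis
  proof (rule that[OF wi])
    show "(\<lambda>k. LINT x|M. \<bar>g k x - w x\<bar>) \<longlonglongrightarrow> 0"
    proof (rule LIMSEQ_I)
      fix e :: real assume e: "e > 0"
      obtain j where j: "(1 / 2) ^ j < e" using real_arch_pow_inv[OF e, of "1/2"] by auto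
      show "\<exists>no. \<forall>k\<ge>no. norm ((LINT x|M. \<bar>g k x - w x\<bar>) - 0) < e"
      proof (intro exI[of _ "\<phi> j"] allI impI)
        fix k assume k: "\<phi> j \<le> k"
        have "ennreal (LINT x|M. \<bar>g k x - w x\<bar>) = (\<integral>\<^sup>+ x. ennreal \<bar>g k x - w x\<bar> \<partial>M)"
          by (rule nn_integral_eq_integral[symmetric]) (use g wi in auto)
        then have "ennreal (LINT x|M. \<bar>g k x - w x\<bar>) \<le> ennreal ((1 / 2) ^ j)" using key[OF k] by simp
        then have "(LINT x|M. \<bar>g k x - w x\<bar>) \<le> (1 / 2) ^ j" by (subst (asm) ennreal_le_iff) auto
        then show "norm ((LINT x|M. \<bar>g k x - w x\<bar>) - 0) < e" using j by simp
      qed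
    qed
  qed
qed

text \<open>
  Along a weakly convergent subsequence the averages against a tent kernel converge pointwise, and
  the translation bound makes them uniformly close to the functions themselves.
\<close>

lemma L1_compactness:
  fixes f :: "nat \<Rightarrow> real ^ 'n \<Rightarrow> real"
  assumes f: "\<And>k. integrable lborel (f k)" "\<And>k. (LINT x|lborel. \<bar>f k x\<bar>) \<le> W"
    and C: "\<And>k h. shift_diff (f k) h \<le> C * norm h"
    and X: "X \<in> sets borel" "bounded X" "\<And>k x. x \<notin> X \<Longrightarrow> f k x = 0"
  obtains r w where "strict_mono (r :: nat \<Rightarrow> nat)" "integrable lborel w" "\<And>x. x \<notin> X \<Longrightarrow> w x = 0"
    "(\<lambda>k. LINT x|lborel. \<bar>f (r k) x - w x\<bar>) \<longlonglongrightarrow> 0"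
proof -
  have [measurable]: "f k \<in> borel_measurable borel" for k using f(1)[of k] by auto
  obtain R0 where "X \<subseteq> ball 0 R0" using bounded_subset_ballD[OF X(2)] by blast
  then have "x \<notin> X" if "R0 \<le> norm x" for x using that by auto
  then have R0: "f k x = 0" if "R0 \<le> norm x" for k x using X(3) that by blast
  obtain r \<mu> \<nu> where r: "strict_mono (r :: nat \<Rightarrow> nat)" and
    lim: "\<And>\<psi> :: real ^ 'n \<Rightarrow> real. continuous_on UNIV \<psi> \<Longrightarrow> bounded (range \<psi>) \<Longrightarrow>
       (\<lambda>k. LINT x|lborel. \<psi> x * f (r k) x) \<longlonglongrightarrow> (LINT x|\<mu>. \<psi> x) - (LINT x|\<nu>. \<psi> x)"
    by (rule weak_limit_signed[of f, OF f R0]) blast+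
  define g where "g k = f (r k)" for k
  have [measurable]: "g k \<in> borel_measurable borel" for k by (simp add: g_def)
  have gi: "integrable lborel (g k)" for k by (simp add: g_def f)
  have "\<exists>N. \<forall>k\<ge>N. \<forall>l\<ge>N. (LINT x|lborel. \<bar>g k x - g l x\<bar>) \<le> e" if e: "e > 0" for e
  proof -
    \<comment> \<open>The radius of the kernel. A difference of two members has translation constant
      2 \<bar>C\<bar>, so averaging over displacements shorter than s changes it by at most 2
      \<bar>C\<bar> s \<le> e/2.\<close>
    define s where "s = e / (4 * (\<bar>C\<bar> + 1))"
    have s: "s > 0" using e by (simp add: s_def)
    have sC: "2 * \<bar>C\<bar> * s \<le> e / 2"
    proof -
      have "2 * \<bar>C\<bar> * s \<le> 2 * (\<bar>C\<bar> + 1) * s" using s by (intro mult_right_mono) auto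
      also have "\<dots> = e / 2" by (simp add: s_def field_simps)
      finally show ?thesis .
    qed
    define \<rho> where "\<rho> h = max 0 (s - norm h)" for h :: "real ^ 'n"
    have \<rho>0: "0 \<le> \<rho> h" "\<rho> h \<le> s" for h using s by (auto simp: \<rho>_def)
    have \<rho>c: "continuous_on UNIV \<rho>" unfolding \<rho>_def by (intro continuous_intros)
    have [measurable]: "\<rho> \<in> borel_measurable borel" by (rule borel_measurable_continuous_onI[OF \<rho>c])
    have bi: "integrable lborel (\<lambda>x :: real ^ 'n. indicator (ball 0 a) x :: real)" for a :: real
      using emeasure_lborel_ball_finite[of "0 :: real ^ 'n" a] by simp
    have \<rho>i: "integrable lborel \<rho>"
    proof (rule Bochner_Integration.integrable_bound[OF integrable_mult_right[OF bi[of s], of s]])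
      show "AE x in lborel. norm (\<rho> x) \<le> norm (s * indicator (ball 0 s) x)"
        using s by (auto simp: \<rho>_def indicator_def)
    qed auto
    define c where "c = (LINT h|lborel. \<rho> h)"
    have c: "c > 0"
    proof -
      have "s / 2 * measure lborel (ball (0 :: real ^ 'n) (s / 2)) = (LINT h|lborel. s / 2 * indicator (ball (0 :: real ^ 'n) (s / 2)) h)"
        by simp
      also have "\<dots> \<le> c"
        unfolding c_def
      proof (rule integral_mono)
        show "s / 2 * indicator (ball 0 (s / 2)) h \<le> \<rho> h" for h
          using s by (auto simp: \<rho>_def indicator_def)
      qed (use bi[of "s / 2"] \<rho>i in auto)
      finally show ?thesis
        using s content_ball_pos[of "s / 2" "0 :: real ^ 'n"] by (smt (verit) half_gt_zero mult_pos_pos)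
    qed
    \<comment> \<open>The kernel is not normalised: G k is c times an average of g k, which explains
      the factor c in the estimates that follow.\<close>
    define G where "G k x = (LINT h|lborel. \<rho> h * g k (x + h))" for k x
    have \<rho>gi: "integrable lborel (\<lambda>h. \<rho> h * v h)" if v: "integrable lborel v" for v :: "real ^ 'n \<Rightarrow> real"
    proof (rule Bochner_Integration.integrable_bound[OF integrable_mult_right[OF integrable_abs[OF v], of s]])
      have "norm (\<rho> h * v h) \<le> norm (s * \<bar>v h\<bar>)" for h
        using \<rho>0[of h] s by (auto simp: abs_mult intro!: mult_right_mono)
      then show "AE h in lborel. norm (\<rho> h * v h) \<le> norm (s * \<bar>v h\<bar>)" by simp
    qed (use v in auto)
    have gti: "integrable lborel (\<lambda>h. g k (x + h))" for k x
      using integrable_translation[OF gi[of k], of x] by (simp add: add.commute)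
    have Gm[measurable]: "G k \<in> borel_measurable borel" for k
      unfolding G_def by (rule lborel.borel_measurable_lebesgue_integral) measurable
    have G_bound: "\<bar>G k x\<bar> \<le> s * W * indicator (ball 0 (\<bar>R0\<bar> + s)) x" for k x
    proof (cases "x \<in> ball 0 (\<bar>R0\<bar> + s)")
      case True
      have "\<bar>G k x\<bar> \<le> (LINT h|lborel. \<bar>\<rho> h * g k (x + h)\<bar>)"
        unfolding G_def using integral_norm_bound[of lborel "\<lambda>h. \<rho> h * g k (x + h)"] by simp
      also have "\<dots> \<le> (LINT h|lborel. s * \<bar>g k (x + h)\<bar>)"
      proof (rule integral_mono)
        show "\<bar>\<rho> h * g k (x + h)\<bar> \<le> s * \<bar>g k (x + h)\<bar>" for h
          using \<rho>0[of h] by (auto simp: abs_mult intro!: mult_right_mono)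
      qed (use \<rho>gi[OF gti] gti in auto)
      also have "\<dots> = s * (LINT h|lborel. \<bar>g k h\<bar>)"
        using integral_translation[of "\<lambda>h. \<bar>g k h\<bar>" x] by (simp add: add.commute)
      also have "\<dots> \<le> s * W" using f(2)[of "r k"] s by (simp add: g_def)
      finally show ?thesis using True by simp
    next
      case False
      have "\<rho> h * g k (x + h) = 0" for h
      proof (cases "norm h < s")
        case True
        then have "R0 \<le> norm (x + h)" using False norm_triangle_ineq4[of "x + h" h] by simp
        then show ?thesis using R0 by (simp add: g_def)
      qed (simp add: \<rho>_def)
      then have "G k x = 0" unfolding G_def by (simp only: Bochner_Integration.integral_zero)
      then show ?thesis using False by simp
    qed
    have Gconv: "convergent (\<lambda>k. G k x)" for x
    proof -
      have c1: "continuous_on UNIV (\<lambda>y. \<rho> (y - x))"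
        by (rule continuous_on_compose2[OF \<rho>c]) (auto intro!: continuous_intros)
      have c2: "bounded (range (\<lambda>y. \<rho> (y - x)))"
        using \<rho>0 by (auto simp: bounded_iff intro!: exI[of _ s])
      have "G k x = (LINT y|lborel. \<rho> (y - x) * f (r k) y)" for k
        unfolding G_def g_def using integral_translation[of "\<lambda>y. \<rho> (y - x) * f (r k) y" x] by (simp add: add.commute)
      then show ?thesis using lim[OF c1 c2] by (auto simp: convergent_def)
    qed
    define G0 where "G0 x = lim (\<lambda>k. G k x)" for x
    have G0: "(\<lambda>k. G k x) \<longlonglongrightarrow> G0 x" for x using Gconv[of x] by (simp add: G0_def convergent_LIMSEQ_iff)
    have [measurable]: "G0 \<in> borel_measurable borel" unfolding G0_def by measurable
    let ?D = "\<lambda>x :: real ^ 'n. s * W * indicator (ball 0 (\<bar>R0\<bar> + s)) x"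
    have Di: "integrable lborel ?D" by (intro integrable_mult_right bi)
    have G0_bound: "\<bar>G0 x\<bar> \<le> ?D x" for x
      by (rule tendsto_upperbound[OF tendsto_rabs[OF G0]]) (use G_bound in auto)
    have Gi: "integrable lborel (G k)" for k
      by (rule Bochner_Integration.integrable_bound[OF Di]) (use G_bound in \<open>auto intro: order_trans[OF _ abs_ge_self]\<close>)
    have G0i: "integrable lborel G0"
      by (rule Bochner_Integration.integrable_bound[OF Di]) (use G0_bound in \<open>auto intro: order_trans[OF _ abs_ge_self]\<close>)
    have "(\<lambda>k. LINT x|lborel. \<bar>G k x - G0 x\<bar>) \<longlonglongrightarrow> (LINT x|(lborel :: (real ^ 'n) measure). 0)"
    proof (rule integral_dominated_convergence[where w = "\<lambda>x. 2 * ?D x"])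
      show "integrable lborel (\<lambda>x. 2 * ?D x)" by (intro integrable_mult_right bi)
      show "AE x in lborel. (\<lambda>k. \<bar>G k x - G0 x\<bar>) \<longlonglongrightarrow> 0"
        using G0 by (auto intro!: tendsto_rabs_zero LIM_zero)
      show "AE x in lborel. norm \<bar>G k x - G0 x\<bar> \<le> 2 * ?D x" for k
      proof (rule AE_I2)
        show "norm \<bar>G k x - G0 x\<bar> \<le> 2 * ?D x" for x
          using G_bound[of k x] G0_bound[of x] by (simp add: abs_le_iff)
      qed
    qed auto
    then have "(\<lambda>k. LINT x|lborel. \<bar>G k x - G0 x\<bar>) \<longlonglongrightarrow> 0" by simp
    then have "\<forall>\<^sub>F k in sequentially. (LINT x|lborel. \<bar>G k x - G0 x\<bar>) < c * e / 4"
      by (rule order_tendstoD) (use c e in auto)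
    then obtain N where N: "\<And>k. N \<le> k \<Longrightarrow> (LINT x|lborel. \<bar>G k x - G0 x\<bar>) < c * e / 4"
      by (auto simp: eventually_sequentially)
    have "(LINT x|lborel. \<bar>g k x - g l x\<bar>) \<le> e" if kl: "N \<le> k" "N \<le> l" for k l
    proof -
      define d where "d x = g k x - g l x" for x
      have di: "integrable lborel d" unfolding d_def using gi by auto
      have [measurable]: "d \<in> borel_measurable borel" using di by auto
      define I where "I = (LINT x|lborel. \<bar>d x\<bar>)"
      have dti: "integrable lborel (\<lambda>h. d (x + h))" for x
        using integrable_translation[OF di, of x] by (simp add: add.commute)
      have sd: "shift_diff d h \<le> 2 * \<bar>C\<bar> * norm h" for h
      proof -
        have "shift_diff d h \<le> shift_diff (g k) h + shift_diff (g l) h"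
          unfolding d_def by (rule shift_diff_diff_le[OF gi gi])
        also have "\<dots> \<le> \<bar>C\<bar> * norm h + \<bar>C\<bar> * norm h"
          unfolding g_def by (intro add_mono order_trans[OF C] mult_right_mono) auto
        finally show ?thesis by simp
      qed
      have Gd: "integrable lborel (\<lambda>x. \<bar>G k x - G l x\<bar>)" using Gi by auto
      have pw: "ennreal (c * \<bar>d x\<bar>) \<le> (\<integral>\<^sup>+ h. ennreal (\<rho> h * \<bar>d (x + h) - d x\<bar>) \<partial>lborel) + ennreal \<bar>G k x - G l x\<bar>" for x
      proof -
        have i1: "integrable lborel (\<lambda>h. \<rho> h * d (x + h))" by (rule \<rho>gi[OF dti])
        have i2: "integrable lborel (\<lambda>h. \<rho> h * d x)" using \<rho>i by simp
        have i3: "integrable lborel (\<lambda>h. \<rho> h * (d (x + h) - d x))"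
          using Bochner_Integration.integrable_diff[OF i1 i2] by (simp add: right_diff_distrib)
        have i4: "integrable lborel (\<lambda>h. \<rho> h * \<bar>d (x + h) - d x\<bar>)"
          using integrable_abs[OF i3] \<rho>0 by (simp add: abs_mult)
        have G_eq: "G k x - G l x = (LINT h|lborel. \<rho> h * d (x + h))"
          unfolding G_def d_def using \<rho>gi[OF gti] by (simp add: right_diff_distrib)
        have "c * d x = (LINT h|lborel. \<rho> h * d x)" by (simp add: c_def)
        also have "\<dots> = (LINT h|lborel. \<rho> h * d (x + h)) - (LINT h|lborel. \<rho> h * (d (x + h) - d x))"
          using i1 i2 by (simp add: right_diff_distrib)
        finally have "\<bar>c * d x\<bar> \<le> \<bar>G k x - G l x\<bar> + \<bar>LINT h|lborel. \<rho> h * (d (x + h) - d x)\<bar>"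
          using G_eq by linarith
        also have "\<bar>LINT h|lborel. \<rho> h * (d (x + h) - d x)\<bar> \<le> (LINT h|lborel. \<rho> h * \<bar>d (x + h) - d x\<bar>)"
          using integral_norm_bound[of lborel "\<lambda>h. \<rho> h * (d (x + h) - d x)"] \<rho>0 by (simp add: abs_mult)
        finally have "c * \<bar>d x\<bar> \<le> (LINT h|lborel. \<rho> h * \<bar>d (x + h) - d x\<bar>) + \<bar>G k x - G l x\<bar>"
          using c by (simp add: abs_mult)
        then have "ennreal (c * \<bar>d x\<bar>) \<le> ennreal ((LINT h|lborel. \<rho> h * \<bar>d (x + h) - d x\<bar>) + \<bar>G k x - G l x\<bar>)"
          by (rule ennreal_leI)
        also have "\<dots> = ennreal (LINT h|lborel. \<rho> h * \<bar>d (x + h) - d x\<bar>) + ennreal \<bar>G k x - G l x\<bar>"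
          by (intro ennreal_plus Bochner_Integration.integral_nonneg) (auto simp: \<rho>0)
        also have "ennreal (LINT h|lborel. \<rho> h * \<bar>d (x + h) - d x\<bar>) = (\<integral>\<^sup>+ h. ennreal (\<rho> h * \<bar>d (x + h) - d x\<bar>) \<partial>lborel)"
          by (rule nn_integral_eq_integral[symmetric, OF i4]) (auto simp: \<rho>0)
        finally show ?thesis .
      qed
      have "ennreal (c * I) = (\<integral>\<^sup>+ x. ennreal (c * \<bar>d x\<bar>) \<partial>lborel)"
        unfolding I_def using c di by (subst nn_integral_eq_integral) auto
      also have "\<dots> \<le> (\<integral>\<^sup>+ x. (\<integral>\<^sup>+ h. ennreal (\<rho> h * \<bar>d (x + h) - d x\<bar>) \<partial>lborel) + ennreal \<bar>G k x - G l x\<bar> \<partial>lborel)"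
        by (intro nn_integral_mono pw)
      also have "\<dots> = (\<integral>\<^sup>+ x. (\<integral>\<^sup>+ h. ennreal (\<rho> h * \<bar>d (x + h) - d x\<bar>) \<partial>lborel) \<partial>lborel) + (\<integral>\<^sup>+ x. ennreal \<bar>G k x - G l x\<bar> \<partial>lborel)"
        by (rule nn_integral_add) measurable
      also have "(\<integral>\<^sup>+ x. (\<integral>\<^sup>+ h. ennreal (\<rho> h * \<bar>d (x + h) - d x\<bar>) \<partial>lborel) \<partial>lborel) =
          (\<integral>\<^sup>+ h. (\<integral>\<^sup>+ x. ennreal (\<rho> h * \<bar>d (x + h) - d x\<bar>) \<partial>lborel) \<partial>lborel)"
        by (rule lborel_pair.Fubini') measurable
      also have "\<dots> \<le> (\<integral>\<^sup>+ h. ennreal (2 * \<bar>C\<bar> * s * \<rho> h) \<partial>lborel)"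
      proof (intro nn_integral_mono)
        fix h
        have "(\<integral>\<^sup>+ x. ennreal (\<rho> h * \<bar>d (x + h) - d x\<bar>) \<partial>lborel) = ennreal (\<rho> h * shift_diff d h)"
          unfolding shift_diff_def using integrable_shift_diff[OF di, of h] \<rho>0
          by (subst nn_integral_eq_integral) auto
        also have "\<rho> h * shift_diff d h \<le> \<rho> h * (2 * \<bar>C\<bar> * s)"
        proof (cases "norm h < s")
          case True
          have "shift_diff d h \<le> 2 * \<bar>C\<bar> * s"
            by (rule order_trans[OF sd]) (use True in \<open>auto intro!: mult_left_mono\<close>)
          then show ?thesis using \<rho>0 by (intro mult_left_mono)
        qed (simp add: \<rho>_def)
        finally show "(\<integral>\<^sup>+ x. ennreal (\<rho> h * \<bar>d (x + h) - d x\<bar>) \<partial>lborel) \<le> ennreal (2 * \<bar>C\<bar> * s * \<rho> h)"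
          by (simp add: ennreal_leI mult_ac)
      qed
      also have "(\<integral>\<^sup>+ h. ennreal (2 * \<bar>C\<bar> * s * \<rho> h) \<partial>lborel) = ennreal (2 * \<bar>C\<bar> * s * c)"
        unfolding c_def using \<rho>i \<rho>0 s by (subst nn_integral_eq_integral) auto
      also have "(\<integral>\<^sup>+ x. ennreal \<bar>G k x - G l x\<bar> \<partial>lborel) = ennreal (LINT x|lborel. \<bar>G k x - G l x\<bar>)"
        by (rule nn_integral_eq_integral[OF Gd]) simp
      also have "ennreal (2 * \<bar>C\<bar> * s * c) + ennreal (LINT x|lborel. \<bar>G k x - G l x\<bar>) = ennreal (2 * \<bar>C\<bar> * s * c + (LINT x|lborel. \<bar>G k x - G l x\<bar>))"
        using s c by (intro ennreal_plus[symmetric]) auto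
      finally have "ennreal (c * I) \<le> ennreal (2 * \<bar>C\<bar> * s * c + (LINT x|lborel. \<bar>G k x - G l x\<bar>))"
        by (auto elim: order_trans intro: add_mono)
      then have "c * I \<le> 2 * \<bar>C\<bar> * s * c + (LINT x|lborel. \<bar>G k x - G l x\<bar>)"
        using s c by (subst (asm) ennreal_le_iff) (auto intro!: add_nonneg_nonneg)
      also have "(LINT x|lborel. \<bar>G k x - G l x\<bar>) \<le> (LINT x|lborel. \<bar>G k x - G0 x\<bar> + \<bar>G l x - G0 x\<bar>)"
        using Gi G0i by (intro integral_mono) auto
      also have "\<dots> = (LINT x|lborel. \<bar>G k x - G0 x\<bar>) + (LINT x|lborel. \<bar>G l x - G0 x\<bar>)"
        using Gi G0i by (intro Bochner_Integration.integral_add) auto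
      also have "\<dots> \<le> c * e / 4 + c * e / 4" using N kl by (intro add_mono less_imp_le) auto
      also have "2 * \<bar>C\<bar> * s * c + (c * e / 4 + c * e / 4) \<le> e / 2 * c + (c * e / 4 + c * e / 4)"
        using sC c by (intro add_mono mult_right_mono) auto
      also have "\<dots> = c * e" by simp
      finally have "c * I \<le> c * e" by simp
      then show ?thesis using c by (simp add: I_def d_def)
    qed
    then show ?thesis by blast
  qed
  then obtain w where w: "integrable lborel w" "(\<lambda>k. LINT x|lborel. \<bar>g k x - w x\<bar>) \<longlonglongrightarrow> 0"
    using L1_Cauchy_limit[of lborel g, OF gi] by blast
  have [measurable]: "w \<in> borel_measurable borel" "X \<in> sets borel" using w X by auto
  \<comment> \<open>The limit is determined only almost everywhere. Multiplying by the indicator of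
    X makes it vanish at every point off X, and the distance to f (r k) does not grow because f (r
    k) vanishes there too.\<close>
  show ?thesis
  proof (rule that[OF r, of "\<lambda>x. indicator X x * w x"])
    show iX: "integrable lborel (\<lambda>x. indicator X x * w x)" by (rule integrable_indicator_mult[OF w(1)]) simp
    show "indicator X x * w x = 0" if "x \<notin> X" for x using that by simp
    show "(\<lambda>k. LINT x|lborel. \<bar>f (r k) x - indicator X x * w x\<bar>) \<longlonglongrightarrow> 0"
    proof (rule tendsto_sandwich[OF _ _ tendsto_const w(2)])
      show "\<forall>\<^sub>F k in sequentially. (LINT x|lborel. \<bar>f (r k) x - indicator X x * w x\<bar>) \<le> (LINT x|lborel. \<bar>g k x - w x\<bar>)"
      proof (intro always_eventually allI integral_mono)
        fix k x
        show "\<bar>f (r k) x - indicator X x * w x\<bar> \<le> \<bar>g k x - w x\<bar>"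
          using X(3)[of x "r k"] by (auto simp: g_def indicator_def)
      qed (use gi w iX f in auto)
    qed simp
  qed
qed

subsection \<open>Extremal parallelepipeds in the unit ball of the directional variation\<close>

text \<open>A norm with an explicit constant m of nondegeneracy. For \<open>dir_var w\<close> this
  constant is an L^1 bound divided by the radius of the support.\<close>

definition seminorm_like :: "('a::euclidean_space \<Rightarrow> real) \<Rightarrow> real \<Rightarrow> bool" where
  "seminorm_like N m \<longleftrightarrow> continuous_on UNIV N \<and> (\<forall>x y. N (x + y) \<le> N x + N y) \<and>
     (\<forall>c x. N (c *\<^sub>R x) = \<bar>c\<bar> * N x) \<and> 0 < m \<and> (\<forall>x. m * norm x \<le> N x)"

lemma seminorm_likeD:
  assumes "seminorm_like N m"
  shows "continuous_on UNIV N" "N (x + y) \<le> N x + N y" "N (c *\<^sub>R x) = \<bar>c\<bar> * N x" "0 < m" "m * norm x \<le> N x"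
    "0 \<le> N x" "x \<noteq> 0 \<Longrightarrow> 0 < N x"
proof -
  show *: "continuous_on UNIV N" "N (x + y) \<le> N x + N y" "N (c *\<^sub>R x) = \<bar>c\<bar> * N x" "0 < m" "m * norm x \<le> N x"
    using assms by (auto simp: seminorm_like_def)
  show "0 \<le> N x" by (rule order_trans[OF _ *(5)]) (use *(4) in simp)
  show "0 < N x" if "x \<noteq> 0" by (rule less_le_trans[OF _ *(5)]) (use *(4) that in simp)
qed

lemma continuous_on_det: "continuous_on UNIV (\<lambda>A :: real ^ 'n ^ 'n. det A)"
  unfolding det_def by (intro continuous_intros)

lemma det_bound:
  fixes B :: "real ^ 'n ^ 'n"
  assumes "\<And>i j. \<bar>B $ i $ j\<bar> \<le> M"
  shows "\<bar>det B\<bar> \<le> (\<Sum>p\<in>{p. p permutes (UNIV :: 'n set)}. M ^ CARD('n))"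
proof -
  have "\<bar>det B\<bar> \<le> (\<Sum>p\<in>{p. p permutes (UNIV :: 'n set)}. \<bar>of_int (sign p) * (\<Prod>i\<in>UNIV. B $ i $ p i)\<bar>)"
    unfolding det_def by (rule sum_abs)
  also have "\<dots> \<le> (\<Sum>p\<in>{p. p permutes (UNIV :: 'n set)}. M ^ CARD('n))"
  proof (rule sum_mono)
    fix p assume "p \<in> {p. p permutes (UNIV :: 'n set)}"
    have "\<bar>of_int (sign p) * (\<Prod>i\<in>UNIV. B $ i $ p i)\<bar> = (\<Prod>i\<in>UNIV. \<bar>B $ i $ p i\<bar>)"
      by (simp add: abs_mult abs_prod sign_def)
    also have "\<dots> \<le> (\<Prod>i\<in>(UNIV :: 'n set). M)" using assms by (intro prod_mono) auto
    finally show "\<bar>of_int (sign p) * (\<Prod>i\<in>UNIV. B $ i $ p i)\<bar> \<le> M ^ CARD('n)" by simp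
  qed
  finally show ?thesis .
qed

lemma cramer_solution:
  fixes B :: "real ^ 'n ^ 'n"
  assumes "det B \<noteq> 0"
  shows "x = B *v (\<chi> k. det (\<chi> i j. if j = k then x $ i else B $ i $ j) / det B)"
  using cramer[OF assms, of "\<chi> k. det (\<chi> i j. if j = k then x $ i else B $ i $ j) / det B" x] by simp

text \<open>Auerbach's lemma: take the columns in the unit ball of \<open>N\<close> with largest determinant.\<close>

lemma Auerbach:
  fixes N :: "real ^ 'n \<Rightarrow> real"
  assumes N: "seminorm_like N m"
  obtains B :: "real ^ 'n ^ 'n" where "det B \<noteq> 0" "\<And>i. N (column i B) \<le> 1"
    "\<And>x. N x \<le> 1 \<Longrightarrow> \<exists>t. (\<forall>i. \<bar>t $ i\<bar> \<le> 1) \<and> x = B *v t"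
proof -
  note N' = seminorm_likeD[OF N]
  define S where "S = {B :: real ^ 'n ^ 'n. \<forall>i. N (column i B) \<le> 1}"
  have colc: "continuous_on UNIV (\<lambda>B :: real ^ 'n ^ 'n. N (column i B))" for i
  proof (rule continuous_on_compose2[OF N'(1)])
    show "continuous_on UNIV (\<lambda>B :: real ^ 'n ^ 'n. column i B)"
      unfolding column_def by (intro continuous_intros)
  qed simp
  have "closed S"
    unfolding S_def Collect_all_eq by (intro closed_INT ballI closed_Collect_le colc continuous_on_const)
  moreover have "bounded S"
  proof -
    have "norm B \<le> (\<Sum>i\<in>(UNIV::'n set). \<Sum>j\<in>(UNIV::'n set). 1 / m)" if B: "B \<in> S" for B
    proof -
      have e: "\<bar>B $ i $ j\<bar> \<le> 1 / m" for i j
      proof -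
        have "N (column j B) \<le> 1" using B by (simp add: S_def)
        then have "m * norm (column j B) \<le> 1" using N'(5)[of "column j B"] by linarith
        then have "norm (column j B) \<le> 1 / m" using N'(4) by (simp add: field_simps)
        moreover have "\<bar>B $ i $ j\<bar> \<le> norm (column j B)"
          using component_le_norm_cart[of "column j B" i] by (simp add: column_def)
        ultimately show ?thesis by linarith
      qed
      have "norm B \<le> (\<Sum>i\<in>UNIV. norm (B $ i))"
        unfolding norm_vec_def by (rule L2_set_le_sum) auto
      also have "\<dots> \<le> (\<Sum>i\<in>UNIV. \<Sum>j\<in>UNIV. \<bar>B $ i $ j\<bar>)" by (intro sum_mono norm_le_l1_cart)
      also have "\<dots> \<le> (\<Sum>i\<in>(UNIV::'n set). \<Sum>j\<in>(UNIV::'n set). 1 / m)" by (intro sum_mono e)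
      finally show ?thesis .
    qed
    then show ?thesis unfolding bounded_iff by blast
  qed
  ultimately have "compact S" by (simp add: compact_eq_bounded_closed)
  \<comment> \<open>A small multiple of the identity has its columns in the unit ball, so the
    maximal determinant is not 0.\<close>
  define \<epsilon> where "\<epsilon> = 1 / (1 + (\<Sum>i\<in>UNIV. N (axis i (1::real))))"
  have sN: "0 \<le> (\<Sum>i\<in>UNIV. N (axis i (1::real)))" by (intro sum_nonneg N'(6))
  then have \<epsilon>: "\<epsilon> > 0" by (simp add: \<epsilon>_def)
  define E :: "real ^ 'n ^ 'n" where "E = \<epsilon> *\<^sub>R mat 1"
  have E: "E \<in> S"
    unfolding S_def
  proof (intro CollectI allI)
    fix i
    have "column i E = \<epsilon> *\<^sub>R axis i 1" by (auto simp: E_def column_def mat_def axis_def vec_eq_iff)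
    then have "N (column i E) = \<epsilon> * N (axis i 1)" using N'(3) \<epsilon> by simp
    also have "N (axis i 1) \<le> (\<Sum>i\<in>UNIV. N (axis i (1::real)))" by (rule member_le_sum) (auto intro: N'(6))
    then have "\<epsilon> * N (axis i 1) \<le> 1" using sN by (simp add: \<epsilon>_def field_simps)
    finally show "N (column i E) \<le> 1" .
  qed
  have detE: "det E \<noteq> 0"
  proof -
    have "det E = (\<Prod>i\<in>(UNIV :: 'n set). E $ i $ i)" by (rule det_diagonal) (simp add: E_def mat_def)
    then show ?thesis using \<epsilon> by (simp add: E_def mat_def)
  qed
  have "continuous_on S (\<lambda>B. \<bar>det B\<bar>)"
    by (intro continuous_on_rabs continuous_on_subset[OF continuous_on_det]) auto
  then obtain B where B: "B \<in> S" "\<And>A. A \<in> S \<Longrightarrow> \<bar>det A\<bar> \<le> \<bar>det B\<bar>"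
    using continuous_attains_sup[OF \<open>compact S\<close>, of "\<lambda>B. \<bar>det B\<bar>"] E by auto
  have dB: "det B \<noteq> 0" using B(2)[OF E] detE by auto
  show ?thesis
  proof (rule that[OF dB])
    show "N (column i B) \<le> 1" for i using B(1) by (simp add: S_def)
    fix x assume x: "N x \<le> 1"
    define R where "R k = (\<chi> i j. if j = k then x $ i else B $ i $ j)" for k
    define t where "t = (\<chi> k. det (R k) / det B)"
    \<comment> \<open>Replacing a column by x does not leave the set S, so the determinant does not
      increase in absolute value. By Cramer's rule the coordinates of x are such quotients of
      determinants.\<close>
    have "R k \<in> S" for k
      unfolding S_def
    proof (intro CollectI allI)
      fix j
      have "column j (R k) = (if j = k then x else column j B)" by (auto simp: R_def column_def vec_eq_iff)
      then show "N (column j (R k)) \<le> 1" using x B(1) by (simp add: S_def)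
    qed
    then have "\<bar>t $ k\<bar> \<le> 1" for k using B(2)[of "R k"] dB by (simp add: t_def abs_divide)
    moreover have "x = B *v t" unfolding t_def R_def by (rule cramer_solution[OF dB])
    ultimately show "\<exists>t. (\<forall>i. \<bar>t $ i\<bar> \<le> 1) \<and> x = B *v t" by blast
  qed
qed

section \<open>Comparison of the integral over the sphere with the volume of the unit ball\<close>

lemma inverse_ennreal_antimono:
  fixes x y :: ennreal
  assumes "x \<le> y"
  shows "inverse y \<le> inverse x"
proof (cases "x = 0 \<or> y = \<infinity>")
  case False
  then obtain r s where "x = ennreal r" "y = ennreal s" "0 < r" "0 < s" "r \<le> s"
    using assms by (cases x; cases y) (auto simp: ennreal_le_iff top_unique)
  then show ?thesis by (simp add: inverse_ennreal ennreal_leI le_imp_inverse_le)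
qed auto

lemma ennreal_term_le_suminf: "f k \<le> (\<Sum>k. f k)" for f :: "nat \<Rightarrow> ennreal"
  using sum_le_suminf[of f "{k}"] by simp

text \<open>
  Polar coordinates up to a factor \<open>2\<^sup>n\<close>: on the cone where the radial function \<open>\<rho>\<close> of the unit
  ball of \<open>N\<close> lies in a dyadic interval, \<open>\<rho>\<close> is replaced by the endpoints of that interval.
\<close>

lemma sphere_integral_le_volume:
  fixes N :: "real ^ 'n \<Rightarrow> real"
  assumes N: "seminorm_like N m"
  shows "(\<integral>\<^sup>+ \<xi>. inverse (ennreal (N \<xi>) ^ CARD('n)) \<partial>sphere_measure)
    \<le> of_nat CARD('n) * (2 ^ CARD('n) * emeasure lborel {x. N x \<le> 1})"
proof -
  note N' = seminorm_likeD[OF N]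
  have [measurable]: "N \<in> borel_measurable borel" by (rule borel_measurable_continuous_onI[OF N'(1)])
  define n where "n = CARD('n)"
  let ?U = "cball 0 1 - {0 :: real ^ 'n}"
  let ?g = "\<lambda>\<xi>. inverse (ennreal (N \<xi>) ^ n)"
  define \<rho> where "\<rho> x = norm x / N x" for x
  have [measurable]: "\<rho> \<in> borel_measurable borel" unfolding \<rho>_def by measurable
  have \<rho>: "0 < \<rho> x" "\<rho> x \<le> 1 / m" if "x \<noteq> 0" for x
  proof -
    show "0 < \<rho> x" using N'(7)[OF that] that by (simp add: \<rho>_def)
    show "\<rho> x \<le> 1 / m" using N'(5)[of x] N'(7)[OF that] N'(4) by (simp add: \<rho>_def field_simps)
  qed
  have \<rho>_scale: "\<rho> (c *\<^sub>R x) = \<rho> x" if "c \<noteq> 0" for c x using that by (simp add: \<rho>_def N'(3))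
  have m: "m > 0" by (rule N'(4))
  have g\<rho>: "?g (x /\<^sub>R norm x) = ennreal (\<rho> x ^ n)" if "x \<noteq> 0" for x
  proof -
    have p: "0 < N (x /\<^sub>R norm x)" using N'(7) that by simp
    have "?g (x /\<^sub>R norm x) = ennreal (inverse (N (x /\<^sub>R norm x) ^ n))"
      using p by (simp add: ennreal_power inverse_ennreal)
    also have "inverse (N (x /\<^sub>R norm x) ^ n) = \<rho> x ^ n"
      unfolding N'(3) by (simp add: \<rho>_def power_inverse[symmetric] divide_inverse mult.commute)
    finally show ?thesis .
  qed
  have meas: "(\<lambda>x. x /\<^sub>R norm x) \<in> restrict_space lborel ?U \<rightarrow>\<^sub>M restrict_space borel (sphere 0 1)"
    by (intro measurable_restrict_space2 measurable_restrict_space1) (auto simp: space_restrict_space)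
  have gm: "?g \<in> borel_measurable (restrict_space borel (sphere 0 1))"
    by (rule measurable_restrict_space1) measurable
  \<comment> \<open>Surface measure was defined by cones, so an integral over the sphere is n times
    the integral of its 0-homogeneous extension over the punctured unit ball.\<close>
  have "(\<integral>\<^sup>+ \<xi>. ?g \<xi> \<partial>sphere_measure) = of_nat n * (\<integral>\<^sup>+ x. ?g (x /\<^sub>R norm x) \<partial>restrict_space lborel ?U)"
    unfolding sphere_measure_def n_def[symmetric]
  proof (subst nn_integral_scale_measure)
    have gd: "?g \<in> borel_measurable (distr (restrict_space lborel ?U) (restrict_space borel (sphere 0 1)) (\<lambda>x. x /\<^sub>R norm x))"
      using gm by simp
    then show "?g \<in> borel_measurable (distr (restrict_space lborel ?U) (restrict_space borel (sphere 0 1)) (\<lambda>x. x /\<^sub>R norm x))" .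
    show "of_nat n * (\<integral>\<^sup>+ \<xi>. ?g \<xi> \<partial>distr (restrict_space lborel ?U) (restrict_space borel (sphere 0 1)) (\<lambda>x. x /\<^sub>R norm x)) =
      of_nat n * (\<integral>\<^sup>+ x. ?g (x /\<^sub>R norm x) \<partial>restrict_space lborel ?U)"
      by (subst nn_integral_distr[OF meas gd]) simp
  qed
  also have "(\<integral>\<^sup>+ x. ?g (x /\<^sub>R norm x) \<partial>restrict_space lborel ?U) = (\<integral>\<^sup>+ x. ?g (x /\<^sub>R norm x) * indicator ?U x \<partial>lborel)"
    by (rule nn_integral_restrict_space) auto
  also have "\<dots> = (\<integral>\<^sup>+ x. ennreal (\<rho> x ^ n) * indicator ?U x \<partial>lborel)"
  proof (rule nn_integral_cong)
    show "?g (x /\<^sub>R norm x) * indicator ?U x = ennreal (\<rho> x ^ n) * indicator ?U x" for x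
      using g\<rho>[of x] by (cases "x = 0") auto
  qed
  also have "\<dots> \<le> 2 ^ n * emeasure lborel {x. N x \<le> 1}"
  proof -
    \<comment> \<open>Dyadic radii below 1 / m, the largest value \<rho> can take. On A k the
      function \<rho> lies between s k and 2 s k.\<close>
    define s where "s k = 1 / m / 2 ^ Suc k" for k :: nat
    have s: "s k > 0" for k using m by (simp add: s_def)
    define A where "A k = {x. x \<noteq> 0 \<and> s k < \<rho> x \<and> \<rho> x \<le> 2 * s k}" for k
    have [measurable]: "A k \<in> sets borel" for k unfolding A_def by measurable
    have [measurable]: "A k \<inter> cball 0 a \<in> sets borel" for k a by auto
    have ex: "\<exists>k. x \<in> A k" if x: "x \<noteq> 0" for x
    proof -
      have "\<exists>k. s k < \<rho> x"
      proof -
        obtain k where k: "(1 / 2) ^ k < \<rho> x * m" using real_arch_pow_inv[of "\<rho> x * m" "1/2"] \<rho>(1)[OF x] m by auto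
        have "s k \<le> (1 / 2) ^ k / m" using m by (simp add: s_def power_one_over field_simps)
        also have "\<dots> < \<rho> x" using k m by (simp add: field_simps)
        finally show ?thesis by blast
      qed
      define k where "k = (LEAST k. s k < \<rho> x)"
      have k: "s k < \<rho> x" unfolding k_def using \<open>\<exists>k. s k < \<rho> x\<close> by (rule LeastI_ex)
      have "\<rho> x \<le> 2 * s k"
      proof (cases k)
        case 0
        then show ?thesis using \<rho>(2)[OF x] by (simp add: s_def)
      next
        case (Suc j)
        then have "\<not> s j < \<rho> x" unfolding k_def by (metis lessI not_less_Least)
        moreover have "2 * s k = s j" by (simp add: Suc s_def)
        ultimately show ?thesis by simp
      qed
      then show ?thesis using k x by (auto simp: A_def)
    qed
    have disj: "disjoint_family (\<lambda>k. A k \<inter> cball 0 (s k))"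
    proof -
      have "A i \<inter> A j = {}" if "i < j" for i j
      proof -
        have "2 * s j \<le> s i"
        proof -
          have "(2::real) ^ Suc i \<le> 2 ^ j" using that by (intro power_increasing) auto
          then show ?thesis using m by (simp add: s_def field_simps)
        qed
        then show ?thesis by (auto simp: A_def)
      qed
      then have "A i \<inter> A j = {}" if "i \<noteq> j" for i j using that by (metis Int_commute linorder_neq_iff)
      then show ?thesis by (auto simp: disjoint_family_on_def)
    qed
    have scale: "ennreal (s k ^ n) * emeasure lborel (A k \<inter> cball 0 1) = emeasure lborel (A k \<inter> cball 0 (s k))" for k
    proof -
      have eq: "(\<lambda>x. 0 + s k *\<^sub>R x) -` (A k \<inter> cball 0 (s k)) = A k \<inter> cball 0 1"
        using s[of k] \<rho>_scale[of "s k"] by (auto simp: A_def)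
      have "emeasure lborel (A k \<inter> cball 0 (s k)) =
          emeasure (density (distr lborel borel (\<lambda>x. 0 + s k *\<^sub>R x)) (\<lambda>_. ennreal (\<bar>s k\<bar> ^ DIM(real ^ 'n)))) (A k \<inter> cball 0 (s k))"
        using lborel_affine[of "s k" "0 :: real ^ 'n"] s[of k] by simp
      also have "\<dots> = ennreal (\<bar>s k\<bar> ^ DIM(real ^ 'n)) * emeasure lborel (A k \<inter> cball 0 1)"
        unfolding eq[symmetric] by (subst emeasure_density_const) (auto simp: emeasure_distr)
      finally show ?thesis using s[of k] by (simp add: n_def)
    qed
    have "(\<integral>\<^sup>+ x. ennreal (\<rho> x ^ n) * indicator ?U x \<partial>lborel) \<le>
        (\<integral>\<^sup>+ x. (\<Sum>k. ennreal ((2 * s k) ^ n) * indicator (A k \<inter> cball 0 1) x) \<partial>lborel)"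
    proof (rule nn_integral_mono)
      fix x
      show "ennreal (\<rho> x ^ n) * indicator ?U x \<le> (\<Sum>k. ennreal ((2 * s k) ^ n) * indicator (A k \<inter> cball 0 1) x)"
      proof (cases "x \<in> ?U")
        case True
        then obtain k where k: "x \<in> A k" using ex by auto
        have "ennreal (\<rho> x ^ n) * indicator ?U x \<le> ennreal ((2 * s k) ^ n) * indicator (A k \<inter> cball 0 1) x"
        proof -
          have "\<rho> x ^ n \<le> (2 * s k) ^ n" using True k \<rho>(1)[of x] by (intro power_mono) (auto simp: A_def)
          then show ?thesis using True k by (simp add: ennreal_leI del: power_mult_distrib)
        qed
        also have "\<dots> \<le> (\<Sum>k. ennreal ((2 * s k) ^ n) * indicator (A k \<inter> cball 0 1) x)"
          by (rule ennreal_term_le_suminf[of "\<lambda>k. ennreal ((2 * s k) ^ n) * indicator (A k \<inter> cball 0 1) x"])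
        finally show ?thesis .
      qed simp
    qed
    also have "\<dots> = (\<Sum>k. ennreal ((2 * s k) ^ n) * emeasure lborel (A k \<inter> cball 0 1))"
      by (subst nn_integral_suminf) (auto simp: nn_integral_cmult_indicator)
    also have "\<dots> = (\<Sum>k. 2 ^ n * emeasure lborel (A k \<inter> cball 0 (s k)))"
    proof (rule suminf_cong)
      fix k
      have "ennreal ((2 * s k) ^ n) = 2 ^ n * ennreal (s k ^ n)"
        using s[of k] by (simp add: power_mult_distrib ennreal_mult ennreal_power[symmetric])
      then show "ennreal ((2 * s k) ^ n) * emeasure lborel (A k \<inter> cball 0 1) = 2 ^ n * emeasure lborel (A k \<inter> cball 0 (s k))"
        using scale[of k] by (simp add: mult.assoc)
    qed
    also have "\<dots> = 2 ^ n * (\<Sum>k. emeasure lborel (A k \<inter> cball 0 (s k)))" by (rule ennreal_suminf_cmult)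
    also have "(\<Sum>k. emeasure lborel (A k \<inter> cball 0 (s k))) = emeasure lborel (\<Union>k. A k \<inter> cball 0 (s k))"
      by (rule suminf_emeasure[OF _ disj]) auto
    \<comment> \<open>On A k the radius of the unit ball of N exceeds s k, so the pieces cut off at
      radius s k lie inside that ball and, being disjoint, add up to at most its volume.\<close>
    also have "\<dots> \<le> emeasure lborel {x. N x \<le> 1}"
    proof (rule emeasure_mono)
      show "(\<Union>k. A k \<inter> cball 0 (s k)) \<subseteq> {x. N x \<le> 1}"
      proof clarsimp
        fix x k assume x: "x \<in> A k" "norm x \<le> s k"
        then have "norm x < norm x / N x" "x \<noteq> 0" by (auto simp: A_def \<rho>_def)
        then show "N x \<le> 1" using N'(7)[of x] by (simp add: less_divide_eq)
      qed
    qed measurable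
    finally show ?thesis by (simp add: mult_left_mono)
  qed
  finally show ?thesis by (simp add: n_def mult_left_mono)
qed

section \<open>The affine energy expressed through the directional variation\<close>

text \<open>In polar coordinates this is n times the volume of the unit ball of
  \<open>dir_var w\<close>, that is, of the polar projection body attached to w.\<close>

definition polar_integral :: "(real ^ 'n \<Rightarrow> real) \<Rightarrow> ennreal" where
  "polar_integral w = (\<integral>\<^sup>+ \<xi>. inverse (ennreal (dir_var w \<xi>) ^ CARD('n)) \<partial>sphere_measure)"

definition affine_constant :: "nat \<Rightarrow> real" where
  "affine_constant n = (2 * unit_ball_vol (real n - 1)) powr (-1) * (real n * unit_ball_vol (real n)) powr (1 + 1 / real n)"

text \<open>\<open>gradient_measure_dir_var\<close> holds for every gradient measure, in particular
  for the chosen one; bounded support provides the existence that gives the choice a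
  meaning.\<close>

lemma affine_energy_eq:
  fixes w :: "real ^ 'n \<Rightarrow> real"
  assumes w: "finite_variation w" and R: "\<And>x. R \<le> norm x \<Longrightarrow> w x = 0"
  shows "affine_energy w = (if polar_integral w = \<infinity> then 0
    else affine_constant CARD('n) * enn2real (polar_integral w) powr (- 1 / CARD('n)))"
proof -
  have "\<exists>D. is_gradient_measure w D" by (rule gradient_measure_exists[OF w R])
  then have "is_gradient_measure w (gradient_measure w)"
    unfolding gradient_measure_def by (rule someI_ex)
  from gradient_measure_dir_var[OF w this]
  show ?thesis
    by (simp add: affine_energy_def Let_def polar_integral_def affine_constant_def gradient_direction_def gradient_variation_def)
qed

lemma affine_constant_pos: "n \<ge> 1 \<Longrightarrow> affine_constant n > 0"
proof -
  assume "n \<ge> 1"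
  then have "unit_ball_vol (real n - 1) > 0" "unit_ball_vol (real n) > 0" by (intro unit_ball_vol_pos; simp)+
  then have "2 * unit_ball_vol (real n - 1) > 0" "real n * unit_ball_vol (real n) > 0" using \<open>n \<ge> 1\<close> by auto
  then show ?thesis unfolding affine_constant_def by (intro mult_pos_pos; subst powr_gt_zero; linarith)
qed

lemma seminorm_like_dir_var:
  fixes w :: "'a::euclidean_space \<Rightarrow> real"
  assumes w: "finite_variation w" and R: "R > 0" "\<And>x. R \<le> norm x \<Longrightarrow> w x = 0" and a: "0 < a" "a \<le> (LINT x|lborel. \<bar>w x\<bar>)"
  shows "seminorm_like (dir_var w) (a / R)"
  unfolding seminorm_like_def
proof (intro conjI allI continuous_on_dir_var w dir_var_add_le dir_var_scaleR)
  fix \<xi> :: 'a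
  have "a * norm \<xi> \<le> (LINT x|lborel. \<bar>w x\<bar>) * norm \<xi>" using a by (intro mult_right_mono) auto
  also have "\<dots> \<le> R * dir_var w \<xi>" by (rule dir_var_ge_L1[OF w R])
  finally show "a / R * norm \<xi> \<le> dir_var w \<xi>" using R(1) by (simp add: field_simps)
qed (use a R in auto)

lemma matrix_vector_columns: "(B :: real ^ 'n ^ 'n) *v t = (\<Sum>i\<in>UNIV. t $ i *\<^sub>R column i B)"
  by (simp add: matrix_mult_sum scalar_mult_eq_scaleR)

lemma dir_var_matrix_le:
  fixes B :: "real ^ 'n ^ 'n"
  assumes w: "finite_variation w" and B: "\<And>i. dir_var w (column i B) \<le> 1" and t: "\<And>i. \<bar>t $ i\<bar> \<le> r"
  shows "dir_var w (B *v t) \<le> r * CARD('n)"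
proof -
  have "dir_var w (B *v t) \<le> (\<Sum>i\<in>UNIV. \<bar>t $ i\<bar> * dir_var w (column i B))"
    unfolding matrix_vector_columns by (rule dir_var_sum_le[OF w]) simp
  also have "\<dots> \<le> (\<Sum>i\<in>(UNIV :: 'n set). r * 1)"
    using B t dir_var_nonneg[OF w] by (intro sum_mono mult_mono) (auto intro: order_trans[OF abs_ge_zero])
  finally show ?thesis by (simp add: mult.commute)
qed

lemma box_shift_bound_columns:
  fixes B :: "real ^ 'n ^ 'n"
  assumes w: "finite_variation w" and B: "\<And>i. dir_var w (column i B) \<le> 1"
  shows "box_shift_bound w B (CARD('n))"
  unfolding box_shift_bound_def
proof (intro allI impI)
  fix r :: real and t :: "real ^ 'n" assume "0 \<le> r" "\<forall>i. 0 \<le> t $ i \<and> t $ i \<le> r"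
  then have "dir_var w (B *v t) \<le> r * CARD('n)" by (intro dir_var_matrix_le[OF w B]) auto
  then show "shift_diff w (B *v t) \<le> r * CARD('n)" using shift_diff_le_dir_var[OF w, of "B *v t"] by linarith
qed

text \<open>The factor 4^n has two sources: 2^n from the dyadic comparison of sphere and volume, and
  2^n as the volume of the cube [-1, 1]^n, whose image under B contains the unit ball of
  \<open>dir_var w\<close>.\<close>

lemma polar_integral_parallelepiped:
  fixes w :: "real ^ 'n \<Rightarrow> real"
  assumes w: "finite_variation w" and N: "seminorm_like (dir_var w) m"
  obtains B :: "real ^ 'n ^ 'n" where "det B \<noteq> 0" "\<And>i. dir_var w (column i B) \<le> 1"
    "polar_integral w \<le> ennreal (CARD('n) * 4 ^ CARD('n) * \<bar>det B\<bar>)"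
proof -
  obtain B :: "real ^ 'n ^ 'n" where B: "det B \<noteq> 0" "\<And>i. dir_var w (column i B) \<le> 1"
    "\<And>x. dir_var w x \<le> 1 \<Longrightarrow> \<exists>t. (\<forall>i. \<bar>t $ i\<bar> \<le> 1) \<and> x = B *v t"
    by (rule Auerbach[OF N]) blast
  define n where "n = CARD('n)"
  let ?Q = "cbox (\<chi> i. - 1) (\<chi> i. 1) :: (real ^ 'n) set"
  have "{x. dir_var w x \<le> 1} \<subseteq> (*v) B ` ?Q"
  proof
    fix x assume "x \<in> {x. dir_var w x \<le> 1}"
    then obtain t where t: "\<forall>i. \<bar>t $ i\<bar> \<le> 1" "x = B *v t" using B(3)[of x] by auto
    have "- 1 \<le> t $ i \<and> t $ i \<le> 1" for i using t(1)[rule_format, of i] by (simp add: abs_le_iff)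
    then have "t \<in> ?Q" by (simp add: mem_box_cart)
    then show "x \<in> (*v) B ` ?Q" using t(2) by blast
  qed
  then have "emeasure lborel {x. dir_var w x \<le> 1} \<le> emeasure lborel ((*v) B ` ?Q)"
    using emeasure_linear_image_cbox(1)[OF B(1)] by (intro emeasure_mono) auto
  also have "\<dots> = ennreal \<bar>det B\<bar> * ennreal (2 ^ n)"
    unfolding emeasure_linear_image_cbox(2)[OF B(1)] by (subst emeasure_box_cart) (auto simp: n_def)
  finally have v: "emeasure lborel {x. dir_var w x \<le> 1} \<le> ennreal (\<bar>det B\<bar> * 2 ^ n)" by (simp add: ennreal_mult)
  have "polar_integral w \<le> of_nat n * (2 ^ n * emeasure lborel {x. dir_var w x \<le> 1})"
    unfolding polar_integral_def n_def by (rule sphere_integral_le_volume[OF N])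
  also have "\<dots> \<le> of_nat n * (2 ^ n * ennreal (\<bar>det B\<bar> * 2 ^ n))" by (intro mult_left_mono v) auto
  also have "\<dots> = ennreal (real n) * (ennreal (2 ^ n) * ennreal (\<bar>det B\<bar> * 2 ^ n))"
    by (simp add: ennreal_of_nat_eq_real_of_nat ennreal_power[symmetric])
  also have "\<dots> = ennreal (real n * (2 ^ n * (\<bar>det B\<bar> * 2 ^ n)))" by (simp add: ennreal_mult)
  also have "real n * (2 ^ n * (\<bar>det B\<bar> * 2 ^ n)) = real n * 4 ^ n * \<bar>det B\<bar>"
  proof -
    have "(4::real) ^ n = 2 ^ n * 2 ^ n" by (simp flip: power_mult_distrib)
    then show ?thesis by simp
  qed
  finally show ?thesis using that[OF B(1,2)] by (simp add: n_def)
qed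

text \<open>Finite variation bounds \<open>dir_var w\<close> on the sphere, which has positive
  measure. The value 0 must be excluded because \<open>powr\<close> sends 0 to 0 even for negative
  exponents.\<close>

lemma polar_integral_pos:
  fixes w :: "real ^ 'n \<Rightarrow> real"
  assumes w: "finite_variation w"
  shows "0 < polar_integral w"
proof -
  define n where "n = CARD('n)"
  obtain C0 where C0: "\<And>h. shift_diff w h \<le> C0 * norm h" using w by (auto simp: finite_variation_def)
  define C where "C = \<bar>C0\<bar> + 1"
  have C: "C > 0" by (simp add: C_def)
  have N: "dir_var w \<xi> \<le> C" if "norm \<xi> = 1" for \<xi>
    using dir_var_le_norm[OF C0, of \<xi>] that by (simp add: C_def)
  have "0 < emeasure (sphere_measure :: (real ^ 'n) measure) (sphere 0 1)"
  proof -
    have "emeasure (sphere_measure :: (real ^ 'n) measure) (sphere 0 1) =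
        of_nat CARD('n) * emeasure lborel {r *\<^sub>R \<xi> | r \<xi>. 0 < r \<and> r \<le> 1 \<and> \<xi> \<in> sphere (0 :: real ^ 'n) 1}"
      by (rule emeasure_sphere_measure) auto
    also have "{r *\<^sub>R \<xi> | r \<xi>. 0 < r \<and> r \<le> 1 \<and> \<xi> \<in> sphere (0 :: real ^ 'n) 1} = cball 0 1 - {0}"
    proof (intro equalityI subsetI)
      fix x :: "real ^ 'n" assume "x \<in> cball 0 1 - {0}"
      then have "x = norm x *\<^sub>R (x /\<^sub>R norm x) \<and> 0 < norm x \<and> norm x \<le> 1 \<and> x /\<^sub>R norm x \<in> sphere 0 1" by auto
      then show "x \<in> {r *\<^sub>R \<xi> | r \<xi>. 0 < r \<and> r \<le> 1 \<and> \<xi> \<in> sphere (0 :: real ^ 'n) 1}" by blast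
    qed auto
    also have "emeasure lborel (cball 0 1 - {0 :: real ^ 'n}) = emeasure lborel (cball (0 :: real ^ 'n) 1)"
      by (rule emeasure_Diff_null_set) auto
    finally show ?thesis
      by (simp add: emeasure_cball ennreal_zero_less_mult_iff unit_ball_vol_pos ennreal_of_nat_eq_real_of_nat)
  qed
  moreover have "ennreal (inverse (C ^ n)) * emeasure (sphere_measure :: (real ^ 'n) measure) (sphere 0 1) \<le> polar_integral w"
  proof -
    have "ennreal (inverse (C ^ n)) * emeasure (sphere_measure :: (real ^ 'n) measure) (sphere 0 1) =
        (\<integral>\<^sup>+ \<xi>. ennreal (inverse (C ^ n)) \<partial>(sphere_measure :: (real ^ 'n) measure))"
      by (simp add: space_sphere_measure)
    also have "\<dots> \<le> polar_integral w"
      unfolding polar_integral_def n_def[symmetric]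
    proof (rule nn_integral_mono)
      fix \<xi> assume "\<xi> \<in> space (sphere_measure :: (real ^ 'n) measure)"
      then have "ennreal (dir_var w \<xi>) ^ n \<le> ennreal C ^ n"
        using N by (intro power_mono ennreal_leI) (auto simp: space_sphere_measure)
      then have "inverse (ennreal C ^ n) \<le> inverse (ennreal (dir_var w \<xi>) ^ n)" by (rule inverse_ennreal_antimono)
      then show "ennreal (inverse (C ^ n)) \<le> inverse (ennreal (dir_var w \<xi>) ^ n)"
        using C by (simp add: ennreal_power inverse_ennreal)
    qed
    finally show ?thesis .
  qed
  ultimately show ?thesis
    using C by (metis ennreal_less_zero_iff ennreal_zero_less_mult_iff inverse_positive_iff_positive less_le_trans zero_less_power)
qed

text \<open>By Cramer's rule the coefficients of a unit vector in the columns of B are determinants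
  with entries at most max M 1, divided by det B. Columns of bounded length and a determinant
  bounded below thus bound the coefficients, and subadditivity bounds the variation in every
  direction.\<close>

lemma dir_var_bound_of_det:
  fixes B :: "real ^ 'n ^ 'n"
  assumes w: "finite_variation w" and B: "\<And>i. dir_var w (column i B) \<le> 1" "c \<le> \<bar>det B\<bar>" "c > 0"
    and M: "\<And>i. norm (column i B) \<le> M"
  shows "dir_var w \<xi> \<le> (\<Sum>p\<in>{p. p permutes (UNIV :: 'n set)}. max M 1 ^ CARD('n)) / c * CARD('n) * norm \<xi>"
proof (cases "\<xi> = 0")
  case True then show ?thesis by (simp add: dir_var_0[OF w])
next
  case False
  define K where "K = (\<Sum>p\<in>{p. p permutes (UNIV :: 'n set)}. max M 1 ^ CARD('n))"
  have dB: "det B \<noteq> 0" using B by auto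
  define e where "e = \<xi> /\<^sub>R norm \<xi>"
  have e: "norm e = 1" "\<xi> = norm \<xi> *\<^sub>R e" using False by (auto simp: e_def)
  define R where "R k = (\<chi> i j. if j = k then e $ i else B $ i $ j)" for k
  define t where "t = (\<chi> k. det (R k) / det B)"
  have "\<bar>R k $ i $ j\<bar> \<le> max M 1" for i j k
  proof (cases "j = k")
    case True
    then show ?thesis using component_le_norm_cart[of e i] e(1) by (simp add: R_def)
  next
    case False
    then have "\<bar>R k $ i $ j\<bar> \<le> norm (column j B)"
      using component_le_norm_cart[of "column j B" i] by (simp add: R_def column_def)
    then show ?thesis using M[of j] by simp
  qed
  then have "\<bar>det (R k)\<bar> \<le> K" for k unfolding K_def by (rule det_bound)
  then have "\<bar>t $ k\<bar> \<le> K / c" for k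
    unfolding t_def using B(2,3) by (simp add: abs_divide) (intro frac_le; use order_trans[OF abs_ge_zero] in auto)
  then have "dir_var w (B *v t) \<le> K / c * CARD('n)" by (intro dir_var_matrix_le[OF w B(1)])
  moreover have "e = B *v t" unfolding t_def R_def by (rule cramer_solution[OF dB])
  ultimately have "norm \<xi> * dir_var w e \<le> norm \<xi> * (K / c * CARD('n))" by (intro mult_left_mono) auto
  moreover have "dir_var w \<xi> = norm \<xi> * dir_var w e" using dir_var_scaleR[OF w, of "norm \<xi>" e] e(2) by simp
  ultimately show ?thesis by (simp add: K_def mult_ac)
qed

subsection \<open>Sequences in the affine ball\<close>

lemma affine_energy_nonneg: "0 \<le> affine_energy w"
  by (simp add: affine_energy_def Let_def)

text \<open>Translates upper bounds on the energy into lower bounds on the polar integral, where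
  integral estimates and limits are taken.\<close>

lemma powr_threshold:
  fixes a b J :: real
  assumes "a > 0" "b > 0" "J > 0" "n > 0"
  shows "a * J powr (- 1 / real n) \<le> b \<longleftrightarrow> (a / b) ^ n \<le> J"
proof -
  have Jn: "(J powr (1 / n)) ^ n = J" using assms by (subst powr_realpow[symmetric]) (auto simp: powr_powr)
  have "a * J powr (- 1 / real n) = a / J powr (1 / n)" by (simp add: powr_minus_divide)
  moreover have "a / X \<le> b \<longleftrightarrow> a / b \<le> X" if "X > 0" for X using assms that by (simp add: field_simps)
  ultimately have "a * J powr (- 1 / real n) \<le> b \<longleftrightarrow> a / b \<le> J powr (1 / n)"
    using assms by (simp only: powr_gt_zero)
  also have "\<dots> \<longleftrightarrow> (a / b) ^ n \<le> (J powr (1 / n)) ^ n"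
    using assms power_mono_iff[of "a / b" "J powr (1 / n)" n] by simp
  finally show ?thesis unfolding Jn .
qed

text \<open>For w of positive L^1 norm the unit ball of \<open>dir_var w\<close> is bounded, hence
  the integral is finite and the convention for infinite integrals does not apply.\<close>

lemma polar_integral_finite:
  fixes w :: "real ^ 'n \<Rightarrow> real"
  assumes w: "finite_variation w" and R: "R > 0" "\<And>x. R \<le> norm x \<Longrightarrow> w x = 0" and a: "0 < (LINT x|lborel. \<bar>w x\<bar>)"
  obtains J where "J > 0" "polar_integral w = ennreal J"
    "affine_energy w = affine_constant CARD('n) * J powr (- 1 / CARD('n))"
proof -
  have N: "seminorm_like (dir_var w) ((LINT x|lborel. \<bar>w x\<bar>) / R)"
    by (rule seminorm_like_dir_var[OF w R a order_refl])
  obtain B :: "real ^ 'n ^ 'n" where "polar_integral w \<le> ennreal (CARD('n) * 4 ^ CARD('n) * \<bar>det B\<bar>)"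
    by (rule polar_integral_parallelepiped[OF w N])
  then have f: "polar_integral w < \<infinity>" by (rule order_le_less_trans) simp
  define J where "J = enn2real (polar_integral w)"
  have J: "polar_integral w = ennreal J" using f by (simp add: J_def)
  have "J > 0" using polar_integral_pos[OF w] unfolding J by simp
  then show ?thesis using that[of J] J affine_energy_eq[OF w R(2)] by simp
qed

text \<open>Energy at most 1 means a polar integral of at least \<alpha>^n, and the Auerbach
  parallelepiped turns this into a bound on its determinant. That bound is free of a; only the
  length of the columns depends on a. The first fact serves sequences with vanishing L^1 norm, both
  together serve the others.\<close>

lemma affine_ball_parallelepiped:
  fixes w :: "real ^ 'n \<Rightarrow> real"
  assumes w: "finite_variation w" and R: "R > 0" "\<And>x. R \<le> norm x \<Longrightarrow> w x = 0"
    and a: "0 < a" "a \<le> (LINT x|lborel. \<bar>w x\<bar>)" and E: "affine_energy w \<le> 1"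
  obtains B :: "real ^ 'n ^ 'n" where "affine_constant CARD('n) ^ CARD('n) / (CARD('n) * 4 ^ CARD('n)) \<le> \<bar>det B\<bar>"
    "\<And>i. dir_var w (column i B) \<le> 1" "\<And>i. norm (column i B) \<le> R / a"
proof -
  define n where "n = CARD('n)"
  have N: "seminorm_like (dir_var w) (a / R)" by (rule seminorm_like_dir_var[OF w R a])
  have w0: "0 < (LINT x|lborel. \<bar>w x\<bar>)" using a by linarith
  obtain B :: "real ^ 'n ^ 'n" where B: "\<And>i. dir_var w (column i B) \<le> 1"
    "polar_integral w \<le> ennreal (CARD('n) * 4 ^ CARD('n) * \<bar>det B\<bar>)"
    by (rule polar_integral_parallelepiped[OF w N]) blast
  obtain J where J: "J > 0" "polar_integral w = ennreal J"
    "affine_energy w = affine_constant CARD('n) * J powr (- 1 / CARD('n))"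
    by (rule polar_integral_finite[OF w R w0]) blast
  have n: "n > 0" by (simp add: n_def)
  have "affine_constant n > 0" using affine_constant_pos[of n] n by simp
  then have "(affine_constant n / 1) ^ n \<le> J"
    using J(3) E powr_threshold[of "affine_constant n" 1 J n] J(1) n by (simp add: n_def)
  moreover have "J \<le> n * 4 ^ n * \<bar>det B\<bar>"
    using B(2) unfolding J(2) n_def by (subst (asm) ennreal_le_iff) auto
  ultimately have "affine_constant n ^ n / (n * 4 ^ n) \<le> \<bar>det B\<bar>" using n by (simp add: field_simps)
  moreover have "norm (column i B) \<le> R / a" for i
  proof -
    have "a / R * norm (column i B) \<le> 1" using seminorm_likeD(5)[OF N, of "column i B"] B(1)[of i] by linarith
    then show ?thesis using a R(1) by (simp add: field_simps)
  qed
  ultimately show ?thesis using that B(1) by (simp add: n_def)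
qed

lemma box_shift_bound_identity:
  fixes w :: "real ^ 'n \<Rightarrow> real"
  assumes C: "\<And>h. shift_diff w h \<le> C * norm h" and "0 \<le> C"
  shows "box_shift_bound w (mat 1) (C * CARD('n))"
  unfolding box_shift_bound_def
proof (intro allI impI)
  fix r :: real and t :: "real ^ 'n" assume t: "\<forall>i. 0 \<le> t $ i \<and> t $ i \<le> r"
  have "norm t \<le> (\<Sum>i\<in>UNIV. \<bar>t $ i\<bar>)" by (rule norm_le_l1_cart)
  also have "\<dots> \<le> (\<Sum>i\<in>(UNIV :: 'n set). r)" using t by (intro sum_mono) auto
  finally have "norm t \<le> r * CARD('n)" by (simp add: mult.commute)
  then have "C * norm t \<le> C * (r * CARD('n))" using \<open>0 \<le> C\<close> by (intro mult_left_mono)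
  then show "shift_diff w (mat 1 *v t) \<le> r * (C * CARD('n))"
    using C[of t] by (simp add: mult_ac)
qed

section \<open>Semicontinuity of the affine energy\<close>

text \<open>A value y below the supremum is beaten by a single quotient, and for this fixed
  displacement \<open>shift_diff\<close> is continuous in L^1.\<close>

lemma dir_var_lower_semicontinuous:
  fixes w :: "'a::euclidean_space \<Rightarrow> real" and f :: "nat \<Rightarrow> 'a \<Rightarrow> real"
  assumes w: "finite_variation w" and f: "\<And>k. finite_variation (f k)"
    and lim: "(\<lambda>k. LINT x|lborel. \<bar>f k x - w x\<bar>) \<longlonglongrightarrow> 0" and y: "y < dir_var w \<xi>"
  shows "\<forall>\<^sub>F k in sequentially. y \<le> dir_var (f k) \<xi>"
proof -
  have "\<exists>t>0. t * y < shift_diff w (t *\<^sub>R \<xi>)"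
  proof (rule ccontr)
    assume "\<not> (\<exists>t>0. t * y < shift_diff w (t *\<^sub>R \<xi>))"
    then have "shift_diff w (t *\<^sub>R \<xi>) \<le> t * y" if "t > 0" for t using that by (meson not_less)
    then have "dir_var w \<xi> \<le> y" by (rule dir_var_least)
    then show False using y by simp
  qed
  then obtain t where t: "t > 0" "t * y < shift_diff w (t *\<^sub>R \<xi>)" by blast
  have "\<forall>\<^sub>F k in sequentially. (LINT x|lborel. \<bar>f k x - w x\<bar>) < (shift_diff w (t *\<^sub>R \<xi>) - t * y) / 2"
    by (rule order_tendstoD(2)[OF lim]) (use t in simp)
  then show ?thesis
  proof eventually_elim
    fix k assume k: "(LINT x|lborel. \<bar>f k x - w x\<bar>) < (shift_diff w (t *\<^sub>R \<xi>) - t * y) / 2"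
    have "shift_diff w (t *\<^sub>R \<xi>) \<le> shift_diff (f k) (t *\<^sub>R \<xi>) + 2 * (LINT x|lborel. \<bar>w x - f k x\<bar>)"
      by (rule shift_diff_L1_le[OF finite_variation_integrable[OF w] finite_variation_integrable[OF f]])
    also have "(LINT x|lborel. \<bar>w x - f k x\<bar>) = (LINT x|lborel. \<bar>f k x - w x\<bar>)" by (simp add: abs_minus_commute)
    finally have "shift_diff w (t *\<^sub>R \<xi>) \<le> shift_diff (f k) (t *\<^sub>R \<xi>) + 2 * (LINT x|lborel. \<bar>f k x - w x\<bar>)" .
    moreover have "shift_diff (f k) (t *\<^sub>R \<xi>) \<le> t * dir_var (f k) \<xi>" using dir_var_upper[OF f] t by simp
    ultimately have "t * y \<le> t * dir_var (f k) \<xi>" using k by argo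
    then show "y \<le> dir_var (f k) \<xi>" using t by simp
  qed
qed

lemma sphere_measure_finite: "emeasure (sphere_measure :: (real ^ 'n) measure) (sphere 0 1) < \<infinity>"
proof -
  have "emeasure (sphere_measure :: (real ^ 'n) measure) (sphere 0 1) =
      of_nat CARD('n) * emeasure lborel {r *\<^sub>R \<xi> | r \<xi>. 0 < r \<and> r \<le> 1 \<and> \<xi> \<in> sphere (0 :: real ^ 'n) 1}"
    by (rule emeasure_sphere_measure) auto
  also have "\<dots> \<le> of_nat CARD('n) * emeasure lborel (cball (0 :: real ^ 'n) 1)"
    by (intro mult_left_mono emeasure_mono) auto
  also have "\<dots> < \<infinity>"
    using emeasure_lborel_cball_finite[of "0 :: real ^ 'n" 1] by (simp add: ennreal_mult_less_top ennreal_of_nat_eq_real_of_nat)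
  finally show ?thesis .
qed

text \<open>Reverse Fatou applied to the lower semicontinuity of each directional variation.\<close>

lemma polar_integral_upper_semicontinuous:
  fixes w :: "real ^ 'n \<Rightarrow> real"
  assumes w: "finite_variation w" and f: "\<And>k. finite_variation (f k)"
    and lim: "(\<lambda>k. LINT x|lborel. \<bar>f k x - w x\<bar>) \<longlonglongrightarrow> 0"
    and m: "m > 0" "\<And>k \<xi>. m * norm \<xi> \<le> dir_var (f k) \<xi>" "\<And>\<xi>. m * norm \<xi> \<le> dir_var w \<xi>"
  shows "limsup (\<lambda>k. polar_integral (f k)) \<le> polar_integral w"
proof -
  define n where "n = CARD('n)"
  let ?u = "\<lambda>k \<xi>. inverse (ennreal (dir_var (f k) \<xi>) ^ n)"
  let ?S = "sphere_measure :: (real ^ 'n) measure"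
  have meas: "(\<lambda>\<xi>. inverse (ennreal (dir_var v \<xi>) ^ n)) \<in> borel_measurable ?S" if v: "finite_variation v" for v
  proof -
    have [measurable]: "dir_var v \<in> borel_measurable borel" using v by measurable
    have "(\<lambda>\<xi>. inverse (ennreal (dir_var v \<xi>) ^ n)) \<in> borel_measurable (restrict_space borel (sphere 0 1))"
      by (rule measurable_restrict_space1) measurable
    then show ?thesis by (simp add: sphere_measure_def)
  qed
  have "limsup (\<lambda>k. \<integral>\<^sup>+ \<xi>. ?u k \<xi> \<partial>?S) \<le> (\<integral>\<^sup>+ \<xi>. limsup (\<lambda>k. ?u k \<xi>) \<partial>?S)"
  \<comment> \<open>Reverse Fatou needs an integrable majorant. The uniform lower bound m on the
    sphere provides a constant one, and the sphere has finite measure.\<close>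
  proof (rule nn_integral_limsup[where w = "\<lambda>_. inverse (ennreal m ^ n)"])
    show "AE \<xi> in ?S. ?u k \<xi> \<le> inverse (ennreal m ^ n)" for k
    proof (rule AE_I2)
      fix \<xi> assume "\<xi> \<in> space ?S"
      then have "m \<le> dir_var (f k) \<xi>" using m(2)[of \<xi> k] by (simp add: space_sphere_measure)
      then have "ennreal m ^ n \<le> ennreal (dir_var (f k) \<xi>) ^ n" by (intro power_mono ennreal_leI) auto
      then show "?u k \<xi> \<le> inverse (ennreal m ^ n)" by (rule inverse_ennreal_antimono)
    qed
    show "(\<integral>\<^sup>+ \<xi>. inverse (ennreal m ^ n) \<partial>?S) < \<infinity>"
      using m(1) sphere_measure_finite[where 'n = 'n] by (simp add: space_sphere_measure ennreal_power inverse_ennreal ennreal_mult_less_top)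
  qed (use meas f in auto)
  also have "\<dots> \<le> (\<integral>\<^sup>+ \<xi>. inverse (ennreal (dir_var w \<xi>) ^ n) \<partial>?S)"
  proof (rule nn_integral_mono)
    fix \<xi> assume "\<xi> \<in> space ?S"
    then have V: "0 < dir_var w \<xi>" using m(3)[of \<xi>] m(1) by (simp add: space_sphere_measure)
    define V where "V = dir_var w \<xi>"
    have V0: "V > 0" using V by (simp add: V_def)
    have le: "limsup (\<lambda>k. ?u k \<xi>) \<le> ennreal (inverse (y ^ n))" if y: "0 < y" "y < V" for y
    proof (rule Limsup_bounded)
      show "\<forall>\<^sub>F k in sequentially. ?u k \<xi> \<le> ennreal (inverse (y ^ n))"
        using dir_var_lower_semicontinuous[OF w f lim y(2)[unfolded V_def]]
      proof eventually_elim
        fix k assume "y \<le> dir_var (f k) \<xi>"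
        then have "ennreal y ^ n \<le> ennreal (dir_var (f k) \<xi>) ^ n" by (intro power_mono ennreal_leI) auto
        then have "?u k \<xi> \<le> inverse (ennreal y ^ n)" by (rule inverse_ennreal_antimono)
        then show "?u k \<xi> \<le> ennreal (inverse (y ^ n))" using y(1) by (simp add: ennreal_power inverse_ennreal)
      qed
    qed
    have "((\<lambda>y. ennreal (inverse (y ^ n))) \<longlongrightarrow> ennreal (inverse (V ^ n))) (at_left V)"
      using V0 by (intro tendsto_ennrealI tendsto_intros) auto
    then have "limsup (\<lambda>k. ?u k \<xi>) \<le> ennreal (inverse (V ^ n))"
    proof (rule tendsto_lowerbound)
      show "\<forall>\<^sub>F y in at_left V. limsup (\<lambda>k. ?u k \<xi>) \<le> ennreal (inverse (y ^ n))"
        using eventually_at_left_real[OF V0] by eventually_elim (use le in auto)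
    qed simp
    then show "limsup (\<lambda>k. ?u k \<xi>) \<le> inverse (ennreal (dir_var w \<xi>) ^ n)"
      using V0 unfolding V_def[symmetric] by (simp add: ennreal_power inverse_ennreal)
  qed
  finally show ?thesis by (simp add: polar_integral_def n_def)
qed

text \<open>Here the integrand is infinite on the whole sphere, and the convention for an infinite
  outer integral gives the value 0.\<close>

lemma affine_energy_zero:
  "affine_energy (\<lambda>x :: real ^ 'n. 0) = 0" "finite_variation (\<lambda>x :: real ^ 'n. 0)"
proof -
  have s: "shift_diff (\<lambda>x :: real ^ 'n. 0) h = 0" for h by (simp add: shift_diff_def)
  then show fv: "finite_variation (\<lambda>x :: real ^ 'n. 0)" by (auto simp: finite_variation_def intro!: exI[of _ 0])
  have "dir_var (\<lambda>x :: real ^ 'n. 0) \<xi> \<le> 0 * norm \<xi>" for \<xi> by (rule dir_var_le_norm) (simp add: s)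
  then have d: "ennreal (dir_var (\<lambda>x :: real ^ 'n. 0) \<xi>) = 0" for \<xi> by (simp add: ennreal_neg)
  have "polar_integral (\<lambda>x :: real ^ 'n. 0) = \<infinity> * emeasure sphere_measure (sphere (0 :: real ^ 'n) 1)"
    by (simp add: polar_integral_def d space_sphere_measure power_0_left)
  \<comment> \<open>If the sphere had measure 0, the product with infinity would be 0, against the
    positivity of the polar integral.\<close>
  moreover have "emeasure sphere_measure (sphere (0 :: real ^ 'n) 1) \<noteq> 0"
  proof
    assume "emeasure sphere_measure (sphere (0 :: real ^ 'n) 1) = 0"
    then show False using calculation polar_integral_pos[OF fv] by simp
  qed
  ultimately have "polar_integral (\<lambda>x :: real ^ 'n. 0) = \<infinity>" by (simp add: ennreal_top_mult)
  then show "affine_energy (\<lambda>x :: real ^ 'n. 0) = 0" using affine_energy_eq[OF fv, of 0] by simp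
qed

text \<open>An energy of w above the limit of the bounds would leave a number b in between, and the
  corresponding threshold for polar integrals contradicts their upper semicontinuity. The common
  lower bound a on the L^1 norms makes all directional variations uniformly nondegenerate.\<close>

lemma affine_energy_lower_semicontinuous:
  fixes w :: "real ^ 'n \<Rightarrow> real"
  assumes w: "finite_variation w" and f: "\<And>k. finite_variation (f k)"
    and R: "R > 0" "\<And>k x. R \<le> norm x \<Longrightarrow> f k x = 0" "\<And>x. R \<le> norm x \<Longrightarrow> w x = 0"
    and lim: "(\<lambda>k. LINT x|lborel. \<bar>f k x - w x\<bar>) \<longlonglongrightarrow> 0"
    and a: "0 < a" "\<And>k. a \<le> (LINT x|lborel. \<bar>f k x\<bar>)" "a \<le> (LINT x|lborel. \<bar>w x\<bar>)"
    and E: "\<And>k. affine_energy (f k) \<le> s k" "s \<longlonglongrightarrow> s0" "\<And>k. 0 \<le> s k"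
  shows "affine_energy w \<le> s0"
proof (rule ccontr)
  define n where "n = CARD('n)"
  have n: "n > 0" by (simp add: n_def)
  define \<alpha> where "\<alpha> = affine_constant n"
  have \<alpha>: "\<alpha> > 0" using affine_constant_pos[of n] n by (simp add: \<alpha>_def)
  assume "\<not> affine_energy w \<le> s0"
  then obtain b where b: "s0 < b" "b < affine_energy w" using dense by (auto simp: not_le)
  have "0 \<le> s0" by (rule LIMSEQ_le_const[OF E(2)]) (use E(3) in auto)
  then have b0: "b > 0" using b by linarith
  have w0: "0 < (LINT x|lborel. \<bar>w x\<bar>)" using a by linarith
  obtain J where J: "J > 0" "polar_integral w = ennreal J" "affine_energy w = \<alpha> * J powr (- 1 / n)"
    unfolding \<alpha>_def n_def by (rule polar_integral_finite[OF w R(1,3) w0]) blast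
  have Jb: "J < (\<alpha> / b) ^ n" using powr_threshold[OF \<alpha> b0 J(1) n] b J(3) by linarith
  have "\<forall>\<^sub>F k in sequentially. s k < b" by (rule order_tendstoD(2)[OF E(2) b(1)])
  then have "\<forall>\<^sub>F k in sequentially. ennreal ((\<alpha> / b) ^ n) \<le> polar_integral (f k)"
  proof eventually_elim
    fix k assume k: "s k < b"
    have f0: "0 < (LINT x|lborel. \<bar>f k x\<bar>)" using a(1) a(2)[of k] by linarith
    obtain Jk where Jk: "Jk > 0" "polar_integral (f k) = ennreal Jk" "affine_energy (f k) = \<alpha> * Jk powr (- 1 / n)"
      unfolding \<alpha>_def n_def by (rule polar_integral_finite[OF f R(1,2) f0]) blast
    have "\<alpha> * Jk powr (- 1 / n) \<le> b" using E(1)[of k] k Jk(3) by linarith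
    then have "(\<alpha> / b) ^ n \<le> Jk" using powr_threshold[OF \<alpha> b0 Jk(1) n] by simp
    then show "ennreal ((\<alpha> / b) ^ n) \<le> polar_integral (f k)" unfolding Jk(2) by (rule ennreal_leI)
  qed
  then have "ennreal ((\<alpha> / b) ^ n) \<le> liminf (\<lambda>k. polar_integral (f k))" by (rule Liminf_bounded)
  also have "\<dots> \<le> limsup (\<lambda>k. polar_integral (f k))" by (rule Liminf_le_Limsup) simp
  also have "\<dots> \<le> polar_integral w"
  proof (rule polar_integral_upper_semicontinuous[OF w f lim])
    show "a / R > 0" using a R by simp
    show "a / R * norm \<xi> \<le> dir_var (f k) \<xi>" for k \<xi>
      by (rule seminorm_likeD(5)[OF seminorm_like_dir_var[OF f R(1,2) a(1,2)]])
    show "a / R * norm \<xi> \<le> dir_var w \<xi>" for \<xi>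
      by (rule seminorm_likeD(5)[OF seminorm_like_dir_var[OF w R(1,3) a(1,3)]])
  qed
  also have "\<dots> = ennreal J" by (rule J(2))
  finally have "(\<alpha> / b) ^ n \<le> J" using J(1) by (subst (asm) ennreal_le_iff) auto
  then show False using Jb by simp
qed

lemma nn_integral_tendsto_0I:
  fixes g :: "nat \<Rightarrow> 'a \<Rightarrow> ennreal"
  assumes "\<And>e. e > 0 \<Longrightarrow> \<forall>\<^sub>F k in sequentially. (\<integral>\<^sup>+ x. g k x \<partial>M) \<le> ennreal e"
  shows "(\<lambda>k. \<integral>\<^sup>+ x. g k x \<partial>M) \<longlonglongrightarrow> 0"
proof (rule order_tendstoI)
  fix a :: ennreal assume a: "0 < a"
  obtain e where e: "e > 0" "ennreal e < a"
  proof (cases a)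
    case (real r)
    then show ?thesis using a that[of "r / 2"] by (auto simp: ennreal_less_iff)
  next
    case top
    then show ?thesis using that[of 1] by simp
  qed
  show "\<forall>\<^sub>F k in sequentially. (\<integral>\<^sup>+ x. g k x \<partial>M) < a"
    using assms[OF e(1)] by eventually_elim (use e(2) in auto)
qed simp

lemma affine_ball_sequence:
  fixes f :: "nat \<Rightarrow> real ^ 'n \<Rightarrow> real"
  assumes n: "CARD('n) \<ge> 2" and \<Omega>: "open \<Omega>" "bounded \<Omega>"
    and q: "1 \<le> q" "q < real CARD('n) / (real CARD('n) - 1)"
    and f: "\<And>k. finite_variation (f k)" "\<And>k x. x \<notin> \<Omega> \<Longrightarrow> f k x = 0"
    and E: "\<And>k. (LINT x|lborel. \<bar>f k x\<bar>) + affine_energy (f k) \<le> 1"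
  obtains r w where "strict_mono (r :: nat \<Rightarrow> nat)" "finite_variation w" "\<And>x. x \<notin> \<Omega> \<Longrightarrow> w x = 0"
    "(LINT x|lborel. \<bar>w x\<bar>) + affine_energy w \<le> 1"
    "(\<lambda>k. \<integral>\<^sup>+ x. ennreal (\<bar>f (r k) x - w x\<bar> powr q) \<partial>lborel) \<longlonglongrightarrow> 0"
proof -
  define a where "a k = (LINT x|lborel. \<bar>f k x\<bar>)" for k
  have fi: "integrable lborel (f k)" for k by (rule finite_variation_integrable[OF f(1)])
  have a0: "0 \<le> a k" for k by (simp add: a_def)
  have a1: "a k \<le> 1" and E1: "affine_energy (f k) \<le> 1" for k
    using E[of k] affine_energy_nonneg[of "f k"] a0[of k] unfolding a_def by linarith+
  obtain R0 where R0: "R0 > 0" "\<Omega> \<subseteq> ball 0 R0" using bounded_subset_ballD[OF \<Omega>(2)] by blast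
  have out: "x \<notin> \<Omega>" if "R0 \<le> norm x" for x using R0(2) that by auto
  have fR: "f k x = 0" if "R0 \<le> norm x" for k x using f(2) out[OF that] by blast
  define c0 where "c0 = affine_constant CARD('n) ^ CARD('n) / (CARD('n) * 4 ^ CARD('n))"
  have c0: "c0 > 0" using affine_constant_pos[of "CARD('n)"] n by (simp add: c0_def)
  \<comment> \<open>The L^1 norms lie in [0, 1], so they converge along a subsequence. The argument
    splits according to the limit.\<close>
  obtain a' r0 where a': "a' \<in> {0..1}" and r0: "strict_mono (r0 :: nat \<Rightarrow> nat)" "(a \<circ> r0) \<longlonglongrightarrow> a'"
    by (rule seq_compactE[OF compact_imp_seq_compact[OF compact_Icc[of 0 "1::real"]], of a]) (use a0 a1 in auto)
  show ?thesis
  proof (cases "a' = 0")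
    case True
    show ?thesis
    proof (rule that[OF r0(1), of "\<lambda>x. 0"])
      show "(\<lambda>k. \<integral>\<^sup>+ x. ennreal (\<bar>f (r0 k) x - 0\<bar> powr q) \<partial>lborel) \<longlonglongrightarrow> 0"
      proof (rule nn_integral_tendsto_0I)
        fix e :: real assume e: "e > 0"
        have S0: "0 \<le> real CARD('n)" by simp
        obtain \<delta> where \<delta>: "\<delta> > 0"
          "\<And>(w :: real ^ 'n \<Rightarrow> real) B S. integrable lborel w \<Longrightarrow> box_shift_bound w B S \<Longrightarrow> 0 \<le> S \<Longrightarrow> S \<le> real CARD('n) \<Longrightarrow>
            c0 \<le> \<bar>det B\<bar> \<Longrightarrow> (LINT x|lborel. \<bar>w x\<bar>) \<le> \<delta> \<Longrightarrow> (\<integral>\<^sup>+ x. ennreal (\<bar>w x\<bar> powr q) \<partial>lborel) \<le> ennreal e"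
          using Lq_small_of_L1_small[OF n c0 S0 e q] by metis
        have "\<forall>\<^sub>F k in sequentially. (a \<circ> r0) k < \<delta>" by (rule order_tendstoD(2)[OF r0(2)]) (use True \<delta> in simp)
        then show "\<forall>\<^sub>F k in sequentially. (\<integral>\<^sup>+ x. ennreal (\<bar>f (r0 k) x - 0\<bar> powr q) \<partial>lborel) \<le> ennreal e"
        proof eventually_elim
          fix k assume k: "(a \<circ> r0) k < \<delta>"
          show "(\<integral>\<^sup>+ x. ennreal (\<bar>f (r0 k) x - 0\<bar> powr q) \<partial>lborel) \<le> ennreal e"
          \<comment> \<open>A parallelepiped is available only for functions of positive L^1 norm; a
            function vanishing almost everywhere is settled directly.\<close>
          proof (cases "a (r0 k) = 0")
            case True
            then have "AE x in lborel. \<bar>f (r0 k) x\<bar> = 0"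
              unfolding a_def by (subst (asm) integral_nonneg_eq_0_iff_AE) (use fi in auto)
            then have "AE x in lborel. ennreal (\<bar>f (r0 k) x - 0\<bar> powr q) = 0" by eventually_elim simp
            then have "(\<integral>\<^sup>+ x. ennreal (\<bar>f (r0 k) x - 0\<bar> powr q) \<partial>lborel) = (\<integral>\<^sup>+ x. 0 \<partial>(lborel :: (real ^ 'n) measure))"
              by (rule nn_integral_cong_AE)
            then show ?thesis by simp
          next
            case False
            then have p: "0 < a (r0 k)" using a0[of "r0 k"] by linarith
            obtain B :: "real ^ 'n ^ 'n" where B: "c0 \<le> \<bar>det B\<bar>" "\<And>i. dir_var (f (r0 k)) (column i B) \<le> 1"
              unfolding c0_def
              by (rule affine_ball_parallelepiped[OF f(1) R0(1) fR p _ E1]) (auto simp: a_def)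
            have "(\<integral>\<^sup>+ x. ennreal (\<bar>f (r0 k) x\<bar> powr q) \<partial>lborel) \<le> ennreal e"
              by (rule \<delta>(2)[OF fi box_shift_bound_columns[OF f(1) B(2)] _ _ B(1)]) (use k in \<open>auto simp: a_def\<close>)
            then show ?thesis by simp
          qed
        qed
      qed
    qed (auto simp: affine_energy_zero)
  next
    case False
    \<comment> \<open>From some index on all L^1 norms exceed b, which bounds the columns of all
      parallelepipeds by \<open>R0 / b\<close> and gives one translation constant C for the
      sequence.\<close>
    define b where "b = a' / 2"
    have b: "b > 0" "b < a'" using False a' by (auto simp: b_def)
    have "\<forall>\<^sub>F k in sequentially. b < (a \<circ> r0) k" by (rule order_tendstoD(1)[OF r0(2) b(2)])
    then obtain N where N: "\<And>k. N \<le> k \<Longrightarrow> b < a (r0 k)" by (auto simp: eventually_sequentially)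
    define r1 where "r1 k = r0 (k + N)" for k
    have r1: "strict_mono r1" using r0(1) by (auto simp: r1_def strict_mono_def)
    have ab: "b \<le> a (r1 k)" for k using N[of "k + N"] by (simp add: r1_def)
    have ar1: "(\<lambda>k. a (r1 k)) \<longlonglongrightarrow> a'"
      using LIMSEQ_ignore_initial_segment[OF r0(2), of N] by (simp add: r1_def comp_def)
    define C where "C = (\<Sum>p\<in>{p. p permutes (UNIV :: 'n set)}. max (R0 / b) 1 ^ CARD('n)) / c0 * CARD('n)"
    have C: "0 \<le> C" using c0 by (auto simp: C_def intro!: mult_nonneg_nonneg divide_nonneg_nonneg sum_nonneg)
    have sC: "shift_diff (f (r1 k)) h \<le> C * norm h" for k h
    proof -
      obtain B :: "real ^ 'n ^ 'n" where B: "c0 \<le> \<bar>det B\<bar>" "\<And>i. dir_var (f (r1 k)) (column i B) \<le> 1"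
        "\<And>i. norm (column i B) \<le> R0 / b"
        unfolding c0_def
        by (rule affine_ball_parallelepiped[OF f(1) R0(1) fR b(1) _ E1, of "r1 k"]) (use ab[of k] in \<open>auto simp: a_def\<close>)
      have "dir_var (f (r1 k)) h \<le> C * norm h"
        unfolding C_def by (rule dir_var_bound_of_det[OF f(1) B(2) B(1) c0 B(3)])
      then show ?thesis using shift_diff_le_dir_var[OF f(1), of "r1 k" h] by linarith
    qed
    have \<Omega>b: "\<Omega> \<in> sets borel" using \<Omega>(1) by simp
    obtain r2 w where r2: "strict_mono (r2 :: nat \<Rightarrow> nat)" and w: "integrable lborel w" "\<And>x. x \<notin> \<Omega> \<Longrightarrow> w x = 0"
      and L1: "(\<lambda>k. LINT x|lborel. \<bar>f (r1 (r2 k)) x - w x\<bar>) \<longlonglongrightarrow> 0"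
      by (rule L1_compactness[of "\<lambda>k. f (r1 k)" 1 C \<Omega>, OF fi _ sC \<Omega>b \<Omega>(2) f(2)]) (use a1 in \<open>auto simp: a_def\<close>)
    define g where "g k = f (r1 (r2 k))" for k
    have gfv: "finite_variation (g k)" and gi: "integrable lborel (g k)" for k by (auto simp: g_def f(1) fi)
    have gL1: "(\<lambda>k. LINT x|lborel. \<bar>g k x - w x\<bar>) \<longlonglongrightarrow> 0" using L1 by (simp add: g_def)
    have wR: "w x = 0" if "R0 \<le> norm x" for x using w(2) out[OF that] by blast
    have swC: "shift_diff w h \<le> C * norm h" for h
    proof (rule tendsto_lowerbound)
      show "(\<lambda>k. C * norm h + 2 * (LINT x|lborel. \<bar>g k x - w x\<bar>)) \<longlonglongrightarrow> C * norm h"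
        using tendsto_add[OF tendsto_const[of "C * norm h"] tendsto_mult_left[OF gL1, of 2]] by simp
      show "\<forall>\<^sub>F k in sequentially. shift_diff w h \<le> C * norm h + 2 * (LINT x|lborel. \<bar>g k x - w x\<bar>)"
      proof (intro always_eventually allI)
        fix k
        have "shift_diff w h \<le> shift_diff (g k) h + 2 * (LINT x|lborel. \<bar>w x - g k x\<bar>)"
          by (rule shift_diff_L1_le[OF w(1) gi])
        then show "shift_diff w h \<le> C * norm h + 2 * (LINT x|lborel. \<bar>g k x - w x\<bar>)"
          using sC[of "r2 k" h] by (simp add: abs_minus_commute g_def)
      qed
    qed simp
    have wfv: "finite_variation w" using w(1) swC by (auto simp: finite_variation_def)
    have aw: "(LINT x|lborel. \<bar>w x\<bar>) = a'"
    proof (rule LIMSEQ_unique)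
      show "(\<lambda>k. LINT x|lborel. \<bar>g k x\<bar>) \<longlonglongrightarrow> a'"
        using LIMSEQ_subseq_LIMSEQ[OF ar1 r2] by (simp add: g_def a_def comp_def)
      have "\<bar>(LINT x|lborel. \<bar>g k x\<bar>) - (LINT x|lborel. \<bar>w x\<bar>)\<bar> \<le> (LINT x|lborel. \<bar>g k x - w x\<bar>)" for k
      proof -
        have "(LINT x|lborel. \<bar>g k x\<bar>) - (LINT x|lborel. \<bar>w x\<bar>) = (LINT x|lborel. \<bar>g k x\<bar> - \<bar>w x\<bar>)"
          using gi w(1) by simp
        also have "\<bar>\<dots>\<bar> \<le> (LINT x|lborel. \<bar>\<bar>g k x\<bar> - \<bar>w x\<bar>\<bar>)"
          using integral_norm_bound[of lborel "\<lambda>x. \<bar>g k x\<bar> - \<bar>w x\<bar>"] by simp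
        also have "\<dots> \<le> (LINT x|lborel. \<bar>g k x - w x\<bar>)"
          using gi w(1) by (intro integral_mono) auto
        finally show ?thesis .
      qed
      then have "(\<lambda>k. (LINT x|lborel. \<bar>g k x\<bar>) - (LINT x|lborel. \<bar>w x\<bar>)) \<longlonglongrightarrow> 0"
        by (intro Lim_null_comparison[OF _ gL1]) auto
      then show "(\<lambda>k. LINT x|lborel. \<bar>g k x\<bar>) \<longlonglongrightarrow> (LINT x|lborel. \<bar>w x\<bar>)" by (simp add: LIM_zero_iff)
    qed
    have "affine_energy w \<le> 1 - a'"
    \<comment> \<open>The energies are bounded by the varying numbers 1 minus the L^1 norm. As these
      norms converge to that of w, the limit bound leaves exactly the room allowed by the
      ball.\<close>
    proof (rule affine_energy_lower_semicontinuous[OF wfv gfv R0(1) _ wR gL1 b(1)])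
      show "g k x = 0" if "R0 \<le> norm x" for k x using fR[OF that] by (simp add: g_def)
      show "b \<le> (LINT x|lborel. \<bar>g k x\<bar>)" for k using ab[of "r2 k"] by (simp add: g_def a_def)
      show "b \<le> (LINT x|lborel. \<bar>w x\<bar>)" using b(2) aw by simp
      show "affine_energy (g k) \<le> 1 - a (r1 (r2 k))" for k using E[of "r1 (r2 k)"] by (simp add: g_def a_def)
      show "(\<lambda>k. 1 - a (r1 (r2 k))) \<longlonglongrightarrow> 1 - a'"
        using LIMSEQ_subseq_LIMSEQ[OF ar1 r2] by (intro tendsto_diff tendsto_const) (simp add: comp_def)
      show "0 \<le> 1 - a (r1 (r2 k))" for k using a1 by simp
    qed
    then have wE: "(LINT x|lborel. \<bar>w x\<bar>) + affine_energy w \<le> 1" using aw by simp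
    have "(\<lambda>k. \<integral>\<^sup>+ x. ennreal (\<bar>g k x - w x\<bar> powr q) \<partial>lborel) \<longlonglongrightarrow> 0"
    proof (rule nn_integral_tendsto_0I)
      fix e :: real assume e: "e > 0"
      \<comment> \<open>The differences g k - w have translation constant 2 C, and the unit cube
        serves as parallelepiped. Smallness in L^1 thus becomes smallness in L^q.\<close>
      define S where "S = 2 * C * CARD('n)"
      have S: "0 \<le> S" using C by (simp add: S_def)
      obtain \<delta> where \<delta>: "\<delta> > 0"
        "\<And>(w :: real ^ 'n \<Rightarrow> real) B S'. integrable lborel w \<Longrightarrow> box_shift_bound w B S' \<Longrightarrow> 0 \<le> S' \<Longrightarrow> S' \<le> S \<Longrightarrow>
          1 \<le> \<bar>det B\<bar> \<Longrightarrow> (LINT x|lborel. \<bar>w x\<bar>) \<le> \<delta> \<Longrightarrow> (\<integral>\<^sup>+ x. ennreal (\<bar>w x\<bar> powr q) \<partial>lborel) \<le> ennreal e"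
        using Lq_small_of_L1_small[OF n zero_less_one S e q] by metis
      have "\<forall>\<^sub>F k in sequentially. (LINT x|lborel. \<bar>g k x - w x\<bar>) < \<delta>"
        by (rule order_tendstoD(2)[OF gL1 \<delta>(1)])
      then show "\<forall>\<^sub>F k in sequentially. (\<integral>\<^sup>+ x. ennreal (\<bar>g k x - w x\<bar> powr q) \<partial>lborel) \<le> ennreal e"
      proof eventually_elim
        fix k assume k: "(LINT x|lborel. \<bar>g k x - w x\<bar>) < \<delta>"
        have "shift_diff (\<lambda>x. g k x - w x) h \<le> (2 * C) * norm h" for h
          using shift_diff_diff_le[OF gi w(1), of k h] sC[of "r2 k" h] swC[of h] by (simp add: g_def)
        then have "box_shift_bound (\<lambda>x. g k x - w x) (mat 1) S"
          unfolding S_def by (rule box_shift_bound_identity) (use C in simp)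
        then show "(\<integral>\<^sup>+ x. ennreal (\<bar>g k x - w x\<bar> powr q) \<partial>lborel) \<le> ennreal e"
          by (intro \<delta>(2)[of "\<lambda>x. g k x - w x" "mat 1" S]) (use gi w(1) S k in auto)
      qed
    qed
    then show ?thesis
      using that[of "r1 \<circ> r2" w] strict_mono_o[OF r1 r2] wfv w(2) wE by (simp add: g_def)
  qed
qed

text \<open>Scaling by a small t > 0 puts t w within reach of the estimate with target 1: both its
  translation constant and its L^1 norm become as small as required.\<close>

lemma Lq_integral_finite:
  fixes w :: "real ^ 'n \<Rightarrow> real"
  assumes n: "CARD('n) \<ge> 2" and q: "1 \<le> q" "q < real CARD('n) / (real CARD('n) - 1)" and w: "finite_variation w"
  shows "(\<integral>\<^sup>+ x. ennreal (\<bar>w x\<bar> powr q) \<partial>lborel) < \<infinity>"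
proof -
  obtain C0 where C0: "\<And>h. shift_diff w h \<le> C0 * norm h" using w by (auto simp: finite_variation_def)
  define C where "C = \<bar>C0\<bar>"
  have C: "shift_diff w h \<le> C * norm h" for h
    by (rule order_trans[OF C0]) (auto simp: C_def intro: mult_right_mono)
  obtain \<delta> where \<delta>: "\<delta> > 0"
    "\<And>(w :: real ^ 'n \<Rightarrow> real) B S. integrable lborel w \<Longrightarrow> box_shift_bound w B S \<Longrightarrow> 0 \<le> S \<Longrightarrow> S \<le> 1 \<Longrightarrow>
      1 \<le> \<bar>det B\<bar> \<Longrightarrow> (LINT x|lborel. \<bar>w x\<bar>) \<le> \<delta> \<Longrightarrow> (\<integral>\<^sup>+ x. ennreal (\<bar>w x\<bar> powr q) \<partial>lborel) \<le> ennreal 1"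
    using Lq_small_of_L1_small[OF n zero_less_one zero_le_one zero_less_one q] by metis
  note wi = finite_variation_integrable[OF w]
  define I where "I = (LINT x|lborel. \<bar>w x\<bar>)"
  have I0: "0 \<le> I" by (simp add: I_def)
  define t where "t = min (1 / (C * CARD('n) + 1)) (\<delta> / (I + 1))"
  have C0': "0 \<le> C" by (simp add: C_def)
  have t: "t > 0" using \<delta>(1) I0 C0' by (auto simp: t_def intro!: divide_pos_pos add_nonneg_pos)
  have t1: "t * C * CARD('n) \<le> 1"
  proof -
    have "t * (C * CARD('n)) \<le> 1 / (C * CARD('n) + 1) * (C * CARD('n))"
      using C0' by (intro mult_right_mono) (auto simp: t_def)
    also have "\<dots> \<le> 1" using C0' by (simp add: divide_le_eq add_nonneg_pos)
    finally show ?thesis by (simp add: mult.assoc)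
  qed
  have t2: "t * I \<le> \<delta>"
  proof -
    have "t * I \<le> \<delta> / (I + 1) * I" using I0 by (intro mult_right_mono) (auto simp: t_def)
    also have "\<dots> \<le> \<delta>" using I0 \<delta>(1) by (simp add: divide_le_eq mult_left_mono)
    finally show ?thesis .
  qed
  have "shift_diff (\<lambda>x. t * w x) h \<le> (t * C) * norm h" for h
    using mult_left_mono[OF C, of t h] t by (simp add: shift_diff_cmult mult.assoc)
  then have "box_shift_bound (\<lambda>x. t * w x) (mat 1) (t * C * CARD('n))"
    by (rule box_shift_bound_identity) (use t C0' in simp)
  then have "(\<integral>\<^sup>+ x. ennreal (\<bar>t * w x\<bar> powr q) \<partial>lborel) \<le> ennreal 1"
    by (rule \<delta>(2)[rotated]) (use wi t C0' t1 t2 in \<open>auto simp: abs_mult I_def\<close>)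
  moreover have "(\<integral>\<^sup>+ x. ennreal (\<bar>t * w x\<bar> powr q) \<partial>lborel) = ennreal (t powr q) * (\<integral>\<^sup>+ x. ennreal (\<bar>w x\<bar> powr q) \<partial>lborel)"
    using t wi by (subst nn_integral_cmult[symmetric]) (auto simp: abs_mult powr_mult ennreal_mult)
  ultimately have "ennreal (t powr q) * (\<integral>\<^sup>+ x. ennreal (\<bar>w x\<bar> powr q) \<partial>lborel) < \<infinity>"
    by (simp add: order_le_less_trans)
  then show ?thesis using t by (auto simp: ennreal_mult_less_top)
qed

subsection \<open>Passage to classes of Lebesgue measurable functions\<close>

text \<open>Elements of \<open>BV \<Omega>\<close> are Lebesgue measurable and arbitrary off
  \<Omega>. A Borel version vanishing there is what the translation arguments over
  \<open>lborel\<close> work with.\<close>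

lemma BV_representative:
  fixes u :: "real ^ 'n \<Rightarrow> real"
  assumes \<Omega>: "open \<Omega>" "bounded \<Omega>" "lipschitz_boundary \<Omega>" and u: "u \<in> BV \<Omega>"
  obtains w where "finite_variation w" "\<And>x. x \<notin> \<Omega> \<Longrightarrow> w x = 0" "AE x in lebesgue. w x = zero_extension \<Omega> u x"
proof -
  have ui: "integrable (lebesgue_on \<Omega>) u" using u by (simp add: BV_def)
  have zi: "integrable lebesgue (\<lambda>x. indicator \<Omega> x *\<^sub>R u x)"
    using ui \<Omega>(1) by (subst (asm) integrable_restrict_space) auto
  have z_eq: "(\<lambda>x. indicator \<Omega> x *\<^sub>R u x) = zero_extension \<Omega> u" by (auto simp: zero_extension_def indicator_def)
  have z: "integrable lebesgue (zero_extension \<Omega> u)" using zi unfolding z_eq .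
  then have "zero_extension \<Omega> u \<in> borel_measurable lebesgue" by auto
  then obtain v where v: "v \<in> borel_measurable lborel" "AE x in lborel. zero_extension \<Omega> u x = v x"
    using completion_ex_borel_measurable_real by blast
  define w where "w x = indicator \<Omega> x * v x" for x
  have [measurable]: "v \<in> borel_measurable borel" "\<Omega> \<in> sets borel" using v \<Omega>(1) by auto
  have wm[measurable]: "w \<in> borel_measurable borel" unfolding w_def by measurable
  have ae: "AE x in lebesgue. w x = zero_extension \<Omega> u x"
    using AE_completion[OF v(2)] by eventually_elim (auto simp: w_def zero_extension_def indicator_def split: if_splits)
  have "integrable lebesgue w"
    by (rule integrable_cong_AE_imp[OF z]) (use ae in \<open>auto intro: measurable_completion\<close>)
  then have wi: "integrable lborel w" using integrable_completion[of w lborel] by simp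
  have w0: "w x = 0" if "x \<notin> \<Omega>" for x using that by (simp add: w_def)
  obtain C where C: "0 \<le> C"
    "\<And>\<psi> \<psi>' \<xi>. test_function \<Omega> \<psi> \<psi>' \<Longrightarrow> (\<And>x. \<bar>\<psi> x\<bar> \<le> 1) \<Longrightarrow> \<bar>LINT x|lborel. w x * \<psi>' x \<xi>\<bar> \<le> C * norm \<xi>"
    using BV_directional_bound[OF \<Omega>(1) u wi w0 ae] by metis
  have "finite_variation w" by (rule finite_variation_zero_extension[OF \<Omega> wi w0 C])
  then show ?thesis using that w0 ae by blast
qed

text \<open>The function enters \<open>is_gradient_measure\<close> only under an integral. Functions
  equal almost everywhere have the same gradient measures, and the choice operator then picks the
  same one.\<close>

lemma affine_energy_cong_AE:
  fixes v w :: "real ^ 'n \<Rightarrow> real"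
  assumes [measurable]: "v \<in> borel_measurable lebesgue" "w \<in> borel_measurable lebesgue" and ae: "AE x in lebesgue. v x = w x"
  shows "affine_energy v = affine_energy w"
proof -
  have "(LINT x|lebesgue. v x * divergence \<phi> x) = (LINT x|lebesgue. w x * divergence \<phi> x)"
    if \<phi>: "\<phi> \<in> C1c_fields UNIV" for \<phi> :: "real ^ 'n \<Rightarrow> real ^ 'n"
  proof -
    obtain \<phi>' where \<phi>': "\<And>i. test_function UNIV (\<lambda>x. \<phi> x $ i) (\<phi>' i)"
      "\<And>x. divergence \<phi> x = (\<Sum>i\<in>UNIV. \<phi>' i x (axis i 1))"
      by (rule field_test_function[OF \<phi>]) blast
    have "(\<lambda>x. \<phi>' i x (axis i 1)) \<in> borel_measurable borel" for i
      using test_functionD(1)[OF \<phi>'(1)] by (intro borel_measurable_continuous_onI continuous_intros)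
    then have "divergence \<phi> \<in> borel_measurable borel" unfolding \<phi>'(2)[abs_def] by (intro borel_measurable_sum)
    then have [measurable]: "divergence \<phi> \<in> borel_measurable lebesgue" by (intro measurable_completion) simp
    show ?thesis by (rule integral_cong_AE) (use ae in auto)
  qed
  then have "is_gradient_measure v = is_gradient_measure w"
    by (auto simp: fun_eq_iff is_gradient_measure_def)
  then have "gradient_measure v = gradient_measure w" by (simp add: gradient_measure_def)
  then show ?thesis by (simp add: affine_energy_def gradient_direction_def gradient_variation_def)
qed

lemma integral_lebesgue_on_zero_extension:
  fixes g :: "'a::euclidean_space \<Rightarrow> real"
  assumes \<Omega>: "open \<Omega>" and g: "g \<in> borel_measurable borel" "\<And>x. x \<notin> \<Omega> \<Longrightarrow> g x = 0"
  shows "(LINT x|lebesgue_on \<Omega>. g x) = (LINT x|lborel. g x)"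
    and "integrable (lebesgue_on \<Omega>) g \<longleftrightarrow> integrable lborel g"
proof -
  have e: "(\<lambda>x. indicat_real \<Omega> x * g x) = g" using g(2) by (force simp: indicator_def)
  show "(LINT x|lebesgue_on \<Omega>. g x) = (LINT x|lborel. g x)"
    using integral_restrict_space[of \<Omega> lebesgue g] \<Omega> g(1) by (simp add: e integral_lebesgue_eq_lborel)
  show "integrable (lebesgue_on \<Omega>) g \<longleftrightarrow> integrable lborel g"
    using integrable_restrict_space[of \<Omega> lebesgue g] \<Omega> integrable_completion[of g lborel] g(1) by (simp add: e)
qed

text \<open>Brings limits back into \<open>BV \<Omega>\<close>: the divergence is split into
  coordinate derivatives, each of which contributes at most the variation in its axis
  direction.\<close>

lemma BV_of_finite_variation:
  fixes w :: "real ^ 'n \<Rightarrow> real"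
  assumes \<Omega>: "open \<Omega>" and w: "finite_variation w" "\<And>x. x \<notin> \<Omega> \<Longrightarrow> w x = 0"
  shows "w \<in> BV \<Omega>"
proof -
  note wi = finite_variation_integrable[OF w(1)]
  have [measurable]: "w \<in> borel_measurable borel" using wi by auto
  have "(LINT x|lebesgue_on \<Omega>. w x * divergence \<phi> x) \<le> (\<Sum>i\<in>UNIV. dir_var w (axis i 1))"
    if \<phi>: "\<phi> \<in> C1c_fields \<Omega>" "\<forall>x. norm (\<phi> x) \<le> 1" for \<phi> :: "real ^ 'n \<Rightarrow> real ^ 'n"
  proof -
    obtain \<phi>' where \<phi>': "\<And>i. test_function \<Omega> (\<lambda>x. \<phi> x $ i) (\<phi>' i)"
      "\<And>x. divergence \<phi> x = (\<Sum>i\<in>UNIV. \<phi>' i x (axis i 1))"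
      by (rule field_test_function[OF \<phi>(1)]) blast
    have [measurable]: "(\<lambda>x. \<phi>' i x (axis i 1)) \<in> borel_measurable borel" for i
      using test_functionD(1)[OF \<phi>'(1)] by (intro borel_measurable_continuous_onI continuous_intros)
    have i1: "integrable lborel (\<lambda>x. w x * \<phi>' i x (axis i 1))" for i
    proof -
      obtain B where B: "B > 0" "\<And>x. norm (\<phi>' i x) \<le> B"
        by (rule test_function_bounded[OF \<phi>'(1)[of i]]) blast
      show ?thesis
      proof (rule Bochner_Integration.integrable_bound[OF integrable_mult_right[OF integrable_abs[OF wi], of B]])
        have "norm (w x * \<phi>' i x (axis i 1)) \<le> norm (B * \<bar>w x\<bar>)" for x
        proof -
          have "\<bar>\<phi>' i x (axis i 1)\<bar> \<le> \<bar>B\<bar>" using norm_blinfun[of "\<phi>' i x" "axis i 1"] B(2)[of x] by simp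
          then have "\<bar>w x\<bar> * \<bar>\<phi>' i x (axis i 1)\<bar> \<le> \<bar>w x\<bar> * \<bar>B\<bar>" by (intro mult_left_mono) auto
          then show ?thesis by (simp add: abs_mult mult.commute)
        qed
        then show "AE x in lborel. norm (w x * \<phi>' i x (axis i 1)) \<le> norm (B * \<bar>w x\<bar>)" by simp
      qed auto
    qed
    have "(LINT x|lebesgue_on \<Omega>. w x * divergence \<phi> x) = (LINT x|lborel. w x * divergence \<phi> x)"
      by (rule integral_lebesgue_on_zero_extension(1)[OF \<Omega>]) (auto simp: \<phi>'(2) w(2))
    also have "\<dots> = (\<Sum>i\<in>UNIV. LINT x|lborel. w x * \<phi>' i x (axis i 1))"
      unfolding \<phi>'(2) sum_distrib_left by (rule Bochner_Integration.integral_sum) (rule i1)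
    also have "\<dots> \<le> (\<Sum>i\<in>UNIV. dir_var w (axis i 1))"
    proof (rule sum_mono)
      fix i
      have b: "\<bar>- (\<phi> x $ i)\<bar> \<le> 1" for x
        using component_le_norm_cart[of "\<phi> x" i] \<phi>(2)[rule_format, of x] by simp
      have "- (LINT x|lborel. w x * (- \<phi>' i x) (axis i 1)) \<le> dir_var w (axis i 1)"
        by (rule integral_test_le_dir_var[OF w(1) test_function_uminus[OF \<phi>'(1)] b])
      then show "(LINT x|lborel. w x * \<phi>' i x (axis i 1)) \<le> dir_var w (axis i 1)"
        by (simp add: uminus_blinfun.rep_eq)
    qed
    finally show ?thesis .
  qed
  then have "bdd_above {LINT x|lebesgue_on \<Omega>. w x * divergence \<phi> x | \<phi>. \<phi> \<in> C1c_fields \<Omega> \<and> (\<forall>x. norm (\<phi> x) \<le> 1)}"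
    by (auto simp: bdd_above_def)
  moreover have "integrable (lebesgue_on \<Omega>) w"
    using integral_lebesgue_on_zero_extension(2)[OF \<Omega> _ w(2)] wi by simp
  ultimately show ?thesis by (simp add: BV_def)
qed

lemma affine_ball_representative:
  fixes u :: "real ^ 'n \<Rightarrow> real"
  assumes \<Omega>: "open \<Omega>" "bounded \<Omega>" "lipschitz_boundary \<Omega>" and u: "u \<in> affine_ball \<Omega>"
  obtains w where "finite_variation w" "\<And>x. x \<notin> \<Omega> \<Longrightarrow> w x = 0" "AE x in lebesgue_on \<Omega>. u x = w x"
    "(LINT x|lborel. \<bar>w x\<bar>) + affine_energy w \<le> 1"
proof -
  have uBV: "u \<in> BV \<Omega>" and E: "(LINT x|lebesgue_on \<Omega>. \<bar>u x\<bar>) + affine_energy (zero_extension \<Omega> u) \<le> 1"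
    using u by (auto simp: affine_ball_def)
  obtain w where w: "finite_variation w" "\<And>x. x \<notin> \<Omega> \<Longrightarrow> w x = 0" "AE x in lebesgue. w x = zero_extension \<Omega> u x"
    by (rule BV_representative[OF \<Omega> uBV]) blast
  have wi: "integrable lborel w" by (rule finite_variation_integrable[OF w(1)])
  have wm[measurable]: "w \<in> borel_measurable borel" using wi by auto
  have um[measurable]: "u \<in> borel_measurable (lebesgue_on \<Omega>)" using uBV by (auto simp: BV_def)
  have ae: "AE x in lebesgue_on \<Omega>. u x = w x"
  proof (subst AE_restrict_space_iff)
    show "AE x in lebesgue. x \<in> \<Omega> \<longrightarrow> u x = w x" using w(3) by eventually_elim (auto simp: zero_extension_def)
  qed (use \<Omega>(1) in auto)
  have wm': "w \<in> borel_measurable lebesgue" by (rule measurable_completion) simp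
  have "zero_extension \<Omega> u \<in> borel_measurable lebesgue"
  proof -
    have "(\<lambda>x. if x \<in> \<Omega> then u x else 0) \<in> borel_measurable lebesgue"
      using um \<Omega>(1) by (subst borel_measurable_if) auto
    then show ?thesis by (simp add: zero_extension_def[abs_def])
  qed
  then have "affine_energy (zero_extension \<Omega> u) = affine_energy w"
    using affine_energy_cong_AE[OF wm' _ w(3)] by simp
  moreover have "(LINT x|lebesgue_on \<Omega>. \<bar>u x\<bar>) = (LINT x|lborel. \<bar>w x\<bar>)"
  proof -
    have "(LINT x|lebesgue_on \<Omega>. \<bar>u x\<bar>) = (LINT x|lebesgue_on \<Omega>. \<bar>w x\<bar>)"
    proof (rule integral_cong_AE)
      show "(\<lambda>x. \<bar>w x\<bar>) \<in> borel_measurable (lebesgue_on \<Omega>)"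
        using measurable_restrict_space1[OF wm'] by auto
    qed (use ae in auto)
    also have "\<dots> = (LINT x|lborel. \<bar>w x\<bar>)"
      by (rule integral_lebesgue_on_zero_extension(1)[OF \<Omega>(1)]) (auto simp: w(2))
    finally show ?thesis .
  qed
  ultimately show ?thesis using that[OF w(1,2) ae] E by simp
qed

lemma ae_class_in_Lq_space:
  fixes f :: "'a::euclidean_space \<Rightarrow> real"
  assumes \<Omega>: "open \<Omega>" and f: "f \<in> borel_measurable borel" "\<And>x. x \<notin> \<Omega> \<Longrightarrow> f x = 0"
    and fin: "(\<integral>\<^sup>+ x. ennreal (\<bar>f x\<bar> powr q) \<partial>lborel) < \<infinity>"
  shows "ae_class \<Omega> f \<in> Lq_space \<Omega> q"
proof -
  note [measurable] = f(1)
  have "integrable lborel (\<lambda>x. \<bar>f x\<bar> powr q)"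
    using fin by (intro integrableI_bounded) auto
  then have "integrable (lebesgue_on \<Omega>) (\<lambda>x. \<bar>f x\<bar> powr q)"
    using integral_lebesgue_on_zero_extension(2)[OF \<Omega>, of "\<lambda>x. \<bar>f x\<bar> powr q"] f(2) by simp
  moreover have "f \<in> borel_measurable (lebesgue_on \<Omega>)"
    by (intro measurable_restrict_space1 measurable_completion) simp
  ultimately show ?thesis unfolding Lq_space_def by blast
qed

text \<open>The distance is defined through chosen representatives. They agree almost everywhere
  with f and g, so the integral does not depend on the choice.\<close>

lemma Lq_dist_ae_class:
  fixes f g :: "'a::euclidean_space \<Rightarrow> real"
  assumes \<Omega>: "open \<Omega>" and f: "f \<in> borel_measurable borel" "\<And>x. x \<notin> \<Omega> \<Longrightarrow> f x = 0"
    and g: "g \<in> borel_measurable borel" "\<And>x. x \<notin> \<Omega> \<Longrightarrow> g x = 0"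
  shows "Lq_dist \<Omega> q (ae_class \<Omega> f) (ae_class \<Omega> g) =
    enn2real (\<integral>\<^sup>+ x. ennreal (\<bar>f x - g x\<bar> powr q) \<partial>lborel) powr (1 / q)"
proof -
  note [measurable] = f(1) g(1)
  have rep: "(SOME v. v \<in> ae_class \<Omega> u) \<in> ae_class \<Omega> u" if "u \<in> borel_measurable borel" for u :: "'a \<Rightarrow> real"
    by (rule someI[of _ u], rule ae_class_self, intro measurable_restrict_space1 measurable_completion) (use that in simp)
  define f' where "f' = (SOME v. v \<in> ae_class \<Omega> f)"
  define g' where "g' = (SOME v. v \<in> ae_class \<Omega> g)"
  have f': "f' \<in> borel_measurable (lebesgue_on \<Omega>)" "AE x in lebesgue_on \<Omega>. f' x = f x"
    and g': "g' \<in> borel_measurable (lebesgue_on \<Omega>)" "AE x in lebesgue_on \<Omega>. g' x = g x"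
    using rep[OF f(1)] rep[OF g(1)] by (simp_all add: f'_def g'_def ae_class_def)
  note [measurable] = f'(1) g'(1)
  have "f \<in> borel_measurable (lebesgue_on \<Omega>)" "g \<in> borel_measurable (lebesgue_on \<Omega>)"
    by (intro measurable_restrict_space1 measurable_completion; simp)+
  then have "(LINT x|lebesgue_on \<Omega>. \<bar>f' x - g' x\<bar> powr q) = (LINT x|lebesgue_on \<Omega>. \<bar>f x - g x\<bar> powr q)"
    by (intro integral_cong_AE) (use f'(2) g'(2) in auto)
  also have "\<dots> = (LINT x|lborel. \<bar>f x - g x\<bar> powr q)"
    by (rule integral_lebesgue_on_zero_extension(1)[OF \<Omega>]) (auto simp: f(2) g(2))
  also have "\<dots> = enn2real (\<integral>\<^sup>+ x. ennreal (\<bar>f x - g x\<bar> powr q) \<partial>lborel)"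
    by (rule integral_eq_nn_integral) auto
  finally show ?thesis by (simp add: Lq_dist_def f'_def g'_def)
qed

theorem theorem4p1:
  fixes \<Omega> :: "(real ^ 'n) set" and q :: real
  assumes "CARD('n) \<ge> 2"
    and "open \<Omega>" and "bounded \<Omega>" and "lipschitz_boundary \<Omega>"
    and "1 \<le> q" and "q < real CARD('n) / (real CARD('n) - 1)"
  shows "compactin (Lq_topology \<Omega> q) (ae_class \<Omega> ` affine_ball \<Omega>)"
proof -
  interpret Metric_space "Lq_space \<Omega> q" "Lq_dist \<Omega> q" by (rule Metric_space_Lq[OF assms(5)])
  \<comment> \<open>Ties a class to a Borel representative that vanishes off \<Omega>. Every class
    of the ball has one, and every class that has one lies in the ball, so that sequences and limits
    can be handled on the level of functions.\<close>
  define rep where "rep F w \<longleftrightarrow> F = ae_class \<Omega> w \<and> finite_variation w \<and> (\<forall>x. x \<notin> \<Omega> \<longrightarrow> w x = 0) \<and>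
    (LINT x|lborel. \<bar>w x\<bar>) + affine_energy w \<le> 1" for F w
  have repD: "F = ae_class \<Omega> w" "finite_variation w" "\<And>x. x \<notin> \<Omega> \<Longrightarrow> w x = 0"
    "(LINT x|lborel. \<bar>w x\<bar>) + affine_energy w \<le> 1" "w \<in> borel_measurable borel"
    if "rep F w" for F w
    using that finite_variation_integrable[of w] by (auto simp: rep_def)
  have rep_ex: "\<exists>w. rep F w" if "F \<in> ae_class \<Omega> ` affine_ball \<Omega>" for F
  proof -
    obtain u where u: "u \<in> affine_ball \<Omega>" "F = ae_class \<Omega> u" using \<open>F \<in> _\<close> by blast
    obtain w where w: "finite_variation w" "\<And>x. x \<notin> \<Omega> \<Longrightarrow> w x = 0" "AE x in lebesgue_on \<Omega>. u x = w x"
      "(LINT x|lborel. \<bar>w x\<bar>) + affine_energy w \<le> 1"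
      using affine_ball_representative[OF assms(2-4) u(1)] by metis
    show ?thesis using w(1,2,4) u(2) ae_class_eqI[OF w(3)] unfolding rep_def by blast
  qed
  have rep_ball: "F \<in> ae_class \<Omega> ` affine_ball \<Omega>" if "rep F w" for F w
  proof -
    note w = repD[OF that]
    have "zero_extension \<Omega> w = w" using w(3) by (auto simp: zero_extension_def)
    moreover have "(LINT x|lebesgue_on \<Omega>. \<bar>w x\<bar>) = (LINT x|lborel. \<bar>w x\<bar>)"
      by (rule integral_lebesgue_on_zero_extension(1)[OF assms(2)]) (use w(3,5) in auto)
    ultimately have "w \<in> affine_ball \<Omega>"
      using BV_of_finite_variation[OF assms(2) w(2,3)] w(4) by (simp add: affine_ball_def)
    then show ?thesis using w(1) by blast
  qed
  have rep_Lq: "F \<in> Lq_space \<Omega> q" if "rep F w" for F w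
    unfolding repD(1)[OF that]
    by (rule ae_class_in_Lq_space[OF assms(2) repD(5,3)[OF that] Lq_integral_finite[OF assms(1,5,6) repD(2)[OF that]]])
  have "compactin mtopology (ae_class \<Omega> ` affine_ball \<Omega>)"
    unfolding compactin_sequentially
  proof (intro conjI allI impI)
    show "ae_class \<Omega> ` affine_ball \<Omega> \<subseteq> Lq_space \<Omega> q" using rep_ex rep_Lq by blast
    fix \<sigma> :: "nat \<Rightarrow> (real ^ 'n \<Rightarrow> real) set" assume \<sigma>: "range \<sigma> \<subseteq> ae_class \<Omega> ` affine_ball \<Omega>"
    then have "\<forall>k. \<exists>w. rep (\<sigma> k) w" using rep_ex by blast
    then obtain f where f: "\<And>k. rep (\<sigma> k) (f k)" by metis
    have f0: "f k x = 0" if "x \<notin> \<Omega>" for k x by (rule repD(3)[OF f that])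
    have "\<exists>r w. strict_mono (r :: nat \<Rightarrow> nat) \<and> rep (ae_class \<Omega> w) w \<and>
      (\<lambda>k. \<integral>\<^sup>+ x. ennreal (\<bar>f (r k) x - w x\<bar> powr q) \<partial>lborel) \<longlonglongrightarrow> 0"
    proof (rule affine_ball_sequence[where f = f, OF assms(1-3,5,6) repD(2)[OF f] f0 repD(4)[OF f]])
      fix r :: "nat \<Rightarrow> nat" and w :: "real ^ 'n \<Rightarrow> real"
      assume r: "strict_mono r" and w: "finite_variation w" "\<And>x. x \<notin> \<Omega> \<Longrightarrow> w x = 0"
        "(LINT x|lborel. \<bar>w x\<bar>) + affine_energy w \<le> 1"
        and conv: "(\<lambda>k. \<integral>\<^sup>+ x. ennreal (\<bar>f (r k) x - w x\<bar> powr q) \<partial>lborel) \<longlonglongrightarrow> 0"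
      have "rep (ae_class \<Omega> w) w" using w by (simp add: rep_def)
      then show ?thesis using r conv by (intro exI[of _ r] exI[of _ w] conjI)
    qed
    then obtain r w where r: "strict_mono (r :: nat \<Rightarrow> nat)" and rw: "rep (ae_class \<Omega> w) w"
      and conv: "(\<lambda>k. \<integral>\<^sup>+ x. ennreal (\<bar>f (r k) x - w x\<bar> powr q) \<partial>lborel) \<longlonglongrightarrow> 0"
      by (elim exE conjE)
    have "Lq_dist \<Omega> q (\<sigma> (r k)) (ae_class \<Omega> w) =
      enn2real (\<integral>\<^sup>+ x. ennreal (\<bar>f (r k) x - w x\<bar> powr q) \<partial>lborel) powr (1 / q)" for k
      unfolding repD(1)[OF f] by (rule Lq_dist_ae_class[OF assms(2) repD(5,3)[OF f] repD(5,3)[OF rw]])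
    moreover have "(\<lambda>k. enn2real (\<integral>\<^sup>+ x. ennreal (\<bar>f (r k) x - w x\<bar> powr q) \<partial>lborel) powr (1 / q)) \<longlonglongrightarrow> 0"
    proof (rule tendsto_zero_powrI)
      show "(\<lambda>k. enn2real (\<integral>\<^sup>+ x. ennreal (\<bar>f (r k) x - w x\<bar> powr q) \<partial>lborel)) \<longlonglongrightarrow> 0"
        using tendsto_enn2real[OF conv[folded ennreal_0]] by simp
    qed (use assms(5) in auto)
    ultimately have "(\<lambda>k. Lq_dist \<Omega> q ((\<sigma> \<circ> r) k) (ae_class \<Omega> w)) \<longlonglongrightarrow> 0" by simp
    then have "limitin mtopology (\<sigma> \<circ> r) (ae_class \<Omega> w) sequentially"
      using rep_Lq[OF f] rep_Lq[OF rw] by (simp add: limitin_metric_dist_null)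
    then show "\<exists>l r. l \<in> ae_class \<Omega> ` affine_ball \<Omega> \<and> strict_mono r \<and> limitin mtopology (\<sigma> \<circ> r) l sequentially"
      using r rep_ball[OF rw] by blast
  qed
  then show ?thesis by (simp add: Lq_topology_def)
qed

end
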